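(* For each sufficiently small $\kappa>0$ and each $\eta\in(0,1)$ there exist $L_0\in(0,\infty)$ and $\beta_0\in(0,\infty)$ such that for every $\beta\ge\beta_0$ there exist numbers $\Gamma\in(0,1)$ and a positive integer $B$ with the following property: if $\mathcal B$ denotes the event (defined with these $\kappa,\Gamma,B$) that the block $\Lambda_B$ is bad, then for every $L\ge L_0$ (with $L$ such that $L/B$ is a power of two) and any distinct $\boldsymbol t_1,\dots,\boldsymbol t_m\in\mathbb T_{L/B}$, $$\mathbb P_{L,\beta}\bigl(\vartheta_{\boldsymbol t_1}(\mathcal B)\cap\dots\cap\vartheta_{\boldsymbol t_m}(\mathcal B)\bigr)\le\eta^m.$$
   Context: 120$^\circ$-model: spins $\boldsymbol S_{\boldsymbol r}=(\cos\theta_{\boldsymbol r},\sin\theta_{\boldsymbol r})$ on the torus $\mathbb T_L=\mathbb Z^3/(L\mathbb Z)^3$; $S^{(1)}_{\boldsymbol r}=\cos\theta_{\boldsymbol r}$, $S^{(2)}_{\boldsymbol r}=\cos(\theta_{\boldsymbol r}-\tfrac{2\pi}3)$, $S^{(3)}_{\boldsymbol r}=\cos(\theta_{\boldsymbol r}+\tfrac{2\pi}3)$ (projections on $\hat{\mathrm a}=(1,0)$, $\hat{\mathrm b}=(-\tfrac12,\tfrac{\sqrt3}2)$, $\hat{\mathrm c}=(-\tfrac12,-\tfrac{\sqrt3}2)$). The torus Hamiltonian is $\mathscr H_L=\frac J2\sum_{\boldsymbol r\in\mathbb T_L}\sum_{\alpha=1}^3(S^{(\alpha)}_{\boldsymbol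 r}-S^{(\alpha)}_{\boldsymbol r+\hat{\mathrm e}_\alpha})^2$, $J>0$, and $\mathbb P_{L,\beta}$ is the probability measure proportional to $e^{-\beta\mathscr H_L}\prod_{\boldsymbol r}d\theta_{\boldsymbol r}$ on $[0,2\pi)^{\mathbb T_L}$. $\Lambda_B\subset\mathbb T_L$ is the cube $\{0,\dots,B\}^3$ of $(B+1)^3$ sites. The block is good if (a) $|S^{(\alpha)}_{\boldsymbol r}-S^{(\alpha)}_{\boldsymbol r+\hat{\mathrm e}_\alpha}|<\Gamma$ for every $\alpha$ and every nearest-neighbour pair $\boldsymbol r,\boldsymbol r+\hat{\mathrm e}_\alpha$ in $\Lambda_B$, and (b) there is $\tau\in\{1,\dots,6\}$ with $|\theta_{\boldsymbol r}-\tfrac\pi3\tau|<2\kappa$ (mod $2\pi$) for all $\boldsymbol r\in\Lambda_B$; bad means not good. For $\boldsymbol t\in\mathbb T_{L/B}$, $\vartheta_{\boldsymbol t}(\mathcal B)$ is the event $\mathcal B$ translated by $B\boldsymbol t$ (for coordinates of $\boldsymbol t$ that are odd, the event is first reflected through the corresponding midplanes of $\Lambda_B$; the bad event is invariant under such spatial reflections). *)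

theory Defs
  imports "HOL-Analysis.Analysis"
begin

type_synonym site = "int \<times> int \<times> int"
type_synonym config = "site \<Rightarrow> real"

text \<open>The torus T_L = Z^3/(LZ)^3, represented by {0,...,L-1}^3.\<close>
definition torus :: "nat \<Rightarrow> site set" where
  "torus L = {(a,b,c). 0 \<le> a \<and> a < int L \<and> 0 \<le> b \<and> b < int L \<and> 0 \<le> c \<and> c < int L}"

definition modL :: "nat \<Rightarrow> site \<Rightarrow> site" where
  "modL L r = (case r of (a,b,c) \<Rightarrow> (a mod int L, b mod int L, c mod int L))"

definition vadd :: "site \<Rightarrow> site \<Rightarrow> site" where
  "vadd r s = (case r of (a,b,c) \<Rightarrow> case s of (x,y,z) \<Rightarrow> (a+x, b+y, c+z))"

definition unit_vec :: "nat \<Rightarrow> site" where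
  "unit_vec \<alpha> = (if \<alpha> = 1 then (1,0,0) else if \<alpha> = 2 then (0,1,0) else (0,0,1))"

definition spin_proj :: "nat \<Rightarrow> real \<Rightarrow> real" where
  "spin_proj \<alpha> \<theta> = (if \<alpha> = 1 then cos \<theta>
                     else if \<alpha> = 2 then cos (\<theta> - 2*pi/3) else cos (\<theta> + 2*pi/3))"

definition hamiltonian :: "real \<Rightarrow> nat \<Rightarrow> config \<Rightarrow> real" where
  "hamiltonian J L \<theta> = J / 2 * (\<Sum>r\<in>torus L. \<Sum>\<alpha>\<in>{1,2,3::nat}.
      (spin_proj \<alpha> (\<theta> r) - spin_proj \<alpha> (\<theta> (modL L (vadd r (unit_vec \<alpha>)))))\<^sup>2)"

definition config_measure :: "nat \<Rightarrow> config measure" where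
  "config_measure L = PiM (torus L) (\<lambda>_. lborel)"

definition angle_box :: "nat \<Rightarrow> config set" where
  "angle_box L = {\<theta>. \<forall>r\<in>torus L. 0 \<le> \<theta> r \<and> \<theta> r < 2*pi}"

definition gibbs_weight :: "real \<Rightarrow> real \<Rightarrow> nat \<Rightarrow> config \<Rightarrow> real" where
  "gibbs_weight J \<beta> L \<theta> = indicator (angle_box L) \<theta> * exp (- \<beta> * hamiltonian J L \<theta>)"

definition gibbs_prob :: "real \<Rightarrow> nat \<Rightarrow> real \<Rightarrow> config set \<Rightarrow> real" where
  "gibbs_prob J L \<beta> E =
     (\<integral>\<theta>. indicator E \<theta> * gibbs_weight J \<beta> L \<theta> \<partial>config_measure L) /
     (\<integral>\<theta>. gibbs_weight J \<beta> L \<theta> \<partial>config_measure L)"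

text \<open>The block Lambda_B = {0,...,B}^3 (coordinates before reduction mod L).\<close>
definition block :: "nat \<Rightarrow> site set" where
  "block B = {(a,b,c). 0 \<le> a \<and> a \<le> int B \<and> 0 \<le> b \<and> b \<le> int B \<and> 0 \<le> c \<and> c \<le> int B}"

definition good_block :: "nat \<Rightarrow> real \<Rightarrow> real \<Rightarrow> nat \<Rightarrow> config \<Rightarrow> bool" where
  "good_block L \<kappa> \<Gamma> B \<theta> \<longleftrightarrow>
     (\<forall>r\<in>block B. \<forall>\<alpha>\<in>{1,2,3::nat}. vadd r (unit_vec \<alpha>) \<in> block B \<longrightarrow>
        \<bar>spin_proj \<alpha> (\<theta> (modL L r)) - spin_proj \<alpha> (\<theta> (modL L (vadd r (unit_vec \<alpha>))))\<bar> < \<Gamma>)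
   \<and> (\<exists>\<tau>\<in>{1..6::nat}. \<forall>r\<in>block B. \<exists>n::int.
        \<bar>\<theta> (modL L r) - pi / 3 * real \<tau> - 2 * pi * real_of_int n\<bar> < 2 * \<kappa>)"

definition bad_event :: "nat \<Rightarrow> real \<Rightarrow> real \<Rightarrow> nat \<Rightarrow> config set" where
  "bad_event L \<kappa> \<Gamma> B = {\<theta>. \<not> good_block L \<kappa> \<Gamma> B \<theta>}"

text \<open>Site map of vartheta_t: reflect coordinate i through the midplane of Lambda_B
  (x |-> B - x) when t_i is odd, then translate by B t; reduced mod L.\<close>
definition refl_coord :: "nat \<Rightarrow> int \<Rightarrow> int \<Rightarrow> int" where
  "refl_coord B t x = (if odd t then int B - x else x)"

definition block_map :: "nat \<Rightarrow> nat \<Rightarrow> site \<Rightarrow> site \<Rightarrow> site" where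
  "block_map L B t r = (case t of (t1,t2,t3) \<Rightarrow> case r of (a,b,c) \<Rightarrow>
      modL L (int B * t1 + refl_coord B t1 a, int B * t2 + refl_coord B t2 b,
              int B * t3 + refl_coord B t3 c))"

definition vartheta :: "nat \<Rightarrow> nat \<Rightarrow> site \<Rightarrow> config set \<Rightarrow> config set" where
  "vartheta L B t E = {\<theta>. restrict (\<lambda>r. \<theta> (block_map L B t r)) (torus L) \<in> E}"

end

theory Submission
  imports Defs "HOL-Probability.Probability" "HOL-Real_Asymp.Real_Asymp"
begin

text \<open>By the chessboard estimate for unit cubes, events in distinct cubes are controlled by partition
  functions in which one event is repeated in all cubes of the torus. A bad block contains a cube with a
  costly edge, or all its spins are close to an angle outside \<open>(\<pi>/3)\<int>\<close>, or two consecutive layers in a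
  direction \<open>\<alpha>\<close> are mirror images of each other. Costly edges are suppressed by their energy, \<open>exp (- c \<beta> \<Gamma>\<^sup>2)\<close>
  per site. The other two events occupy \<open>B\<^sup>3\<close> or \<open>B\<^sup>2\<close> cubes and lose entropy only: near such a spin pattern the
  energy is a quadratic form \<open>1 - t A\<close> with \<open>A\<close> the kernel of a random walk, so the logarithm of its Gaussian
  partition function is \<open>\<Sum>\<^sub>j t\<^sup>j tr (A\<^sup>j) / (2 j)\<close> up to the normalization. All traces are dominated, and the fourth one
  strictly, by those of the walk with weights \<open>(0, 1/2, 1/2)\<close> belonging to the six preferred angles. This gives
  a factor \<open>exp (- g)\<close> per cube with \<open>g\<close> independent of \<open>\<beta>\<close>, and a block size \<open>B\<close> growing like
  \<open>\<beta> powr (1 / 16)\<close> beats the number of possible patterns.\<close>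

text \<open>The form \<open>1 - A\<close> degenerates on constant configurations, so its Gaussian
  integral diverges and a mass has to be inserted on both sides. Above, deviations are at most 1,
  hence a factor \<open>exp s\<close> per site pays for a mass; below, deviations are at most
  \<open>w\<close>, and the soft direction of the reference state \<open>\<theta> = pi\<close>
  itself produces a mass of order \<open>w^2\<close>. Both are cheap because the traces per site of
  the reference walk decay like \<open>n powr (- 1 / 2)\<close>. The gain has a geometric source:
  the stiffness vectors of all angles lie on the inscribed circle of the probability simplex, which
  touches the edges at the vectors of the six preferred angles. Traces of order at least
  \<open>L\<close> escape the comparison and leave an error of order
  \<open>ln \<beta> / sqrt L\<close>; hence the recurring condition
  \<open>\<beta> powr (1 / 20) \<le> L\<close>. An opposite limit on \<open>B\<close> comes from
  costly edges: spins drift along the edges of a block, so the angle tolerance per edge is of order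
  \<open>1 / B\<close>, the energy threshold of order \<open>1 / B^4\<close>, and
  \<open>\<beta> / B^4\<close> must beat \<open>ln \<beta>\<close>.\<close>

abbreviation dirs :: "nat set" where "dirs \<equiv> {1,2,3}"

abbreviation lborelP :: "'i set => ('i => real) measure" where
  "lborelP I \<equiv> PiM I (\<lambda>_. lborel)"

abbreviation sumsq :: "'i set => ('i => real) => real" where
  "sumsq I x \<equiv> (\<Sum>i\<in>I. (x i)\<^sup>2)"

section \<open>Gaussian integrals\<close>

abbreviation gexp :: "real => real => real => real" where
  "gexp a b y \<equiv> exp (- (a * y\<^sup>2 + 2 * b * y) / 2)"

interpretation PL: product_sigma_finite "\<lambda>_::'i. lborel :: real measure"
  unfolding product_sigma_finite_def by (simp add: lborel.sigma_finite_measure_axioms)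

definition quad :: "'i set => ('i => 'i => real) => ('i => real) => real" where
  "quad I M x = (\<Sum>i\<in>I. \<Sum>j\<in>I. M i j * x i * x j)"

abbreviation gweight :: "'i set => ('i => 'i => real) => ('i => real) => real" where
  "gweight I M x \<equiv> exp (- quad I M x / 2)"

lemma measurable_quad [measurable]:
  "quad I M \<in> borel_measurable (lborelP I)"
  unfolding quad_def by measurable

lemma quad_insert:
  assumes I: "finite I" "i \<notin> I" and sym: "\<And>k. M k i = M i k"
  shows "quad (insert i I) M (x(i := y)) = M i i * y\<^sup>2 + 2 * (\<Sum>k\<in>I. M i k * x k) * y + quad I M x"
proof -
  have "(\<Sum>k\<in>I. \<Sum>j\<in>I. M k j * (x(i:=y)) k * (x(i:=y)) j) = quad I M x"
    unfolding quad_def using I by (intro sum.cong refl) auto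
  moreover have "(\<Sum>k\<in>I. M k i * (x(i:=y)) k * y) = (\<Sum>k\<in>I. M i k * x k) * y"
    unfolding sum_distrib_right using I sym by (intro sum.cong refl) (metis fun_upd_other)
  moreover have "(\<Sum>k\<in>I. M i k * y * (x(i:=y)) k) = (\<Sum>k\<in>I. M i k * x k) * y"
    unfolding sum_distrib_right using I by (intro sum.cong refl) auto
  ultimately show ?thesis
    using I by (simp add: quad_def sum.distrib power2_eq_square algebra_simps)
qed

text \<open>Completing the square makes \<open>gexp a b\<close> a multiple of the normal density
  with mean \<open>- b / a\<close> and variance \<open>1 / a\<close>. The last two facts are
  integrations by parts: up to sign, the integrands are the derivatives of \<open>gexp a b y\<close>
  and of \<open>y * gexp a b y\<close>.\<close>

lemma
  fixes a b :: real
  assumes a: "a > 0"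
  shows integrable_gauss1: "integrable lborel (\<lambda>y. gexp a b y)"
    and integral_gauss1: "(\<integral>y. gexp a b y \<partial>lborel) = sqrt (2 * pi / a) * exp (b\<^sup>2 / (2 * a))"
    and gauss1_grad: "has_bochner_integral lborel (\<lambda>y. (a * y + b) * gexp a b y) 0"
    and gauss1_grad': "has_bochner_integral lborel (\<lambda>y. ((a * y + b) * y - 1) * gexp a b y) 0"
proof -
  define \<mu> where "\<mu> = - b / a"
  define \<sigma> where "\<sigma> = 1 / sqrt a"
  define C where "C = sqrt (2 * pi / a) * exp (b\<^sup>2 / (2 * a))"
  have \<sigma>: "\<sigma> > 0" "\<sigma>\<^sup>2 = 1 / a" using a by (auto simp: \<sigma>_def power_divide)
  have eq: "gexp a b y = C * normal_density \<mu> \<sigma> y" for y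
  proof -
    have "- (a * y\<^sup>2 + 2 * b * y) / 2 = b\<^sup>2 / (2 * a) + - (y - \<mu>)\<^sup>2 / (2 * \<sigma>\<^sup>2)"
      unfolding \<sigma> \<mu>_def using a by (simp add: field_simps power2_eq_square)
    then have "gexp a b y = exp (b\<^sup>2 / (2 * a)) * exp (- (y - \<mu>)\<^sup>2 / (2 * \<sigma>\<^sup>2))"
      by (simp only: exp_add)
    moreover have "sqrt (2 * pi / a) = sqrt (2 * pi * \<sigma>\<^sup>2)" unfolding \<sigma> by simp
    ultimately show ?thesis unfolding C_def normal_density_def using a \<sigma> by simp
  qed
  show "integrable lborel (\<lambda>y. gexp a b y)"
    unfolding eq using \<sigma> by simp
  show "(\<integral>y. gexp a b y \<partial>lborel) = sqrt (2 * pi / a) * exp (b\<^sup>2 / (2 * a))"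
    unfolding eq using \<sigma> by (simp add: C_def)
  have lin: "a * y + b = a * (y - \<mu>)" for y using a by (simp add: \<mu>_def field_simps)
  have m1: "has_bochner_integral lborel (\<lambda>x. normal_density \<mu> \<sigma> x * (x - \<mu>)) 0"
    using normal_moment_odd[OF \<sigma>(1), of \<mu> 0] by simp
  have m2: "has_bochner_integral lborel (\<lambda>x. normal_density \<mu> \<sigma> x * (x - \<mu>)\<^sup>2) (1/a)"
    using normal_moment_even[OF \<sigma>(1), of \<mu> 1] by (simp add: \<sigma>(2) mult.commute)
  have m0: "has_bochner_integral lborel (normal_density \<mu> \<sigma>) 1"
    using \<sigma> by (simp add: has_bochner_integral_iff)
  have "has_bochner_integral lborel (\<lambda>x. (C * a) * (normal_density \<mu> \<sigma> x * (x - \<mu>))) ((C * a) * 0)"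
    by (intro has_bochner_integral_mult_right m1)
  then show "has_bochner_integral lborel (\<lambda>y. (a * y + b) * gexp a b y) 0"
    unfolding eq lin by (simp add: ac_simps)
  have "has_bochner_integral lborel (\<lambda>x. (C * a) * (normal_density \<mu> \<sigma> x * (x - \<mu>)\<^sup>2)
     + (C * a * \<mu>) * (normal_density \<mu> \<sigma> x * (x - \<mu>)) - C * normal_density \<mu> \<sigma> x)
     ((C * a) * (1/a) + (C * a * \<mu>) * 0 - C * 1)"
    by (intro has_bochner_integral_add has_bochner_integral_diff has_bochner_integral_mult_right m0 m1 m2)
  also have "(\<lambda>x. (C * a) * (normal_density \<mu> \<sigma> x * (x - \<mu>)\<^sup>2)
     + (C * a * \<mu>) * (normal_density \<mu> \<sigma> x * (x - \<mu>)) - C * normal_density \<mu> \<sigma> x) =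
     (\<lambda>y. ((a * y + b) * y - 1) * gexp a b y)"
    unfolding eq lin by (auto simp: fun_eq_iff algebra_simps power2_eq_square)
  also have "(C * a) * (1/a) + (C * a * \<mu>) * 0 - C * 1 = 0" using a by simp
  finally show "has_bochner_integral lborel (\<lambda>y. ((a * y + b) * y - 1) * gexp a b y) 0" .
qed

lemma integrable_gauss_prod:
  assumes "finite I" "c > (0::real)"
  shows "integrable (lborelP I) (\<lambda>x. exp (- c * sumsq I x))"
proof -
  have "integrable lborel (\<lambda>y::real. exp (- c * y\<^sup>2))"
    using integrable_gauss1[of "2 * c" 0] assms by simp
  then have "integrable (lborelP I) (\<lambda>x. \<Prod>i\<in>I. exp (- c * (x i)\<^sup>2))"
    by (intro PL.product_integrable_prod assms)
  then show ?thesis using assms by (simp add: exp_sum sum_distrib_left)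
qed

lemma integrable_gauss:
  assumes I: "finite I" and m: "m > 0" and pd: "\<And>x. m * sumsq I x \<le> quad I M x"
  shows "integrable (lborelP I) (\<lambda>x. gweight I M x)"
proof (rule Bochner_Integration.integrable_bound[OF integrable_gauss_prod[OF I, of "m/2"]])
  show "AE x in lborelP I. norm (gweight I M x) \<le> norm (exp (- (m / 2) * sumsq I x))"
    using pd by (auto simp: field_simps)
qed (use m in auto)

text \<open>The quadratic factor is at most \<open>s = sumsq I x\<close>, and
  \<open>s \<le> 4 / m * exp (m / 4 * s)\<close> absorbs it into half of the Gaussian decay.\<close>

lemma integrable_gauss_mom2:
  assumes I: "finite I" and m: "m > 0" and pd: "\<And>x. m * sumsq I x \<le> quad I M x"
    and ab: "a \<in> I" "b \<in> I"
  shows "integrable (lborelP I) (\<lambda>x. x a * x b * gweight I M x)"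
proof (rule Bochner_Integration.integrable_bound[OF integrable_mult_right[OF integrable_gauss_prod[OF I, of "m/4"], of "4/m"]])
  note [measurable] = ab
  show "(\<lambda>x. x a * x b * gweight I M x) \<in> borel_measurable (lborelP I)"
    using ab by measurable
  show "AE x in lborelP I. norm (x a * x b * gweight I M x) \<le>
      norm (4 / m * exp (- (m / 4) * sumsq I x))"
  proof (rule AE_I2)
    fix x :: "'a => real"
    define s where "s = sumsq I x"
    have le: "(x i)\<^sup>2 \<le> s" if "i \<in> I" for i
      unfolding s_def using I that by (intro member_le_sum) auto
    have "\<bar>x a * x b\<bar> \<le> ((x a)\<^sup>2 + (x b)\<^sup>2) / 2"
      using sum_squares_bound[of "\<bar>x a\<bar>" "\<bar>x b\<bar>"] by (simp add: abs_mult)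
    also have "... \<le> s" using le[OF ab(1)] le[OF ab(2)] by simp
    also have "m / 4 * s \<le> exp (m / 4 * s)" using exp_ge_add_one_self[of "m / 4 * s"] by linarith
    then have "s \<le> 4 / m * exp (m / 4 * s)" using m by (simp add: field_simps)
    finally have 1: "\<bar>x a * x b\<bar> \<le> 4 / m * exp (m / 4 * s)" .
    have 2: "gweight I M x \<le> exp (- (m / 2) * s)"
      using pd[of x] by (simp add: s_def)
    have "\<bar>x a * x b\<bar> * gweight I M x \<le> (4 / m * exp (m / 4 * s)) * exp (- (m / 2) * s)"
      using 1 2 m by (intro mult_mono) auto
    also have "... = 4 / m * exp (- (m / 4) * s)"
      by (simp add: exp_add[symmetric] mult.assoc)
    finally show "norm (x a * x b * gweight I M x) \<le>
      norm (4 / m * exp (- (m / 4) * sumsq I x))"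
      using m by (simp add: abs_mult s_def)
  qed
qed (use m in auto)

text \<open>With all coordinates but \<open>i\<close> frozen, the exponent is that of
  \<open>gexp\<close>, and the inner integral vanishes by \<open>gauss1_grad\<close> or
  \<open>gauss1_grad'\<close>. The identity says that the normalized second moments invert
  \<open>M\<close>, so that covariances are reached without determinants or matrix inverses.\<close>

lemma gauss_integration_by_parts:
  assumes I: "finite I" and m: "m > 0" and pd: "\<And>x. m * sumsq I x \<le> quad I M x"
    and sym: "\<And>i j. M i j = M j i" and ij: "i \<in> I" "j \<in> I"
  shows "(\<Sum>k\<in>I. M i k * (\<integral>x. x k * x j * gweight I M x \<partial>lborelP I))
       = (if i = j then 1 else 0) * (\<integral>x. gweight I M x \<partial>lborelP I)"
proof -
  let ?P = "lborelP I :: ('a => real) measure"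
  define d where "d = (if i = j then 1 else 0 :: real)"
  define f where "f x = ((\<Sum>k\<in>I. M i k * x k) * x j - d) * gweight I M x" for x
  note int1 = integrable_gauss[OF I m pd]
  note int2 = integrable_gauss_mom2[OF I m pd]
  have f_eq: "f x = (\<Sum>k\<in>I. M i k * (x k * x j * gweight I M x)) - d * gweight I M x" for x
    unfolding f_def by (simp add: left_diff_distrib sum_distrib_right mult.assoc)
  have fint: "integrable ?P f"
    unfolding f_eq[abs_def] using int1 int2 ij
    by (intro Bochner_Integration.integrable_diff Bochner_Integration.integrable_sum integrable_mult_right) auto
  define I' where "I' = I - {i}"
  have I': "I = insert i I'" "i \<notin> I'" "finite I'" using ij I by (auto simp: I'_def)
  have a: "M i i > 0"
    using pd[of "\<lambda>k. if k = i then 1 else 0"] ij I m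
    by (simp add: quad_def if_distrib[of "\<lambda>z. _ * z"] if_distrib[of "\<lambda>z. z ^ _"] sum.delta' sum.delta cong: if_cong)
  have inner: "(\<integral>y. f (x(i:=y)) \<partial>lborel) = 0" for x :: "'a => real"
  proof -
    define b where "b = (\<Sum>k\<in>I'. M i k * x k)"
    have q: "quad I M (x(i:=y)) = M i i * y\<^sup>2 + 2 * b * y + quad I' M x" for y
      unfolding I'(1) b_def by (rule quad_insert) (use I' sym in auto)
    have s: "(\<Sum>k\<in>I. M i k * (x(i:=y)) k) = M i i * y + b" for y
    proof -
      have "(\<Sum>k\<in>I'. M i k * (x(i:=y)) k) = b" unfolding b_def using I' by (intro sum.cong) auto
      then show ?thesis unfolding I'(1) using I' by simp
    qed
    have ex: "exp (- quad I M (x(i:=y)) / 2) = exp (- quad I' M x / 2) * exp (- (M i i * y\<^sup>2 + 2 * b * y) / 2)" for y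
      unfolding q by (simp add: exp_add[symmetric] field_simps)
    show ?thesis
    proof (cases "i = j")
      case True
      have "f (x(i:=y)) = exp (- quad I' M x / 2) * (((M i i * y + b) * y - 1) * exp (- (M i i * y\<^sup>2 + 2 * b * y) / 2))" for y
        unfolding f_def ex s using True by (simp add: d_def)
      then show ?thesis using has_bochner_integral_integral_eq[OF gauss1_grad'[OF a, of b]] by simp
    next
      case False
      have "f (x(i:=y)) = (exp (- quad I' M x / 2) * x j) * ((M i i * y + b) * exp (- (M i i * y\<^sup>2 + 2 * b * y) / 2))" for y
        unfolding f_def ex s using False by (simp add: d_def)
      then show ?thesis using has_bochner_integral_integral_eq[OF gauss1_grad[OF a, of b]] by simp
    qed
  qed
  have "integral\<^sup>L ?P f = (\<integral>x. (\<integral>y. f (x(i:=y)) \<partial>lborel) \<partial>lborelP I')"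
    unfolding I'(1) by (rule PL.product_integral_insert) (use I' fint in auto)
  then have "integral\<^sup>L ?P f = 0" using inner by simp
  moreover have "integral\<^sup>L ?P f = (\<Sum>k\<in>I. M i k * (\<integral>x. x k * x j * gweight I M x \<partial>?P))
      - d * (\<integral>x. gweight I M x \<partial>?P)"
    unfolding f_eq[abs_def] using int1 int2 ij by simp
  ultimately show ?thesis by (simp add: d_def)
qed


section \<open>The Gaussian partition function of \<open>1 - t A\<close> and its trace
  expansion\<close>

definition contraction_kernel :: "'i set => ('i => 'i => real) => bool" where
  "contraction_kernel I A \<longleftrightarrow> finite I \<and> (\<forall>i j. A i j = A j i) \<and> (\<forall>i\<in>I. (\<Sum>j\<in>I. \<bar>A i j\<bar>) \<le> 1)"

text \<open>Schur test: each product is at most the mean of the two squares, and by symmetry of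
  \<open>A\<close> both halves collect row sums. It bounds the form by that of the identity without
  a spectral theorem.\<close>

lemma quad_contraction:
  assumes "contraction_kernel I A"
  shows "\<bar>quad I A x\<bar> \<le> sumsq I x"
proof -
  have fin: "finite I" and sym: "\<And>i j. A i j = A j i" and row: "\<And>i. i \<in> I ==> (\<Sum>j\<in>I. \<bar>A i j\<bar>) \<le> 1"
    using assms by (auto simp: contraction_kernel_def)
  have "\<bar>quad I A x\<bar> \<le> (\<Sum>i\<in>I. \<Sum>j\<in>I. \<bar>A i j * x i * x j\<bar>)"
    unfolding quad_def by (intro order.trans[OF sum_abs] sum_mono order.trans[OF sum_abs] order.refl)
  also have "... \<le> (\<Sum>i\<in>I. \<Sum>j\<in>I. \<bar>A i j\<bar> * ((x i)\<^sup>2 / 2) + \<bar>A i j\<bar> * ((x j)\<^sup>2 / 2))"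
  proof (intro sum_mono)
    fix i j
    have "\<bar>x i * x j\<bar> \<le> (x i)\<^sup>2 / 2 + (x j)\<^sup>2 / 2"
      using sum_squares_bound[of "\<bar>x i\<bar>" "\<bar>x j\<bar>"] by (simp add: abs_mult)
    then have "\<bar>A i j\<bar> * \<bar>x i * x j\<bar> \<le> \<bar>A i j\<bar> * ((x i)\<^sup>2 / 2 + (x j)\<^sup>2 / 2)"
      by (intro mult_left_mono) auto
    then show "\<bar>A i j * x i * x j\<bar> \<le> \<bar>A i j\<bar> * ((x i)\<^sup>2 / 2) + \<bar>A i j\<bar> * ((x j)\<^sup>2 / 2)"
      by (simp add: abs_mult mult.assoc distrib_left)
  qed
  also have "... = (\<Sum>i\<in>I. (\<Sum>j\<in>I. \<bar>A i j\<bar>) * ((x i)\<^sup>2 / 2)) + (\<Sum>i\<in>I. \<Sum>j\<in>I. \<bar>A i j\<bar> * ((x j)\<^sup>2 / 2))"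
    by (simp only: sum.distrib sum_distrib_right)
  also have "(\<Sum>i\<in>I. \<Sum>j\<in>I. \<bar>A i j\<bar> * ((x j)\<^sup>2 / 2)) = (\<Sum>i\<in>I. (\<Sum>j\<in>I. \<bar>A i j\<bar>) * ((x i)\<^sup>2 / 2))"
  proof -
    have "\<bar>A i j\<bar> = \<bar>A j i\<bar>" for i j using sym[of i j] by simp
    then show ?thesis
      by (subst sum.swap) (simp only: sum_distrib_right)
  qed
  also have "(\<Sum>i\<in>I. (\<Sum>j\<in>I. \<bar>A i j\<bar>) * ((x i)\<^sup>2 / 2)) \<le> (\<Sum>i\<in>I. 1 * ((x i)\<^sup>2 / 2))"
    by (intro sum_mono mult_right_mono row) auto
  finally show ?thesis by (simp add: sum_divide_distrib[symmetric])
qed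

definition id_minus :: "real => ('i => 'i => real) => 'i => 'i => real" where
  "id_minus t A i j = (if i = j then 1 else 0) - t * A i j"

lemma quad_id_minus:
  assumes "finite I"
  shows "quad I (id_minus t A) x = sumsq I x - t * quad I A x"
proof -
  have "(\<Sum>j\<in>I. id_minus t A i j * x i * x j) = (x i)\<^sup>2 - t * (\<Sum>j\<in>I. A i j * x i * x j)" if "i \<in> I" for i
  proof -
    have "(\<Sum>j\<in>I. id_minus t A i j * x i * x j) = (\<Sum>j\<in>I. (if i = j then x i * x j else 0) - t * (A i j * x i * x j))"
      by (intro sum.cong) (auto simp: id_minus_def algebra_simps)
    also have "... = (x i)\<^sup>2 - t * (\<Sum>j\<in>I. A i j * x i * x j)"
      using assms that by (simp add: sum_subtractf sum_distrib_left power2_eq_square)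
    finally show ?thesis .
  qed
  then show ?thesis by (simp add: quad_def sum_subtractf sum_distrib_left)
qed

lemma quad_id_minus_ge:
  assumes "contraction_kernel I A"
  shows "(1 - \<bar>t\<bar>) * sumsq I x \<le> quad I (id_minus t A) x"
proof -
  have "t * quad I A x \<le> \<bar>t\<bar> * \<bar>quad I A x\<bar>" by (metis abs_ge_self abs_mult)
  also have "... \<le> \<bar>t\<bar> * sumsq I x"
    by (intro mult_left_mono quad_contraction assms) auto
  finally show ?thesis using assms by (simp add: quad_id_minus contraction_kernel_def algebra_simps)
qed

fun kpow :: "'i set => ('i => 'i => real) => nat => 'i => 'i => real" where
  "kpow I A 0 i j = (if i = j then 1 else 0)"
| "kpow I A (Suc n) i j = (\<Sum>k\<in>I. kpow I A n i k * A k j)"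

definition ktrace :: "'i set => ('i => 'i => real) => nat => real" where
  "ktrace I A n = (\<Sum>i\<in>I. kpow I A n i i)"

lemma kpow_row_le:
  assumes "contraction_kernel I A" "i \<in> I"
  shows "(\<Sum>j\<in>I. \<bar>kpow I A n i j\<bar>) \<le> 1"
proof (induction n)
  case 0
  have "(\<Sum>j\<in>I. \<bar>kpow I A 0 i j\<bar>) = (\<Sum>j\<in>I. if i = j then 1 else 0)" by (intro sum.cong) auto
  then show ?case using assms by (simp add: contraction_kernel_def)
next
  case (Suc n)
  have "(\<Sum>j\<in>I. \<bar>kpow I A (Suc n) i j\<bar>) \<le> (\<Sum>j\<in>I. \<Sum>k\<in>I. \<bar>kpow I A n i k\<bar> * \<bar>A k j\<bar>)"
    by (intro sum_mono) (simp add: abs_mult[symmetric])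
  also have "... = (\<Sum>k\<in>I. \<bar>kpow I A n i k\<bar> * (\<Sum>j\<in>I. \<bar>A k j\<bar>))"
    by (subst sum.swap) (simp add: sum_distrib_left)
  also have "... \<le> (\<Sum>k\<in>I. \<bar>kpow I A n i k\<bar> * 1)"
    using assms by (intro sum_mono mult_left_mono) (auto simp: contraction_kernel_def)
  finally show ?case using Suc by simp
qed

lemma ktrace_abs_le:
  assumes "contraction_kernel I A"
  shows "\<bar>ktrace I A n\<bar> \<le> card I"
proof -
  have fin: "finite I" using assms by (auto simp: contraction_kernel_def)
  have "\<bar>kpow I A n i i\<bar> \<le> 1" if "i \<in> I" for i
    using member_le_sum[OF that, of "\<lambda>j. \<bar>kpow I A n i j\<bar>"] kpow_row_le[OF assms that, of n] fin by simp
  then have "\<bar>ktrace I A n\<bar> \<le> (\<Sum>i\<in>I. 1)" unfolding ktrace_def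
    by (intro order.trans[OF sum_abs] sum_mono) auto
  then show ?thesis by simp
qed

lemma summable_ktrace:
  assumes "contraction_kernel I A" "\<bar>t\<bar> < 1"
  shows "summable (\<lambda>n. ktrace I A (Suc n) * t ^ n)"
proof (rule summable_comparison_test')
  show "summable (\<lambda>n. real (card I) * \<bar>t\<bar> ^ n)"
    using assms by (intro summable_mult summable_geometric) auto
  show "norm (ktrace I A (Suc n) * t ^ n) \<le> real (card I) * \<bar>t\<bar> ^ n" for n
    using ktrace_abs_le[OF assms(1), of "Suc n"]
    by (simp add: abs_mult power_abs mult_right_mono del: kpow.simps)
qed

definition gaussZ :: "'i set => ('i => 'i => real) => real" where
  "gaussZ I M = (\<integral>x. gweight I M x \<partial>lborelP I)"

text \<open>A positive function with integral zero would vanish almost everywhere, which is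
  impossible on a space of nonzero total mass.\<close>

lemma gauss_pos:
  assumes I: "finite I" and m: "m > 0" and pd: "\<And>x. m * sumsq I x \<le> quad I M x"
  shows "gaussZ I M > 0"
proof -
  let ?P = "lborelP I :: ('a => real) measure"
  note int = integrable_gauss[OF I m pd]
  have "gaussZ I M \<noteq> 0"
  proof
    assume "gaussZ I M = 0"
    then have "AE x in ?P. gweight I M x = 0"
      unfolding gaussZ_def using int by (subst (asm) integral_nonneg_eq_0_iff_AE) auto
    then have "AE x in ?P. False" by simp
    then have "emeasure ?P (space ?P) = 0" by (simp add: AE_iff_measurable[OF _ refl])
    moreover have "emeasure ?P (space ?P) = (\<Prod>i\<in>I. \<infinity>)"
      unfolding space_PiM using I by (subst PL.emeasure_PiM) auto
    ultimately show False using I by (auto simp: prod_zero_iff)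
  qed
  moreover have "gaussZ I M \<ge> 0" unfolding gaussZ_def by simp
  ultimately show ?thesis by linarith
qed

text \<open>Applying the inequality to \<open>(s, t)\<close> and to \<open>(t, s)\<close> squeezes
  the difference quotient between \<open>\<phi> s\<close> and \<open>\<phi> t\<close>. This lets the
  logarithm of a partition function be differentiated through Jensen's inequality instead of under
  the integral sign.\<close>

lemma has_derivative_of_subgradient:
  fixes f \<phi> :: "real => real"
  assumes sub: "\<And>s t. s \<in> S ==> t \<in> S ==> (t - s) * \<phi> s \<le> f t - f s"
    and S: "open S" "s \<in> S" and cont: "isCont \<phi> s"
  shows "(f has_real_derivative \<phi> s) (at s)"
  unfolding has_field_derivative_iff
proof (rule LIM_zero_cancel, rule Lim_null_comparison)
  have "((\<lambda>t. \<bar>\<phi> t - \<phi> s\<bar>) \<longlongrightarrow> \<bar>\<phi> s - \<phi> s\<bar>) (at s)"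
    using cont unfolding isCont_def by (intro tendsto_intros)
  then show "((\<lambda>t. \<bar>\<phi> t - \<phi> s\<bar>) \<longlongrightarrow> 0) (at s)" by simp
  show "\<forall>\<^sub>F t in at s. norm ((f t - f s) / (t - s) - \<phi> s) \<le> \<bar>\<phi> t - \<phi> s\<bar>"
    unfolding eventually_at_topological
  proof (intro exI[of _ S] conjI S ballI impI)
    fix t assume t: "t \<in> S" "t \<noteq> s"
    have "\<bar>f t - f s - (t - s) * \<phi> s\<bar> \<le> \<bar>(t - s) * (\<phi> t - \<phi> s)\<bar>"
      using sub[OF S(2) t(1)] sub[OF t(1) S(2)] by (simp add: algebra_simps abs_if)
    then have "\<bar>(f t - f s - (t - s) * \<phi> s) / (t - s)\<bar> \<le> \<bar>\<phi> t - \<phi> s\<bar>"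
      using t unfolding abs_divide abs_mult by (subst pos_divide_le_eq) (auto simp: mult.commute)
    moreover have "(f t - f s - (t - s) * \<phi> s) / (t - s) = (f t - f s) / (t - s) - \<phi> s"
      using t by (simp add: diff_divide_distrib)
    ultimately show "norm ((f t - f s) / (t - s) - \<phi> s) \<le> \<bar>\<phi> t - \<phi> s\<bar>" by simp
  qed
qed

context
  fixes I :: "'i set" and A :: "'i => 'i => real"
  assumes A: "contraction_kernel I A"
begin

private lemma fin: "finite I" and sym: "A i j = A j i"
  using A by (auto simp: contraction_kernel_def)

private abbreviation "W t \<equiv> \<lambda>x. gweight I (id_minus t A) x"
private abbreviation "P \<equiv> lborelP I :: ('i => real) measure"

private definition cov :: "real => 'i => 'i => real" where
  "cov t i j = (\<integral>x. x i * x j * W t x \<partial>P) / gaussZ I (id_minus t A)"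

private lemma pd: "\<bar>t\<bar> < 1 ==> 0 < 1 - \<bar>t\<bar>" for t :: real by simp

private lemma Wint: "\<bar>t\<bar> < 1 ==> integrable P (W t)"
  by (rule integrable_gauss[OF fin pd quad_id_minus_ge[OF A]])

private lemma Wint2: "\<bar>t\<bar> < 1 ==> i \<in> I ==> j \<in> I ==> integrable P (\<lambda>x. x i * x j * W t x)"
  by (rule integrable_gauss_mom2[OF fin pd quad_id_minus_ge[OF A]])

private lemma Zpos: "\<bar>t\<bar> < 1 ==> gaussZ I (id_minus t A) > 0"
  by (rule gauss_pos[OF fin pd quad_id_minus_ge[OF A]])

text \<open>Integration by parts for \<open>M = 1 - t A\<close>: the covariance solves
  \<open>C = 1 + t A C\<close>.\<close>

private lemma cov_eq:
  assumes t: "\<bar>t\<bar> < 1" and ij: "i \<in> I" "j \<in> I"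
  shows "cov t i j = (if i = j then 1 else 0) + t * (\<Sum>k\<in>I. A i k * cov t k j)"
proof -
  have "(\<Sum>k\<in>I. id_minus t A i k * (\<integral>x. x k * x j * W t x \<partial>P)) =
     (if i = j then 1 else 0) * gaussZ I (id_minus t A)"
    unfolding gaussZ_def
    by (rule gauss_integration_by_parts[OF fin pd[OF t] quad_id_minus_ge[OF A] _ ij]) (auto simp: id_minus_def sym)
  then have "(\<Sum>k\<in>I. id_minus t A i k * cov t k j) = (if i = j then 1 else 0)"
    unfolding cov_def times_divide_eq_right sum_divide_distrib[symmetric] using Zpos[OF t] by simp
  also have "(\<Sum>k\<in>I. id_minus t A i k * cov t k j) = (\<Sum>k\<in>I. (if i = k then cov t k j else 0) - t * (A i k * cov t k j))"
    by (intro sum.cong) (auto simp: id_minus_def algebra_simps)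
  also have "... = cov t i j - t * (\<Sum>k\<in>I. A i k * cov t k j)"
    using ij fin by (simp add: sum_subtractf sum_distrib_left)
  finally show ?thesis by simp
qed

text \<open>Iterating \<open>cov_eq\<close> gives the Neumann series of the inverse of
  \<open>1 - t A\<close> with an explicit remainder.\<close>

private lemma cov_expand:
  assumes t: "\<bar>t\<bar> < 1" and ij: "i \<in> I" "j \<in> I"
  shows "cov t i j = (\<Sum>n<N. t ^ n * kpow I A n i j) + t ^ N * (\<Sum>k\<in>I. kpow I A N i k * cov t k j)"
proof (induction N)
  case 0
  have "(\<Sum>k\<in>I. kpow I A 0 i k * cov t k j) = (\<Sum>k\<in>I. if i = k then cov t k j else 0)"
    by (intro sum.cong) auto
  then show ?case using ij fin by simp
next
  case (Suc N)
  have "(\<Sum>k\<in>I. kpow I A N i k * cov t k j) =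
     (\<Sum>k\<in>I. (if k = j then kpow I A N i k else 0) + t * (\<Sum>l\<in>I. kpow I A N i k * A k l * cov t l j))"
    using ij by (intro sum.cong refl, subst cov_eq[OF t])
      (auto simp: algebra_simps sum_distrib_left)
  also have "... = kpow I A N i j + t * (\<Sum>k\<in>I. \<Sum>l\<in>I. kpow I A N i k * A k l * cov t l j)"
    using ij fin by (simp add: sum.distrib sum_distrib_left)
  also have "(\<Sum>k\<in>I. \<Sum>l\<in>I. kpow I A N i k * A k l * cov t l j) = (\<Sum>l\<in>I. kpow I A (Suc N) i l * cov t l j)"
    by (subst sum.swap) (simp add: sum_distrib_right)
  finally show ?case using Suc by (simp add: algebra_simps)
qed

text \<open>The mean of the quadratic form of \<open>A\<close> is the trace of \<open>A\<close>
  times the covariance; the Neumann series turns it into traces of powers. The remainder is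
  \<open>t ^ N\<close> times a quantity bounded uniformly in \<open>N\<close>, because the rows of
  \<open>kpow\<close> have absolute sum at most 1.\<close>

private lemma mean_quad_sums:
  assumes t: "\<bar>t\<bar> < 1"
  shows "(\<lambda>n. ktrace I A (Suc n) * t ^ n) sums ((\<integral>x. quad I A x * W t x \<partial>P) / gaussZ I (id_minus t A))"
proof -
  define m where "m = (\<Sum>i\<in>I. \<Sum>k\<in>I. cov t i k * A k i)"
  have "(\<integral>x. quad I A x * W t x \<partial>P) = (\<Sum>i\<in>I. \<Sum>k\<in>I. A i k * (\<integral>x. x i * x k * W t x \<partial>P))"
    using Wint2[OF t] by (simp add: quad_def sum_distrib_right mult.assoc Bochner_Integration.integral_sum)
  then have m: "(\<integral>x. quad I A x * W t x \<partial>P) / gaussZ I (id_minus t A) = m"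
    unfolding m_def cov_def times_divide_eq_left sum_divide_distrib[symmetric]
    by (simp add: sym mult.commute)
  define c where "c = (\<Sum>i\<in>I. \<Sum>k\<in>I. \<bar>cov t i k\<bar>)"
  have c: "\<bar>cov t i k\<bar> \<le> c" if "i \<in> I" "k \<in> I" for i k
  proof -
    have "\<bar>cov t i k\<bar> \<le> (\<Sum>k\<in>I. \<bar>cov t i k\<bar>)" using that fin by (intro member_le_sum) auto
    also have "... \<le> c" unfolding c_def using that fin by (intro member_le_sum) (auto intro: sum_nonneg)
    finally show ?thesis .
  qed
  have c0: "c \<ge> 0" unfolding c_def by (intro sum_nonneg) auto
  define R where "R N = (\<Sum>i\<in>I. \<Sum>k\<in>I. (\<Sum>l\<in>I. kpow I A N i l * cov t l k) * A k i)" for N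
  have R: "\<bar>R N\<bar> \<le> card I * c" for N
  proof -
    have "\<bar>R N\<bar> \<le> (\<Sum>i\<in>I. \<Sum>k\<in>I. \<bar>(\<Sum>l\<in>I. kpow I A N i l * cov t l k)\<bar> * \<bar>A k i\<bar>)"
      unfolding R_def by (intro order.trans[OF sum_abs] sum_mono order.trans[OF sum_abs]) (simp add: abs_mult)
    also have "... \<le> (\<Sum>i\<in>I. \<Sum>k\<in>I. c * \<bar>A i k\<bar>)"
    proof (intro sum_mono)
      fix i k assume ik: "i \<in> I" "k \<in> I"
      have "\<bar>(\<Sum>l\<in>I. kpow I A N i l * cov t l k)\<bar> \<le> (\<Sum>l\<in>I. \<bar>kpow I A N i l\<bar> * c)"
        using ik by (intro order.trans[OF sum_abs] sum_mono) (auto simp: abs_mult intro!: mult_left_mono c)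
      also have "... \<le> 1 * c" unfolding sum_distrib_right[symmetric]
        using kpow_row_le[OF A ik(1), of N] c0 by (intro mult_right_mono) auto
      finally show "\<bar>(\<Sum>l\<in>I. kpow I A N i l * cov t l k)\<bar> * \<bar>A k i\<bar> \<le> c * \<bar>A i k\<bar>"
        by (simp add: sym[of i k] mult_right_mono)
    qed
    also have "... \<le> (\<Sum>i\<in>I. c * 1)"
      unfolding sum_distrib_left[symmetric] using A c0
      by (intro mult_left_mono sum_mono) (auto simp: contraction_kernel_def)
    finally show ?thesis by (simp add: mult.commute)
  qed
  have exp: "m = (\<Sum>n<N. ktrace I A (Suc n) * t ^ n) + t ^ N * R N" for N
  proof -
    have "m = (\<Sum>i\<in>I. \<Sum>k\<in>I. ((\<Sum>n<N. t ^ n * kpow I A n i k) + t ^ N * (\<Sum>l\<in>I. kpow I A N i l * cov t l k)) * A k i)"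
      unfolding m_def using cov_expand[OF t, of _ _ N] by (intro sum.cong refl) simp
    also have "... = (\<Sum>i\<in>I. \<Sum>k\<in>I. \<Sum>n<N. t ^ n * (kpow I A n i k * A k i)) + t ^ N * R N"
      unfolding R_def by (simp add: algebra_simps sum.distrib sum_distrib_left sum_distrib_right)
    also have "(\<Sum>i\<in>I. \<Sum>k\<in>I. \<Sum>n<N. t ^ n * (kpow I A n i k * A k i)) =
       (\<Sum>i\<in>I. \<Sum>n<N. \<Sum>k\<in>I. t ^ n * (kpow I A n i k * A k i))"
      by (intro sum.cong refl, rule sum.swap)
    also have "... = (\<Sum>n<N. ktrace I A (Suc n) * t ^ n)"
      by (subst sum.swap) (simp add: ktrace_def sum_distrib_left sum_distrib_right mult.commute)
    finally show ?thesis .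
  qed
  have "(\<lambda>N. t ^ N * (card I * c)) \<longlonglongrightarrow> 0 * (card I * c)"
    by (intro tendsto_mult tendsto_const LIMSEQ_power_zero) (use t in auto)
  then have "(\<lambda>N. \<bar>t\<bar> ^ N * (card I * c)) \<longlonglongrightarrow> 0"
    using t by (intro tendsto_mult_left_zero LIMSEQ_power_zero) auto
  then have "(\<lambda>N. t ^ N * R N) \<longlonglongrightarrow> 0"
    by (rule Lim_null_comparison[rotated])
       (auto simp: abs_mult power_abs intro!: always_eventually mult_left_mono R)
  then have "(\<lambda>N. m - t ^ N * R N) \<longlonglongrightarrow> m - 0" by (intro tendsto_intros)
  moreover have "m - t ^ N * R N = (\<Sum>n<N. ktrace I A (Suc n) * t ^ n)" for N
    using exp[of N] by simp
  ultimately show ?thesis unfolding m sums_def by simp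
qed

private definition mean :: "real => real" where
  "mean t = (\<integral>x. quad I A x * W t x \<partial>P) / gaussZ I (id_minus t A)"

private lemma Wqint: "\<bar>t\<bar> < 1 ==> integrable P (\<lambda>x. quad I A x * W t x)"
  unfolding quad_def[of I A] sum_distrib_right
  by (intro Bochner_Integration.integrable_sum)
     (use Wint2 in \<open>auto simp: mult.assoc intro!: integrable_mult_right\<close>)

text \<open>The tangent of the exponential at the mean \<open>e\<close> gives
  \<open>exp u \<ge> exp e * (1 + (u - e))\<close>, and averaging over the measure with parameter
  \<open>s\<close> cancels the linear term. Hence \<open>mean s / 2\<close> is a subgradient of
  \<open>ln Z\<close> at \<open>s\<close>.\<close>

private lemma Z_jensen:
  assumes s: "\<bar>s\<bar> < 1" and t: "\<bar>t\<bar> < 1"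
  shows "gaussZ I (id_minus s A) * exp ((t - s) / 2 * mean s) \<le> gaussZ I (id_minus t A)"
proof -
  define e where "e = (t - s) / 2 * mean s"
  have "(\<integral>x. exp e * ((1 - e) * W s x + (t - s) / 2 * (quad I A x * W s x)) \<partial>P) \<le> gaussZ I (id_minus t A)"
    unfolding gaussZ_def
  proof (rule integral_mono)
    show "integrable P (\<lambda>x. exp e * ((1 - e) * W s x + (t - s) / 2 * (quad I A x * W s x)))"
      by (intro integrable_mult_right Bochner_Integration.integrable_add Wint Wqint s)
    show "integrable P (W t)" by (rule Wint[OF t])
    fix x :: "'i => real"
    define u where "u = (t - s) / 2 * quad I A x"
    have W: "W t x = W s x * exp u"
      unfolding u_def quad_id_minus[OF fin] exp_add[symmetric] by (simp add: field_simps)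
    have "exp e * (1 + (u - e)) \<le> exp e * exp (u - e)"
      by (intro mult_left_mono exp_ge_add_one_self) auto
    also have "... = exp u" by (simp add: exp_add[symmetric])
    finally have "W s x * (exp e * (1 + (u - e))) \<le> W s x * exp u"
      by (intro mult_left_mono) auto
    then show "exp e * ((1 - e) * W s x + (t - s) / 2 * (quad I A x * W s x)) \<le> W t x"
      unfolding W by (simp add: u_def algebra_simps)
  qed
  also have "(\<integral>x. exp e * ((1 - e) * W s x + (t - s) / 2 * (quad I A x * W s x)) \<partial>P) =
     exp e * ((1 - e) * gaussZ I (id_minus s A) + (t - s) / 2 * (mean s * gaussZ I (id_minus s A)))"
  proof -
    have "(\<integral>x. quad I A x * W s x \<partial>P) = mean s * gaussZ I (id_minus s A)"
      using Zpos[OF s] by (simp add: mean_def)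
    moreover have "(\<integral>x. W s x \<partial>P) = gaussZ I (id_minus s A)"
      by (simp add: gaussZ_def)
    ultimately show ?thesis
      using Bochner_Integration.integral_add[OF integrable_mult_right[OF Wint[OF s], of "1 - e"]
          integrable_mult_right[OF Wqint[OF s], of "(t - s) / 2"]]
      by (simp only: integral_mult_right_zero)
  qed
  also have "... = gaussZ I (id_minus s A) * exp e"
    unfolding e_def by (simp add: algebra_simps)
  finally show ?thesis unfolding e_def .
qed

text \<open>This is the expansion of \<open>- ln (det (1 - t A)) / 2\<close>. The derivative of
  \<open>ln Z\<close> is \<open>mean / 2\<close>, whose power series is known, and the value at
  \<open>t = 0\<close> is a product of one-variable Gaussian integrals. The summand with
  \<open>n = 0\<close> is 0, since division by 0 yields 0.\<close>

theorem ln_gaussZ: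
  assumes t: "\<bar>t\<bar> < 1"
  shows "ln (gaussZ I (id_minus t A)) = card I / 2 * ln (2 * pi) + (\<Sum>n. ktrace I A n / n * t ^ n) / 2"
proof -
  define f where "f t = ln (gaussZ I (id_minus t A))" for t
  define c where "c n = ktrace I A n / n" for n
  have diffs: "diffs c n = ktrace I A (Suc n)" for n
    by (simp add: diffs_def c_def del: of_nat_Suc)
  have summ: "summable (\<lambda>n. c n * z ^ n)" if "norm z < 1" for z :: real
  proof (rule summable_comparison_test')
    show "summable (\<lambda>n. real (card I) * \<bar>z\<bar> ^ n)"
      using that by (intro summable_mult summable_geometric) auto
    show "norm (c n * z ^ n) \<le> real (card I) * \<bar>z\<bar> ^ n" for n
    proof -
      have "\<bar>c n\<bar> \<le> card I"
      proof (cases "n = 0")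
        case False
        have "\<bar>c n\<bar> \<le> \<bar>ktrace I A n\<bar> / 1" unfolding c_def abs_divide
          using False by (intro divide_left_mono) auto
        then show ?thesis using ktrace_abs_le[OF A, of n] by simp
      qed (simp add: c_def)
      then show ?thesis by (simp add: abs_mult power_abs mult_right_mono)
    qed
  qed
  have mean_eq: "mean s = (\<Sum>n. diffs c n * s ^ n)" if "\<bar>s\<bar> < 1" for s
    using mean_quad_sums[OF that] by (simp add: mean_def diffs sums_iff)
  have dPhi: "((\<lambda>z. \<Sum>n. c n * z ^ n) has_real_derivative mean s) (at s)" if "\<bar>s\<bar> < 1" for s
    unfolding mean_eq[OF that] by (rule termdiffs_strong'[where K=1]) (use that summ in auto)
  have sumd: "summable (\<lambda>n. diffs c n * z ^ n)" if "norm z < 1" for z :: real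
    using summable_ktrace[OF A, of z] that by (simp add: diffs)
  have cont: "isCont mean s" if s: "\<bar>s\<bar> < 1" for s
  proof -
    have "((\<lambda>z. \<Sum>n. diffs c n * z ^ n) has_real_derivative (\<Sum>n. diffs (diffs c) n * s ^ n)) (at s)"
      by (rule termdiffs_strong'[where K=1]) (use s sumd in auto)
    then have "isCont (\<lambda>z. \<Sum>n. diffs c n * z ^ n) s" by (rule DERIV_isCont)
    moreover have "eventually (\<lambda>z. (\<Sum>n. diffs c n * z ^ n) = mean z) (nhds s)"
      unfolding eventually_nhds using s
      by (intro exI[of _ "{-1<..<1}"]) (auto simp: mean_eq abs_less_iff)
    ultimately show ?thesis by (simp add: isCont_cong)
  qed
  have df: "(f has_real_derivative mean s / 2) (at s)" if s: "\<bar>s\<bar> < 1" for s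
  proof (rule has_derivative_of_subgradient[where S="{-1<..<1}" and \<phi>="\<lambda>s. mean s / 2"])
    fix s t :: real assume st: "s \<in> {-1<..<1}" "t \<in> {-1<..<1}"
    then have st': "\<bar>s\<bar> < 1" "\<bar>t\<bar> < 1" by auto
    have "ln (gaussZ I (id_minus s A) * exp ((t - s) / 2 * mean s)) \<le> f t"
      unfolding f_def using Zpos st' Z_jensen[OF st'] by (subst ln_le_cancel_iff) auto
    then show "(t - s) * (mean s / 2) \<le> f t - f s"
      using Zpos[OF st'(1)] by (simp add: f_def ln_mult algebra_simps)
  qed (use s in \<open>auto intro!: continuous_intros cont\<close>)
  have const: "f t - (\<Sum>n. c n * t ^ n) / 2 = f 0 - (\<Sum>n. c n * 0 ^ n) / 2"
  proof (rule DERIV_isconst3[where a="-1" and b=1 and f="\<lambda>t. f t - (\<Sum>n. c n * t ^ n) / 2"])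
    fix x :: real assume "x \<in> {-1<..<1}"
    then have x: "\<bar>x\<bar> < 1" by auto
    show "((\<lambda>t. f t - (\<Sum>n. c n * t ^ n) / 2) has_real_derivative 0) (at x)"
      using DERIV_diff[OF df[OF x] DERIV_cdivide[OF dPhi[OF x], of 2]] by simp
  qed (use t in auto)
  have "gaussZ I (id_minus 0 A) = (\<integral>x. (\<Prod>i\<in>I. exp (- (x i)\<^sup>2 / 2)) \<partial>P)"
    unfolding gaussZ_def quad_id_minus[OF fin] using fin
    by (simp add: exp_sum[symmetric] sum_divide_distrib sum_negf[symmetric])
  also have "... = (\<Prod>i\<in>I. (\<integral>y. exp (- y\<^sup>2 / 2) \<partial>lborel))"
    using integrable_gauss1[of 1 0] fin by (intro PL.product_integral_prod) auto
  also have "(\<integral>y. exp (- y\<^sup>2 / 2) \<partial>lborel) = sqrt (2 * pi)"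
    using integral_gauss1[of 1 0] by simp
  finally have "f 0 = card I * ln (sqrt (2 * pi))"
    unfolding f_def by (simp add: ln_realpow)
  also have "ln (sqrt (2 * pi)) = ln (2 * pi) / 2" by (simp add: ln_sqrt)
  finally have "f 0 = card I / 2 * ln (2 * pi)" by simp
  moreover have "(\<Sum>n. c n * 0 ^ n) = 0" by (subst powser_zero) (simp add: c_def)
  ultimately show ?thesis using const unfolding f_def c_def by linarith
qed

end

section \<open>Gaussian integrals restricted to a box\<close>

text \<open>Chebyshev's inequality for the gradient \<open>a y + b\<close> of the exponent: outside \<open>[-R, R]\<close> it is at
  least \<open>m R\<close>, while its second moment is \<open>a\<close>.\<close>

lemma gauss1_truncated:
  fixes a b m K R :: real
  assumes m: "0 < m" "m \<le> a" "a \<le> K" and R: "R > 0" and b: "\<bar>b\<bar> \<le> R * (a - m)"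
    and K: "K \<le> (m * R)\<^sup>2"
  shows "ennreal (1 - K / (m * R)\<^sup>2) * ennreal (sqrt (2 * pi / a) * exp (b\<^sup>2 / (2 * a)))
     \<le> (\<integral>\<^sup>+y. indicator {-R..R} y * ennreal (gexp a b y) \<partial>lborel)"
proof -
  define g where "g y = gexp a b y" for y
  have a: "a > 0" using m by simp
  have mR: "m * R > 0" using m R by simp
  have g0: "integrable lborel g" unfolding g_def by (rule integrable_gauss1[OF a])
  have G: "integral\<^sup>L lborel g = sqrt (2 * pi / a) * exp (b\<^sup>2 / (2 * a))"
    unfolding g_def by (rule integral_gauss1[OF a])
  have ig: "integrable lborel (\<lambda>y. indicator {-R..R} y * g y)"
    using integrable_mult_indicator[OF _ g0, of "{-R..R}"] by simp
  have "has_bochner_integral lborel (\<lambda>y. a * (((a * y + b) * y - 1) * g y) + b * ((a * y + b) * g y) + a * g y)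
      (a * 0 + b * 0 + a * integral\<^sup>L lborel g)"
    unfolding g_def
    by (intro has_bochner_integral_add has_bochner_integral_mult_right gauss1_grad gauss1_grad'
        has_bochner_integral_integrable integrable_gauss1 a)
  also have "(\<lambda>y. a * (((a * y + b) * y - 1) * g y) + b * ((a * y + b) * g y) + a * g y) = (\<lambda>y. (a * y + b)\<^sup>2 * g y)"
    by (simp add: fun_eq_iff power2_eq_square algebra_simps)
  finally have sq: "has_bochner_integral lborel (\<lambda>y. (a * y + b)\<^sup>2 * g y) (a * integral\<^sup>L lborel g)" by simp
  then have sqi: "integrable lborel (\<lambda>y. (a * y + b)\<^sup>2 * g y)" and sqe: "(\<integral>y. (a * y + b)\<^sup>2 * g y \<partial>lborel) = a * integral\<^sup>L lborel g"
    by (auto simp: has_bochner_integral_iff)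
  have "integral\<^sup>L lborel g \<le> (\<integral>y. indicator {-R..R} y * g y + 1 / (m * R)\<^sup>2 * ((a * y + b)\<^sup>2 * g y) \<partial>lborel)"
  proof (rule integral_mono)
    show "integrable lborel g" by (rule g0)
    show "integrable lborel (\<lambda>y. indicator {-R..R} y * g y + 1 / (m * R)\<^sup>2 * ((a * y + b)\<^sup>2 * g y))"
      by (intro Bochner_Integration.integrable_add ig integrable_mult_right sqi)
    fix y :: real
    have g: "g y \<ge> 0" by (simp add: g_def)
    show "g y \<le> indicator {-R..R} y * g y + 1 / (m * R)\<^sup>2 * ((a * y + b)\<^sup>2 * g y)"
    proof (cases "y \<in> {-R..R}")
      case True then show ?thesis using g by simp
    next
      case False
      then have "\<bar>y\<bar> \<ge> R" by auto
      then have "a * R \<le> \<bar>a * y\<bar>" using a by (simp add: abs_mult)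
      \<comment> \<open>The bound on \<open>b\<close> keeps the mean \<open>- b / a\<close> inside
        the box with slack: \<open>a * R - R * (a - m) = m * R\<close>.\<close>
      then have "m * R \<le> \<bar>a * y + b\<bar>" using b by (simp add: algebra_simps)
      then have "(m * R)\<^sup>2 \<le> (a * y + b)\<^sup>2" using mR by (simp add: abs_le_square_iff[symmetric])
      then have "1 \<le> 1 / (m * R)\<^sup>2 * (a * y + b)\<^sup>2"
        using zero_less_power[OF mR, of 2] by (simp add: pos_le_divide_eq)
      then have "1 * g y \<le> (1 / (m * R)\<^sup>2 * (a * y + b)\<^sup>2) * g y" using g by (rule mult_right_mono)
      then show ?thesis using False by simp
    qed
  qed
  also have "... = (\<integral>y. indicator {-R..R} y * g y \<partial>lborel) + 1 / (m * R)\<^sup>2 * (a * integral\<^sup>L lborel g)"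
    using ig sqi sqe by simp
  also have "... \<le> (\<integral>y. indicator {-R..R} y * g y \<partial>lborel) + 1 / (m * R)\<^sup>2 * (K * integral\<^sup>L lborel g)"
    using m by (intro add_left_mono mult_left_mono mult_right_mono) (auto simp: g_def)
  finally have "(1 - K / (m * R)\<^sup>2) * integral\<^sup>L lborel g \<le> (\<integral>y. indicator {-R..R} y * g y \<partial>lborel)"
    by (simp add: algebra_simps)
  then have "ennreal ((1 - K / (m * R)\<^sup>2) * integral\<^sup>L lborel g) \<le> ennreal (\<integral>y. indicator {-R..R} y * g y \<partial>lborel)"
    by (rule ennreal_leI)
  also have "ennreal (\<integral>y. indicator {-R..R} y * g y \<partial>lborel) = (\<integral>\<^sup>+y. ennreal (indicator {-R..R} y * g y) \<partial>lborel)"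
    by (rule nn_integral_eq_integral[symmetric]) (use ig in \<open>auto simp: g_def\<close>)
  also have "... = (\<integral>\<^sup>+y. indicator {-R..R} y * ennreal (g y) \<partial>lborel)"
    by (intro nn_integral_cong) (auto simp: indicator_def)
  finally show ?thesis
    unfolding G g_def using K mR a by (subst ennreal_mult[symmetric]) (auto simp: divide_le_eq_1)
qed

lemma nn_integral_gauss1:
  fixes a b :: real
  assumes a: "a > 0"
  shows "(\<integral>\<^sup>+y. ennreal (gexp a b y) \<partial>lborel) = ennreal (sqrt (2 * pi / a) * exp (b\<^sup>2 / (2 * a)))"
  using nn_integral_eq_integral[OF integrable_gauss1[OF a, of b]] integral_gauss1[OF a, of b] by simp

text \<open>Strict diagonal dominance. The margin \<open>m\<close> bounds the gradient outside the
  box from below, the bound \<open>K\<close> on the diagonal controls its second moment.\<close>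

definition dominant :: "'i set => ('i => 'i => real) => real => real => bool" where
  "dominant I M m K \<longleftrightarrow> (\<forall>i j. M i j = M j i) \<and>
     (\<forall>i\<in>I. (\<Sum>j\<in>I - {i}. \<bar>M i j\<bar>) + m \<le> M i i \<and> M i i \<le> K)"

definition schur :: "'i => ('i => 'i => real) => 'i => 'i => real" where
  "schur v M i j = M i j - M v i * M v j / M v v"

text \<open>Row \<open>i\<close> loses the entry \<open>\<bar>M i v\<bar>\<close>, its remaining
  off-diagonal entries grow by at most \<open>\<bar>M v i\<bar> - (M v i)^2 / M v v\<close> in
  total, and the diagonal drops by exactly \<open>(M v i)^2 / M v v\<close>; hence the same margin
  \<open>m\<close> survives.\<close>

lemma dominant_schur:
  assumes dom: "dominant (insert v I) M m K" and I: "finite I" "v \<notin> I" and m: "m > 0"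
  shows "dominant I (schur v M) m K"
proof -
  have sym: "\<And>i j. M i j = M j i"
    and row: "\<And>i. i \<in> insert v I ==> (\<Sum>j\<in>insert v I - {i}. \<bar>M i j\<bar>) + m \<le> M i i"
    and up: "\<And>i. i \<in> insert v I ==> M i i \<le> K"
    using dom by (auto simp: dominant_def)
  have rv: "(\<Sum>j\<in>I. \<bar>M v j\<bar>) + m \<le> M v v"
    using row[of v] I by simp
  have "(\<Sum>j\<in>I. \<bar>M v j\<bar>) \<ge> 0" by (intro sum_nonneg) auto
  then have vm: "m \<le> M v v" and vv: "M v v > 0" using rv m by linarith+
  show ?thesis unfolding dominant_def
  proof (intro conjI ballI allI)
    show "schur v M i j = schur v M j i" for i j
      unfolding schur_def by (simp add: sym[of i j])
  next
    fix i assume i: "i \<in> I"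
    have "schur v M i i = M i i - (M v i)\<^sup>2 / M v v" by (simp add: schur_def power2_eq_square)
    moreover have "0 \<le> (M v i)\<^sup>2 / M v v" using vv by simp
    ultimately show "schur v M i i \<le> K" using up[of i] i by simp
  next
    fix i assume i: "i \<in> I"
    have "(\<Sum>j\<in>I - {i}. \<bar>schur v M i j\<bar>) \<le> (\<Sum>j\<in>I - {i}. \<bar>M i j\<bar> + \<bar>M v i\<bar> / M v v * \<bar>M v j\<bar>)"
    proof (rule sum_mono)
      fix j
      have "\<bar>schur v M i j\<bar> \<le> \<bar>M i j\<bar> + \<bar>M v i * M v j / M v v\<bar>"
        unfolding schur_def by (rule abs_triangle_ineq4)
      then show "\<bar>schur v M i j\<bar> \<le> \<bar>M i j\<bar> + \<bar>M v i\<bar> / M v v * \<bar>M v j\<bar>"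
        using vv by (simp add: abs_mult abs_divide)
    qed
    also have "... = (\<Sum>j\<in>I - {i}. \<bar>M i j\<bar>) + \<bar>M v i\<bar> / M v v * (\<Sum>j\<in>I - {i}. \<bar>M v j\<bar>)"
      by (simp add: sum.distrib sum_distrib_left)
    also have "... \<le> (\<Sum>j\<in>I - {i}. \<bar>M i j\<bar>) + \<bar>M v i\<bar> / M v v * (M v v - \<bar>M v i\<bar>)"
      using rv m i I vv by (intro add_left_mono mult_left_mono) (auto simp: sum_diff1)
    also have "\<bar>M v i\<bar> / M v v * (M v v - \<bar>M v i\<bar>) = \<bar>M v i\<bar> - (M v i)\<^sup>2 / M v v"
      using vv by (simp add: field_simps power2_eq_square abs_mult_self)
    finally have 1: "(\<Sum>j\<in>I - {i}. \<bar>schur v M i j\<bar>) \<le> (\<Sum>j\<in>I - {i}. \<bar>M i j\<bar>) + (\<bar>M v i\<bar> - (M v i)\<^sup>2 / M v v)"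
      .
    have "insert v I - {i} = insert v (I - {i})" using I i by auto
    then have "(\<Sum>j\<in>I - {i}. \<bar>M i j\<bar>) + \<bar>M v i\<bar> + m \<le> M i i"
      using row[of i] i I by (simp add: sym[of i v])
    then show "(\<Sum>j\<in>I - {i}. \<bar>schur v M i j\<bar>) + m \<le> schur v M i i"
      using 1 by (simp add: schur_def power2_eq_square)
  qed
qed

lemma quad_complete_square:
  assumes I: "finite I" "v \<notin> I" and sym: "\<And>i j. M i j = M j i" and vv: "M v v \<noteq> 0"
  shows "quad I (schur v M) x = quad I M x - (\<Sum>k\<in>I. M v k * x k)\<^sup>2 / M v v"
proof -
  have "quad I (schur v M) x = (\<Sum>i\<in>I. \<Sum>j\<in>I. M i j * x i * x j - (M v i * x i) * (M v j * x j) / M v v)"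
    unfolding quad_def schur_def by (intro sum.cong refl) (simp add: algebra_simps)
  also have "... = quad I M x - (\<Sum>i\<in>I. \<Sum>j\<in>I. (M v i * x i) * (M v j * x j)) / M v v"
    by (simp add: quad_def sum_subtractf sum_divide_distrib)
  also have "(\<Sum>i\<in>I. \<Sum>j\<in>I. (M v i * x i) * (M v j * x j)) = (\<Sum>k\<in>I. M v k * x k)\<^sup>2"
    by (simp add: power2_eq_square sum_product)
  finally show ?thesis .
qed

text \<open>Variables are eliminated one at a time; Schur complements inherit the diagonal dominance, so the
  conditional mean of each variable stays inside \<open>[-R, R]\<close> as long as the others do.\<close>

lemma gauss_box_lower:
  assumes "finite I" "dominant I M m K" and m: "m > 0" and R: "R > 0" and K: "K \<le> (m * R)\<^sup>2"
  shows "ennreal (1 - K / (m * R)\<^sup>2) ^ card I * (\<integral>\<^sup>+x. ennreal (gweight I M x) \<partial>lborelP I)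
    \<le> (\<integral>\<^sup>+x. (\<Prod>i\<in>I. indicator {-R..R} (x i)) * ennreal (gweight I M x) \<partial>lborelP I)"
  using assms(1,2)
proof (induction I arbitrary: M rule: finite_induct)
  case empty
  then show ?case by simp
next
  case (insert v I)
  note I = insert.hyps
  define p where "p = ennreal (1 - K / (m * R)\<^sup>2)"
  have sym: "\<And>i j. M i j = M j i" using insert.prems by (auto simp: dominant_def)
  have rv: "(\<Sum>j\<in>I. \<bar>M v j\<bar>) + m \<le> M v v" and vK: "M v v \<le> K"
    using insert.prems I by (auto simp: dominant_def)
  have "(\<Sum>j\<in>I. \<bar>M v j\<bar>) \<ge> 0" by (intro sum_nonneg) auto
  then have vm: "m \<le> M v v" and vv: "M v v > 0" using rv m by linarith+
  define b where "b x = (\<Sum>k\<in>I. M v k * x k)" for x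
  define C where "C = ennreal (sqrt (2 * pi / M v v))"
  have q: "ennreal (exp (- quad (insert v I) M (x(v := y)) / 2)) =
     ennreal (exp (- (M v v * y\<^sup>2 + 2 * b x * y) / 2)) * ennreal (gweight I M x)" for x y
    unfolding b_def by (subst quad_insert[OF I sym]) (simp add: ennreal_mult[symmetric] exp_add[symmetric] field_simps)
  \<comment> \<open>Integrating out \<open>v\<close> completes the square and leaves the weight of
    the Schur complement.\<close>
  have s: "ennreal (sqrt (2 * pi / M v v) * exp ((b x)\<^sup>2 / (2 * M v v))) * ennreal (gweight I M x)
     = C * ennreal (gweight I (schur v M) x)" for x
    unfolding C_def using vv
    by (subst quad_complete_square[OF I sym])
       (simp_all add: b_def ennreal_mult[symmetric] mult.assoc exp_add[symmetric] field_simps)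
  have mI: "I \<subseteq> insert v I" by auto
  have [measurable]: "(\<lambda>x. ennreal (gweight (insert v I) M x)) \<in> borel_measurable (lborelP (insert v I))"
    by measurable
  have [measurable]: "(\<lambda>x. ennreal (gweight I (schur v M) x)) \<in> borel_measurable (lborelP I)"
    by measurable
  have [measurable]: "(\<lambda>x. (\<Prod>i\<in>I. indicator {-R..R} (x i)) * ennreal (gweight I (schur v M) x)) \<in> borel_measurable (lborelP I)"
    by measurable
  have [measurable]: "(\<lambda>x. (\<Prod>i\<in>insert v I. indicator {-R..R} (x i)) * ennreal (gweight (insert v I) M x)) \<in> borel_measurable (lborelP (insert v I))"
    by measurable
  have "(\<integral>\<^sup>+x. ennreal (gweight (insert v I) M x) \<partial>lborelP (insert v I)) =
     (\<integral>\<^sup>+x. \<integral>\<^sup>+y. ennreal (exp (- quad (insert v I) M (x(v := y)) / 2)) \<partial>lborel \<partial>lborelP I)"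
    by (rule PL.product_nn_integral_insert) (use I in auto)
  also have "... = (\<integral>\<^sup>+x. C * ennreal (gweight I (schur v M) x) \<partial>lborelP I)"
  proof -
    have "(\<integral>\<^sup>+y. ennreal (exp (- quad (insert v I) M (x(v := y)) / 2)) \<partial>lborel)
      = C * ennreal (gweight I (schur v M) x)" for x
      unfolding q s[symmetric] nn_integral_gauss1[OF vv, symmetric] by (rule nn_integral_multc) measurable
    then show ?thesis by simp
  qed
  also have "... = C * (\<integral>\<^sup>+x. ennreal (gweight I (schur v M) x) \<partial>lborelP I)"
    by (rule nn_integral_cmult) measurable
  finally have lhs: "p ^ card (insert v I) * (\<integral>\<^sup>+x. ennreal (gweight (insert v I) M x) \<partial>lborelP (insert v I))
     = p * C * (p ^ card I * (\<integral>\<^sup>+x. ennreal (gweight I (schur v M) x) \<partial>lborelP I))"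
    using I by (simp add: ac_simps)
  also have "... \<le> p * C * (\<integral>\<^sup>+x. (\<Prod>i\<in>I. indicator {-R..R} (x i)) * ennreal (gweight I (schur v M) x) \<partial>lborelP I)"
    unfolding p_def by (intro mult_left_mono insert.IH dominant_schur[OF insert.prems I m]) auto
  also have "... = (\<integral>\<^sup>+x. p * C * ((\<Prod>i\<in>I. indicator {-R..R} (x i)) * ennreal (gweight I (schur v M) x)) \<partial>lborelP I)"
    by (rule nn_integral_cmult[symmetric]) measurable
  also have "... \<le> (\<integral>\<^sup>+x. \<integral>\<^sup>+y. (\<Prod>i\<in>insert v I. indicator {-R..R} ((x(v := y)) i)) * ennreal (exp (- quad (insert v I) M (x(v := y)) / 2)) \<partial>lborel \<partial>lborelP I)"
  proof (rule nn_integral_mono)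
    fix x :: "'a => real"
    have pr: "(\<Prod>i\<in>insert v I. indicator {-R..R} ((x(v := y)) i)) = indicator {-R..R} y * (\<Prod>i\<in>I. indicator {-R..R} (x i) :: ennreal)" for y
    proof -
      have "(\<Prod>i\<in>I. indicator {-R..R} ((x(v := y)) i)) = (\<Prod>i\<in>I. indicator {-R..R} (x i) :: ennreal)"
        using I by (intro prod.cong) auto
      then show ?thesis using I by simp
    qed
    show "p * C * ((\<Prod>i\<in>I. indicator {-R..R} (x i)) * ennreal (gweight I (schur v M) x))
      \<le> (\<integral>\<^sup>+y. (\<Prod>i\<in>insert v I. indicator {-R..R} ((x(v := y)) i)) * ennreal (exp (- quad (insert v I) M (x(v := y)) / 2)) \<partial>lborel)"
    proof (cases "\<forall>i\<in>I. x i \<in> {-R..R}")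
      case False
      then have "(\<Prod>i\<in>I. indicator {-R..R} (x i) :: ennreal) = 0" using I by (intro prod_zero) (auto simp: indicator_def)
      then show ?thesis by (simp only: mult_zero_left mult_zero_right zero_le)
    next
      case True
      then have one: "(\<Prod>i\<in>I. indicator {-R..R} (x i) :: ennreal) = 1" by (intro prod.neutral) auto
      have "\<bar>b x\<bar> \<le> (\<Sum>k\<in>I. \<bar>M v k\<bar> * R)"
        unfolding b_def using True by (intro order.trans[OF sum_abs] sum_mono) (auto simp: abs_mult intro!: mult_left_mono)
      also have "... = R * (\<Sum>k\<in>I. \<bar>M v k\<bar>)" by (simp add: sum_distrib_left mult.commute)
      also have "... \<le> R * (M v v - m)" using rv R by (intro mult_left_mono) auto
      finally have bx: "\<bar>b x\<bar> \<le> R * (M v v - m)" .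
      have "p * C * ennreal (gweight I (schur v M) x) =
        p * ennreal (sqrt (2 * pi / M v v) * exp ((b x)\<^sup>2 / (2 * M v v))) * ennreal (gweight I M x)"
        using s[of x] by (simp add: mult.assoc)
      also have "... \<le> (\<integral>\<^sup>+y. indicator {-R..R} y * ennreal (exp (- (M v v * y\<^sup>2 + 2 * b x * y) / 2)) \<partial>lborel) * ennreal (gweight I M x)"
        unfolding p_def by (intro mult_right_mono gauss1_truncated[OF m vm vK R bx K]) auto
      also have "... = (\<integral>\<^sup>+y. indicator {-R..R} y * ennreal (exp (- (M v v * y\<^sup>2 + 2 * b x * y) / 2)) * ennreal (gweight I M x) \<partial>lborel)"
        by (rule nn_integral_multc[symmetric]) measurable
      finally show ?thesis unfolding pr one q by (simp add: mult.assoc)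
    qed
  qed
  also have "... = (\<integral>\<^sup>+x. (\<Prod>i\<in>insert v I. indicator {-R..R} (x i)) * ennreal (gweight (insert v I) M x) \<partial>lborelP (insert v I))"
    by (rule PL.product_nn_integral_insert[symmetric]) (use I in auto)
  finally show ?case unfolding p_def .
qed

section \<open>Change of variables in product Lebesgue measure\<close>

lemma measurable_PiM_insert_slice:
  fixes f :: "('i => real) => 'b :: topological_space" and g :: "real => real"
  assumes "f \<in> borel_measurable (lborelP (insert i I))" and g: "g \<in> borel_measurable lborel"
  shows "(\<lambda>(x, y). f (x(i := g y))) \<in> borel_measurable (lborelP I \<Otimes>\<^sub>M lborel)"
proof -
  have "(\<lambda>(x, y). (x, g y)) \<in> lborelP I \<Otimes>\<^sub>M lborel \<rightarrow>\<^sub>M lborelP I \<Otimes>\<^sub>M (lborel :: real measure)"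
    using g by measurable
  from measurable_comp[OF measurable_comp[OF this measurable_add_dim[of i I "\<lambda>_. lborel"]] assms(1)]
  have "f \<circ> ((\<lambda>(x, y). x(i := y)) \<circ> (\<lambda>(x, y). (x, g y))) \<in> borel_measurable (lborelP I \<Otimes>\<^sub>M lborel)" .
  moreover have "f \<circ> ((\<lambda>(x, y). x(i := y)) \<circ> (\<lambda>(x, y). (x, g y))) = (\<lambda>(x, y). f (x(i := g y)))"
    by auto
  ultimately show ?thesis by simp
qed

text \<open>Splitting off one coordinate at a time reduces the claim to affine substitution on the
  line.\<close>

lemma nn_integral_PiM_affine:
  fixes f :: "('i => real) => ennreal"
  assumes "finite I" "f \<in> borel_measurable (lborelP I)" "\<And>i. s i \<noteq> (0::real)"
  shows "(\<integral>\<^sup>+x. f x \<partial>lborelP I) =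
    ennreal (\<Prod>i\<in>I. \<bar>s i\<bar>) * (\<integral>\<^sup>+x. f (\<lambda>i\<in>I. t i + s i * x i) \<partial>lborelP I)"
  using assms(1,2)
proof (induction I arbitrary: f rule: finite_induct)
  case empty
  then show ?case by (simp add: PiM_empty nn_integral_count_space_finite restrict_def)
next
  case (insert i I f)
  note [measurable] = insert.prems
  let ?P = "lborelP I :: ('i => real) measure"
  define F where "F x = (\<integral>\<^sup>+y. f (x(i := t i + s i * y)) \<partial>lborel)" for x
  have Fm [measurable]: "F \<in> borel_measurable ?P"
    unfolding F_def
    using lborel.borel_measurable_nn_integral[OF measurable_PiM_insert_slice[OF insert.prems, of "\<lambda>y. t i + s i * y"]]
    by simp
  have slice: "(\<lambda>y. f (x(i := y))) \<in> borel_measurable lborel" if "x \<in> space ?P" for x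
    using measurable_comp[OF measurable_component_update insert.prems, OF that] insert.hyps
    by (simp add: comp_def fun_upd_def)
  have "(\<integral>\<^sup>+x. f x \<partial>lborelP (insert i I)) = (\<integral>\<^sup>+x. \<integral>\<^sup>+y. f (x(i := y)) \<partial>lborel \<partial>?P)"
    by (rule PL.product_nn_integral_insert) (use insert.hyps insert.prems in auto)
  also have "... = (\<integral>\<^sup>+x. ennreal \<bar>s i\<bar> * F x \<partial>?P)"
    using slice assms(3) unfolding F_def by (intro nn_integral_cong nn_integral_real_affine) auto
  also have "... = ennreal \<bar>s i\<bar> * (\<integral>\<^sup>+x. F x \<partial>?P)"
    by (rule nn_integral_cmult) simp
  also have "(\<integral>\<^sup>+x. F x \<partial>?P) = ennreal (\<Prod>i\<in>I. \<bar>s i\<bar>) * (\<integral>\<^sup>+x. F (\<lambda>i\<in>I. t i + s i * x i) \<partial>?P)"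
    by (rule insert.IH) simp
  also have "(\<integral>\<^sup>+x. F (\<lambda>i\<in>I. t i + s i * x i) \<partial>?P) =
      (\<integral>\<^sup>+x. \<integral>\<^sup>+y. f (\<lambda>j\<in>insert i I. t j + s j * (x(i := y)) j) \<partial>lborel \<partial>?P)"
  proof (intro nn_integral_cong)
    fix x :: "'i => real"
    have "(\<lambda>j\<in>I. t j + s j * x j)(i := t i + s i * y) = (\<lambda>j\<in>insert i I. t j + s j * (x(i := y)) j)" for y
      using insert.hyps by (auto simp: fun_eq_iff restrict_def)
    then show "F (\<lambda>i\<in>I. t i + s i * x i) = (\<integral>\<^sup>+y. f (\<lambda>j\<in>insert i I. t j + s j * (x(i := y)) j) \<partial>lborel)"
      unfolding F_def by simp
  qed
  also have "... = (\<integral>\<^sup>+x. f (\<lambda>j\<in>insert i I. t j + s j * x j) \<partial>lborelP (insert i I))"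
    by (rule PL.product_nn_integral_insert[symmetric]) (use insert.hyps in measurable)
  finally show ?case using insert.hyps by (simp add: ennreal_mult prod_nonneg mult.assoc restrict_def)
qed

lemma periodic_int_shift:
  fixes f :: "real => 'a"
  assumes "\<And>x. f (x + p) = f x"
  shows "f (x + p * of_int k) = f x"
proof -
  have nat: "f (x + p * real n) = f x" for n x
  proof (induction n)
    case (Suc n)
    have "f (x + p * real (Suc n)) = f ((x + p * real n) + p)" by (simp add: algebra_simps)
    then show ?case using Suc assms by simp
  qed simp
  show ?thesis
  proof (cases "k \<ge> 0")
    case True then show ?thesis using nat[of x "nat k"] by simp
  next
    case False
    then show ?thesis using nat[of "x + p * of_int k" "nat (- k)"] by simp
  qed
qed

text \<open>A translation by a multiple of the period lets the window start at some \<open>d\<close>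
  in \<open>[0, p)\<close>; the part beyond \<open>p\<close> is then moved back by one
  period.\<close>

lemma nn_integral_periodic_1:
  fixes f :: "real => ennreal"
  assumes [measurable]: "f \<in> borel_measurable borel" and per: "\<And>x. f (x + p) = f x" and p: "p > 0"
  shows "(\<integral>\<^sup>+x. indicator {0..<p} x * f x \<partial>lborel) = (\<integral>\<^sup>+x. indicator {c..<c+p} x * f x \<partial>lborel)"
proof -
  define k where "k = \<lfloor>c / p\<rfloor>"
  define d where "d = c - p * of_int k"
  have d: "0 \<le> d" "d < p"
  proof -
    have "of_int k \<le> c / p" "c / p < of_int k + 1" unfolding k_def by linarith+
    then show "0 \<le> d" "d < p" using p by (simp_all add: d_def pos_le_divide_eq pos_divide_less_eq algebra_simps)
  qed
  have "(\<integral>\<^sup>+x. indicator {c..<c+p} x * f x \<partial>lborel) =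
     (\<integral>\<^sup>+x. indicator {c..<c+p} (p * of_int k + 1 * x) * f (p * of_int k + 1 * x) \<partial>lborel)"
    by (subst nn_integral_real_affine[where c=1 and t="p * of_int k"]) auto
  also have "... = (\<integral>\<^sup>+x. indicator {d..<p} x * f x + indicator {p..<p+d} x * f x \<partial>lborel)"
    using periodic_int_shift[of f p, OF per] d
    by (intro nn_integral_cong) (auto simp: indicator_def d_def add.commute)
  also have "... = (\<integral>\<^sup>+x. indicator {d..<p} x * f x \<partial>lborel) + (\<integral>\<^sup>+x. indicator {p..<p+d} x * f x \<partial>lborel)"
    by (rule nn_integral_add) auto
  also have "(\<integral>\<^sup>+x. indicator {p..<p+d} x * f x \<partial>lborel) = (\<integral>\<^sup>+x. indicator {p..<p+d} (p + 1 * x) * f (p + 1 * x) \<partial>lborel)"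
    by (subst nn_integral_real_affine[where c=1 and t=p]) auto
  also have "... = (\<integral>\<^sup>+x. indicator {0..<d} x * f x \<partial>lborel)"
    using per by (intro nn_integral_cong) (auto simp: indicator_def add.commute)
  also have "(\<integral>\<^sup>+x. indicator {d..<p} x * f x \<partial>lborel) + (\<integral>\<^sup>+x. indicator {0..<d} x * f x \<partial>lborel) =
     (\<integral>\<^sup>+x. indicator {d..<p} x * f x + indicator {0..<d} x * f x \<partial>lborel)"
    by (rule nn_integral_add[symmetric]) auto
  also have "... = (\<integral>\<^sup>+x. indicator {0..<p} x * f x \<partial>lborel)"
    using d by (intro nn_integral_cong) (auto simp: indicator_def)
  finally show ?thesis by simp
qed

text \<open>It allows the window of every spin to be centred at its own reference angle, so that a
  deviation modulo \<open>2 * pi\<close> becomes an ordinary real number.\<close>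

lemma nn_integral_PiM_periodic:
  fixes f :: "('i => real) => ennreal"
  assumes "finite I" "f \<in> borel_measurable (lborelP I)"
    and "\<And>x i. i \<in> I ==> f (x(i := x i + p)) = f x" and p: "p > 0"
  shows "(\<integral>\<^sup>+x. (\<Prod>i\<in>I. indicator {0..<p} (x i)) * f x \<partial>lborelP I) =
         (\<integral>\<^sup>+x. (\<Prod>i\<in>I. indicator {c i..<c i + p} (x i)) * f x \<partial>lborelP I)"
  using assms(1-3)
proof (induction I arbitrary: f rule: finite_induct)
  case empty
  then show ?case by simp
next
  case (insert i I f)
  note [measurable] = insert.prems(1)
  let ?P = "lborelP I :: ('i => real) measure"
  define F where "F x = (\<integral>\<^sup>+y. indicator {c i..<c i + p} y * f (x(i := y)) \<partial>lborel)" for x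
  have "(\<lambda>(x, y). indicator {c i..<c i + p} y * (\<lambda>(x, y). f (x(i := y))) (x, y)) \<in> borel_measurable (?P \<Otimes>\<^sub>M lborel)"
    using measurable_PiM_insert_slice[OF insert.prems(1), of "\<lambda>y. y"] by measurable
  then have Fm [measurable]: "F \<in> borel_measurable ?P"
    unfolding F_def using lborel.borel_measurable_nn_integral by fastforce
  have slice: "(\<lambda>y. f (x(i := y))) \<in> borel_measurable borel" if "x \<in> space ?P" for x
    using measurable_comp[OF measurable_component_update insert.prems(1), OF that] insert.hyps
    by (simp add: comp_def fun_upd_def)
  have pr: "(\<Prod>j\<in>insert i I. indicator (S j) ((x(i := y)) j)) = indicator (S i) y * (\<Prod>j\<in>I. indicator (S j) (x j) :: ennreal)"
    for S :: "'i => real set" and x y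
  proof -
    have "(\<Prod>j\<in>I. indicator (S j) ((x(i := y)) j)) = (\<Prod>j\<in>I. indicator (S j) (x j) :: ennreal)"
      using insert.hyps by (intro prod.cong) auto
    then show ?thesis using insert.hyps by simp
  qed
  have split: "(\<integral>\<^sup>+x. (\<Prod>j\<in>insert i I. indicator (S j) (x j)) * f x \<partial>lborelP (insert i I)) =
    (\<integral>\<^sup>+x. (\<Prod>j\<in>I. indicator (S j) (x j)) * (\<integral>\<^sup>+y. indicator (S i) y * f (x(i := y)) \<partial>lborel) \<partial>?P)"
    if [measurable]: "\<And>j. S j \<in> sets borel" for S
  proof -
    have "(\<integral>\<^sup>+x. (\<Prod>j\<in>insert i I. indicator (S j) (x j)) * f x \<partial>lborelP (insert i I)) =
       (\<integral>\<^sup>+x. \<integral>\<^sup>+y. (\<Prod>j\<in>insert i I. indicator (S j) ((x(i := y)) j)) * f (x(i := y)) \<partial>lborel \<partial>?P)"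
      by (rule PL.product_nn_integral_insert) (use insert.hyps in \<open>auto\<close>)
    also have "... = (\<integral>\<^sup>+x. \<integral>\<^sup>+y. (\<Prod>j\<in>I. indicator (S j) (x j)) * (indicator (S i) y * f (x(i := y))) \<partial>lborel \<partial>?P)"
      unfolding pr by (simp add: ac_simps)
    also have "... = (\<integral>\<^sup>+x. (\<Prod>j\<in>I. indicator (S j) (x j)) * (\<integral>\<^sup>+y. indicator (S i) y * f (x(i := y)) \<partial>lborel) \<partial>?P)"
      using slice by (intro nn_integral_cong nn_integral_cmult) auto
    finally show ?thesis .
  qed
  have "(\<integral>\<^sup>+x. (\<Prod>j\<in>insert i I. indicator {0..<p} (x j)) * f x \<partial>lborelP (insert i I)) =
    (\<integral>\<^sup>+x. (\<Prod>j\<in>I. indicator {0..<p} (x j)) * (\<integral>\<^sup>+y. indicator {0..<p} y * f (x(i := y)) \<partial>lborel) \<partial>?P)"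
    by (rule split) simp
  also have "... = (\<integral>\<^sup>+x. (\<Prod>j\<in>I. indicator {0..<p} (x j)) * F x \<partial>?P)"
  proof (intro nn_integral_cong arg_cong2[where f="(*)"] refl)
    fix x assume x: "x \<in> space ?P"
    show "(\<integral>\<^sup>+y. indicator {0..<p} y * f (x(i := y)) \<partial>lborel) = F x"
      unfolding F_def
    proof (rule nn_integral_periodic_1[OF slice[OF x] _ p])
      show "f (x(i := y + p)) = f (x(i := y))" for y
      proof -
        have "(x(i := y))(i := (x(i := y)) i + p) = x(i := y + p)" by simp
        then show ?thesis using insert.prems(2)[of i "x(i := y)"] by (metis insertI1)
      qed
    qed
  qed
  also have "... = (\<integral>\<^sup>+x. (\<Prod>j\<in>I. indicator {c j..<c j + p} (x j)) * F x \<partial>?P)"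
  proof (rule insert.IH[OF Fm])
    fix x j assume j: "j \<in> I"
    then have ji: "j \<noteq> i" using insert.hyps by auto
    have "f ((x(j := x j + p))(i := y)) = f (x(i := y))" for y
    proof -
      have "(x(i := y))(j := (x(i := y)) j + p) = (x(j := x j + p))(i := y)"
        using ji by (auto simp: fun_eq_iff)
      then show ?thesis using insert.prems(2)[of j "x(i := y)"] j by (metis insertI2)
    qed
    then show "F (x(j := x j + p)) = F x" unfolding F_def by simp
  qed
  also have "... = (\<integral>\<^sup>+x. (\<Prod>j\<in>insert i I. indicator {c j..<c j + p} (x j)) * f x \<partial>lborelP (insert i I))"
    unfolding F_def by (rule split[symmetric]) simp
  finally show ?case .
qed

section \<open>Reflection positivity and the chessboard estimate\<close>

text \<open>Product Lebesgue measure does not depend on the names of the coordinates; it suffices to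
  compare the measures of boxes.\<close>

lemma nn_integral_PiM_reindex:
  fixes f :: "('i => real) => ennreal"
  assumes fin: "finite I" "finite J" and bij: "bij_betw \<rho> J I"
    and f [measurable]: "f \<in> borel_measurable (lborelP J)"
  shows "(\<integral>\<^sup>+x. f x \<partial>lborelP J) = (\<integral>\<^sup>+x. f (\<lambda>j\<in>J. x (\<rho> j)) \<partial>lborelP I)"
proof -
  let ?T = "\<lambda>x. \<lambda>j\<in>J. x (\<rho> j)"
  have \<rho>: "\<rho> j \<in> I" if "j \<in> J" for j using bij that by (auto simp: bij_betw_def)
  have T: "?T \<in> lborelP I \<rightarrow>\<^sub>M lborelP J"
    using \<rho> by (intro measurable_restrict measurable_component_singleton) auto
  have "distr (lborelP I) (lborelP J) ?T = lborelP J"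
  proof (rule PL.PiM_eqI[OF fin(2)])
    fix A :: "'i => real set" assume A: "\<And>i. i \<in> J ==> A i \<in> sets lborel"
    let ?s = "inv_into J \<rho>"
    have s: "?s i \<in> J" if "i \<in> I" for i using bij that by (metis bij_betw_def inv_into_into)
    have "?T -` Pi\<^sub>E J A \<inter> space (lborelP I) = Pi\<^sub>E I (\<lambda>i. A (?s i))"
    proof (intro equalityI subsetI)
      fix x assume x: "x \<in> ?T -` Pi\<^sub>E J A \<inter> space (lborelP I)"
      have "x i \<in> A (?s i)" if "i \<in> I" for i
      proof -
        have "x (\<rho> (?s i)) \<in> A (?s i)" using x s[OF that] by (auto simp: PiE_iff restrict_def)
        then show ?thesis using bij that by (simp add: bij_betw_inv_into_right)
      qed
      then show "x \<in> Pi\<^sub>E I (\<lambda>i. A (?s i))" using x by (auto simp: space_PiM PiE_iff)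
    next
      fix x assume x: "x \<in> Pi\<^sub>E I (\<lambda>i. A (?s i))"
      have "x (\<rho> j) \<in> A j" if "j \<in> J" for j
        using x \<rho>[OF that] bij_betw_inv_into_left[OF bij that] by (auto simp: PiE_iff)
      then show "x \<in> ?T -` Pi\<^sub>E J A \<inter> space (lborelP I)"
        using x by (auto simp: space_PiM PiE_iff)
    qed
    then have "emeasure (distr (lborelP I) (lborelP J) ?T) (Pi\<^sub>E J A) =
       emeasure (lborelP I) (Pi\<^sub>E I (\<lambda>i. A (?s i)))"
      using A fin T by (subst emeasure_distr) (auto intro!: sets_PiM_I_finite)
    also have "... = (\<Prod>i\<in>I. emeasure lborel (A (?s i)))"
      using A s fin by (intro PL.emeasure_PiM) auto
    also have "... = (\<Prod>j\<in>J. emeasure lborel (A j))"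
      using bij_betw_inv_into_left[OF bij]
      by (subst prod.reindex_bij_betw[OF bij, symmetric]) (intro prod.cong refl, simp)
    finally show "emeasure (distr (lborelP I) (lborelP J) ?T) (Pi\<^sub>E J A) = (\<Prod>j\<in>J. emeasure lborel (A j))" .
  qed simp
  then show ?thesis using nn_integral_distr[OF T, of f] by simp
qed

text \<open>Given the spins on the reflection planes \<open>\<Lambda>\<^sub>0\<close> the two halves are independent copies of one another,
  so reflection positivity is Cauchy-Schwarz with respect to the spins on the planes.\<close>

lemma reflection_positivity:
  fixes F G :: "('i => real) => ennreal"
  assumes fin: "finite \<Lambda>0" "finite P" "finite N"
    and disj: "\<Lambda>0 \<inter> P = {}" "\<Lambda>0 \<inter> N = {}" "P \<inter> N = {}"
    and \<rho>: "bij_betw \<rho> P N" "\<And>r. r \<in> \<Lambda>0 ==> \<rho> r = r"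
    and loc: "\<And>x y. (\<And>r. r \<in> \<Lambda>0 \<union> P ==> x r = y r) ==> F x = F y"
      "\<And>x y. (\<And>r. r \<in> \<Lambda>0 \<union> P ==> x r = y r) ==> G x = G y"
    and [measurable]: "F \<in> borel_measurable (lborelP (\<Lambda>0 \<union> P))" "G \<in> borel_measurable (lborelP (\<Lambda>0 \<union> P))"
  shows "(\<integral>\<^sup>+x. F x * G (\<lambda>r. x (\<rho> r)) \<partial>lborelP (\<Lambda>0 \<union> (P \<union> N)))\<^sup>2 \<le>
     (\<integral>\<^sup>+x. F x * F (\<lambda>r. x (\<rho> r)) \<partial>lborelP (\<Lambda>0 \<union> (P \<union> N))) *
     (\<integral>\<^sup>+x. G x * G (\<lambda>r. x (\<rho> r)) \<partial>lborelP (\<Lambda>0 \<union> (P \<union> N)))"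
proof -
  \<comment> \<open>Integrates out the interior of one half with the spins on the planes held fixed;
    the other half contributes a function of the same kind after relabelling by
    \<open>\<rho>\<close>.\<close>
  define \<phi> where "\<phi> H x = (\<integral>\<^sup>+y. H (merge \<Lambda>0 P (x, y)) \<partial>lborelP P)"
    for H :: "('i => real) => ennreal" and x
  interpret S: sigma_finite_measure "lborelP P"
    by (rule PL.sigma_finite[OF fin(2)])
  have \<rho>P: "\<rho> r \<in> N" if "r \<in> P" for r using \<rho>(1) that by (auto simp: bij_betw_def)
  have mer [measurable]: "(\<lambda>z. H (merge \<Lambda>0 P z)) \<in> borel_measurable (lborelP \<Lambda>0 \<Otimes>\<^sub>M lborelP P)"
    if "H \<in> borel_measurable (lborelP (\<Lambda>0 \<union> P))" for H :: "('i => real) => ennreal"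
    using measurable_comp[OF measurable_merge that] by (simp add: comp_def)
  have \<phi>m: "\<phi> H \<in> borel_measurable (lborelP \<Lambda>0)"
    if "H \<in> borel_measurable (lborelP (\<Lambda>0 \<union> P))" for H :: "('i => real) => ennreal"
    unfolding \<phi>_def using S.borel_measurable_nn_integral_fst[OF mer[OF that]] by simp
  have eq: "(\<integral>\<^sup>+x. H x * K (\<lambda>r. x (\<rho> r)) \<partial>lborelP (\<Lambda>0 \<union> (P \<union> N))) =
     (\<integral>\<^sup>+x. \<phi> H x * \<phi> K x \<partial>lborelP \<Lambda>0)"
    if H: "H \<in> borel_measurable (lborelP (\<Lambda>0 \<union> P))" and K: "K \<in> borel_measurable (lborelP (\<Lambda>0 \<union> P))"
      and locH: "\<And>x y. (\<And>r. r \<in> \<Lambda>0 \<union> P ==> x r = y r) ==> H x = H y"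
      and locK: "\<And>x y. (\<And>r. r \<in> \<Lambda>0 \<union> P ==> x r = y r) ==> K x = K y"
    for H K :: "('i => real) => ennreal"
  proof -
    note [measurable] = H K
    let ?\<Lambda> = "\<Lambda>0 \<union> (P \<union> N)"
    have H': "H \<in> borel_measurable (lborelP ?\<Lambda>)"
    proof -
      have "(\<lambda>x. H (restrict x (\<Lambda>0 \<union> P))) \<in> borel_measurable (lborelP ?\<Lambda>)"
        by (rule measurable_compose[OF measurable_restrict_subset H]) auto
      moreover have "H (restrict x (\<Lambda>0 \<union> P)) = H x" for x by (rule locH) auto
      ultimately show ?thesis by simp
    qed
    have K': "(\<lambda>x. K (\<lambda>r. x (\<rho> r))) \<in> borel_measurable (lborelP ?\<Lambda>)"
    proof -
      have "(\<lambda>x. K (\<lambda>r\<in>\<Lambda>0 \<union> P. x (\<rho> r))) \<in> borel_measurable (lborelP ?\<Lambda>)"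
        by (rule measurable_compose[OF _ K], intro measurable_restrict measurable_component_singleton)
          (use \<rho> \<rho>P in auto)
      moreover have "K (\<lambda>r\<in>\<Lambda>0 \<union> P. x (\<rho> r)) = K (\<lambda>r. x (\<rho> r))" for x by (rule locK) auto
      ultimately show ?thesis by simp
    qed
    let ?h = "\<lambda>x. H x * K (\<lambda>r. x (\<rho> r))"
    have h: "?h \<in> borel_measurable (lborelP ?\<Lambda>)" using H' K' by simp
    have slice: "(\<lambda>y. ?h (merge \<Lambda>0 (P \<union> N) (x, y))) \<in> borel_measurable (lborelP (P \<union> N))"
      if x: "x \<in> space (lborelP \<Lambda>0)" for x
      using measurable_compose[OF measurable_Pair1'[OF x] measurable_compose[OF measurable_merge h]] by simp
    have sliceH: "(\<lambda>y. J (merge \<Lambda>0 P (x, y))) \<in> borel_measurable (lborelP P)"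
      if x: "x \<in> space (lborelP \<Lambda>0)" and J: "J \<in> borel_measurable (lborelP (\<Lambda>0 \<union> P))"
      for x and J :: "('i => real) => ennreal"
      using measurable_compose[OF measurable_Pair1'[OF x] mer[OF J]] by simp
    have "(\<integral>\<^sup>+x. ?h x \<partial>lborelP ?\<Lambda>) =
       (\<integral>\<^sup>+x. \<integral>\<^sup>+y. ?h (merge \<Lambda>0 (P \<union> N) (x, y)) \<partial>lborelP (P \<union> N) \<partial>lborelP \<Lambda>0)"
      by (rule PL.product_nn_integral_fold) (use disj fin h in auto)
    also have "... = (\<integral>\<^sup>+x. \<integral>\<^sup>+y. \<integral>\<^sup>+z. ?h (merge \<Lambda>0 (P \<union> N) (x, merge P N (y, z))) \<partial>lborelP N \<partial>lborelP P \<partial>lborelP \<Lambda>0)"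
      by (intro nn_integral_cong PL.product_nn_integral_fold) (use disj fin slice in auto)
    also have "... = (\<integral>\<^sup>+x. \<phi> H x * \<phi> K x \<partial>lborelP \<Lambda>0)"
    proof (intro nn_integral_cong)
      fix x :: "'i => real" assume x: "x \<in> space (lborelP \<Lambda>0)"
      have h_eq: "?h (merge \<Lambda>0 (P \<union> N) (x, merge P N (y, z))) = H (merge \<Lambda>0 P (x, y)) * K (merge \<Lambda>0 P (x, \<lambda>r\<in>P. z (\<rho> r)))" for y z :: "'i => real"
      proof -
        have "H (merge \<Lambda>0 (P \<union> N) (x, merge P N (y, z))) = H (merge \<Lambda>0 P (x, y))"
          by (rule locH) (auto simp: merge_def)
        moreover have "K (\<lambda>r. merge \<Lambda>0 (P \<union> N) (x, merge P N (y, z)) (\<rho> r)) = K (merge \<Lambda>0 P (x, \<lambda>r\<in>P. z (\<rho> r)))"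
          by (rule locK) (use \<rho> \<rho>P disj in \<open>auto simp: merge_def\<close>)
        ultimately show ?thesis by simp
      qed
      have Kz: "(\<lambda>z. K (merge \<Lambda>0 P (x, \<lambda>r\<in>P. z (\<rho> r)))) \<in> borel_measurable (lborelP N)"
        by (rule measurable_compose[OF _ sliceH[OF x K]], intro measurable_restrict measurable_component_singleton)
          (use \<rho>P in auto)
      have "(\<integral>\<^sup>+z. K (merge \<Lambda>0 P (x, \<lambda>r\<in>P. z (\<rho> r))) \<partial>lborelP N) = \<phi> K x"
        unfolding \<phi>_def by (rule nn_integral_PiM_reindex[OF fin(3,2) \<rho>(1) sliceH[OF x K], symmetric])
      then show "(\<integral>\<^sup>+y. \<integral>\<^sup>+z. ?h (merge \<Lambda>0 (P \<union> N) (x, merge P N (y, z))) \<partial>lborelP N \<partial>lborelP P) = \<phi> H x * \<phi> K x"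
        unfolding h_eq using Kz sliceH[OF x H] by (simp add: nn_integral_cmult nn_integral_multc \<phi>_def)
    qed
    finally show ?thesis .
  qed
  have FG: "F \<in> borel_measurable (lborelP (\<Lambda>0 \<union> P))" "G \<in> borel_measurable (lborelP (\<Lambda>0 \<union> P))"
    by measurable
  have eqFG: "(\<integral>\<^sup>+x. F x * G (\<lambda>r. x (\<rho> r)) \<partial>lborelP (\<Lambda>0 \<union> (P \<union> N))) =
      (\<integral>\<^sup>+x. \<phi> F x * \<phi> G x \<partial>lborelP \<Lambda>0)"
    by (rule eq) (fact FG | erule loc)+
  have eqFF: "(\<integral>\<^sup>+x. F x * F (\<lambda>r. x (\<rho> r)) \<partial>lborelP (\<Lambda>0 \<union> (P \<union> N))) =
      (\<integral>\<^sup>+x. \<phi> F x * \<phi> F x \<partial>lborelP \<Lambda>0)"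
    by (rule eq) (fact FG | erule loc)+
  have eqGG: "(\<integral>\<^sup>+x. G x * G (\<lambda>r. x (\<rho> r)) \<partial>lborelP (\<Lambda>0 \<union> (P \<union> N))) =
      (\<integral>\<^sup>+x. \<phi> G x * \<phi> G x \<partial>lborelP \<Lambda>0)"
    by (rule eq) (fact FG | erule loc)+
  show ?thesis
    unfolding eqFG eqFF eqGG power2_eq_square[of "\<phi> _ _", symmetric]
    by (rule Cauchy_Schwarz_nn_integral) (intro \<phi>m FG)+
qed

text \<open>Divide \<open>Z a\<close> by the product over the sites of \<open>z (a r)\<close>, the
  root of order \<open>card \<Lambda>\<close> of the constant values. By \<open>count\<close> the
  quotient \<open>R\<close> satisfies the same reflection inequality, so the assignments that
  maximize \<open>R\<close> are closed under both foldings. \<open>closure\<close> finds among them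
  one that is constant on \<open>\<Lambda>\<close>, and there \<open>R = 1\<close>.\<close>

lemma chessboard_abstract:
  fixes Z :: "('r => 'k) => real" and \<Phi> :: "(('r => 'r) \<times> ('r => 'r)) set"
  assumes fin: "finite \<Lambda>" "\<Lambda> \<noteq> {}"
    and Z0: "\<And>a. Z a \<ge> 0" and Zcong: "\<And>a b. (\<And>r. r \<in> \<Lambda> ==> a r = b r) ==> Z a = Z b"
    and maps: "\<And>\<phi> \<psi> r. (\<phi>, \<psi>) \<in> \<Phi> ==> r \<in> \<Lambda> ==> \<phi> r \<in> \<Lambda> \<and> \<psi> r \<in> \<Lambda>"
    and RP: "\<And>\<phi> \<psi> a. (\<phi>, \<psi>) \<in> \<Phi> ==> (Z a)\<^sup>2 \<le> Z (a \<circ> \<phi>) * Z (a \<circ> \<psi>)"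
    and count: "\<And>\<phi> \<psi> f. (\<phi>, \<psi>) \<in> \<Phi> ==> (\<Prod>r\<in>\<Lambda>. f (\<phi> r)) * (\<Prod>r\<in>\<Lambda>. f (\<psi> r)) = (\<Prod>r\<in>\<Lambda>. f r :: real)\<^sup>2"
    and closure: "\<And>S (a :: 'r => 'k) r0. \<lbrakk>\<And>\<phi> \<psi> a. (\<phi>, \<psi>) \<in> \<Phi> ==> a \<in> S ==> a \<circ> \<phi> \<in> S \<and> a \<circ> \<psi> \<in> S; a \<in> S; r0 \<in> \<Lambda>\<rbrakk>
       \<Longrightarrow> \<exists>b\<in>S. \<forall>r\<in>\<Lambda>. b r = a r0"
  shows "Z a \<le> (\<Prod>r\<in>\<Lambda>. Z (\<lambda>_. a r) powr (1 / card \<Lambda>))"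
proof (cases "Z a = 0")
  case True
  then show ?thesis by (simp add: prod_nonneg)
next
  case False
  then have Za: "Z a > 0" using Z0[of a] by linarith
  define z where "z k = Z (\<lambda>_. k) powr (1 / card \<Lambda>)" for k
  have zk: "Z (\<lambda>_. a r) > 0" if r: "r \<in> \<Lambda>" for r
  proof -
    \<comment> \<open>Positivity is inherited by both foldings, so that no constant value in the
      denominator vanishes.\<close>
    have "\<exists>b\<in>{b. Z b > 0}. \<forall>r'\<in>\<Lambda>. b r' = a r"
    proof (rule closure[where a=a])
      fix \<phi> \<psi> b assume *: "(\<phi>, \<psi>) \<in> \<Phi>" "b \<in> {b. 0 < Z b}"
      then have "0 < (Z b)\<^sup>2" by simp
      also note RP[OF *(1), of b]
      finally have "0 < Z (b \<circ> \<phi>) * Z (b \<circ> \<psi>)" .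
      then show "b \<circ> \<phi> \<in> {b. 0 < Z b} \<and> b \<circ> \<psi> \<in> {b. 0 < Z b}"
        using Z0[of "b \<circ> \<phi>"] Z0[of "b \<circ> \<psi>"] by (auto simp: zero_less_mult_iff)
    qed (use Za r in auto)
    then obtain b where "Z b > 0" "\<forall>r'\<in>\<Lambda>. b r' = a r" by auto
    then show ?thesis using Zcong[of b "\<lambda>_. a r"] by auto
  qed
  define K where "K = a ` \<Lambda>"
  have zpos: "z k > 0" if "k \<in> K" for k using zk that by (force simp: z_def K_def)
  define T where "T = {b. \<forall>r\<in>\<Lambda>. b r \<in> K}"
  define R where "R b = Z b / (\<Prod>r\<in>\<Lambda>. z (b r))" for b
  have prodpos: "(\<Prod>r\<in>\<Lambda>. z (b r)) > 0" if "b \<in> T" for b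
    using that zpos by (intro prod_pos) (auto simp: T_def)
  have Rcong: "R b = R (restrict b \<Lambda>)" for b
  proof -
    have "Z b = Z (restrict b \<Lambda>)" by (rule Zcong) auto
    moreover have "(\<Prod>r\<in>\<Lambda>. z (b r)) = (\<Prod>r\<in>\<Lambda>. z (restrict b \<Lambda> r))" by (intro prod.cong) auto
    ultimately show ?thesis by (simp add: R_def)
  qed
  have "R ` T \<subseteq> R ` (\<Pi>\<^sub>E r\<in>\<Lambda>. K)"
  proof
    fix v assume "v \<in> R ` T"
    then obtain b where b: "b \<in> T" "v = R b" by auto
    moreover have "restrict b \<Lambda> \<in> (\<Pi>\<^sub>E r\<in>\<Lambda>. K)" using b by (auto simp: T_def)
    ultimately show "v \<in> R ` (\<Pi>\<^sub>E r\<in>\<Lambda>. K)" using Rcong by (metis image_eqI)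
  qed
  moreover have "finite (\<Pi>\<^sub>E r\<in>\<Lambda>. K)" using fin by (intro finite_PiE) (auto simp: K_def)
  ultimately have finR: "finite (R ` T)" by (meson finite_imageI finite_subset)
  have aT: "a \<in> T" by (auto simp: T_def K_def)
  define M where "M = Max (R ` T)"
  have Mge: "R b \<le> M" if "b \<in> T" for b unfolding M_def using finR that by (intro Max_ge) auto
  have "0 < R a" unfolding R_def using Za prodpos[OF aT] by simp
  then have M0: "M > 0" using Mge[OF aT] by linarith
  have "M \<in> R ` T" unfolding M_def using finR aT by (intro Max_in) auto
  then obtain c where c: "c \<in> T" "R c = M" by auto
  obtain r0 where r0: "r0 \<in> \<Lambda>" using fin by auto
  have R0: "R b \<ge> 0" if "b \<in> T" for b unfolding R_def using Z0 prodpos[OF that] by simp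
  have "\<exists>b\<in>{b\<in>T. R b = M}. \<forall>r\<in>\<Lambda>. b r = c r0"
  proof (rule closure[where a=c])
    fix \<phi> \<psi> b assume *: "(\<phi>, \<psi>) \<in> \<Phi>" "b \<in> {b\<in>T. R b = M}"
    have T: "b \<circ> \<phi> \<in> T" "b \<circ> \<psi> \<in> T" using * maps[OF *(1)] by (auto simp: T_def)
    have "M\<^sup>2 = (Z b)\<^sup>2 / (\<Prod>r\<in>\<Lambda>. z (b r))\<^sup>2" using * by (auto simp: R_def power_divide)
    also have "... \<le> Z (b \<circ> \<phi>) * Z (b \<circ> \<psi>) / (\<Prod>r\<in>\<Lambda>. z (b r))\<^sup>2"
      by (intro divide_right_mono RP[OF *(1)]) auto
    also have "(\<Prod>r\<in>\<Lambda>. z (b r))\<^sup>2 = (\<Prod>r\<in>\<Lambda>. z ((b \<circ> \<phi>) r)) * (\<Prod>r\<in>\<Lambda>. z ((b \<circ> \<psi>) r))"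
      using count[OF *(1), of "\<lambda>r. z (b r)"] by simp
    also have "Z (b \<circ> \<phi>) * Z (b \<circ> \<psi>) / ... = R (b \<circ> \<phi>) * R (b \<circ> \<psi>)" by (simp add: R_def)
    \<comment> \<open>Two numbers in \<open>[0, M]\<close> whose product reaches
      \<open>M * M\<close> are both equal to \<open>M\<close>.\<close>
    finally have le: "M * M \<le> R (b \<circ> \<phi>) * R (b \<circ> \<psi>)" by (simp add: power2_eq_square)
    have "R (b \<circ> \<phi>) * R (b \<circ> \<psi>) \<le> R (b \<circ> \<phi>) * M" "R (b \<circ> \<phi>) * R (b \<circ> \<psi>) \<le> M * R (b \<circ> \<psi>)"
      using Mge T R0 by (auto intro: mult_left_mono mult_right_mono)
    then have "M * M \<le> R (b \<circ> \<phi>) * M" "M * M \<le> M * R (b \<circ> \<psi>)" using le by linarith+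
    then have "M \<le> R (b \<circ> \<phi>)" "M \<le> R (b \<circ> \<psi>)" using M0 by auto
    then show "b \<circ> \<phi> \<in> {b\<in>T. R b = M} \<and> b \<circ> \<psi> \<in> {b\<in>T. R b = M}"
      using Mge T by (auto intro: antisym)
  qed (use c r0 in auto)
  then obtain b where b: "b \<in> T" "R b = M" "\<And>r. r \<in> \<Lambda> ==> b r = c r0" by auto
  have "R b = Z (\<lambda>_. c r0) / (\<Prod>r\<in>\<Lambda>. z (c r0))"
    unfolding R_def using Zcong[of b "\<lambda>_. c r0"] b(3) by simp
  moreover have "Z (\<lambda>_. c r0) > 0" using c(1) r0 zk by (auto simp: T_def K_def)
  then have "(\<Prod>r\<in>\<Lambda>. z (c r0)) = Z (\<lambda>_. c r0)"
    unfolding z_def using fin by (simp add: powr_realpow[symmetric] powr_powr)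
  ultimately have "M = 1" using b(2) \<open>Z (\<lambda>_. c r0) > 0\<close> by simp
  then have "R a \<le> 1" using Mge[OF aT] by simp
  then show ?thesis unfolding R_def z_def[symmetric] using prodpos[OF aT] by (simp add: divide_le_eq_1)
qed

section \<open>Coordinates of sites and foldings of the torus\<close>

definition crd :: "nat => site => int" where
  "crd \<alpha> r = (case r of (a, b, c) => if \<alpha> = 1 then a else if \<alpha> = 2 then b else c)"

definition upd :: "nat => site => int => site" where
  "upd \<alpha> r x = (case r of (a, b, c) => if \<alpha> = 1 then (x, b, c) else if \<alpha> = 2 then (a, x, c) else (a, b, x))"

lemma crd_upd: "\<alpha> \<in> dirs ==> \<nu> \<in> dirs ==> crd \<nu> (upd \<alpha> r x) = (if \<nu> = \<alpha> then x else crd \<nu> r)"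
  by (auto simp: crd_def upd_def split: prod.splits)

lemma upd_upd [simp]: "upd \<alpha> (upd \<alpha> r x) y = upd \<alpha> r y"
  by (auto simp: upd_def split: prod.splits)

lemma upd_crd [simp]: "upd \<alpha> r (crd \<alpha> r) = r"
  by (auto simp: upd_def crd_def split: prod.splits)

lemma crd_upd_same [simp]: "crd \<alpha> (upd \<alpha> r x) = x"
  by (auto simp: upd_def crd_def split: prod.splits)

lemma site_eqI:
  assumes "\<And>\<alpha>. \<alpha> \<in> dirs ==> crd \<alpha> r = crd \<alpha> s"
  shows "r = s"
  using assms[of 1] assms[of 2] assms[of 3] by (cases r; cases s) (auto simp: crd_def)

lemma torus_iff: "r \<in> torus L \<longleftrightarrow> (\<forall>\<alpha>\<in>dirs. 0 \<le> crd \<alpha> r \<and> crd \<alpha> r < int L)"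
  by (cases r) (auto simp: torus_def crd_def)

lemma torus_eq: "torus L = {0..<int L} \<times> {0..<int L} \<times> {0..<int L}"
  by (auto simp: torus_def)

lemma finite_torus [simp, intro]: "finite (torus L)"
  by (simp add: torus_eq)

lemma card_torus: "card (torus L) = L ^ 3"
  by (simp add: torus_eq card_cartesian_product power3_eq_cube)

lemma upd_torus: "r \<in> torus L ==> 0 \<le> x ==> x < int L ==> upd \<alpha> r x \<in> torus L"
  by (cases r) (auto simp: torus_def upd_def)

lemma crd_torus: "r \<in> torus L ==> 0 \<le> crd \<alpha> r \<and> crd \<alpha> r < int L"
  by (cases r) (auto simp: torus_def crd_def)

text \<open>A cube is indexed by its lower corner, so the reflection of sites \<open>x\<close> to
  \<open>2 * j - x\<close> through the plane at \<open>j\<close> sends the cube at \<open>x\<close>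
  to the cube at \<open>2 * j - 1 - x\<close>. The half of length \<open>L div 2\<close> that starts
  at \<open>j\<close> is kept and copied, mirrored, onto the other one.\<close>

definition fold_map :: "nat => nat => int => site => site" where
  "fold_map L \<alpha> j r = (if (crd \<alpha> r - j) mod int L < int (L div 2) then r
     else upd \<alpha> r ((2 * j - 1 - crd \<alpha> r) mod int L))"

lemma fold_map_torus:
  assumes "r \<in> torus L" "L > 0"
  shows "fold_map L \<alpha> j r \<in> torus L"
  using assms by (auto simp: fold_map_def intro!: upd_torus)

lemma mod_reflect:
  fixes L x j :: int
  assumes "L > 0"
  shows "((2 * j - 1 - x) mod L - j) mod L = L - 1 - (x - j) mod L"
proof -
  have "((2 * j - 1 - x) mod L - j) mod L = (- 1 - (x - j)) mod L"
    by (simp add: mod_simps algebra_simps)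
  also have "... = (- 1 - (x - j) mod L) mod L" by (rule mod_diff_right_eq[symmetric])
  also have "... = (L + (- 1 - (x - j) mod L)) mod L" by (rule mod_add_self1[symmetric])
  also have "L + (- 1 - (x - j) mod L) = L - 1 - (x - j) mod L" by simp
  also have "... mod L = L - 1 - (x - j) mod L"
    using pos_mod_bound[OF assms, of "x - j"] pos_mod_sign[OF assms, of "x - j"]
    by (intro mod_pos_pos_trivial) linarith+
  finally show ?thesis .
qed

lemma mod_antipode:
  fixes L x j :: int
  assumes "L > 0" "even L"
  shows "(x - (j + L div 2)) mod L < L div 2 \<longleftrightarrow> \<not> (x - j) mod L < L div 2"
proof -
  define d where "d = (x - j) mod L"
  have d: "0 \<le> d" "d < L" using assms by (auto simp: d_def)
  have "(x - (j + L div 2)) mod L = (d - L div 2) mod L"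
    unfolding d_def mod_diff_left_eq by (simp add: algebra_simps)
  moreover have "(d - L div 2) mod L = (if d < L div 2 then d + L div 2 else d - L div 2)"
  proof (cases "d < L div 2")
    case True
    have "(d - L div 2) mod L = (d - L div 2 + L) mod L" by (rule mod_add_self2[symmetric])
    also have "d - L div 2 + L = d + L div 2" using assms(2) by auto
    also have "... mod L = d + L div 2" using True d by (intro mod_pos_pos_trivial) auto
    finally show ?thesis using True by simp
  next
    case False
    then show ?thesis using d assms by (auto intro!: mod_pos_pos_trivial)
  qed
  ultimately show ?thesis unfolding d_def[symmetric] using d assms(2) by auto
qed

text \<open>A run of \<open>m\<close> equal layers starting at \<open>j\<close> is doubled by folding along the plane at \<open>j\<close>.\<close>

lemma fold_closure_stage:
  assumes L: "even L" "L > 0" and closed: "\<And>a j. a \<in> S ==> a \<circ> fold_map L \<alpha> j \<in> S"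
    and a: "a \<in> S" and x: "0 \<le> x" "x < int L"
  shows "\<exists>b\<in>S. \<forall>r\<in>torus L. b r = a (upd \<alpha> r x)"
proof -
  have "\<exists>b\<in>S. \<exists>j. \<forall>r\<in>torus L. (crd \<alpha> r - j) mod int L < 2 ^ m --> b r = a (upd \<alpha> r x)" for m
  proof (induction m)
    case 0
    show ?case
    proof (intro bexI[OF _ a] exI[of _ x] ballI impI)
      fix r assume r: "r \<in> torus L" and *: "(crd \<alpha> r - x) mod int L < 2 ^ 0"
      have "0 \<le> (crd \<alpha> r - x) mod int L" using L by simp
      then have "(crd \<alpha> r - x) mod int L = 0" using * by simp
      then have "crd \<alpha> r mod int L = x mod int L" by (metis mod_eq_dvd_iff dvd_eq_mod_eq_0)
      then have "crd \<alpha> r = x" using x crd_torus[OF r, of \<alpha>] by simp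
      then show "a r = a (upd \<alpha> r x)" by auto
    qed
  next
    case (Suc m)
    then obtain b j where b: "b \<in> S" and run: "\<And>r. r \<in> torus L ==> (crd \<alpha> r - j) mod int L < 2 ^ m ==> b r = a (upd \<alpha> r x)"
      by auto
    show ?case
    proof (intro bexI[OF _ closed[OF b, of j]] exI[of _ "j - 2 ^ m"] ballI impI)
      fix r assume r: "r \<in> torus L" and *: "(crd \<alpha> r - (j - 2 ^ m)) mod int L < 2 ^ Suc m"
      define d where "d = (crd \<alpha> r - j) mod int L"
      have d: "0 \<le> d" "d < int L" using L by (auto simp: d_def)
      have *: "(d + 2 ^ m) mod int L < 2 ^ Suc m"
        using * unfolding d_def mod_add_left_eq by (simp add: algebra_simps)
      have cond: "d < 2 ^ m \<or> int L - 1 - d < 2 ^ m"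
      proof (rule ccontr)
        assume neg: "\<not> (d < 2 ^ m \<or> int L - 1 - d < 2 ^ m)"
        then have "(d + 2 ^ m) mod int L = d + 2 ^ m" using d by (intro mod_pos_pos_trivial) auto
        then show False using * neg by auto
      qed
      have half: "2 * int (L div 2) = int L" using L by (metis dvd_mult_div_cancel of_nat_mult of_nat_numeral)
      show "(b \<circ> fold_map L \<alpha> j) r = a (upd \<alpha> r x)"
      proof (cases "d < int (L div 2)")
        case True
        then have "d < 2 ^ m" using cond half by linarith
        then show ?thesis using True run[OF r] by (simp add: fold_map_def d_def)
      next
        case False
        define r' where "r' = upd \<alpha> r ((2 * j - 1 - crd \<alpha> r) mod int L)"
        have r': "r' \<in> torus L" unfolding r'_def using r L by (intro upd_torus) auto
        have "(crd \<alpha> r' - j) mod int L = int L - 1 - d"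
          unfolding r'_def d_def crd_upd_same by (rule mod_reflect) (use L in simp)
        moreover have "int L - 1 - d < 2 ^ m" using cond False half by linarith
        ultimately have "b r' = a (upd \<alpha> r' x)" using run[OF r'] by simp
        then show ?thesis using False by (simp add: fold_map_def d_def r'_def)
      qed
    qed
  qed
  from this[of L] obtain b j where b: "b \<in> S"
    and run: "\<And>r. r \<in> torus L ==> (crd \<alpha> r - j) mod int L < 2 ^ L ==> b r = a (upd \<alpha> r x)" by auto
  have "(crd \<alpha> r - j) mod int L < 2 ^ L" for r
  proof -
    have "(crd \<alpha> r - j) mod int L < int L" using L by simp
    also have "int L < 2 ^ L" by (metis of_nat_less_two_power)
    finally show ?thesis .
  qed
  then show ?thesis using b run by blast
qed

text \<open>One application of \<open>fold_closure_stage\<close> per direction substitutes the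
  coordinates of \<open>r0\<close> one after another.\<close>

lemma fold_closure:
  assumes L: "even L" "L > 0" and closed: "\<And>a \<alpha> j. \<alpha> \<in> dirs ==> a \<in> S ==> a \<circ> fold_map L \<alpha> j \<in> S"
    and a: "a \<in> S" and r0: "r0 \<in> torus L"
  shows "\<exists>b\<in>S. \<forall>r\<in>torus L. b r = a r0"
proof -
  note st = fold_closure_stage[OF L]
  have c: "0 \<le> crd \<alpha> r0" "crd \<alpha> r0 < int L" for \<alpha> using crd_torus[OF r0] by auto
  obtain b1 where b1: "b1 \<in> S" "\<And>r. r \<in> torus L ==> b1 r = a (upd 1 r (crd 1 r0))"
    using st[of S 1 a "crd 1 r0"] closed[of 1] a c by auto
  obtain b2 where b2: "b2 \<in> S" "\<And>r. r \<in> torus L ==> b2 r = b1 (upd 2 r (crd 2 r0))"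
    using st[of S 2 b1 "crd 2 r0"] closed[of 2] b1 c by auto
  obtain b3 where b3: "b3 \<in> S" "\<And>r. r \<in> torus L ==> b3 r = b2 (upd 3 r (crd 3 r0))"
    using st[of S 3 b2 "crd 3 r0"] closed[of 3] b2 c by auto
  have "b3 r = a r0" if r: "r \<in> torus L" for r
  proof -
    have "b3 r = a (upd 1 (upd 2 (upd 3 r (crd 3 r0)) (crd 2 r0)) (crd 1 r0))"
      using r c by (simp add: b1 b2 b3 upd_torus)
    also have "upd 1 (upd 2 (upd 3 r (crd 3 r0)) (crd 2 r0)) (crd 1 r0) = r0"
      by (cases r; cases r0) (simp add: upd_def crd_def)
    finally show ?thesis .
  qed
  then show ?thesis using b3(1) by blast
qed

text \<open>With \<open>B = 1\<close> the map \<open>block_map\<close> reads cubes with odd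
  coordinates mirrored. For even \<open>L\<close> a site is therefore found at the same position,
  its coordinates modulo 2, in every cube that contains it.\<close>

definition cube :: "nat => config => site => config" where
  "cube L \<theta> r = (\<lambda>u\<in>torus 2. \<theta> (block_map L 1 r u))"

definition cubeZ :: "nat => ('k => config => ennreal) => (site => 'k) => ennreal" where
  "cubeZ L g a = (\<integral>\<^sup>+\<theta>. (\<Prod>r\<in>torus L. g (a r) (cube L \<theta> r)) \<partial>config_measure L)"

lemma crd_block_map_1:
  "\<alpha> \<in> dirs ==> crd \<alpha> (block_map L 1 r u) =
     (crd \<alpha> r + (if odd (crd \<alpha> r) then 1 - crd \<alpha> u else crd \<alpha> u)) mod int L"
  by (cases r; cases u) (auto simp: crd_def block_map_def modL_def refl_coord_def)

lemma block_map_torus: "L > 0 ==> block_map L B r u \<in> torus L"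
  by (cases r; cases u) (auto simp: block_map_def modL_def torus_def)

lemma measurable_cube:
  assumes "\<And>u. u \<in> torus 2 ==> block_map L 1 r u \<in> S"
  shows "(\<lambda>\<theta>. cube L \<theta> r) \<in> lborelP S \<rightarrow>\<^sub>M lborelP (torus 2)"
  unfolding cube_def using assms by (intro measurable_restrict measurable_component_singleton) auto

section \<open>Reflection of cubes through a pair of planes of sites\<close>

context
  fixes L :: nat and \<alpha> :: nat and j :: int
  assumes L: "even L" "L > 0" and \<alpha>: "\<alpha> \<in> dirs"
begin

private definition off :: "site => int" where "off r = (crd \<alpha> r - j) mod int L"
text \<open>\<open>sref\<close> and \<open>cref\<close> are one geometric reflection, acting on
  sites and on the lower corners of cubes. Sites at offset 0 and \<open>L div 2\<close> are fixed by
  it; no cube is.\<close>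

private definition sref :: "site => site" where "sref s = upd \<alpha> s ((2 * j - crd \<alpha> s) mod int L)"
private definition cref :: "site => site" where "cref r = upd \<alpha> r ((2 * j - 1 - crd \<alpha> r) mod int L)"
private definition half :: "site set" where "half = {r \<in> torus L. off r < int (L div 2)}"

private lemma L2: "2 * int (L div 2) = int L" "int L \<ge> 2" "0 < int (L div 2)" "even (int L)"
proof -
  show 1: "2 * int (L div 2) = int L" using L(1) by (metis dvd_mult_div_cancel of_nat_mult of_nat_numeral)
  show "int L \<ge> 2" "0 < int (L div 2)" "even (int L)" using L 1 by auto
qed

private lemma off_bounds: "0 \<le> off r" "off r < int L"
  using L by (auto simp: off_def)

private lemma cref_torus: "r \<in> torus L ==> cref r \<in> torus L"
  unfolding cref_def using L by (intro upd_torus) auto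

private lemma sref_torus: "r \<in> torus L ==> sref r \<in> torus L"
  unfolding sref_def using L by (intro upd_torus) auto

private lemma mod_invol: "r \<in> torus L ==> (c - (c - crd \<alpha> r) mod int L) mod int L = crd \<alpha> r"
  using crd_torus[of r L \<alpha>] by (simp add: mod_diff_right_eq)

private lemma cref_cref: "r \<in> torus L ==> cref (cref r) = r"
  using mod_invol[of r "2 * j - 1"] by (simp add: cref_def)

private lemma sref_sref: "r \<in> torus L ==> sref (sref r) = r"
  using mod_invol[of r "2 * j"] by (simp add: sref_def)

private lemma off_cref: "off (cref r) = int L - 1 - off r"
  unfolding off_def cref_def crd_upd_same by (rule mod_reflect) (use L in simp)

private lemma off_sref: "off (sref r) = (if off r = 0 then 0 else int L - off r)"
proof -
  have "off (sref r) = (j - crd \<alpha> r) mod int L"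
    unfolding off_def sref_def crd_upd_same mod_diff_left_eq by (simp add: algebra_simps)
  also have "j - crd \<alpha> r = - (crd \<alpha> r - j)" by simp
  finally show ?thesis by (simp only: zmod_zminus1_eq_if off_def)
qed

private lemma cref_half: "r \<in> half ==> cref r \<in> torus L - half" "r \<in> torus L - half ==> cref r \<in> half"
  using L2 by (auto simp: half_def cref_torus off_cref)

private lemma cref_bij: "bij_betw cref half (torus L - half)"
  by (rule bij_betw_byWitness[where f'=cref]) (use cref_half cref_cref in \<open>auto simp: half_def\<close>)

text \<open>\<open>cref\<close> changes the parity of the coordinate, so a cube that was read
  mirrored is now read directly, and vice versa. The reflected cube thus shows the reflected sites
  at unchanged positions.\<close>

private lemma block_map_cref:
  assumes r: "r \<in> torus L"
  shows "block_map L 1 (cref r) u = sref (block_map L 1 r u)"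
proof (rule site_eqI)
  fix \<nu> :: nat assume \<nu>: "\<nu> \<in> dirs"
  show "crd \<nu> (block_map L 1 (cref r) u) = crd \<nu> (sref (block_map L 1 r u))"
  proof (cases "\<nu> = \<alpha>")
    case False
    then show ?thesis
      unfolding sref_def cref_def crd_block_map_1[OF \<nu>] crd_upd[OF \<alpha> \<nu>] by (simp only: if_False)
  next
    case True
    define x where "x = crd \<alpha> r"
    define v where "v = crd \<alpha> u"
    have par: "odd ((2 * j - 1 - x) mod int L) \<longleftrightarrow> even x"
      using L2(4) by (auto simp: dvd_mod_iff)
    have "((2 * j - 1 - x) mod int L + (if odd ((2 * j - 1 - x) mod int L) then 1 - v else v)) mod int L
       = (2 * j - 1 - x + (if odd ((2 * j - 1 - x) mod int L) then 1 - v else v)) mod int L"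
      by (rule mod_add_left_eq)
    also have "... = (2 * j - (x + (if odd x then 1 - v else v))) mod int L"
      unfolding par by (simp add: algebra_simps)
    also have "... = (2 * j - (x + (if odd x then 1 - v else v)) mod int L) mod int L"
      by (rule mod_diff_right_eq[symmetric])
    finally show ?thesis
      unfolding True sref_def cref_def crd_block_map_1[OF \<alpha>] crd_upd_same x_def v_def .
  qed
qed

private lemma cube_cref: "r \<in> torus L ==> cube L \<theta> (cref r) = cube L (\<lambda>s. \<theta> (sref s)) r"
  unfolding cube_def by (simp only: block_map_cref)

private lemma off_block_map:
  assumes r: "r \<in> half" and u: "u \<in> torus 2"
  shows "off (block_map L 1 r u) \<le> int (L div 2)"
proof -
  define w where "w = (if odd (crd \<alpha> r) then 1 - crd \<alpha> u else crd \<alpha> u)"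
  have w: "w \<in> {0, 1}" using crd_torus[OF u, of \<alpha>] by (auto simp: w_def)
  have "off (block_map L 1 r u) = ((crd \<alpha> r + w) - j) mod int L"
    unfolding off_def crd_block_map_1[OF \<alpha>] w_def by (rule mod_diff_left_eq)
  also have "... = ((crd \<alpha> r - j) mod int L + w) mod int L"
    unfolding mod_add_left_eq by (simp add: algebra_simps)
  also have "... = off r + w"
    unfolding off_def[symmetric] using r w off_bounds[of r] L2 by (intro mod_pos_pos_trivial) (auto simp: half_def)
  finally show ?thesis using r w by (auto simp: half_def)
qed

private definition plane :: "site set" where "plane = {s \<in> torus L. off s = 0 \<or> off s = int (L div 2)}"
private definition pos :: "site set" where "pos = {s \<in> torus L. 0 < off s \<and> off s < int (L div 2)}"
private definition neg :: "site set" where "neg = {s \<in> torus L. int (L div 2) < off s}"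

private lemma planes_Un: "plane \<union> (pos \<union> neg) = torus L"
proof (rule set_eqI)
  fix s show "s \<in> plane \<union> (pos \<union> neg) \<longleftrightarrow> s \<in> torus L"
    using off_bounds(1)[of s] by (auto simp: plane_def pos_def neg_def)
qed

private lemma block_map_half: "r \<in> half ==> u \<in> torus 2 ==> block_map L 1 r u \<in> plane \<union> pos"
  using off_block_map[of r u] block_map_torus[of L 1 r u] off_bounds[of "block_map L 1 r u"] L
  by (auto simp: plane_def pos_def)

private lemma sref_plane: "s \<in> plane ==> sref s = s"
proof -
  assume s: "s \<in> plane"
  then have "off (sref s) = off s" using L2 by (auto simp: plane_def off_sref)
  then have "int L dvd (crd \<alpha> (sref s) - j) - (crd \<alpha> s - j)" unfolding off_def by (rule mod_eq_dvd_iff[THEN iffD1])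
  then have "crd \<alpha> (sref s) mod int L = crd \<alpha> s mod int L" by (simp add: mod_eq_dvd_iff)
  then have "crd \<alpha> (sref s) = crd \<alpha> s"
    using s crd_torus[of s L \<alpha>] by (auto simp: plane_def sref_def)
  then show ?thesis by (metis crd_upd_same sref_def upd_crd)
qed

private lemma sref_bij: "bij_betw sref pos neg"
proof (rule bij_betw_byWitness[where f'=sref])
  have 1: "sref s \<in> neg" if "s \<in> pos" for s
    using that L2(1) sref_torus[of s] off_sref[of s] by (auto simp: pos_def neg_def)
  have 2: "sref s \<in> pos" if "s \<in> neg" for s
    using that L2(1,3) sref_torus[of s] off_bounds[of s] off_sref[of s] by (auto simp: pos_def neg_def)
  show "sref ` pos \<subseteq> neg" "sref ` neg \<subseteq> pos" using 1 2 by auto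
qed (auto simp: pos_def neg_def sref_sref)

private lemma fold1: "r \<in> half ==> fold_map L \<alpha> j r = r" "r \<in> torus L - half ==> fold_map L \<alpha> j r = cref r"
  by (auto simp: fold_map_def half_def off_def cref_def)

text \<open>The half that starts at the antipodal plane is the complement of \<open>half\<close>,
  and the reflections through the two planes coincide modulo \<open>L\<close>.\<close>

private lemma fold2: "r \<in> half ==> fold_map L \<alpha> (j + int (L div 2)) r = cref r"
  "r \<in> torus L - half ==> fold_map L \<alpha> (j + int (L div 2)) r = r"
proof -
  have a: "(crd \<alpha> r - (j + int (L div 2))) mod int L < int (L div 2) \<longleftrightarrow> \<not> off r < int (L div 2)"
    unfolding off_def using mod_antipode[of "int L" "crd \<alpha> r" j] L L2(4) by (simp add: zdiv_int)
  have "2 * (j + int (L div 2)) - 1 - crd \<alpha> r = (2 * j - 1 - crd \<alpha> r) + int L" using L2(1) by simp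
  then have b: "(2 * (j + int (L div 2)) - 1 - crd \<alpha> r) mod int L = (2 * j - 1 - crd \<alpha> r) mod int L"
    by (simp only: mod_add_self2)
  show "r \<in> half ==> fold_map L \<alpha> (j + int (L div 2)) r = cref r"
    "r \<in> torus L - half ==> fold_map L \<alpha> (j + int (L div 2)) r = r"
    unfolding fold_map_def a b by (auto simp: half_def cref_def)
qed

private lemma prod_half:
  fixes h :: "site => 'z :: comm_monoid_mult"
  shows "(\<Prod>r\<in>torus L. h r) = (\<Prod>r\<in>half. h r) * (\<Prod>r\<in>half. h (cref r))"
proof -
  have sub: "half \<subseteq> torus L" by (auto simp: half_def)
  have "(\<Prod>r\<in>torus L. h r) = (\<Prod>r\<in>torus L - half. h r) * (\<Prod>r\<in>half. h r)"
    by (rule prod.subset_diff[OF sub finite_torus])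
  also have "(\<Prod>r\<in>torus L - half. h r) = (\<Prod>r\<in>half. h (cref r))"
    by (rule prod.reindex_bij_betw[OF cref_bij, symmetric])
  finally show ?thesis by (simp add: mult.commute)
qed

lemma fold_map_count:
  fixes f :: "site => 'z :: comm_ring_1"
  shows "(\<Prod>r\<in>torus L. f (fold_map L \<alpha> j r)) * (\<Prod>r\<in>torus L. f (fold_map L \<alpha> (j + int (L div 2)) r)) = (\<Prod>r\<in>torus L. f r)\<^sup>2"
proof -
  have sub: "r \<in> torus L" if "r \<in> half" for r using that by (auto simp: half_def)
  have 1: "(\<Prod>r\<in>torus L. f (fold_map L \<alpha> j r)) = (\<Prod>r\<in>half. f r) * (\<Prod>r\<in>half. f r)"
    unfolding prod_half[of "\<lambda>r. f (fold_map L \<alpha> j r)"]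
    by (intro arg_cong2[where f="(*)"] prod.cong refl) (use fold1 cref_half cref_cref sub in auto)
  have 2: "(\<Prod>r\<in>torus L. f (fold_map L \<alpha> (j + int (L div 2)) r)) = (\<Prod>r\<in>half. f (cref r)) * (\<Prod>r\<in>half. f (cref r))"
    unfolding prod_half[of "\<lambda>r. f (fold_map L \<alpha> (j + int (L div 2)) r)"]
    by (intro arg_cong2[where f="(*)"] prod.cong refl) (use fold2 cref_half cref_cref sub in auto)
  show ?thesis unfolding 1 2 prod_half[of f] by (simp add: power2_eq_square ac_simps)
qed

text \<open>The product over all cubes splits into a function \<open>F\<close> of one half and the
  mirror image of a function \<open>G\<close> of the same half. The two foldings replace this pair
  by \<open>F\<close> with its own image and by \<open>G\<close> with its own image.\<close>

lemma cubeZ_fold: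
  assumes g: "\<And>k. g k \<in> borel_measurable (lborelP (torus 2))"
  shows "(cubeZ L g a)\<^sup>2 \<le> cubeZ L g (a \<circ> fold_map L \<alpha> j) * cubeZ L g (a \<circ> fold_map L \<alpha> (j + int (L div 2)))"
proof -
  define F where "F \<theta> = (\<Prod>r\<in>half. g (a r) (cube L \<theta> r))" for \<theta>
  define G where "G \<theta> = (\<Prod>r\<in>half. g (a (cref r)) (cube L \<theta> r))" for \<theta>
  have sub: "r \<in> torus L" if "r \<in> half" for r using that by (auto simp: half_def)
  have meas: "(\<lambda>\<theta>. \<Prod>r\<in>half. g (b r) (cube L \<theta> r)) \<in> borel_measurable (lborelP (plane \<union> pos))" for b
    by (intro borel_measurable_prod_ennreal measurable_compose[OF measurable_cube g] block_map_half)
  have loc: "(\<Prod>r\<in>half. g (b r) (cube L x r)) = (\<Prod>r\<in>half. g (b r) (cube L y r))"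
    if "\<And>r. r \<in> plane \<union> pos ==> x r = y r" for b x y
  proof (rule prod.cong[OF refl])
    fix r assume r: "r \<in> half"
    have "cube L x r = cube L y r" unfolding cube_def
      using that block_map_half[OF r] by (intro restrict_ext) blast
    then show "g (b r) (cube L x r) = g (b r) (cube L y r)" by simp
  qed
  have eq: "(\<Prod>r\<in>torus L. g (b r) (cube L \<theta> r)) =
     (\<Prod>r\<in>half. g (b r) (cube L \<theta> r)) * (\<Prod>r\<in>half. g (b (cref r)) (cube L (\<lambda>s. \<theta> (sref s)) r))" for b \<theta>
    unfolding prod_half[of "\<lambda>r. g (b r) (cube L \<theta> r)"]
    by (intro arg_cong2[where f="(*)"] prod.cong refl) (simp add: cube_cref sub)
  have e1: "cubeZ L g a = (\<integral>\<^sup>+\<theta>. F \<theta> * G (\<lambda>s. \<theta> (sref s)) \<partial>lborelP (plane \<union> (pos \<union> neg)))"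
    unfolding cubeZ_def eq F_def G_def planes_Un config_measure_def by simp
  have e2: "cubeZ L g (a \<circ> fold_map L \<alpha> j) = (\<integral>\<^sup>+\<theta>. F \<theta> * F (\<lambda>s. \<theta> (sref s)) \<partial>lborelP (plane \<union> (pos \<union> neg)))"
    unfolding cubeZ_def eq F_def planes_Un config_measure_def
    by (intro nn_integral_cong arg_cong2[where f="(*)"] prod.cong refl)
       (use fold1 cref_half cref_cref sub in auto)
  have e3: "cubeZ L g (a \<circ> fold_map L \<alpha> (j + int (L div 2))) =
      (\<integral>\<^sup>+\<theta>. G \<theta> * G (\<lambda>s. \<theta> (sref s)) \<partial>lborelP (plane \<union> (pos \<union> neg)))"
    unfolding cubeZ_def eq G_def planes_Un config_measure_def
    by (intro nn_integral_cong arg_cong2[where f="(*)"] prod.cong refl)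
       (use fold2 cref_half cref_cref sub in auto)
  have fin: "finite plane" "finite pos" "finite neg"
    by (rule finite_subset[OF _ finite_torus[of L]]; auto simp: plane_def pos_def neg_def)+
  have disj: "plane \<inter> pos = {}" "plane \<inter> neg = {}" "pos \<inter> neg = {}"
    using L2 by (auto simp: plane_def pos_def neg_def)
  show ?thesis unfolding e1 e2 e3
  proof (rule reflection_positivity[OF fin disj sref_bij sref_plane])
    show "F x = F y" if "\<And>r. r \<in> plane \<union> pos ==> x r = y r" for x y
      unfolding F_def by (rule loc) (use that in blast)
    show "G x = G y" if "\<And>r. r \<in> plane \<union> pos ==> x r = y r" for x y
      unfolding G_def by (rule loc) (use that in blast)
  qed (auto simp: F_def[abs_def] G_def[abs_def] intro: meas)
qed

end

text \<open>Folding along arbitrary planes takes the place of dyadic halving, so that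
  \<open>L\<close> may be any positive even number.\<close>

theorem chessboard:
  fixes g :: "'k => config => ennreal"
  assumes L: "even L" "L > 0"
    and g: "\<And>k. g k \<in> borel_measurable (lborelP (torus 2))"
    and fin: "\<And>a. cubeZ L g a < \<infinity>"
  shows "enn2real (cubeZ L g a) \<le> (\<Prod>r\<in>torus L. enn2real (cubeZ L g (\<lambda>_. a r)) powr (1 / L ^ 3))"
proof -
  have ne: "torus L \<noteq> {}" using L card_torus[of L] by (metis card.empty power_eq_0_iff less_irrefl)
  define \<Phi> where "\<Phi> = {(fold_map L \<alpha> j, fold_map L \<alpha> (j + int (L div 2))) |\<alpha> j. \<alpha> \<in> dirs}"
  have "enn2real (cubeZ L g a) \<le> (\<Prod>r\<in>torus L. enn2real (cubeZ L g (\<lambda>_. a r)) powr (1 / card (torus L)))"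
  proof (rule chessboard_abstract[where \<Phi>=\<Phi> and Z="\<lambda>a. enn2real (cubeZ L g a)"])
    show "finite (torus L)" "torus L \<noteq> {}" using ne by auto
    show "0 \<le> enn2real (cubeZ L g a)" for a by simp
    show "enn2real (cubeZ L g a) = enn2real (cubeZ L g b)" if "\<And>r. r \<in> torus L ==> a r = b r" for a b
    proof -
      have "(\<Prod>r\<in>torus L. g (a r) (cube L \<theta> r)) = (\<Prod>r\<in>torus L. g (b r) (cube L \<theta> r))" for \<theta>
        using that by (intro prod.cong) auto
      then show ?thesis by (simp add: cubeZ_def)
    qed
    show "\<phi> r \<in> torus L \<and> \<psi> r \<in> torus L" if "(\<phi>, \<psi>) \<in> \<Phi>" "r \<in> torus L" for \<phi> \<psi> r
      using that L by (auto simp: \<Phi>_def intro!: fold_map_torus)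
    show "(enn2real (cubeZ L g a))\<^sup>2 \<le> enn2real (cubeZ L g (a \<circ> \<phi>)) * enn2real (cubeZ L g (a \<circ> \<psi>))"
      if "(\<phi>, \<psi>) \<in> \<Phi>" for \<phi> \<psi> a
    proof -
      from that obtain \<alpha> j where \<alpha>: "\<alpha> \<in> dirs" and \<phi>: "\<phi> = fold_map L \<alpha> j" "\<psi> = fold_map L \<alpha> (j + int (L div 2))"
        by (auto simp: \<Phi>_def)
      have "enn2real ((cubeZ L g a)\<^sup>2) \<le> enn2real (cubeZ L g (a \<circ> \<phi>) * cubeZ L g (a \<circ> \<psi>))"
        unfolding \<phi> using fin by (intro enn2real_mono cubeZ_fold L \<alpha> g) (auto intro!: ennreal_mult_less_top[THEN iffD2])
      then show ?thesis by (simp add: enn2real_mult power2_eq_square)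
    qed
    show "(\<Prod>r\<in>torus L. f (\<phi> r)) * (\<Prod>r\<in>torus L. f (\<psi> r)) = (\<Prod>r\<in>torus L. f r :: real)\<^sup>2" if "(\<phi>, \<psi>) \<in> \<Phi>" for \<phi> \<psi> f
      using that by (auto simp: \<Phi>_def intro!: fold_map_count[OF L])
    show "\<exists>b\<in>S. \<forall>r\<in>torus L. b r = a r0"
      if cl: "\<And>\<phi> \<psi> a. (\<phi>, \<psi>) \<in> \<Phi> ==> a \<in> S ==> a \<circ> \<phi> \<in> S \<and> a \<circ> \<psi> \<in> S" and a: "a \<in> S" "r0 \<in> torus L"
      for S and a :: "site => 'k" and r0
    proof (rule fold_closure[OF L _ a])
      fix a \<alpha> j assume "\<alpha> \<in> dirs" "a \<in> S"
      then show "a \<circ> fold_map L \<alpha> j \<in> S"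
        using cl[of "fold_map L \<alpha> j" "fold_map L \<alpha> (j + int (L div 2))" a] unfolding \<Phi>_def by blast
    qed
  qed
  then show ?thesis by (simp add: card_torus)
qed

section \<open>Random walks on the torus\<close>

definition rootu :: "nat => int => complex" where
  "rootu L m = cis (2 * pi * of_int m / real L)"

lemma rootu_0 [simp]: "rootu L 0 = 1" by (simp add: rootu_def)

lemma rootu_add: "rootu L (m + n) = rootu L m * rootu L n"
  by (simp add: rootu_def cis_mult add_divide_distrib algebra_simps)

lemma rootu_minus: "rootu L (- m) = cnj (rootu L m)"
  by (simp add: rootu_def cis_cnj)

lemma norm_rootu [simp]: "norm (rootu L m) = 1" by (simp add: rootu_def)

lemma rootu_cnj_self: "cnj (rootu L m) * rootu L m = 1"
  by (simp add: rootu_minus[symmetric] rootu_add[symmetric])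

lemma rootu_eq_1_iff: "L > 0 ==> rootu L m = 1 \<longleftrightarrow> int L dvd m"
proof
  assume L: "L > 0" and "rootu L m = 1"
  then have "exp (\<i> * of_real (2 * pi * of_int m / real L)) = 1" by (simp add: rootu_def cis_conv_exp)
  then obtain n where "2 * pi * of_int m / real L = of_int (2 * n) * pi" by (auto simp: exp_eq_1)
  then have "real_of_int m = of_int n * real L" using L by (simp add: field_simps)
  then have "real_of_int m = real_of_int (n * int L)" by simp
  then have "m = n * int L" by (simp only: of_int_eq_iff)
  then show "int L dvd m" by simp
next
  assume L: "L > 0" and "int L dvd m"
  then obtain n where "m = int L * n" by (elim dvdE)
  then have "2 * pi * of_int m / real L = 2 * pi * of_int n" using L by simp
  then show "rootu L m = 1" unfolding rootu_def by (simp add: cis_multiple_2pi)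
qed

lemma rootu_cong:
  assumes "L > 0" "m mod int L = n mod int L"
  shows "rootu L m = rootu L n"
proof -
  have "int L dvd m - n" using assms by (simp add: mod_eq_dvd_iff)
  then have "rootu L (n + (m - n)) = rootu L n" unfolding rootu_add using assms by (simp add: rootu_eq_1_iff)
  then show ?thesis by simp
qed

lemma rootu_mod [simp]: "L > 0 ==> rootu L (m mod int L) = rootu L m"
  by (rule rootu_cong) auto

lemma rootu_mod_mult: "L > 0 ==> rootu L (k * (m mod int L)) = rootu L (k * m)"
  by (rule rootu_cong) (auto simp: mod_simps)

lemma rootu_power: "rootu L m ^ n = rootu L (int n * m)"
  by (induction n) (simp_all add: rootu_add algebra_simps)

lemma int_interval_image: "{0..<int L} = int ` {..<L}"
  by (metis atLeast0LessThan image_int_atLeastLessThan of_nat_0)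

lemma sum_int_interval: "(\<Sum>a\<in>{0..<int L}. f a) = (\<Sum>n<L. f (int n))"
  unfolding int_interval_image by (subst sum.reindex) auto

lemma sum_rootu:
  assumes "L > 0"
  shows "(\<Sum>a\<in>{0..<int L}. rootu L (a * m)) = (if int L dvd m then of_nat L else 0)"
proof -
  have "(\<Sum>a\<in>{0..<int L}. rootu L (a * m)) = (\<Sum>n<L. rootu L m ^ n)"
    unfolding sum_int_interval by (simp add: rootu_power)
  also have "... = (if int L dvd m then of_nat L else 0)"
  proof (cases "int L dvd m")
    case True
    then have "rootu L m = 1" using rootu_eq_1_iff[OF assms] by blast
    then show ?thesis using True by simp
  next
    case False
    then have "rootu L m \<noteq> 1" using rootu_eq_1_iff[OF assms] by simp
    moreover have "rootu L m ^ L = 1" unfolding rootu_power rootu_eq_1_iff[OF assms] by simp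
    ultimately show ?thesis using False by (simp add: sum_gp_strict)
  qed
  finally show ?thesis .
qed

lemma sum_torus: "(\<Sum>k\<in>torus L. f k) = (\<Sum>a\<in>{0..<int L}. \<Sum>b\<in>{0..<int L}. \<Sum>c\<in>{0..<int L}. f (a, b, c))"
  unfolding torus_eq by (simp add: sum.cartesian_product)

definition dot :: "site => site => int" where
  "dot k r = (\<Sum>\<nu>\<in>dirs. crd \<nu> k * crd \<nu> r)"

lemma sum_rootu_dot:
  assumes "L > 0"
  shows "(\<Sum>k\<in>torus L. rootu L (dot k d)) = (if \<forall>\<nu>\<in>dirs. int L dvd crd \<nu> d then of_nat (L ^ 3) else 0)"
proof -
  obtain x y z where d: "d = (x, y, z)" by (cases d) auto
  have "rootu L (dot (a, b, c) d) = rootu L (a * x) * (rootu L (b * y) * rootu L (c * z))" for a b c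
    by (simp add: dot_def crd_def d rootu_add[symmetric])
  then have "(\<Sum>k\<in>torus L. rootu L (dot k d)) =
    (\<Sum>a\<in>{0..<int L}. rootu L (a * x)) * ((\<Sum>b\<in>{0..<int L}. rootu L (b * y)) * (\<Sum>c\<in>{0..<int L}. rootu L (c * z)))"
    unfolding sum_torus by (simp only: sum_distrib_left[symmetric] sum_distrib_right[symmetric])
  then show ?thesis
    unfolding sum_rootu[OF assms] by (auto simp: d crd_def power3_eq_cube)
qed

lemma rootu_orthogonal:
  assumes L: "L > 0" and r: "r \<in> torus L" "s \<in> torus L"
  shows "(\<Sum>k\<in>torus L. rootu L (dot k s) * cnj (rootu L (dot k r))) = (if r = s then of_nat (L ^ 3) else 0)"
proof -
  define d where "d = (crd 1 s - crd 1 r, crd 2 s - crd 2 r, crd 3 s - crd 3 r)"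
  have cd: "crd \<nu> d = crd \<nu> s - crd \<nu> r" if "\<nu> \<in> dirs" for \<nu>
    using that by (cases r; cases s) (auto simp: d_def crd_def)
  have "rootu L (dot k s) * cnj (rootu L (dot k r)) = rootu L (dot k d)" for k
    unfolding rootu_minus[symmetric] rootu_add[symmetric]
    by (simp add: dot_def cd algebra_simps)
  moreover have "(\<forall>\<nu>\<in>dirs. int L dvd crd \<nu> d) \<longleftrightarrow> r = s"
  proof
    assume *: "\<forall>\<nu>\<in>dirs. int L dvd crd \<nu> d"
    show "r = s"
    proof (rule site_eqI)
      fix \<nu> :: nat assume \<nu>: "\<nu> \<in> dirs"
      have "int L dvd crd \<nu> s - crd \<nu> r" using * \<nu> cd[OF \<nu>] by (metis (lifting))
      then have "crd \<nu> s mod int L = crd \<nu> r mod int L" by (simp add: mod_eq_dvd_iff)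
      then show "crd \<nu> r = crd \<nu> s" using crd_torus[OF r(1), of \<nu>] crd_torus[OF r(2), of \<nu>] by simp
    qed
  qed (auto simp: cd)
  ultimately show ?thesis using sum_rootu_dot[OF L, of d] by simp
qed

definition shift :: "nat => nat => int => site => site" where
  "shift L \<nu> s r = upd \<nu> r ((crd \<nu> r + s) mod int L)"

lemma shift_torus: "L > 0 ==> r \<in> torus L ==> shift L \<nu> s r \<in> torus L"
  unfolding shift_def by (intro upd_torus) auto

lemma shift_shift: "shift L \<nu> s (shift L \<nu> t r) = shift L \<nu> (s + t) r"
  unfolding shift_def crd_upd_same upd_upd mod_add_left_eq by (simp add: add_ac)

lemma shift_0: "r \<in> torus L ==> shift L \<nu> 0 r = r"
  using crd_torus[of r L \<nu>] by (simp add: shift_def)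

lemma shift_inverse: "r \<in> torus L ==> shift L \<nu> s (shift L \<nu> (- s) r) = r"
  by (simp add: shift_shift shift_0)

lemma bij_shift:
  assumes "L > 0"
  shows "bij_betw (shift L \<nu> s) (torus L) (torus L)"
  by (rule bij_betw_byWitness[where f'="shift L \<nu> (- s)"])
     (use assms shift_inverse[of _ L \<nu> s] shift_inverse[of _ L \<nu> "- s"] in \<open>auto intro: shift_torus\<close>)

lemma sum_shift: "L > 0 ==> (\<Sum>r\<in>torus L. f (shift L \<nu> s r)) = (\<Sum>r\<in>torus L. f r)"
  by (rule sum.reindex_bij_betw[OF bij_shift])

lemma dot_upd: "\<nu> \<in> dirs ==> dot k (upd \<nu> r x) = dot k r + crd \<nu> k * (x - crd \<nu> r)"
  by (auto simp: dot_def crd_upd algebra_simps)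

lemma dot_commute: "dot k r = dot r k"
  by (simp add: dot_def mult.commute)

lemma rootu_dot_shift:
  assumes "L > 0" "\<nu> \<in> dirs"
  shows "rootu L (dot k (shift L \<nu> s r)) = rootu L (crd \<nu> k * s) * rootu L (dot k r)"
proof -
  have "rootu L (dot k (shift L \<nu> s r)) = rootu L (dot k r) * rootu L (crd \<nu> k * ((crd \<nu> r + s) mod int L)) * rootu L (- (crd \<nu> k * crd \<nu> r))"
    unfolding shift_def dot_upd[OF assms(2)] rootu_add[symmetric] by (simp add: algebra_simps)
  also have "... = rootu L (crd \<nu> k * s) * rootu L (dot k r)"
    unfolding rootu_mod_mult[OF assms(1)] rootu_add[symmetric] by (simp add: algebra_simps)
  finally show ?thesis .
qed

section \<open>Walks whose weights alternate between layers\<close>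

definition ang :: "nat => site => nat => real" where
  "ang L k \<nu> = 2 * pi * of_int (crd \<nu> k) / real L"

definition wgt :: "nat => (nat => real) => (nat => real) => nat => site => real" where
  "wgt \<alpha> p q \<nu> r = (if even (crd \<alpha> r) then p \<nu> else q \<nu>)"

definition walk :: "nat => nat => (nat => real) => (nat => real) => site => site => real" where
  "walk L \<alpha> p q r s = (if r \<in> torus L \<and> s \<in> torus L then
     (\<Sum>\<nu>\<in>dirs. wgt \<alpha> p q \<nu> r / 2 * (of_bool (s = shift L \<nu> 1 r) + of_bool (s = shift L \<nu> (-1) r))) else 0)"

text \<open>A step in direction \<open>\<alpha>\<close> joins layers of different parity, all other
  steps stay within a layer; \<open>p \<alpha> = q \<alpha>\<close> is therefore what makes the walk
  symmetric.\<close>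

definition walk_weights :: "nat => (nat => real) => (nat => real) => bool" where
  "walk_weights \<alpha> p q \<longleftrightarrow> \<alpha> \<in> dirs \<and> p \<alpha> = q \<alpha> \<and> (\<forall>\<nu>\<in>dirs. p \<nu> \<ge> 0 \<and> q \<nu> \<ge> 0)
     \<and> sum p dirs = 1 \<and> sum q dirs = 1"

context
  fixes L \<alpha> :: nat and p q :: "nat => real"
  assumes L: "even L" "L > 0" and wt: "walk_weights \<alpha> p q"
begin

private lemma al_walk: "\<alpha> \<in> dirs" "p \<alpha> = q \<alpha>" using wt by (auto simp: walk_weights_def)

lemma parity_shift:
  assumes "\<nu> \<in> dirs"
  shows "even (crd \<alpha> (shift L \<nu> s r)) \<longleftrightarrow> (if \<nu> = \<alpha> then even (crd \<alpha> r + s) else even (crd \<alpha> r))"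
proof (cases "\<nu> = \<alpha>")
  case True
  then show ?thesis using L by (simp add: shift_def dvd_mod_iff)
next
  case False
  then show ?thesis unfolding shift_def using crd_upd[OF assms al_walk(1)] by simp
qed

lemma wgt_shift: "\<nu> \<in> dirs ==> wgt \<alpha> p q \<nu> (shift L \<nu> s r) = wgt \<alpha> p q \<nu> r"
  using al_walk(2) by (simp add: wgt_def parity_shift)

lemma walk_sum:
  fixes f :: "site => 'a :: {real_algebra_1}"
  assumes r: "r \<in> torus L"
  shows "(\<Sum>s\<in>torus L. of_real (walk L \<alpha> p q r s) * f s) =
     (\<Sum>\<nu>\<in>dirs. of_real (wgt \<alpha> p q \<nu> r / 2) * (f (shift L \<nu> 1 r) + f (shift L \<nu> (-1) r)))"
proof -
  have one: "(\<Sum>s\<in>torus L. of_real (c * of_bool (s = t)) * f s) = of_real c * f t" if "t \<in> torus L" for c t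
  proof -
    have "(\<Sum>s\<in>torus L. of_real (c * of_bool (s = t)) * f s) = (\<Sum>s\<in>torus L. if s = t then of_real c * f s else 0)"
      by (intro sum.cong) auto
    then show ?thesis using that by simp
  qed
  have "(\<Sum>s\<in>torus L. of_real (walk L \<alpha> p q r s) * f s) =
     (\<Sum>s\<in>torus L. \<Sum>\<nu>\<in>dirs. of_real (wgt \<alpha> p q \<nu> r / 2 * of_bool (s = shift L \<nu> 1 r)) * f s
        + of_real (wgt \<alpha> p q \<nu> r / 2 * of_bool (s = shift L \<nu> (-1) r)) * f s)"
    using r by (intro sum.cong refl) (simp add: walk_def sum_distrib_right algebra_simps)
  also have "... = (\<Sum>\<nu>\<in>dirs. of_real (wgt \<alpha> p q \<nu> r / 2) * (f (shift L \<nu> 1 r) + f (shift L \<nu> (-1) r)))"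
    by (subst sum.swap) (simp only: sum.distrib one shift_torus[OF L(2) r] distrib_left)
  finally show ?thesis .
qed

lemma walk_sym: "walk L \<alpha> p q r s = walk L \<alpha> p q s r"
proof (cases "r \<in> torus L \<and> s \<in> torus L")
  case True
  have sh: "s = shift L \<nu> t r \<longleftrightarrow> r = shift L \<nu> (- t) s" for \<nu> t
    using True shift_inverse[of s L \<nu> t] shift_inverse[of r L \<nu> "- t"] by auto
  have "wgt \<alpha> p q \<nu> r / 2 * (of_bool (s = shift L \<nu> 1 r) + of_bool (s = shift L \<nu> (-1) r)) =
    wgt \<alpha> p q \<nu> s / 2 * (of_bool (r = shift L \<nu> 1 s) + of_bool (r = shift L \<nu> (-1) s))" if \<nu>: "\<nu> \<in> dirs" for \<nu>
  proof -
    have "wgt \<alpha> p q \<nu> r = wgt \<alpha> p q \<nu> s" if "s = shift L \<nu> 1 r \<or> s = shift L \<nu> (-1) r"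
      using that by (elim disjE) (simp_all only: wgt_shift[OF \<nu>])
    then show ?thesis using sh[of \<nu> 1] sh[of \<nu> "-1"] by auto
  qed
  then have "(\<Sum>\<nu>\<in>dirs. wgt \<alpha> p q \<nu> r / 2 * (of_bool (s = shift L \<nu> 1 r) + of_bool (s = shift L \<nu> (-1) r))) =
    (\<Sum>\<nu>\<in>dirs. wgt \<alpha> p q \<nu> s / 2 * (of_bool (r = shift L \<nu> 1 s) + of_bool (r = shift L \<nu> (-1) s)))"
    by (rule sum.cong[OF refl])
  then show ?thesis unfolding walk_def using True by (simp only: if_True simp_thms)
next
  case False
  then have "\<not> (s \<in> torus L \<and> r \<in> torus L)" by blast
  then show ?thesis unfolding walk_def using False by (simp only: if_False)
qed

lemma walk_nonneg: "walk L \<alpha> p q r s \<ge> 0"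
proof -
  have w: "wgt \<alpha> p q \<nu> r \<ge> 0" if "\<nu> \<in> dirs" for \<nu>
  proof -
    have "0 \<le> p \<nu> \<and> 0 \<le> q \<nu>" using wt that unfolding walk_weights_def by blast
    then show ?thesis by (simp add: wgt_def)
  qed
  have "0 \<le> (\<Sum>\<nu>\<in>dirs. wgt \<alpha> p q \<nu> r / 2 * (of_bool (s = shift L \<nu> 1 r) + of_bool (s = shift L \<nu> (-1) r)))"
  proof (rule sum_nonneg)
    fix \<nu> :: nat assume "\<nu> \<in> dirs"
    then have "0 \<le> wgt \<alpha> p q \<nu> r / 2" using w by (metis divide_nonneg_pos zero_less_numeral)
    then show "0 \<le> wgt \<alpha> p q \<nu> r / 2 * (of_bool (s = shift L \<nu> 1 r) + of_bool (s = shift L \<nu> (-1) r))"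
      by (rule mult_nonneg_nonneg) simp
  qed
  then show ?thesis
    unfolding walk_def by (cases "r \<in> torus L \<and> s \<in> torus L") (simp_all only: if_True if_False simp_thms order.refl)
qed

lemma wgt_sum: "(\<Sum>\<nu>\<in>dirs. wgt \<alpha> p q \<nu> r) = 1"
  using wt unfolding wgt_def walk_weights_def by (cases "even (crd \<alpha> r)") simp_all

lemma contraction_walk: "contraction_kernel (torus L) (walk L \<alpha> p q)"
  unfolding contraction_kernel_def
proof (intro conjI allI ballI)
  show "walk L \<alpha> p q r s = walk L \<alpha> p q s r" for r s by (rule walk_sym)
  fix r assume r: "r \<in> torus L"
  have "(\<Sum>s\<in>torus L. \<bar>walk L \<alpha> p q r s\<bar>) = (\<Sum>s\<in>torus L. of_real (walk L \<alpha> p q r s) * (1::real))"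
    using walk_nonneg by simp
  also have "... = (\<Sum>\<nu>\<in>dirs. wgt \<alpha> p q \<nu> r)"
    unfolding walk_sum[OF r] by simp
  finally show "(\<Sum>s\<in>torus L. \<bar>walk L \<alpha> p q r s\<bar>) \<le> 1" using wgt_sum by simp
qed simp

lemma quad_walk:
  "quad (torus L) (walk L \<alpha> p q) x = (\<Sum>r\<in>torus L. \<Sum>\<nu>\<in>dirs. wgt \<alpha> p q \<nu> r * (x r * x (shift L \<nu> 1 r)))"
proof -
  have "quad (torus L) (walk L \<alpha> p q) x = (\<Sum>r\<in>torus L. x r * (\<Sum>s\<in>torus L. of_real (walk L \<alpha> p q r s) * x s))"
    unfolding quad_def by (simp add: sum_distrib_left mult_ac)
  also have "... = (\<Sum>r\<in>torus L. \<Sum>\<nu>\<in>dirs. wgt \<alpha> p q \<nu> r / 2 * (x r * x (shift L \<nu> 1 r)) + wgt \<alpha> p q \<nu> r / 2 * (x r * x (shift L \<nu> (-1) r)))"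
    by (intro sum.cong refl) (simp only: walk_sum sum_distrib_left, intro sum.cong refl, simp add: algebra_simps)
  also have "... = (\<Sum>\<nu>\<in>dirs. (\<Sum>r\<in>torus L. wgt \<alpha> p q \<nu> r / 2 * (x r * x (shift L \<nu> 1 r))) + (\<Sum>r\<in>torus L. wgt \<alpha> p q \<nu> r / 2 * (x r * x (shift L \<nu> (-1) r))))"
    by (subst sum.swap) (simp only: sum.distrib)
  also have "... = (\<Sum>\<nu>\<in>dirs. \<Sum>r\<in>torus L. wgt \<alpha> p q \<nu> r * (x r * x (shift L \<nu> 1 r)))"
  proof (rule sum.cong[OF refl])
    fix \<nu> :: nat assume \<nu>: "\<nu> \<in> dirs"
    have "(\<Sum>r\<in>torus L. wgt \<alpha> p q \<nu> r / 2 * (x r * x (shift L \<nu> (-1) r))) =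
      (\<Sum>r\<in>torus L. wgt \<alpha> p q \<nu> (shift L \<nu> 1 r) / 2 * (x (shift L \<nu> 1 r) * x (shift L \<nu> (-1) (shift L \<nu> 1 r))))"
      by (rule sum_shift[OF L(2), symmetric])
    also have "... = (\<Sum>r\<in>torus L. wgt \<alpha> p q \<nu> r / 2 * (x r * x (shift L \<nu> 1 r)))"
      by (intro sum.cong refl) (simp add: wgt_shift[OF \<nu>] shift_shift shift_0 mult_ac)
    finally have e: "(\<Sum>r\<in>torus L. wgt \<alpha> p q \<nu> r / 2 * (x r * x (shift L \<nu> (-1) r))) =
      (\<Sum>r\<in>torus L. wgt \<alpha> p q \<nu> r / 2 * (x r * x (shift L \<nu> 1 r)))" .
    show "(\<Sum>r\<in>torus L. wgt \<alpha> p q \<nu> r / 2 * (x r * x (shift L \<nu> 1 r))) + (\<Sum>r\<in>torus L. wgt \<alpha> p q \<nu> r / 2 * (x r * x (shift L \<nu> (-1) r)))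
       = (\<Sum>r\<in>torus L. wgt \<alpha> p q \<nu> r * (x r * x (shift L \<nu> 1 r)))"
      unfolding e sum.distrib[symmetric] by (intro sum.cong refl) simp
  qed
  also have "... = (\<Sum>r\<in>torus L. \<Sum>\<nu>\<in>dirs. wgt \<alpha> p q \<nu> r * (x r * x (shift L \<nu> 1 r)))"
    by (rule sum.swap)
  finally show ?thesis .
qed

text \<open>The squares are expanded and the summation variable is shifted, using that a step does
  not change the weight of its own direction (\<open>wgt_shift\<close>). In this form the energy of
  small deviations is recognized as the quadratic form of \<open>1 - A\<close>.\<close>

lemma dirichlet_form:
  "sumsq (torus L) x - quad (torus L) (walk L \<alpha> p q) x =
     (\<Sum>r\<in>torus L. \<Sum>\<nu>\<in>dirs. wgt \<alpha> p q \<nu> r * (x r - x (shift L \<nu> 1 r))\<^sup>2) / 2"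
proof -
  have "(\<Sum>r\<in>torus L. \<Sum>\<nu>\<in>dirs. wgt \<alpha> p q \<nu> r * (x (shift L \<nu> 1 r))\<^sup>2) =
     (\<Sum>\<nu>\<in>dirs. \<Sum>r\<in>torus L. wgt \<alpha> p q \<nu> r * (x (shift L \<nu> 1 r))\<^sup>2)"
    by (rule sum.swap)
  also have "... = (\<Sum>\<nu>\<in>dirs. \<Sum>r\<in>torus L. wgt \<alpha> p q \<nu> r * (x r)\<^sup>2)"
  proof (rule sum.cong[OF refl])
    fix \<nu> :: nat assume \<nu>: "\<nu> \<in> dirs"
    have "(\<Sum>r\<in>torus L. wgt \<alpha> p q \<nu> r * (x (shift L \<nu> 1 r))\<^sup>2) = (\<Sum>r\<in>torus L. wgt \<alpha> p q \<nu> (shift L \<nu> 1 r) * (x (shift L \<nu> 1 r))\<^sup>2)"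
      by (simp add: wgt_shift[OF \<nu>])
    also have "... = (\<Sum>r\<in>torus L. wgt \<alpha> p q \<nu> r * (x r)\<^sup>2)"
      by (rule sum_shift[OF L(2)])
    finally show "(\<Sum>r\<in>torus L. wgt \<alpha> p q \<nu> r * (x (shift L \<nu> 1 r))\<^sup>2) = (\<Sum>r\<in>torus L. wgt \<alpha> p q \<nu> r * (x r)\<^sup>2)" .
  qed
  also have "... = (\<Sum>r\<in>torus L. \<Sum>\<nu>\<in>dirs. wgt \<alpha> p q \<nu> r * (x r)\<^sup>2)"
    by (rule sum.swap)
  finally have b: "(\<Sum>r\<in>torus L. \<Sum>\<nu>\<in>dirs. wgt \<alpha> p q \<nu> r * (x (shift L \<nu> 1 r))\<^sup>2) = (\<Sum>r\<in>torus L. \<Sum>\<nu>\<in>dirs. wgt \<alpha> p q \<nu> r * (x r)\<^sup>2)" .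
  have a: "(\<Sum>r\<in>torus L. \<Sum>\<nu>\<in>dirs. wgt \<alpha> p q \<nu> r * (x r)\<^sup>2) = sumsq (torus L) x"
    by (simp only: sum_distrib_right[symmetric] wgt_sum mult_1)
  have "(\<Sum>r\<in>torus L. \<Sum>\<nu>\<in>dirs. wgt \<alpha> p q \<nu> r * (x r - x (shift L \<nu> 1 r))\<^sup>2) =
     (\<Sum>r\<in>torus L. \<Sum>\<nu>\<in>dirs. wgt \<alpha> p q \<nu> r * (x r)\<^sup>2 + wgt \<alpha> p q \<nu> r * (x (shift L \<nu> 1 r))\<^sup>2
        - 2 * (wgt \<alpha> p q \<nu> r * (x r * x (shift L \<nu> 1 r))))"
    by (intro sum.cong refl) (simp add: power2_eq_square algebra_simps)
  also have "... = 2 * sumsq (torus L) x - 2 * quad (torus L) (walk L \<alpha> p q) x"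
    unfolding sum_subtractf sum.distrib quad_walk sum_distrib_left[symmetric] b a by simp
  finally show ?thesis by simp
qed

end

section \<open>Spectrum and traces of the alternating walk\<close>

definition sgp :: "nat => site => complex" where
  "sgp \<alpha> r = (if even (crd \<alpha> r) then 1 else - 1)"

definition cosL :: "nat => site => nat => real" where
  "cosL L k \<nu> = cos (ang L k \<nu>)"

definition symb :: "nat => nat set => (nat => real) => site => real" where
  "symb L G p k = (\<Sum>\<nu>\<in>G. p \<nu> * cosL L k \<nu>)"

definition band_mid :: "nat => nat => (nat => real) => (nat => real) => site => real" where
  "band_mid L \<alpha> p q k = (symb L (dirs - {\<alpha>}) p k + symb L (dirs - {\<alpha>}) q k) / 2"

text \<open>The plane waves of momentum \<open>k\<close> and of \<open>k\<close> shifted by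
  \<open>L div 2\<close> in direction \<open>\<alpha>\<close> span an invariant space, on which the
  walk acts as \<open>[[S + c, D], [D, S - c]]\<close> with \<open>S = band_mid\<close>. Its
  eigenvalues are \<open>S + R\<close> and \<open>S - R\<close> with
  \<open>R = band_gap\<close>.\<close>

definition band_gap :: "nat => nat => (nat => real) => (nat => real) => site => real" where
  "band_gap L \<alpha> p q k = sqrt ((p \<alpha> * cosL L k \<alpha>)\<^sup>2 +
     ((symb L (dirs - {\<alpha>}) p k - symb L (dirs - {\<alpha>}) q k) / 2)\<^sup>2)"

lemma rootu_pm: "rootu L m + rootu L (- m) = 2 * of_real (cos (2 * pi * of_int m / real L))"
  by (simp add: rootu_def complex_eq_iff)

lemma rootu_half:
  assumes "even L" "L > 0"
  shows "rootu L (m * int (L div 2)) = (if even m then 1 else - 1)"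
proof -
  have h: "real (L div 2) = real L / 2" using assms by (simp add: real_of_nat_div)
  have "rootu L (m * int (L div 2)) = cis (pi * of_int m)"
    unfolding rootu_def of_int_mult of_int_of_nat_eq h using assms by simp
  also have "... = (if even m then 1 else - 1)"
  proof (cases "even m")
    case True
    then obtain n where "m = 2 * n" by (elim evenE)
    then show ?thesis using cis_multiple_2pi[of "of_int n"] by (simp add: mult_ac)
  next
    case False
    then obtain n where "m = 2 * n + 1" by (elim oddE)
    then have "cis (pi * of_int m) = cis (2 * pi * of_int n + pi)" by (simp add: algebra_simps)
    also have "... = cis (2 * pi * of_int n) * cis pi" by (rule cis_mult[symmetric])
    finally have "cis (pi * of_int m) = cis (2 * pi * of_int n) * cis pi" .
    then show ?thesis using False cis_multiple_2pi[of "of_int n"] by simp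
  qed
  finally show ?thesis .
qed

lemma cosL_shift_same:
  assumes "even L" "L > 0"
  shows "cosL L (shift L \<nu> (int (L div 2)) k) \<nu> = - cosL L k \<nu>"
proof -
  have "rootu L (crd \<nu> (shift L \<nu> (int (L div 2)) k)) = rootu L (crd \<nu> k) * rootu L (1 * int (L div 2))"
    unfolding shift_def crd_upd_same rootu_mod[OF assms(2)] by (simp add: rootu_add)
  then have "rootu L (crd \<nu> (shift L \<nu> (int (L div 2)) k)) = - rootu L (crd \<nu> k)"
    unfolding rootu_half[OF assms] by simp
  then have "Re (rootu L (crd \<nu> (shift L \<nu> (int (L div 2)) k))) = Re (- rootu L (crd \<nu> k))" by simp
  then show ?thesis by (simp add: rootu_def cosL_def ang_def)
qed

lemma cosL_shift_other:
  assumes "\<nu> \<in> dirs" "\<delta> \<in> dirs" "\<nu> \<noteq> \<delta>"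
  shows "cosL L (shift L \<nu> s k) \<delta> = cosL L k \<delta>"
  using crd_upd[OF assms(1,2)] assms(3) by (simp add: cosL_def ang_def shift_def)

lemma sum_sgp:
  assumes "even L" "L > 0"
  shows "(\<Sum>r\<in>torus L. sgp \<alpha> r) = 0"
proof -
  have "sgp \<alpha> (shift L \<alpha> 1 r) = - sgp \<alpha> r" for r
    using assms by (simp add: sgp_def shift_def dvd_mod_iff)
  then have "(\<Sum>r\<in>torus L. sgp \<alpha> r) = (\<Sum>r\<in>torus L. - sgp \<alpha> r)"
    using sum_shift[OF assms(2), of "sgp \<alpha>" \<alpha> 1] by simp
  then show ?thesis by (simp add: sum_negf)
qed

context
  fixes L \<alpha> :: nat and p q :: "nat => real"
  assumes L: "even L" "L > 0" and wt: "walk_weights \<alpha> p q"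
begin

private lemma al_spec: "\<alpha> \<in> dirs" "p \<alpha> = q \<alpha>" using wt by (auto simp: walk_weights_def)

private abbreviation "e k r \<equiv> rootu L (dot k r)"
private definition c where "c k = p \<alpha> * cosL L k \<alpha>"
private definition X where "X k = symb L (dirs - {\<alpha>}) p k"
private definition Y where "Y k = symb L (dirs - {\<alpha>}) q k"
private definition S where "S k = (X k + Y k) / 2"
private definition D where "D k = (X k - Y k) / 2"
private definition flip where "flip k = shift L \<alpha> (int (L div 2)) k"

private lemma c_flip: "c (flip k) = - c k"
  unfolding c_def flip_def cosL_shift_same[OF L] by simp

private lemma XY_flip: "X (flip k) = X k" "Y (flip k) = Y k"
  unfolding X_def Y_def symb_def flip_def
  by (intro sum.cong refl, use al_spec(1) in \<open>subst cosL_shift_other; auto\<close>)+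

private lemma SD_flip: "S (flip k) = S k" "D (flip k) = D k"
  by (simp_all add: S_def D_def XY_flip)

private lemma e_flip: "e (flip k) r = sgp \<alpha> r * e k r"
proof -
  have "e (flip k) r = rootu L (dot r (shift L \<alpha> (int (L div 2)) k))"
    by (simp only: flip_def dot_commute)
  also have "... = rootu L (crd \<alpha> r * int (L div 2)) * e k r"
    unfolding rootu_dot_shift[OF L(2) al_spec(1)] by (simp only: dot_commute)
  finally show ?thesis unfolding rootu_half[OF L] sgp_def .
qed

text \<open>The part of the weights that alternates between layers is a multiple of
  \<open>sgp \<alpha>\<close>, itself the plane wave of momentum \<open>L div 2\<close> in direction
  \<open>\<alpha>\<close>; it couples \<open>k\<close> to \<open>flip k\<close> only.\<close>

private lemma walk_e:
  assumes r: "r \<in> torus L"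
  shows "(\<Sum>s\<in>torus L. of_real (walk L \<alpha> p q r s) * e k s) = of_real (c k + S k) * e k r + of_real (D k) * e (flip k) r"
proof -
  have "(\<Sum>s\<in>torus L. of_real (walk L \<alpha> p q r s) * e k s) =
     (\<Sum>\<nu>\<in>dirs. of_real (wgt \<alpha> p q \<nu> r / 2) * (e k (shift L \<nu> 1 r) + e k (shift L \<nu> (-1) r)))"
    by (rule walk_sum[OF L wt r])
  also have "... = (\<Sum>\<nu>\<in>dirs. of_real (wgt \<alpha> p q \<nu> r * cosL L k \<nu>) * e k r)"
  proof (rule sum.cong[OF refl])
    fix \<nu> :: nat assume \<nu>: "\<nu> \<in> dirs"
    have "e k (shift L \<nu> 1 r) + e k (shift L \<nu> (-1) r) = (rootu L (crd \<nu> k) + rootu L (- crd \<nu> k)) * e k r"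
      unfolding rootu_dot_shift[OF L(2) \<nu>] by (simp add: algebra_simps)
    also have "... = 2 * of_real (cosL L k \<nu>) * e k r"
      unfolding rootu_pm by (simp add: cosL_def ang_def)
    finally show "of_real (wgt \<alpha> p q \<nu> r / 2) * (e k (shift L \<nu> 1 r) + e k (shift L \<nu> (-1) r)) = of_real (wgt \<alpha> p q \<nu> r * cosL L k \<nu>) * e k r"
      by simp
  qed
  also have "... = of_real (\<Sum>\<nu>\<in>dirs. wgt \<alpha> p q \<nu> r * cosL L k \<nu>) * e k r"
    unfolding of_real_sum sum_distrib_right ..
  also have "(\<Sum>\<nu>\<in>dirs. wgt \<alpha> p q \<nu> r * cosL L k \<nu>) =
     wgt \<alpha> p q \<alpha> r * cosL L k \<alpha> + (\<Sum>\<nu>\<in>dirs - {\<alpha>}. wgt \<alpha> p q \<nu> r * cosL L k \<nu>)"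
    by (rule sum.remove) (use al_spec in auto)
  also have "... = c k + S k + (if even (crd \<alpha> r) then D k else - D k)"
    using al_spec(2) by (simp add: wgt_def c_def S_def D_def X_def Y_def symb_def field_simps)
  finally show ?thesis unfolding e_flip by (simp add: sgp_def algebra_simps)
qed

private fun uv :: "nat => site => real \<times> real" where
  "uv 0 k = (1, 0)"
| "uv (Suc n) k = (S k * fst (uv n k) + ((c k)\<^sup>2 + (D k)\<^sup>2) * snd (uv n k), fst (uv n k) + S k * snd (uv n k))"

private lemma uv_flip: "uv n (flip k) = uv n k"
  by (induction n) (simp_all add: SD_flip c_flip)

private lemma kpow_e:
  assumes "r \<in> torus L"
  shows "(\<Sum>s\<in>torus L. of_real (kpow (torus L) (walk L \<alpha> p q) n r s) * e k s) =
    of_real (fst (uv n k) + c k * snd (uv n k)) * e k r + of_real (D k * snd (uv n k)) * e (flip k) r"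
proof (induction n arbitrary: k)
  case 0
  have "(\<Sum>s\<in>torus L. of_real (kpow (torus L) (walk L \<alpha> p q) 0 r s) * e k s) = (\<Sum>s\<in>torus L. if r = s then e k s else 0)"
    by (intro sum.cong) auto
  then show ?case using assms by simp
next
  case (Suc n)
  let ?K = "kpow (torus L) (walk L \<alpha> p q) n"
  have "(\<Sum>s\<in>torus L. of_real (kpow (torus L) (walk L \<alpha> p q) (Suc n) r s) * e k s) =
     (\<Sum>s\<in>torus L. \<Sum>t\<in>torus L. of_real (?K r t) * (of_real (walk L \<alpha> p q t s) * e k s))"
    by (simp add: sum_distrib_right mult.assoc)
  also have "... = (\<Sum>t\<in>torus L. of_real (?K r t) * (\<Sum>s\<in>torus L. of_real (walk L \<alpha> p q t s) * e k s))"
    by (subst sum.swap) (simp only: sum_distrib_left)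
  also have "... = (\<Sum>t\<in>torus L. of_real (?K r t) * (of_real (c k + S k) * e k t + of_real (D k) * e (flip k) t))"
    by (intro sum.cong refl) (simp only: walk_e)
  also have "... = of_real (c k + S k) * (\<Sum>t\<in>torus L. of_real (?K r t) * e k t) + of_real (D k) * (\<Sum>t\<in>torus L. of_real (?K r t) * e (flip k) t)"
    by (simp only: distrib_left sum.distrib sum_distrib_left mult.left_commute)
  also have "... = of_real (c k + S k) * (of_real (fst (uv n k) + c k * snd (uv n k)) * e k r + of_real (D k * snd (uv n k)) * e (flip k) r)
     + of_real (D k) * (of_real (fst (uv n k) - c k * snd (uv n k)) * e (flip k) r + of_real (D k * snd (uv n k)) * e k r)"
  proof -
    have ff: "e (flip (flip k)) r = e k r"
      unfolding e_flip by (simp add: sgp_def)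
    show ?thesis unfolding Suc.IH Suc.IH[of "flip k"] uv_flip SD_flip c_flip ff by simp
  qed
  also have "... = of_real (fst (uv (Suc n) k) + c k * snd (uv (Suc n) k)) * e k r + of_real (D k * snd (uv (Suc n) k)) * e (flip k) r"
    by (simp add: algebra_simps power2_eq_square)
  finally show ?case .
qed

text \<open>Inserting the orthogonality relation turns the trace into an average over plane waves.
  The term with \<open>D\<close> drops out by \<open>sum_sgp\<close>, the term with \<open>c\<close>
  because \<open>flip\<close> changes its sign.\<close>

private lemma ktrace_uv:
  "ktrace (torus L) (walk L \<alpha> p q) n = (\<Sum>k\<in>torus L. fst (uv n k))"
proof -
  let ?K = "kpow (torus L) (walk L \<alpha> p q) n"
  have "of_real (ktrace (torus L) (walk L \<alpha> p q) n * real (L ^ 3)) =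
     (\<Sum>r\<in>torus L. \<Sum>s\<in>torus L. of_real (?K r s) * (if r = s then of_nat (L ^ 3) else 0 :: complex))"
  proof -
    have "(\<Sum>s\<in>torus L. of_real (?K r s) * (if r = s then of_nat (L ^ 3) else 0 :: complex)) = of_real (?K r r * real (L ^ 3))"
      if r: "r \<in> torus L" for r
    proof -
      have "(\<Sum>s\<in>torus L. of_real (?K r s) * (if r = s then of_nat (L ^ 3) else 0 :: complex)) =
        (\<Sum>s\<in>torus L. if r = s then of_real (?K r s) * of_nat (L ^ 3) else 0)"
        by (intro sum.cong) auto
      then show ?thesis using r by simp
    qed
    then show ?thesis unfolding ktrace_def sum_distrib_right of_real_sum by (intro sum.cong refl) simp
  qed
  also have "... = (\<Sum>r\<in>torus L. \<Sum>s\<in>torus L. of_real (?K r s) * (\<Sum>k\<in>torus L. e k s * cnj (e k r)))"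
    by (intro sum.cong refl) (simp only: rootu_orthogonal[OF L(2)])
  also have "... = (\<Sum>r\<in>torus L. \<Sum>s\<in>torus L. \<Sum>k\<in>torus L. of_real (?K r s) * e k s * cnj (e k r))"
    by (simp only: sum_distrib_left mult.assoc)
  also have "... = (\<Sum>r\<in>torus L. \<Sum>k\<in>torus L. \<Sum>s\<in>torus L. of_real (?K r s) * e k s * cnj (e k r))"
    by (rule sum.cong[OF refl], rule sum.swap)
  also have "... = (\<Sum>k\<in>torus L. \<Sum>r\<in>torus L. \<Sum>s\<in>torus L. of_real (?K r s) * e k s * cnj (e k r))"
    by (rule sum.swap)
  also have "... = (\<Sum>k\<in>torus L. \<Sum>r\<in>torus L. of_real (fst (uv n k) + c k * snd (uv n k)) + of_real (D k * snd (uv n k)) * sgp \<alpha> r)"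
  proof (intro sum.cong refl)
    fix k r assume r: "r \<in> torus L"
    have "(\<Sum>s\<in>torus L. of_real (?K r s) * e k s * cnj (e k r)) =
      (of_real (fst (uv n k) + c k * snd (uv n k)) + of_real (D k * snd (uv n k)) * sgp \<alpha> r) * (cnj (e k r) * e k r)"
      unfolding sum_distrib_right[symmetric] kpow_e[OF r] e_flip by (simp only: algebra_simps)
    then show "(\<Sum>s\<in>torus L. of_real (?K r s) * e k s * cnj (e k r)) =
      of_real (fst (uv n k) + c k * snd (uv n k)) + of_real (D k * snd (uv n k)) * sgp \<alpha> r"
      unfolding rootu_cnj_self by (simp only: mult_1_right)
  qed
  also have "... = (\<Sum>k\<in>torus L. of_real (fst (uv n k) + c k * snd (uv n k)) * of_nat (L ^ 3))"
    unfolding sum.distrib sum_distrib_left[symmetric] sum_sgp[OF L] by (simp add: card_torus mult.commute)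
  also have "... = of_real ((\<Sum>k\<in>torus L. fst (uv n k) + c k * snd (uv n k)) * real (L ^ 3))"
    by (simp add: sum_distrib_right)
  finally have "ktrace (torus L) (walk L \<alpha> p q) n * real (L ^ 3) = (\<Sum>k\<in>torus L. fst (uv n k) + c k * snd (uv n k)) * real (L ^ 3)"
    by (simp only: of_real_eq_iff)
  then have "ktrace (torus L) (walk L \<alpha> p q) n = (\<Sum>k\<in>torus L. fst (uv n k) + c k * snd (uv n k))"
    using L by simp
  moreover have "(\<Sum>k\<in>torus L. c k * snd (uv n k)) = (\<Sum>k\<in>torus L. c (flip k) * snd (uv n (flip k)))"
    unfolding flip_def by (rule sum_shift[OF L(2), symmetric])
  then have "(\<Sum>k\<in>torus L. c k * snd (uv n k)) = 0"
    by (simp add: c_flip uv_flip sum_negf)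
  ultimately show ?thesis by (simp add: sum.distrib)
qed

private lemma uv_closed:
  fixes R defines "R \<equiv> \<lambda>k. sqrt ((c k)\<^sup>2 + (D k)\<^sup>2)"
  shows "fst (uv n k) + R k * snd (uv n k) = (S k + R k) ^ n" "fst (uv n k) - R k * snd (uv n k) = (S k - R k) ^ n"
proof -
  have R: "(c k)\<^sup>2 + (D k)\<^sup>2 = R k * R k" by (simp add: R_def)
  have "fst (uv n k) + R k * snd (uv n k) = (S k + R k) ^ n \<and> fst (uv n k) - R k * snd (uv n k) = (S k - R k) ^ n"
  proof (induction n)
    case (Suc n)
    have "(S k + R k) ^ Suc n = (S k + R k) * (fst (uv n k) + R k * snd (uv n k))"
      "(S k - R k) ^ Suc n = (S k - R k) * (fst (uv n k) - R k * snd (uv n k))" using Suc by simp_all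
    then show ?case unfolding uv.simps R by (simp add: algebra_simps)
  qed simp
  then show "fst (uv n k) + R k * snd (uv n k) = (S k + R k) ^ n" "fst (uv n k) - R k * snd (uv n k) = (S k - R k) ^ n"
    by auto
qed

text \<open>Each invariant space is counted twice, at \<open>k\<close> and at its shift by
  \<open>L div 2\<close>, whence the factor 1/2.\<close>

theorem ktrace_walk:
  "ktrace (torus L) (walk L \<alpha> p q) n =
     (\<Sum>k\<in>torus L. ((band_mid L \<alpha> p q k + band_gap L \<alpha> p q k) ^ n + (band_mid L \<alpha> p q k - band_gap L \<alpha> p q k) ^ n) / 2)"
  unfolding ktrace_uv
proof (rule sum.cong[OF refl])
  fix k
  show "fst (uv n k) = ((band_mid L \<alpha> p q k + band_gap L \<alpha> p q k) ^ n + (band_mid L \<alpha> p q k - band_gap L \<alpha> p q k) ^ n) / 2"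
    using uv_closed[of n k] unfolding band_mid_def band_gap_def c_def D_def S_def X_def Y_def by simp
qed

end

lemma ang_shift_all: "L > 0 ==> even L ==>
  \<nu> \<in> dirs ==> cosL L (shift L 1 h (shift L 2 h (shift L 3 h k))) \<nu> = - cosL L k \<nu>" if "h = int (L div 2)" for h
proof -
  assume L: "L > 0" "even L" and \<nu>: "\<nu> \<in> dirs"
  have d: "1 \<in> dirs" "2 \<in> dirs" "3 \<in> dirs" "(1::nat) \<noteq> 2" "(1::nat) \<noteq> 3" "(2::nat) \<noteq> 3" by auto
  from \<nu> consider "\<nu> = 1" | "\<nu> = 2" | "\<nu> = 3" by blast
  then show ?thesis unfolding that
    by cases (simp_all only: cosL_shift_same[OF L(2,1)]
    cosL_shift_other[OF d(1) d(2) d(4)] cosL_shift_other[OF d(2) d(1) d(4)[symmetric]]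
    cosL_shift_other[OF d(1) d(3) d(5)] cosL_shift_other[OF d(3) d(1) d(5)[symmetric]]
    cosL_shift_other[OF d(2) d(3) d(6)] cosL_shift_other[OF d(3) d(2) d(6)[symmetric]])
qed

text \<open>For even \<open>L\<close> the torus is bipartite: adding \<open>L div 2\<close> to all
  three momenta negates the pair of eigenvalues.\<close>

lemma ktrace_walk_odd:
  assumes L: "even L" "L > 0" and wt: "walk_weights \<alpha> p q" and m: "odd m"
  shows "ktrace (torus L) (walk L \<alpha> p q) m = 0"
proof -
  define h where "h = int (L div 2)"
  define f where "f k = ((band_mid L \<alpha> p q k + band_gap L \<alpha> p q k) ^ m + (band_mid L \<alpha> p q k - band_gap L \<alpha> p q k) ^ m) / 2" for k
  let ?T = "\<lambda>k. shift L 1 h (shift L 2 h (shift L 3 h k))"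
  have al: "\<alpha> \<in> dirs" using wt by (auto simp: walk_weights_def)
  have sy: "symb L (dirs - {\<alpha>}) w (?T k) = - symb L (dirs - {\<alpha>}) w k" for w k
    unfolding symb_def sum_negf[symmetric]
    by (intro sum.cong refl, subst ang_shift_all[OF h_def L(2,1)]) auto
  have mid: "band_mid L \<alpha> p q (?T k) = - band_mid L \<alpha> p q k" for k
    unfolding band_mid_def sy by (simp add: field_simps)
  have gap: "band_gap L \<alpha> p q (?T k) = band_gap L \<alpha> p q k" for k
    unfolding band_gap_def sy ang_shift_all[OF h_def L(2,1) al] by (simp add: power2_eq_square algebra_simps)
  have anti: "f (?T k) = - f k" for k
  proof -
    have neg: "(- x + y) ^ m + (- x - y) ^ m = - ((x + y) ^ m + (x - y) ^ m)" for x y :: real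
    proof -
      have "- x + y = - (x - y)" "- x - y = - (x + y)" by simp_all
      then show ?thesis by (simp only: power_minus_odd[OF m])
    qed
    show ?thesis unfolding f_def mid gap neg by (simp add: field_simps)
  qed
  have "(\<Sum>k\<in>torus L. f (?T k)) = (\<Sum>k\<in>torus L. f k)"
    using sum_shift[OF L(2), of "\<lambda>k. f (shift L 1 h (shift L 2 h k))" 3 h]
      sum_shift[OF L(2), of "\<lambda>k. f (shift L 1 h k)" 2 h] sum_shift[OF L(2), of f 1 h] by simp
  then have "(\<Sum>k\<in>torus L. f k) = 0" unfolding anti by (simp add: sum_negf)
  then show ?thesis unfolding ktrace_walk[OF L wt] f_def .
qed

section \<open>Comparison with the two homogeneous walks\<close>

lemma binomial_sym_sum:
  fixes S R :: real
  shows "(S + R) ^ m + (S - R) ^ m = (\<Sum>k\<le>m. of_nat (m choose k) * S ^ (m - k) * (R ^ k + (- R) ^ k))"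
proof -
  have "(S + R) ^ m = (\<Sum>k\<le>m. of_nat (m choose k) * R ^ k * S ^ (m - k))"
    using binomial_ring[of R S m] by (simp add: add.commute)
  moreover have "(S - R) ^ m = (\<Sum>k\<le>m. of_nat (m choose k) * (- R) ^ k * S ^ (m - k))"
    using binomial_ring[of "- R" S m] by (simp add: add.commute)
  ultimately show ?thesis by (simp add: sum.distrib[symmetric] algebra_simps)
qed

text \<open>Jensen for powers, by induction: the defect in each step is a multiple of
  \<open>(x - y) * (x ^ n - y ^ n)\<close>, which is nonnegative.\<close>

lemma power_half_sum_le:
  fixes x y :: real
  assumes "x \<ge> 0" "y \<ge> 0"
  shows "((x + y) / 2) ^ n \<le> (x ^ n + y ^ n) / 2"
proof (induction n)
  case (Suc n)
  have "((x + y) / 2) ^ Suc n \<le> (x + y) / 2 * ((x ^ n + y ^ n) / 2)"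
    unfolding power_Suc using assms by (intro mult_left_mono Suc) simp
  also have "... = (x ^ Suc n + y ^ Suc n) / 2 - (x - y) * (x ^ n - y ^ n) / 4"
    by (simp add: field_simps)
  finally have le: "((x + y) / 2) ^ Suc n \<le> (x ^ Suc n + y ^ Suc n) / 2 - (x - y) * (x ^ n - y ^ n) / 4" .
  have "(x - y) * (x ^ n - y ^ n) \<ge> 0"
  proof (cases "x \<le> y")
    case True
    then show ?thesis using power_mono[OF True assms(1), of n] by (intro mult_nonpos_nonpos) auto
  next
    case False
    then show ?thesis using power_mono[of y x n] assms by (intro mult_nonneg_nonneg) auto
  qed
  then show ?case using le by linarith
qed simp

text \<open>Eigenvalues of \<open>[[x, c], [c, y]]\<close> with \<open>S = (x + y) / 2\<close>, \<open>d = (x - y) / 2\<close>.\<close>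

lemma even_power_spread:
  fixes S c d :: real
  assumes "even m"
  defines "R \<equiv> sqrt (c\<^sup>2 + d\<^sup>2)"
  shows "(S + R) ^ m + (S - R) ^ m \<le>
    (((S + (c + d)) ^ m + (S - (c + d)) ^ m) + ((S + (c - d)) ^ m + (S - (c - d)) ^ m)) / 2"
proof -
  \<comment> \<open>\<open>R^2\<close> is the mean of the squares of \<open>c + d\<close> and
    \<open>c - d\<close>. In the symmetric binomial sum only even powers of \<open>R\<close>
    survive, with nonnegative coefficients since \<open>m\<close> is even, and these powers are
    convex in \<open>R^2\<close>.\<close>
  have R2: "R\<^sup>2 = ((c + d)\<^sup>2 + (c - d)\<^sup>2) / 2"
    unfolding R_def by (simp add: power2_eq_square algebra_simps)
  have "of_nat (m choose k) * S ^ (m - k) * (R ^ k + (- R) ^ k) \<le>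
     (of_nat (m choose k) * S ^ (m - k) * ((c + d) ^ k + (- (c + d)) ^ k) +
      of_nat (m choose k) * S ^ (m - k) * ((c - d) ^ k + (- (c - d)) ^ k)) / 2" if k: "k \<le> m" for k
  proof (cases "even k")
    case False
    have z: "x ^ k + (- x) ^ k = 0" for x :: real using power_minus_odd[OF False, of x] by linarith
    show ?thesis unfolding z by simp
  next
    case True
    then obtain i where i: "k = 2 * i" by (elim evenE)
    have ev: "even (m - k)" using True assms(1) by simp
    have "R ^ k \<le> ((c + d) ^ k + (c - d) ^ k) / 2"
      unfolding i power_mult R2 by (rule power_half_sum_le) auto
    then have "(of_nat (m choose k) * S ^ (m - k)) * R ^ k \<le> (of_nat (m choose k) * S ^ (m - k)) * (((c + d) ^ k + (c - d) ^ k) / 2)"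
      using ev by (intro mult_left_mono mult_nonneg_nonneg) (auto simp: zero_le_even_power)
    then show ?thesis using True by (simp only: power_minus_even) (simp add: field_simps)
  qed
  then have "(\<Sum>k\<le>m. of_nat (m choose k) * S ^ (m - k) * (R ^ k + (- R) ^ k)) \<le>
     (\<Sum>k\<le>m. (of_nat (m choose k) * S ^ (m - k) * ((c + d) ^ k + (- (c + d)) ^ k) +
      of_nat (m choose k) * S ^ (m - k) * ((c - d) ^ k + (- (c - d)) ^ k)) / 2)"
    by (intro sum_mono) auto
  then show ?thesis unfolding binomial_sym_sum
    by (simp only: sum_divide_distrib[symmetric] sum.distrib)
qed

text \<open>Only the term \<open>2 * R^4\<close> is not affine in \<open>R^2\<close>; its defect
  \<open>8 * c^2 * d^2\<close> is the quantitative gain of an alternating pattern.\<close>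

lemma fourth_power_spread:
  fixes S c d :: real
  defines "R \<equiv> sqrt (c\<^sup>2 + d\<^sup>2)"
  shows "(S + R) ^ 4 + (S - R) ^ 4 =
    (((S + (c + d)) ^ 4 + (S - (c + d)) ^ 4) + ((S + (c - d)) ^ 4 + (S - (c - d)) ^ 4)) / 2 - 8 * c\<^sup>2 * d\<^sup>2"
proof -
  have R2: "R\<^sup>2 = c\<^sup>2 + d\<^sup>2" unfolding R_def by simp
  have "(S + R) ^ 4 + (S - R) ^ 4 = 2 * S ^ 4 + 12 * S\<^sup>2 * R\<^sup>2 + 2 * (R\<^sup>2)\<^sup>2"
    by (simp add: power2_eq_square power4_eq_xxxx algebra_simps)
  then show ?thesis unfolding R2
    by (simp add: power2_eq_square power4_eq_xxxx algebra_simps)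
qed

lemma symb_split: "\<alpha> \<in> dirs ==> symb L dirs p k = p \<alpha> * cosL L k \<alpha> + symb L (dirs - {\<alpha>}) p k"
  unfolding symb_def by (rule sum.remove) auto

context
  fixes L \<alpha> :: nat and p q :: "nat => real"
  assumes L: "even L" "L > 0" and wt: "walk_weights \<alpha> p q"
begin

private lemma al_trace: "\<alpha> \<in> dirs" "p \<alpha> = q \<alpha>" using wt by (auto simp: walk_weights_def)

private lemma sum_flip:
  assumes "even m"
  shows "(\<Sum>k\<in>torus L. (symb L (dirs - {\<alpha>}) w k - p \<alpha> * cosL L k \<alpha>) ^ m) =
    (\<Sum>k\<in>torus L. (symb L (dirs - {\<alpha>}) w k + p \<alpha> * cosL L k \<alpha>) ^ m)"
proof -
  have "symb L (dirs - {\<alpha>}) w (shift L \<alpha> (int (L div 2)) k) = symb L (dirs - {\<alpha>}) w k" for k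
    unfolding symb_def by (intro sum.cong refl, use al_trace(1) in \<open>subst cosL_shift_other; auto\<close>)
  then show ?thesis
    using sum_shift[OF L(2), of "\<lambda>k. (symb L (dirs - {\<alpha>}) w k - p \<alpha> * cosL L k \<alpha>) ^ m" \<alpha> "int (L div 2)"]
    by (simp add: cosL_shift_same[OF L])
qed

text \<open>With \<open>c + D\<close> and \<open>c - D\<close> in place of \<open>R\<close> the
  eigenvalues become \<open>X + c\<close>, \<open>Y - c\<close>, \<open>Y + c\<close> and
  \<open>X - c\<close>. These belong to the homogeneous walks with weights \<open>p\<close> and
  \<open>q\<close>, after a shift of the momentum in direction \<open>\<alpha>\<close> that turns
  \<open>- c\<close> into \<open>c\<close>.\<close>

lemma ktrace_walk_even_le:
  assumes m: "even m"
  shows "ktrace (torus L) (walk L \<alpha> p q) m \<le> ((\<Sum>k\<in>torus L. symb L dirs p k ^ m) + (\<Sum>k\<in>torus L. symb L dirs q k ^ m)) / 2"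
    and "ktrace (torus L) (walk L \<alpha> p q) 4 = ((\<Sum>k\<in>torus L. symb L dirs p k ^ 4) + (\<Sum>k\<in>torus L. symb L dirs q k ^ 4)) / 2
      - 4 * (\<Sum>k\<in>torus L. (p \<alpha> * cosL L k \<alpha>)\<^sup>2 * ((symb L (dirs - {\<alpha>}) p k - symb L (dirs - {\<alpha>}) q k) / 2)\<^sup>2)"
proof -
  define c where "c k = p \<alpha> * cosL L k \<alpha>" for k
  define X where "X k = symb L (dirs - {\<alpha>}) p k" for k
  define Y where "Y k = symb L (dirs - {\<alpha>}) q k" for k
  define S where "S k = (X k + Y k) / 2" for k
  define D where "D k = (X k - Y k) / 2" for k
  have band: "band_mid L \<alpha> p q k = S k" "band_gap L \<alpha> p q k = sqrt ((c k)\<^sup>2 + (D k)\<^sup>2)" for k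
    by (simp_all add: band_mid_def band_gap_def S_def D_def X_def Y_def c_def)
  have e: "S k + (c k + D k) = X k + c k" "S k - (c k + D k) = Y k - c k"
    "S k + (c k - D k) = Y k + c k" "S k - (c k - D k) = X k - c k" for k
    by (simp_all add: S_def D_def field_simps)
  have s: "symb L dirs p k = X k + c k" "symb L dirs q k = Y k + c k" for k
    using symb_split[OF al_trace(1)] al_trace(2) by (simp_all add: X_def Y_def c_def)
  have tot: "(\<Sum>k\<in>torus L. (((X k + c k) ^ n + (Y k - c k) ^ n) + ((Y k + c k) ^ n + (X k - c k) ^ n)) / 4) =
     ((\<Sum>k\<in>torus L. symb L dirs p k ^ n) + (\<Sum>k\<in>torus L. symb L dirs q k ^ n)) / 2" if "even n" for n
    using sum_flip[OF that, of p] sum_flip[OF that, of q]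
    unfolding s by (simp add: sum_divide_distrib[symmetric] sum.distrib X_def Y_def c_def)
  have "ktrace (torus L) (walk L \<alpha> p q) m \<le> (\<Sum>k\<in>torus L. (((X k + c k) ^ m + (Y k - c k) ^ m) + ((Y k + c k) ^ m + (X k - c k) ^ m)) / 4)"
    unfolding ktrace_walk[OF L wt] band
  proof (rule sum_mono)
    fix k
    have aux: "u / 2 \<le> v / 4" if "u \<le> v / 2" for u v :: real using that by simp
    show "((S k + sqrt ((c k)\<^sup>2 + (D k)\<^sup>2)) ^ m + (S k - sqrt ((c k)\<^sup>2 + (D k)\<^sup>2)) ^ m) / 2
      \<le> (((X k + c k) ^ m + (Y k - c k) ^ m) + ((Y k + c k) ^ m + (X k - c k) ^ m)) / 4"
      by (rule aux[OF even_power_spread[OF m, of "S k" "c k" "D k", unfolded e]])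
  qed
  then show "ktrace (torus L) (walk L \<alpha> p q) m \<le> ((\<Sum>k\<in>torus L. symb L dirs p k ^ m) + (\<Sum>k\<in>torus L. symb L dirs q k ^ m)) / 2"
    unfolding tot[OF m] .
  have "ktrace (torus L) (walk L \<alpha> p q) 4 = (\<Sum>k\<in>torus L. (((X k + c k) ^ 4 + (Y k - c k) ^ 4) + ((Y k + c k) ^ 4 + (X k - c k) ^ 4)) / 4 - 4 * ((c k)\<^sup>2 * (D k)\<^sup>2))"
    unfolding ktrace_walk[OF L wt] band
    by (intro sum.cong refl) (simp only: fourth_power_spread e, simp add: field_simps)
  also have "... = (\<Sum>k\<in>torus L. (((X k + c k) ^ 4 + (Y k - c k) ^ 4) + ((Y k + c k) ^ 4 + (X k - c k) ^ 4)) / 4) - 4 * (\<Sum>k\<in>torus L. (c k)\<^sup>2 * (D k)\<^sup>2)"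
    by (simp only: sum_subtractf sum_distrib_left)
  finally show "ktrace (torus L) (walk L \<alpha> p q) 4 = ((\<Sum>k\<in>torus L. symb L dirs p k ^ 4) + (\<Sum>k\<in>torus L. symb L dirs q k ^ 4)) / 2
      - 4 * (\<Sum>k\<in>torus L. (p \<alpha> * cosL L k \<alpha>)\<^sup>2 * ((symb L (dirs - {\<alpha>}) p k - symb L (dirs - {\<alpha>}) q k) / 2)\<^sup>2)"
    by (subst (asm) tot) (simp_all add: c_def D_def X_def Y_def)
qed

text \<open>The symbols of the other two directions are at most \<open>1 - p \<alpha>\<close> in
  absolute value, hence so is the sum of the absolute values of their half-sum and half-difference;
  \<open>\<bar>c\<bar> \<le> p \<alpha>\<close> supplies the rest.\<close>

private lemma band_le_1: "\<bar>band_mid L \<alpha> p q k\<bar> + band_gap L \<alpha> p q k \<le> 1"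
proof -
  have ab: "\<bar>symb L (dirs - {\<alpha>}) w k\<bar> \<le> 1 - w \<alpha>" if w: "\<And>\<nu>. \<nu> \<in> dirs ==> w \<nu> \<ge> 0" "sum w dirs = 1" for w
  proof -
    have "\<bar>symb L (dirs - {\<alpha>}) w k\<bar> \<le> (\<Sum>\<nu>\<in>dirs - {\<alpha>}. w \<nu> * 1)"
      unfolding symb_def using w
      by (intro order.trans[OF sum_abs] sum_mono) (auto simp: abs_mult cosL_def intro!: mult_left_le)
    also have "... = sum w dirs - w \<alpha>" using al_trace(1) by (subst sum_diff1) auto
    finally show ?thesis using w by simp
  qed
  define c where "c = p \<alpha> * cosL L k \<alpha>"
  define X where "X = symb L (dirs - {\<alpha>}) p k"
  define Y where "Y = symb L (dirs - {\<alpha>}) q k"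
  have pq: "p \<nu> \<ge> 0" "q \<nu> \<ge> 0" if "\<nu> \<in> dirs" for \<nu> using wt that unfolding walk_weights_def by blast+
  have su: "sum p dirs = 1" "sum q dirs = 1" using wt unfolding walk_weights_def by blast+
  have X: "\<bar>X\<bar> \<le> 1 - p \<alpha>" and Y: "\<bar>Y\<bar> \<le> 1 - p \<alpha>"
    using ab[of p] ab[of q] pq su al_trace(2) unfolding X_def Y_def by auto
  have c: "\<bar>c\<bar> \<le> p \<alpha>" unfolding c_def using pq(1)[OF al_trace(1)]
    by (simp add: abs_mult cosL_def mult_left_le)
  have "sqrt (c\<^sup>2 + ((X - Y) / 2)\<^sup>2) \<le> \<bar>c\<bar> + \<bar>(X - Y) / 2\<bar>" by (rule sqrt_sum_squares_le_sum_abs)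
  moreover have "\<bar>(X + Y) / 2\<bar> + \<bar>(X - Y) / 2\<bar> \<le> 1 - p \<alpha>"
    using X Y by (auto simp: abs_if field_simps split: if_splits)
  ultimately have "\<bar>(X + Y) / 2\<bar> + sqrt (c\<^sup>2 + ((X - Y) / 2)\<^sup>2) \<le> 1"
    using c by linarith
  then show ?thesis by (simp add: band_mid_def band_gap_def c_def X_def Y_def)
qed

text \<open>All eigenvalues lie in \<open>[- 1, 1]\<close> by \<open>band_le_1\<close>, where even
  powers decrease with the exponent.\<close>

lemma ktrace_walk_decreasing:
  assumes "even m" "m \<le> n" "even n"
  shows "ktrace (torus L) (walk L \<alpha> p q) n \<le> ktrace (torus L) (walk L \<alpha> p q) m"
proof -
  have mono: "x ^ n \<le> x ^ m" if "\<bar>x\<bar> \<le> 1" for x :: real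
  proof -
    have "\<bar>x\<bar> ^ n \<le> \<bar>x\<bar> ^ m" using that assms by (intro power_decreasing) auto
    then show ?thesis using assms by (simp add: power_even_abs)
  qed
  have gp: "band_gap L \<alpha> p q k \<ge> 0" for k by (simp add: band_gap_def)
  show ?thesis unfolding ktrace_walk[OF L wt]
  proof (intro sum_mono divide_right_mono add_mono mono)
    fix k
    show "\<bar>band_mid L \<alpha> p q k + band_gap L \<alpha> p q k\<bar> \<le> 1" "\<bar>band_mid L \<alpha> p q k - band_gap L \<alpha> p q k\<bar> \<le> 1"
      using band_le_1[of k] gp[of k] by linarith+
  qed simp
qed

end

section \<open>Comparison of return probabilities\<close>

lemma sum_torus_prod:
  fixes F G H :: "int => 'a :: comm_ring_1"
  assumes "{\<alpha>, \<nu>, \<delta>} = dirs"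
  shows "(\<Sum>k\<in>torus L. F (crd \<alpha> k) * (G (crd \<nu> k) * H (crd \<delta> k))) =
    (\<Sum>a\<in>{0..<int L}. F a) * ((\<Sum>a\<in>{0..<int L}. G a) * (\<Sum>a\<in>{0..<int L}. H a))"
proof -
  have base: "(\<Sum>k\<in>torus L. F (crd 1 k) * (G (crd 2 k) * H (crd 3 k))) =
    (\<Sum>a\<in>{0..<int L}. F a) * ((\<Sum>a\<in>{0..<int L}. G a) * (\<Sum>a\<in>{0..<int L}. H a))"
    for F G H :: "int => 'a :: comm_ring_1"
    unfolding sum_torus crd_def by (simp add: sum_distrib_left[symmetric] sum_distrib_right[symmetric])
  have "card {\<alpha>, \<nu>, \<delta>} = 3" unfolding assms by simp
  then have ne: "\<alpha> \<noteq> \<nu>" "\<alpha> \<noteq> \<delta>" "\<nu> \<noteq> \<delta>" by (auto simp: card_insert_if split: if_splits)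
  have "\<alpha> \<in> dirs" "\<nu> \<in> dirs" "\<delta> \<in> dirs" using assms by auto
  then consider "\<alpha> = 1 \<and> \<nu> = 2 \<and> \<delta> = 3" | "\<alpha> = 1 \<and> \<nu> = 3 \<and> \<delta> = 2" | "\<alpha> = 2 \<and> \<nu> = 1 \<and> \<delta> = 3"
    | "\<alpha> = 2 \<and> \<nu> = 3 \<and> \<delta> = 1" | "\<alpha> = 3 \<and> \<nu> = 1 \<and> \<delta> = 2" | "\<alpha> = 3 \<and> \<nu> = 2 \<and> \<delta> = 1"
    using ne by (simp only: insert_iff empty_iff) blast
  then show ?thesis
  proof cases
    case 1 then show ?thesis using base[of F G H] by (simp only: mult_ac)
  next
    case 2 then show ?thesis using base[of F H G] by (simp only: mult_ac)
  next
    case 3 then show ?thesis using base[of G F H] by (simp only: mult_ac)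
  next
    case 4 then show ?thesis using base[of H F G] by (simp only: mult_ac)
  next
    case 5 then show ?thesis using base[of G H F] by (simp only: mult_ac)
  next
    case 6 then show ?thesis using base[of H G F] by (simp only: mult_ac)
  qed
qed

lemma dirs_split:
  assumes "\<alpha> \<in> dirs"
  obtains \<nu>1 \<nu>2 where "dirs = {\<alpha>, \<nu>1, \<nu>2}" "\<nu>1 \<noteq> \<alpha>" "\<nu>2 \<noteq> \<alpha>" "\<nu>1 \<noteq> \<nu>2"
proof -
  consider "\<alpha> = 1" | "\<alpha> = 2" | "\<alpha> = 3" using assms by blast
  then show thesis
  proof cases
    case 1 then show thesis by (intro that[of 2 3]) auto
  next
    case 2 then show thesis by (intro that[of 1 3]) auto
  next
    case 3 then show thesis by (intro that[of 1 2]) auto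
  qed
qed

lemma third_dir:
  assumes "\<nu> \<in> dirs" "\<delta> \<in> dirs" "\<nu> \<noteq> \<delta>"
  obtains \<epsilon> where "{\<nu>, \<delta>, \<epsilon>} = dirs" "\<epsilon> \<noteq> \<nu>" "\<epsilon> \<noteq> \<delta>"
proof -
  have "\<nu> = 1 \<or> \<nu> = 2 \<or> \<nu> = 3" "\<delta> = 1 \<or> \<delta> = 2 \<or> \<delta> = 3" using assms by auto
  then have "{\<nu>, \<delta>, 6 - \<nu> - \<delta>} = dirs" "6 - \<nu> - \<delta> \<noteq> \<nu>" "6 - \<nu> - \<delta> \<noteq> \<delta>"
    using assms(3) by (elim disjE; simp; blast)+
  then show ?thesis by (rule that)
qed

definition cosI :: "nat => int => real" where "cosI L a = Re (rootu L a)"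

lemma cosL_eq: "cosL L k \<nu> = cosI L (crd \<nu> k)"
  by (simp add: cosL_def ang_def cosI_def rootu_def)

lemma cosI_bounds: "\<bar>cosI L a\<bar> \<le> 1"
  unfolding cosI_def using abs_Re_le_cmod[of "rootu L a"] by simp

lemma cosI_minus: "cosI L (- a) = cosI L a"
  by (simp add: cosI_def rootu_minus)

lemma cosI_mod: "L > 0 ==> cosI L (a mod int L) = cosI L a"
  by (simp add: cosI_def)

lemma sum_cosI:
  assumes "L > 1"
  shows "(\<Sum>a\<in>{0..<int L}. cosI L a) = 0"
proof -
  have "(\<Sum>a\<in>{0..<int L}. rootu L (a * 1)) = 0"
    using assms by (subst sum_rootu) auto
  then have "Re (\<Sum>a\<in>{0..<int L}. rootu L (a * 1)) = 0" by simp
  then show ?thesis by (simp add: cosI_def)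
qed

lemma sum_cosI2:
  assumes "L > 2"
  shows "(\<Sum>a\<in>{0..<int L}. (cosI L a)\<^sup>2) = real L / 2"
proof -
  have "(cosI L a)\<^sup>2 = 1 / 2 + Re (rootu L (a * 2)) / 2" for a
  proof -
    have "rootu L (a * 2) = rootu L a * rootu L a" unfolding rootu_add[symmetric] by (simp add: mult_2_right)
    then have "Re (rootu L (a * 2)) = (Re (rootu L a))\<^sup>2 - (Im (rootu L a))\<^sup>2" by (simp add: power2_eq_square)
    moreover have "(Re (rootu L a))\<^sup>2 + (Im (rootu L a))\<^sup>2 = 1"
      using cmod_power2[of "rootu L a"] by simp
    ultimately show ?thesis unfolding cosI_def by argo
  qed
  then have "(\<Sum>a\<in>{0..<int L}. (cosI L a)\<^sup>2) = (\<Sum>a\<in>{0..<int L}. 1 / 2) + Re (\<Sum>a\<in>{0..<int L}. rootu L (a * 2)) / 2"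
    by (simp add: sum.distrib sum_divide_distrib)
  also have "(\<Sum>a\<in>{0..<int L}. rootu L (a * 2)) = 0"
    using assms zdvd_not_zless[of 2 "int L"] by (subst sum_rootu) auto
  finally show ?thesis by simp
qed

text \<open>Replacing one momentum by its difference from another is an involution of the torus; it
  reduces functions of momentum differences to functions of single momenta.\<close>

definition relc :: "nat => nat => nat => site => site" where
  "relc L \<nu> \<delta> k = upd \<delta> k ((crd \<nu> k - crd \<delta> k) mod int L)"

lemma sum_relc:
  assumes "L > 0" "\<nu> \<in> dirs" "\<delta> \<in> dirs" "\<nu> \<noteq> \<delta>"
  shows "(\<Sum>k\<in>torus L. f (relc L \<nu> \<delta> k)) = (\<Sum>k\<in>torus L. f k)"
proof (rule sum.reindex_bij_witness[where i="relc L \<nu> \<delta>" and j="relc L \<nu> \<delta>"])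
  fix k assume k: "k \<in> torus L"
  have "crd \<nu> (relc L \<nu> \<delta> k) = crd \<nu> k" unfolding relc_def using crd_upd[OF assms(3,2)] assms(4) by simp
  then show "relc L \<nu> \<delta> (relc L \<nu> \<delta> k) = k"
    using crd_torus[OF k, of \<delta>] unfolding relc_def[of L \<nu> \<delta> "relc L \<nu> \<delta> k"]
    by (simp add: relc_def mod_diff_right_eq)
  then show "relc L \<nu> \<delta> (relc L \<nu> \<delta> k) = k" .
  show "relc L \<nu> \<delta> k \<in> torus L" unfolding relc_def using k assms by (intro upd_torus) auto
  then show "relc L \<nu> \<delta> k \<in> torus L" .
  show "f (relc L \<nu> \<delta> k) = f (relc L \<nu> \<delta> k)" ..
qed

definition Cd :: "nat => nat => nat => site => real" where
  "Cd L \<nu> \<delta> k = cosI L (crd \<nu> k - crd \<delta> k)"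

lemma Cd_commute: "Cd L \<nu> \<delta> k = Cd L \<delta> \<nu> k"
  unfolding Cd_def using cosI_minus[of L "crd \<nu> k - crd \<delta> k"] by simp

lemma Cd_relc:
  assumes "L > 0" "\<nu> \<in> dirs" "\<delta> \<in> dirs" "\<epsilon> \<in> dirs" "\<nu> \<noteq> \<delta>" "\<epsilon> \<noteq> \<delta>"
  shows "Cd L \<nu> \<delta> (relc L \<nu> \<delta> k) = cosL L k \<delta>" "Cd L \<nu> \<epsilon> (relc L \<nu> \<delta> k) = Cd L \<nu> \<epsilon> k"
    "cosL L (relc L \<nu> \<delta> k) \<epsilon> = cosL L k \<epsilon>"
proof -
  have 1: "crd \<nu> (relc L \<nu> \<delta> k) = crd \<nu> k" "crd \<epsilon> (relc L \<nu> \<delta> k) = crd \<epsilon> k"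
    unfolding relc_def using crd_upd[OF assms(3,2)] crd_upd[OF assms(3,4)] assms by simp_all
  then show "Cd L \<nu> \<epsilon> (relc L \<nu> \<delta> k) = Cd L \<nu> \<epsilon> k" "cosL L (relc L \<nu> \<delta> k) \<epsilon> = cosL L k \<epsilon>"
    by (simp_all add: Cd_def cosL_eq)
  have "Cd L \<nu> \<delta> (relc L \<nu> \<delta> k) = cosI L ((crd \<nu> k - (crd \<nu> k - crd \<delta> k) mod int L) mod int L)"
    unfolding Cd_def 1 cosI_mod[OF assms(1)] by (simp add: relc_def)
  also have "... = cosI L (crd \<delta> k)" unfolding mod_diff_right_eq cosI_mod[OF assms(1)] by simp
  finally show "Cd L \<nu> \<delta> (relc L \<nu> \<delta> k) = cosL L k \<delta>" by (simp add: cosL_eq)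
qed

lemma sum_cosL:
  assumes "\<delta> \<in> dirs"
  shows "(\<Sum>k\<in>torus L. \<phi> (cosL L k \<delta>)) = (real L)\<^sup>2 * (\<Sum>a\<in>{0..<int L}. \<phi> (cosI L a))"
proof -
  obtain \<nu> where "\<nu> \<in> dirs" "\<nu> \<noteq> \<delta>" using assms by (metis insert_iff num.distinct(1) numeral_eq_iff one_eq_numeral_iff)
  then obtain \<epsilon> where e: "{\<delta>, \<nu>, \<epsilon>} = dirs" using third_dir[of \<delta> \<nu>] assms by metis
  show ?thesis
    using sum_torus_prod[OF e, of "\<lambda>a. \<phi> (cosI L a)" "\<lambda>_. 1" "\<lambda>_. 1" L]
    by (simp add: cosL_eq power2_eq_square mult_ac)
qed

lemma sum_Cd:
  assumes "L > 0" "\<nu> \<in> dirs" "\<delta> \<in> dirs" "\<nu> \<noteq> \<delta>"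
  shows "(\<Sum>k\<in>torus L. \<phi> (Cd L \<nu> \<delta> k)) = (real L)\<^sup>2 * (\<Sum>a\<in>{0..<int L}. \<phi> (cosI L a))"
  using sum_relc[OF assms, of "\<lambda>k. \<phi> (Cd L \<nu> \<delta> k)"] sum_cosL[OF assms(3), of \<phi> L]
    Cd_relc(1)[OF assms(1-3,2,4,4)] by simp

lemma sum_Cd_Cd:
  assumes L: "L > 1" and d: "{\<nu>, \<delta>, \<epsilon>} = dirs"
  shows "(\<Sum>k\<in>torus L. Cd L \<nu> \<delta> k * Cd L \<nu> \<epsilon> k) = 0"
proof -
  have "card {\<nu>, \<delta>, \<epsilon>} = 3" unfolding d by simp
  then have ne: "\<nu> \<noteq> \<delta>" "\<nu> \<noteq> \<epsilon>" "\<delta> \<noteq> \<epsilon>" by (auto simp: card_insert_if split: if_splits)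
  have m: "\<nu> \<in> dirs" "\<delta> \<in> dirs" "\<epsilon> \<in> dirs" using d by auto
  have L0: "L > 0" using L by simp
  have "(\<Sum>k\<in>torus L. Cd L \<nu> \<delta> k * Cd L \<nu> \<epsilon> k) = (\<Sum>k\<in>torus L. cosL L k \<delta> * Cd L \<nu> \<epsilon> k)"
    using sum_relc[OF L0 m(1,2) ne(1), of "\<lambda>k. Cd L \<nu> \<delta> k * Cd L \<nu> \<epsilon> k"]
      Cd_relc[OF L0 m ne(1) ne(3)[symmetric]] by simp
  also have "... = (\<Sum>k\<in>torus L. cosL L k \<delta> * cosL L k \<epsilon>)"
    using sum_relc[OF L0 m(1,3) ne(2), of "\<lambda>k. cosL L k \<delta> * Cd L \<nu> \<epsilon> k"]
      Cd_relc[OF L0 m(1,3,2) ne(2,3)] by simp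
  also have "... = 0"
    using sum_torus_prod[OF d, of "\<lambda>_. 1" "cosI L" "cosI L" L] sum_cosI[OF L] by (simp add: cosL_eq)
  finally show ?thesis .
qed

text \<open>The probability that simple random walk on the line is back at its start after \<open>2 n\<close> steps.\<close>

definition ret :: "nat => real" where "ret n = of_nat ((2 * n) choose n) / 4 ^ n"

lemma ret_pos: "ret n > 0" by (simp add: ret_def)

lemma ret_Suc: "ret (Suc n) * (2 * real n + 2) = ret n * (2 * real n + 1)"
proof -
  have "Suc (2 * n) choose Suc n = Suc (2 * n) choose n"
    by (subst binomial_symmetric) auto
  then have a: "(2 * Suc n) choose Suc n = 2 * (Suc (2 * n) choose n)"
    by simp
  have b: "Suc n * (Suc (2 * n) choose Suc n) = Suc (2 * n) * ((2 * n) choose n)"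
    by (rule Suc_times_binomial)
  have "Suc n * ((2 * Suc n) choose Suc n) = 2 * (Suc (2 * n) * ((2 * n) choose n))"
    unfolding a using b \<open>Suc (2 * n) choose Suc n = Suc (2 * n) choose n\<close> by simp
  then have "real (Suc n * ((2 * Suc n) choose Suc n)) = real (2 * (Suc (2 * n) * ((2 * n) choose n)))"
    by (rule arg_cong)
  then have "(real n + 1) * real ((2 * Suc n) choose Suc n) = 2 * (2 * real n + 1) * real ((2 * n) choose n)"
    by (simp only: of_nat_mult of_nat_Suc of_nat_numeral) (simp add: algebra_simps)
  then have "real ((2 * Suc n) choose Suc n) * (2 * real n + 2) = 4 * (real ((2 * n) choose n) * (2 * real n + 1))"
    by argo
  then show ?thesis unfolding ret_def power_Suc times_divide_eq_left by (simp only:) simp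
qed

text \<open>Wallis' bound: from \<open>n\<close> to \<open>n + 1\<close> the left side is multiplied
  by \<open>(2 n + 1) (2 n + 3) / (2 n + 2)^2 < 1\<close>.\<close>

lemma ret_le: "(ret n)\<^sup>2 * (2 * real n + 1) \<le> 1"
proof (induction n)
  case 0 then show ?case by (simp add: ret_def)
next
  case (Suc n)
  have e: "ret (Suc n) = ret n * (2 * real n + 1) / (2 * real n + 2)"
    using ret_Suc[of n] by (simp add: field_simps)
  have "(ret (Suc n))\<^sup>2 * (2 * real (Suc n) + 1) = ((ret n)\<^sup>2 * (2 * real n + 1)) * ((2 * real n + 1) * (2 * real n + 3) / (2 * real n + 2)\<^sup>2)"
    unfolding e by (simp add: power2_eq_square field_simps)
  also have "... \<le> 1 * 1"
  proof (intro mult_mono Suc)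
    have "0 < (2 * real n + 2)\<^sup>2" by (intro zero_less_power) simp
    then show "(2 * real n + 1) * (2 * real n + 3) / (2 * real n + 2)\<^sup>2 \<le> 1"
      by (subst pos_divide_le_eq) (simp_all add: power2_eq_square algebra_simps)
  qed auto
  finally show ?case by simp
qed

text \<open>In the binomial expansion the summand \<open>k\<close> carries the character
  \<open>2 k - 2 n\<close>. As \<open>2 n < L\<close>, only \<open>k = n\<close> survives the
  average, exactly as for the uniform distribution on the circle. This is why traces are compared
  directly only below order \<open>L\<close>.\<close>

lemma sum_Re_rotations:
  assumes n: "2 * n < L"
  shows "(\<Sum>\<psi>\<in>{0..<int L}. (Re (rootu L \<psi> * W)) ^ (2 * n)) = real L * ret n * (cmod W) ^ (2 * n)"
proof -
  have L: "L > 0" using n by simp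
  have Re: "of_real (Re z) = (z + cnj z) / 2" for z by (simp add: complex_eq_iff)
  have pw: "of_real ((Re (rootu L \<psi> * W)) ^ (2 * n)) =
    (\<Sum>k\<le>2*n. of_nat ((2 * n) choose k) * W ^ k * cnj W ^ (2 * n - k) / 4 ^ n * rootu L (\<psi> * (2 * int k - 2 * int n)))" for \<psi>
  proof -
    have "of_real ((Re (rootu L \<psi> * W)) ^ (2 * n)) = (rootu L \<psi> * W + cnj (rootu L \<psi> * W)) ^ (2 * n) / 4 ^ n"
      by (simp only: of_real_power Re) (simp add: power_divide power_mult)
    also have "... = (\<Sum>k\<le>2*n. of_nat ((2 * n) choose k) * (rootu L \<psi> * W) ^ k * (cnj (rootu L \<psi> * W)) ^ (2 * n - k)) / 4 ^ n"
      by (subst binomial_ring) simp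
    also have "... = (\<Sum>k\<le>2*n. of_nat ((2 * n) choose k) * W ^ k * cnj W ^ (2 * n - k) / 4 ^ n * rootu L (\<psi> * (2 * int k - 2 * int n)))"
      unfolding sum_divide_distrib
    proof (rule sum.cong[OF refl])
      fix k assume k: "k \<in> {..2*n}"
      have "(rootu L \<psi>) ^ k * (cnj (rootu L \<psi>)) ^ (2 * n - k) = rootu L (\<psi> * (2 * int k - 2 * int n))"
        unfolding rootu_minus[symmetric] rootu_power rootu_add[symmetric] using k by (simp add: of_nat_diff algebra_simps)
      then show "of_nat ((2 * n) choose k) * (rootu L \<psi> * W) ^ k * (cnj (rootu L \<psi> * W)) ^ (2 * n - k) / 4 ^ n =
        of_nat ((2 * n) choose k) * W ^ k * cnj W ^ (2 * n - k) / 4 ^ n * rootu L (\<psi> * (2 * int k - 2 * int n))"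
        by (simp add: power_mult_distrib)
    qed
    finally show ?thesis .
  qed
  have "of_real (\<Sum>\<psi>\<in>{0..<int L}. (Re (rootu L \<psi> * W)) ^ (2 * n)) =
    (\<Sum>\<psi>\<in>{0..<int L}. \<Sum>k\<le>2*n. of_nat ((2 * n) choose k) * W ^ k * cnj W ^ (2 * n - k) / 4 ^ n * rootu L (\<psi> * (2 * int k - 2 * int n)))"
    unfolding of_real_sum pw ..
  also have "... = (\<Sum>k\<le>2*n. of_nat ((2 * n) choose k) * W ^ k * cnj W ^ (2 * n - k) / 4 ^ n * (\<Sum>\<psi>\<in>{0..<int L}. rootu L (\<psi> * (2 * int k - 2 * int n))))"
    by (subst sum.swap) (simp only: sum_distrib_left)
  also have "... = (\<Sum>k\<le>2*n. if k = n then of_nat ((2 * n) choose n) * W ^ n * cnj W ^ n / 4 ^ n * of_nat L else 0)"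
  proof (rule sum.cong[OF refl])
    fix k assume k: "k \<in> {..2*n}"
    have "int L dvd 2 * int k - 2 * int n \<longleftrightarrow> k = n"
    proof
      assume dvd: "int L dvd 2 * int k - 2 * int n"
      show "k = n"
      proof (rule ccontr)
        assume "k \<noteq> n"
        then have "2 * int k - 2 * int n \<noteq> 0" by simp
        then have "\<bar>int L\<bar> \<le> \<bar>2 * int k - 2 * int n\<bar>" using dvd by (rule dvd_imp_le_int)
        then show False using k n by (auto simp: abs_if split: if_splits)
      qed
    qed simp
    then show "of_nat ((2 * n) choose k) * W ^ k * cnj W ^ (2 * n - k) / 4 ^ n * (\<Sum>\<psi>\<in>{0..<int L}. rootu L (\<psi> * (2 * int k - 2 * int n))) =
      (if k = n then of_nat ((2 * n) choose n) * W ^ n * cnj W ^ n / 4 ^ n * of_nat L else 0)"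
      unfolding sum_rootu[OF L] by simp
  qed
  also have "... = of_nat ((2 * n) choose n) * W ^ n * cnj W ^ n / 4 ^ n * of_nat L" by simp
  also have "... = of_real (real L * ret n * (cmod W) ^ (2 * n))"
  proof -
    have "W ^ n * cnj W ^ n = of_real ((cmod W) ^ (2 * n))"
      unfolding power_mult_distrib[symmetric] complex_norm_square[symmetric] by (simp add: power_mult)
    then show ?thesis by (simp add: ret_def mult_ac)
  qed
  finally show ?thesis by (simp only: of_real_eq_iff)
qed

text \<open>The inscribed circle of the probability simplex, with centre
  \<open>(1/3, 1/3, 1/3)\<close> and squared radius \<open>1/6\<close>. It touches the edges at the
  three permutations of \<open>(0, 1/2, 1/2)\<close>.\<close>

definition circle :: "(nat => real) => bool" where
  "circle p \<longleftrightarrow> (\<forall>\<nu>\<in>dirs. p \<nu> \<ge> 0) \<and> sum p dirs = 1 \<and> (\<Sum>\<nu>\<in>dirs. (p \<nu>)\<^sup>2) = 1 / 2"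

definition p_good :: "nat => real" where "p_good \<nu> = (if \<nu> = 1 then 0 else 1 / 2)"

lemma circle_good: "circle p_good"
  by (simp add: circle_def p_good_def power2_eq_square)

definition Wc :: "nat => (nat => real) => site => complex" where
  "Wc L p k = (\<Sum>\<nu>\<in>dirs. of_real (p \<nu>) * rootu L (crd \<nu> k))"

lemma Re_Wc: "Re (Wc L p k) = symb L dirs p k"
  unfolding Wc_def symb_def cosL_eq cosI_def by simp

text \<open>Shifting all three momenta by \<open>\<psi>\<close> multiplies \<open>Wc\<close> by a
  root of unity. The eigenvalue is the real part of \<open>Wc\<close>; averaging its even powers
  over \<open>\<psi>\<close> leaves the modulus and a return probability.\<close>

lemma sum_symb_even:
  assumes n: "2 * n < L"
  shows "(\<Sum>k\<in>torus L. symb L dirs p k ^ (2 * n)) = ret n * (\<Sum>k\<in>torus L. (cmod (Wc L p k)) ^ (2 * n))"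
proof -
  have L: "L > 0" using n by simp
  let ?T = "\<lambda>\<psi> k. shift L 1 \<psi> (shift L 2 \<psi> (shift L 3 \<psi> k))"
  have inv: "(\<Sum>k\<in>torus L. f (?T \<psi> k)) = (\<Sum>k\<in>torus L. f k)" for f :: "site => real" and \<psi>
    using sum_shift[OF L, of "\<lambda>k. f (shift L 1 \<psi> (shift L 2 \<psi> k))" 3 \<psi>]
      sum_shift[OF L, of "\<lambda>k. f (shift L 1 \<psi> k)" 2 \<psi>] sum_shift[OF L, of f 1 \<psi>] by simp
  have ang: "rootu L (crd \<nu> (?T \<psi> k)) = rootu L \<psi> * rootu L (crd \<nu> k)" if "\<nu> \<in> dirs" for \<nu> \<psi> k
  proof -
    have "crd \<nu> (?T \<psi> k) = (crd \<nu> k + \<psi>) mod int L"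
      using that by (cases k) (auto simp: shift_def crd_def upd_def)
    then show ?thesis using L by (simp add: rootu_add mult.commute)
  qed
  have W: "Wc L p (?T \<psi> k) = rootu L \<psi> * Wc L p k" for \<psi> k
    unfolding Wc_def sum_distrib_left by (intro sum.cong refl, subst ang) (auto simp: mult_ac)
  have "real L * (\<Sum>k\<in>torus L. symb L dirs p k ^ (2 * n)) = (\<Sum>\<psi>\<in>{0..<int L}. \<Sum>k\<in>torus L. Re (Wc L p k) ^ (2 * n))"
    by (simp only: Re_Wc) simp
  also have "... = (\<Sum>\<psi>\<in>{0..<int L}. \<Sum>k\<in>torus L. Re (rootu L \<psi> * Wc L p k) ^ (2 * n))"
    by (simp only: W[symmetric] inv[of "\<lambda>k. Re (Wc L p k) ^ (2 * n)"])
  also have "... = (\<Sum>k\<in>torus L. \<Sum>\<psi>\<in>{0..<int L}. Re (rootu L \<psi> * Wc L p k) ^ (2 * n))"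
    by (rule sum.swap)
  also have "... = real L * (ret n * (\<Sum>k\<in>torus L. (cmod (Wc L p k)) ^ (2 * n)))"
    unfolding sum_Re_rotations[OF n] by (simp only: sum_distrib_left mult.assoc)
  finally show ?thesis using L by simp
qed

definition Xd :: "nat => nat => nat => site => real" where
  "Xd L \<nu> \<delta> k = (1 + Cd L \<nu> \<delta> k) / 2"

lemma Xd_nonneg: "Xd L \<nu> \<delta> k \<ge> 0"
  unfolding Xd_def Cd_def using cosI_bounds[of L "crd \<nu> k - crd \<delta> k"] by (simp add: abs_le_iff)

text \<open>On the circle the products of two different weights add up to 1/4, so that the constant
  \<open>1/2\<close>, the sum of the squared weights, can be distributed over the three pairs. The
  squared modulus becomes a convex combination, with weights
  \<open>4 * p \<nu> * p \<delta>\<close>, of the values \<open>Xd\<close> that belong to the three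
  touching points.\<close>

lemma cmod_Wc:
  assumes "circle p"
  shows "(cmod (Wc L p k))\<^sup>2 = 4 * p 1 * p 2 * Xd L 1 2 k + 4 * p 1 * p 3 * Xd L 1 3 k + 4 * p 2 * p 3 * Xd L 2 3 k"
proof -
  define u where "u \<nu> = rootu L (crd \<nu> k)" for \<nu>
  have C: "Cd L \<nu> \<delta> k = Re (u \<nu>) * Re (u \<delta>) + Im (u \<nu>) * Im (u \<delta>)" for \<nu> \<delta>
  proof -
    have "rootu L (crd \<nu> k - crd \<delta> k) = u \<nu> * cnj (u \<delta>)"
      unfolding u_def rootu_minus[symmetric] rootu_add[symmetric] by simp
    then show ?thesis by (simp add: Cd_def cosI_def)
  qed
  have n1: "(Re (u \<nu>))\<^sup>2 + (Im (u \<nu>))\<^sup>2 = 1" for \<nu>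
    using cmod_power2[of "u \<nu>"] by (simp add: u_def)
  have s: "p 1 + p 2 + p 3 = 1" "(p 1)\<^sup>2 + (p 2)\<^sup>2 + (p 3)\<^sup>2 = 1 / 2"
    using assms by (auto simp: circle_def)
  have "(p 1 + p 2 + p 3)\<^sup>2 = 1" using s by simp
  then have e2: "p 1 * p 2 + p 1 * p 3 + p 2 * p 3 = 1 / 4"
    using s(2) by (simp add: power2_eq_square algebra_simps)
  have W: "Wc L p k = of_real (p 1) * u 1 + of_real (p 2) * u 2 + of_real (p 3) * u 3"
    by (simp add: Wc_def u_def)
  have "(cmod (Wc L p k))\<^sup>2 = (p 1 * Re (u 1) + p 2 * Re (u 2) + p 3 * Re (u 3))\<^sup>2 + (p 1 * Im (u 1) + p 2 * Im (u 2) + p 3 * Im (u 3))\<^sup>2"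
    unfolding cmod_power2 W by simp
  also have "... = (p 1)\<^sup>2 * ((Re (u 1))\<^sup>2 + (Im (u 1))\<^sup>2) + (p 2)\<^sup>2 * ((Re (u 2))\<^sup>2 + (Im (u 2))\<^sup>2)
     + (p 3)\<^sup>2 * ((Re (u 3))\<^sup>2 + (Im (u 3))\<^sup>2)
     + 2 * p 1 * p 2 * Cd L 1 2 k + 2 * p 1 * p 3 * Cd L 1 3 k + 2 * p 2 * p 3 * Cd L 2 3 k"
    unfolding C by (simp add: power2_eq_square algebra_simps)
  also have "... = 1 / 2 + 2 * p 1 * p 2 * Cd L 1 2 k + 2 * p 1 * p 3 * Cd L 1 3 k + 2 * p 2 * p 3 * Cd L 2 3 k"
    unfolding n1 using s(2) by simp
  also have "... = 2 * (p 1 * p 2 + p 1 * p 3 + p 2 * p 3) + 2 * p 1 * p 2 * Cd L 1 2 k + 2 * p 1 * p 3 * Cd L 1 3 k + 2 * p 2 * p 3 * Cd L 2 3 k"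
    unfolding e2 by simp
  also have "... = 4 * p 1 * p 2 * Xd L 1 2 k + 4 * p 1 * p 3 * Xd L 1 3 k + 4 * p 2 * p 3 * Xd L 2 3 k"
    by (simp add: Xd_def field_simps)
  finally show ?thesis .
qed

lemma power_jensen3:
  fixes x y z a b c :: real
  assumes "x \<ge> 0" "y \<ge> 0" "z \<ge> 0" "a \<ge> 0" "b \<ge> 0" "c \<ge> 0" "a + b + c = 1"
  shows "(a * x + b * y + c * z) ^ n \<le> a * x ^ n + b * y ^ n + c * z ^ n"
proof (induction n)
  case 0 then show ?case using assms by simp
next
  case (Suc n)
  have co: "(s - t) * (s ^ n - t ^ n) \<ge> 0" if "s \<ge> 0" "t \<ge> 0" for s t :: real
  proof (cases "s \<le> t")
    case True
    then show ?thesis using power_mono[OF True that(1), of n] by (intro mult_nonpos_nonpos) auto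
  next
    case False
    then show ?thesis using power_mono[of t s n] that by (intro mult_nonneg_nonneg) auto
  qed
  have "(a * x + b * y + c * z) ^ Suc n \<le> (a * x + b * y + c * z) * (a * x ^ n + b * y ^ n + c * z ^ n)"
    unfolding power_Suc using assms by (intro mult_left_mono Suc) simp
  also have "... = (a + b + c) * (a * x ^ Suc n + b * y ^ Suc n + c * z ^ Suc n)
     - (a * b * ((x - y) * (x ^ n - y ^ n)) + a * c * ((x - z) * (x ^ n - z ^ n)) + b * c * ((y - z) * (y ^ n - z ^ n)))"
    by (simp add: algebra_simps)
  also have "... \<le> (a + b + c) * (a * x ^ Suc n + b * y ^ Suc n + c * z ^ Suc n)"
  proof -
    have "0 \<le> a * b * ((x - y) * (x ^ n - y ^ n)) + a * c * ((x - z) * (x ^ n - z ^ n)) + b * c * ((y - z) * (y ^ n - z ^ n))"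
      using assms by (intro add_nonneg_nonneg mult_nonneg_nonneg[of "_ * _"] co) auto
    then show ?thesis by simp
  qed
  finally show ?case using assms by simp
qed

lemma circle_pair_weights:
  assumes "circle p"
  shows "4 * p 1 * p 2 \<ge> 0" "4 * p 1 * p 3 \<ge> 0" "4 * p 2 * p 3 \<ge> 0" "4 * p 1 * p 2 + 4 * p 1 * p 3 + 4 * p 2 * p 3 = 1"
proof -
  have s: "p 1 + p 2 + p 3 = 1" "(p 1)\<^sup>2 + (p 2)\<^sup>2 + (p 3)\<^sup>2 = 1 / 2" "p 1 \<ge> 0" "p 2 \<ge> 0" "p 3 \<ge> 0"
    using assms by (auto simp: circle_def)
  show "4 * p 1 * p 2 \<ge> 0" "4 * p 1 * p 3 \<ge> 0" "4 * p 2 * p 3 \<ge> 0" using s by simp_all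
  have "(p 1 + p 2 + p 3)\<^sup>2 = 1" using s by simp
  then show "4 * p 1 * p 2 + 4 * p 1 * p 3 + 4 * p 2 * p 3 = 1"
    using s(2) by (simp add: power2_eq_square algebra_simps)
qed

lemma sum_Xd:
  assumes "L > 0" "\<nu> \<in> dirs" "\<delta> \<in> dirs" "\<nu> \<noteq> \<delta>"
  shows "(\<Sum>k\<in>torus L. Xd L \<nu> \<delta> k ^ n) = (\<Sum>k\<in>torus L. Xd L 2 3 k ^ n)"
  using sum_Cd[OF assms, of "\<lambda>c. ((1 + c) / 2) ^ n"] sum_Cd[OF assms(1), of 2 3 "\<lambda>c. ((1 + c) / 2) ^ n"]
  by (simp add: Xd_def)

lemma sum_symb_good:
  assumes n: "2 * n < L"
  shows "(\<Sum>k\<in>torus L. symb L dirs p_good k ^ (2 * n)) = ret n * (\<Sum>k\<in>torus L. Xd L 2 3 k ^ n)"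
  unfolding sum_symb_even[OF n] unfolding power_mult cmod_Wc[OF circle_good] by (simp add: p_good_def)

text \<open>Jensen for the convex combination in \<open>cmod_Wc\<close>. The three \<open>Xd\<close>
  have equal power sums by symmetry (\<open>sum_Xd\<close>), and for \<open>p_good\<close> the
  combination is a single \<open>Xd\<close>.\<close>

lemma sum_symb_le:
  assumes n: "2 * n < L" and p: "circle p"
  shows "(\<Sum>k\<in>torus L. symb L dirs p k ^ (2 * n)) \<le> (\<Sum>k\<in>torus L. symb L dirs p_good k ^ (2 * n))"
proof -
  have L: "L > 0" using n by simp
  have "(\<Sum>k\<in>torus L. (cmod (Wc L p k)) ^ (2 * n)) \<le>
    (\<Sum>k\<in>torus L. 4 * p 1 * p 2 * Xd L 1 2 k ^ n + 4 * p 1 * p 3 * Xd L 1 3 k ^ n + 4 * p 2 * p 3 * Xd L 2 3 k ^ n)"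
    unfolding power_mult cmod_Wc[OF p]
    by (intro sum_mono power_jensen3 Xd_nonneg circle_pair_weights[OF p])
  also have "... = (4 * p 1 * p 2 + 4 * p 1 * p 3 + 4 * p 2 * p 3) * (\<Sum>k\<in>torus L. Xd L 2 3 k ^ n)"
    unfolding sum.distrib sum_distrib_left[symmetric]
    using sum_Xd[OF L, of 1 2 n] sum_Xd[OF L, of 1 3 n] by (simp add: algebra_simps)
  also have "... = (\<Sum>k\<in>torus L. Xd L 2 3 k ^ n)" unfolding circle_pair_weights(4)[OF p] by simp
  finally show ?thesis unfolding sum_symb_good[OF n] sum_symb_even[OF n]
    by (intro mult_left_mono) (auto intro: less_imp_le[OF ret_pos])
qed

text \<open>The cosines \<open>Cd\<close> of two pairs that share one direction are uncorrelated,
  each with mean square 1/2.\<close>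

lemma sum_Xd_diff:
  assumes L: "L > 2" and d: "{\<nu>, \<delta>, \<epsilon>} = dirs"
  shows "(\<Sum>k\<in>torus L. (Xd L \<nu> \<delta> k - Xd L \<nu> \<epsilon> k)\<^sup>2) = real L ^ 3 / 4"
proof -
  have "card {\<nu>, \<delta>, \<epsilon>} = 3" unfolding d by simp
  then have ne: "\<nu> \<noteq> \<delta>" "\<nu> \<noteq> \<epsilon>" by (auto simp: card_insert_if split: if_splits)
  have m: "\<nu> \<in> dirs" "\<delta> \<in> dirs" "\<epsilon> \<in> dirs" using d by auto
  have L0: "L > 0" "L > 1" using L by auto
  have sq: "(\<Sum>k\<in>torus L. (Cd L \<nu> \<delta> k)\<^sup>2) = real L ^ 3 / 2" "(\<Sum>k\<in>torus L. (Cd L \<nu> \<epsilon> k)\<^sup>2) = real L ^ 3 / 2"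
    using sum_Cd[OF L0(1) m(1,2) ne(1), of "\<lambda>c. c\<^sup>2"] sum_Cd[OF L0(1) m(1,3) ne(2), of "\<lambda>c. c\<^sup>2"] sum_cosI2[OF L]
    by (simp_all add: power2_eq_square power3_eq_cube)
  have "(\<Sum>k\<in>torus L. (Xd L \<nu> \<delta> k - Xd L \<nu> \<epsilon> k)\<^sup>2) =
    (\<Sum>k\<in>torus L. (Cd L \<nu> \<delta> k)\<^sup>2 / 4 + (Cd L \<nu> \<epsilon> k)\<^sup>2 / 4 - Cd L \<nu> \<delta> k * Cd L \<nu> \<epsilon> k / 2)"
    by (intro sum.cong refl) (simp add: Xd_def power2_eq_square field_simps)
  also have "... = real L ^ 3 / 4"
    unfolding sum_subtractf sum.distrib sum_divide_distrib[symmetric] sq sum_Cd_Cd[OF L0(2) d] by simp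
  finally show ?thesis .
qed

text \<open>For squares the defect in Jensen's inequality is a variance and can be computed exactly:
  the squared differences of the \<open>Xd\<close> each sum to \<open>L^3 / 4\<close>, the weights
  give \<open>a * b + a * c + b * c = 16 * p 1 * p 2 * p 3\<close>, and \<open>ret 2 = 3 / 8\<close>
  produces the factor \<open>3 / 2\<close>.\<close>

lemma sum_symb_4:
  assumes L: "L > 4" and p: "circle p"
  shows "(\<Sum>k\<in>torus L. symb L dirs p k ^ 4) = (\<Sum>k\<in>torus L. symb L dirs p_good k ^ 4) - 3 / 2 * p 1 * p 2 * p 3 * real L ^ 3"
proof -
  define a where "a = 4 * p 1 * p 2"
  define b where "b = 4 * p 1 * p 3"
  define c where "c = 4 * p 2 * p 3"
  have abc: "a + b + c = 1" unfolding a_def b_def c_def by (rule circle_pair_weights(4)[OF p])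
  have n: "2 * 2 < L" using L by simp
  have L0: "L > 0" "L > 2" using L by auto
  have d: "{1, 2, 3} = dirs" "{2, 1, 3} = dirs" "{3, 1, 2} = dirs" by auto
  have XC: "Xd L \<nu> \<delta> k = Xd L \<delta> \<nu> k" for \<nu> \<delta> k by (simp add: Xd_def Cd_commute[of L \<nu> \<delta>])
  have sq: "(a * x + b * y + c * z)\<^sup>2 = a * x\<^sup>2 + b * y\<^sup>2 + c * z\<^sup>2 - (a * b * (x - y)\<^sup>2 + a * c * (x - z)\<^sup>2 + b * c * (y - z)\<^sup>2)" for x y z :: real
  proof -
    have "(a * x + b * y + c * z)\<^sup>2 = (a + b + c) * (a * x\<^sup>2 + b * y\<^sup>2 + c * z\<^sup>2) - (a * b * (x - y)\<^sup>2 + a * c * (x - z)\<^sup>2 + b * c * (y - z)\<^sup>2)"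
      by (simp add: power2_eq_square algebra_simps)
    then show ?thesis unfolding abc by simp
  qed
  have "(\<Sum>k\<in>torus L. (cmod (Wc L p k)) ^ (2 * 2)) =
    (\<Sum>k\<in>torus L. a * (Xd L 1 2 k)\<^sup>2 + b * (Xd L 1 3 k)\<^sup>2 + c * (Xd L 2 3 k)\<^sup>2
       - (a * b * (Xd L 1 2 k - Xd L 1 3 k)\<^sup>2 + a * c * (Xd L 1 2 k - Xd L 2 3 k)\<^sup>2 + b * c * (Xd L 1 3 k - Xd L 2 3 k)\<^sup>2))"
    unfolding power_mult cmod_Wc[OF p] a_def[symmetric] b_def[symmetric] c_def[symmetric] sq ..
  also have "... = (a + b + c) * (\<Sum>k\<in>torus L. (Xd L 2 3 k)\<^sup>2) - (a * b + a * c + b * c) * (real L ^ 3 / 4)"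
  proof -
    have e: "(\<Sum>k\<in>torus L. (Xd L 1 2 k)\<^sup>2) = (\<Sum>k\<in>torus L. (Xd L 2 3 k)\<^sup>2)"
      "(\<Sum>k\<in>torus L. (Xd L 1 3 k)\<^sup>2) = (\<Sum>k\<in>torus L. (Xd L 2 3 k)\<^sup>2)"
      by (rule sum_Xd[OF L0(1)]; simp)+
    have f: "(\<Sum>k\<in>torus L. (Xd L 1 2 k - Xd L 1 3 k)\<^sup>2) = real L ^ 3 / 4"
      "(\<Sum>k\<in>torus L. (Xd L 1 2 k - Xd L 2 3 k)\<^sup>2) = real L ^ 3 / 4"
      "(\<Sum>k\<in>torus L. (Xd L 1 3 k - Xd L 2 3 k)\<^sup>2) = real L ^ 3 / 4"
      using sum_Xd_diff[OF L0(2) d(1)] sum_Xd_diff[OF L0(2) d(2)] sum_Xd_diff[OF L0(2) d(3)]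
      unfolding XC[of 2 1] XC[of 3 1] XC[of 3 2] .
    show ?thesis
      unfolding sum_subtractf sum.distrib sum_distrib_left[symmetric] e f by (simp add: algebra_simps)
  qed
  also have "a * b + a * c + b * c = 16 * (p 1 * p 2 * p 3) * (p 1 + p 2 + p 3)"
    unfolding a_def b_def c_def by (simp add: algebra_simps)
  also have "p 1 + p 2 + p 3 = 1" using p by (simp add: circle_def)
  finally have W4: "(\<Sum>k\<in>torus L. (cmod (Wc L p k)) ^ (2 * 2)) = (\<Sum>k\<in>torus L. (Xd L 2 3 k)\<^sup>2) - 4 * (p 1 * p 2 * p 3) * real L ^ 3"
    unfolding abc by simp
  have "(4::nat) choose 2 = 6" by (simp add: eval_nat_numeral)
  then have r2: "ret 2 = 3 / 8" by (simp add: ret_def)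
  show ?thesis
    using sum_symb_even[OF n, of p] sum_symb_good[OF n] unfolding W4 r2 by (simp add: algebra_simps)
qed

lemma sum_symb_good_le:
  assumes n: "2 * n < L"
  shows "(\<Sum>k\<in>torus L. symb L dirs p_good k ^ (2 * n)) \<le> real L ^ 3 * ret n"
proof -
  have L: "L > 0" using n by simp
  have "Xd L 2 3 k ^ n \<le> 1" for k
  proof -
    have "Xd L 2 3 k \<le> 1" unfolding Xd_def Cd_def using cosI_bounds[of L "crd 2 k - crd 3 k"] by simp
    then show ?thesis using Xd_nonneg by (intro power_le_one) auto
  qed
  then have "(\<Sum>k\<in>torus L. Xd L 2 3 k ^ n) \<le> (\<Sum>k\<in>torus L. 1)" by (intro sum_mono)
  also have "... = real L ^ 3" by (simp add: card_torus)
  finally show ?thesis unfolding sum_symb_good[OF n] using ret_pos[of n] by (simp add: mult.commute[of "ret n"] mult_right_mono)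
qed

lemma walk_weights_good: "walk_weights 1 p_good p_good"
  by (auto simp: walk_weights_def p_good_def)

lemma ktrace_good:
  assumes L: "even L" "L > 0"
  shows "ktrace (torus L) (walk L 1 p_good p_good) m = (\<Sum>k\<in>torus L. symb L dirs p_good k ^ m)"
proof -
  have "band_mid L 1 p_good p_good k = symb L dirs p_good k" "band_gap L 1 p_good p_good k = 0" for k
  proof -
    have "p_good 1 = 0" by (simp add: p_good_def)
    then show "band_mid L 1 p_good p_good k = symb L dirs p_good k" "band_gap L 1 p_good p_good k = 0"
      using symb_split[of 1 L p_good k] unfolding band_mid_def band_gap_def by simp_all
  qed
  then show ?thesis unfolding ktrace_walk[OF L walk_weights_good] by simp
qed

text \<open>The deficit per site of the fourth trace. The first part is the variance term of
  \<open>sum_symb_4\<close>, averaged over \<open>p\<close> and \<open>q\<close>. The second stems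
  from the defect in \<open>fourth_power_spread\<close>, summed over the momenta, where each squared
  cosine averages to 1/2.\<close>

definition pattern_gap :: "nat => (nat => real) => (nat => real) => real" where
  "pattern_gap \<alpha> p q = 3 / 4 * (p 1 * p 2 * p 3 + q 1 * q 2 * q 3) + (p \<alpha>)\<^sup>2 / 4 * (\<Sum>\<nu>\<in>dirs - {\<alpha>}. (p \<nu> - q \<nu>)\<^sup>2)"

context
  fixes L \<alpha> :: nat and p q :: "nat => real"
  assumes L: "even L" "L > 4" and \<alpha>: "\<alpha> \<in> dirs" "p \<alpha> = q \<alpha>" and pq: "circle p" "circle q"
begin

lemma walk_weights_circle: "walk_weights \<alpha> p q"
  using \<alpha> pq unfolding walk_weights_def circle_def by blast

private lemma L0: "L > 0" "L > 2" "L > 1" using L by auto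

lemma ktrace_walk_le_good:
  assumes m: "even m" "m < L"
  shows "ktrace (torus L) (walk L \<alpha> p q) m \<le> ktrace (torus L) (walk L 1 p_good p_good) m"
proof -
  obtain n where n: "m = 2 * n" using m by (elim evenE)
  then have nL: "2 * n < L" using m by simp
  have aux: "t \<le> g" if "t \<le> (a + b) / 2" "a \<le> g" "b \<le> g" for t a b g :: real
    using that by argo
  show ?thesis
    unfolding ktrace_good[OF L(1) L0(1)] n
    by (rule aux[OF ktrace_walk_even_le(1)[OF L(1) L0(1) walk_weights_circle m(1)[unfolded n]] sum_symb_le[OF nL pq(1)] sum_symb_le[OF nL pq(2)]])
qed

lemma ktrace_walk_4:
  "ktrace (torus L) (walk L \<alpha> p q) 4 = ktrace (torus L) (walk L 1 p_good p_good) 4 - pattern_gap \<alpha> p q * real L ^ 3"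
proof -
  obtain \<nu> where "\<nu> \<in> dirs" "\<nu> \<noteq> \<alpha>" using \<alpha> by (metis insert_iff num.distinct(1) numeral_eq_iff one_eq_numeral_iff)
  then obtain \<delta> where d: "{\<alpha>, \<nu>, \<delta>} = dirs" "\<delta> \<noteq> \<alpha>" "\<delta> \<noteq> \<nu>" using third_dir[of \<alpha> \<nu>] \<alpha> by metis
  have G: "dirs - {\<alpha>} = {\<nu>, \<delta>}" using d \<open>\<nu> \<noteq> \<alpha>\<close> by blast
  define u where "u = p \<nu> - q \<nu>"
  define v where "v = p \<delta> - q \<delta>"
  have diff: "symb L (dirs - {\<alpha>}) p k - symb L (dirs - {\<alpha>}) q k = u * cosL L k \<nu> + v * cosL L k \<delta>" for k
    unfolding symb_def G u_def v_def using d(3) by (simp add: algebra_simps)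
  have e: "(\<Sum>k\<in>torus L. (p \<alpha> * cosL L k \<alpha>)\<^sup>2 * ((symb L (dirs - {\<alpha>}) p k - symb L (dirs - {\<alpha>}) q k) / 2)\<^sup>2) =
     (\<Sum>k\<in>torus L. (p \<alpha>)\<^sup>2 / 4 * u\<^sup>2 * ((cosI L (crd \<alpha> k))\<^sup>2 * ((cosI L (crd \<nu> k))\<^sup>2 * 1))
       + (p \<alpha>)\<^sup>2 / 4 * v\<^sup>2 * ((cosI L (crd \<alpha> k))\<^sup>2 * (1 * (cosI L (crd \<delta> k))\<^sup>2))
       + (p \<alpha>)\<^sup>2 / 2 * u * v * ((cosI L (crd \<alpha> k))\<^sup>2 * (cosI L (crd \<nu> k) * cosI L (crd \<delta> k))))"
    unfolding diff cosL_eq by (intro sum.cong refl) (simp add: power2_eq_square field_simps)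
  also have "... = (p \<alpha>)\<^sup>2 / 16 * (u\<^sup>2 + v\<^sup>2) * real L ^ 3"
    unfolding sum.distrib sum_distrib_left[symmetric]
      sum_torus_prod[OF d(1), of "\<lambda>a. (cosI L a)\<^sup>2" "\<lambda>a. (cosI L a)\<^sup>2" "\<lambda>_. 1"]
      sum_torus_prod[OF d(1), of "\<lambda>a. (cosI L a)\<^sup>2" "\<lambda>_. 1" "\<lambda>a. (cosI L a)\<^sup>2"]
      sum_torus_prod[OF d(1), of "\<lambda>a. (cosI L a)\<^sup>2" "\<lambda>a. cosI L a" "\<lambda>a. cosI L a"]
      sum_cosI2[OF L0(2)] sum_cosI[OF L0(3)]
    by (simp add: power3_eq_cube field_simps)
  also have "u\<^sup>2 + v\<^sup>2 = (\<Sum>\<nu>\<in>dirs - {\<alpha>}. (p \<nu> - q \<nu>)\<^sup>2)"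
    unfolding G u_def v_def using d(3) by simp
  finally have e': "(\<Sum>k\<in>torus L. (p \<alpha> * cosL L k \<alpha>)\<^sup>2 * ((symb L (dirs - {\<alpha>}) p k - symb L (dirs - {\<alpha>}) q k) / 2)\<^sup>2) =
    (p \<alpha>)\<^sup>2 / 16 * (\<Sum>\<nu>\<in>dirs - {\<alpha>}. (p \<nu> - q \<nu>)\<^sup>2) * real L ^ 3" .
  show ?thesis
    unfolding ktrace_walk_even_le(2)[OF L(1) L0(1) walk_weights_circle even_numeral] e' ktrace_good[OF L(1) L0(1)]
      sum_symb_4[OF L(2) pq(1)] sum_symb_4[OF L(2) pq(2)] pattern_gap_def
    by (simp add: field_simps)
qed

text \<open>Even traces decrease, and \<open>2 * (L div 2 - 1) = L - 2\<close> is the last even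
  order to which the comparison by Fourier averages applies.\<close>

lemma ktrace_walk_tail:
  assumes m: "even m" "L \<le> m"
  shows "ktrace (torus L) (walk L \<alpha> p q) m \<le> real L ^ 3 * ret (L div 2 - 1)"
proof -
  have ev: "2 * (L div 2) = L" using L by simp
  have "ktrace (torus L) (walk L \<alpha> p q) m \<le> ktrace (torus L) (walk L \<alpha> p q) (2 * (L div 2 - 1))"
    by (rule ktrace_walk_decreasing[OF L(1) L0(1) walk_weights_circle]) (use m ev in auto)
  also have "... \<le> ktrace (torus L) (walk L 1 p_good p_good) (2 * (L div 2 - 1))"
    by (rule ktrace_walk_le_good) (use L ev in auto)
  also have "... \<le> real L ^ 3 * ret (L div 2 - 1)"
    unfolding ktrace_good[OF L(1) L0(1)] by (rule sum_symb_good_le) (use L ev in linarith)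
  finally show ?thesis .
qed

end

section \<open>Comparison of free energies\<close>

text \<open>Per site and uniformly in \<open>L\<close>, this bounds how much the part of order below
  \<open>L\<close> in the trace series of the reference walk changes when the parameter
  \<open>t\<close> replaces 1.\<close>

definition mass_error :: "real => real" where
  "mass_error t = (\<Sum>n. if even n then ret (n div 2) * (1 - t ^ n) / n else 0)"

text \<open>The return probability is at most \<open>n powr (- 1 / 2)\<close> by
  \<open>ret_le\<close>, so after division by \<open>n\<close> the series converges without any help
  from \<open>t\<close>. This allows the mass to tend to 0.\<close>

lemma ret_div_le:
  assumes "even n"
  shows "ret (n div 2) / n \<le> real n powr (- 3 / 2)"
proof (cases "n = 0")
  case False
  then have n: "real n > 0" by simp
  have e: "2 * real (n div 2) = real n" using assms by (simp add: real_of_nat_div)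
  have "(ret (n div 2))\<^sup>2 * real n \<le> (ret (n div 2))\<^sup>2 * (2 * real (n div 2) + 1)"
    unfolding e by (intro mult_left_mono) auto
  also have "... \<le> 1" by (rule ret_le)
  finally have "(ret (n div 2))\<^sup>2 \<le> (real n powr (- 1 / 2))\<^sup>2"
  proof -
    have "(real n powr (- 1 / 2))\<^sup>2 = real n powr (- 1 / 2 + - 1 / 2)"
      by (simp only: power2_eq_square powr_add)
    also have "... = 1 / real n" using n by (simp add: powr_minus_divide)
    finally show "(ret (n div 2))\<^sup>2 \<le> (real n powr (- 1 / 2))\<^sup>2"
      if "(ret (n div 2))\<^sup>2 * real n \<le> 1" using that n by (simp add: pos_le_divide_eq)
  qed
  then have "ret (n div 2) \<le> real n powr (- 1 / 2)"
    by (rule power2_le_imp_le) simp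
  then have "ret (n div 2) / n \<le> real n powr (- 1 / 2) / real n powr 1"
    using n by (simp add: divide_right_mono)
  also have "... = real n powr (- 3 / 2)" by (simp only: powr_diff[symmetric]) simp
  finally show ?thesis .
qed simp

lemma summable_n_powr: "summable (\<lambda>n. real n powr (- 3 / 2))"
  by (subst summable_real_powr_iff) simp

lemma mass_error_summand:
  assumes "0 \<le> t" "t \<le> 1"
  shows "0 \<le> (if even n then ret (n div 2) * (1 - t ^ n) / n else 0)"
    and "(if even n then ret (n div 2) * (1 - t ^ n) / n else 0) \<le> real n powr (- 3 / 2)"
proof -
  have t: "0 \<le> 1 - t ^ n" "1 - t ^ n \<le> 1" using assms by (auto simp: power_le_one)
  show "0 \<le> (if even n then ret (n div 2) * (1 - t ^ n) / n else 0)"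
    using t ret_pos[of "n div 2"] by (auto intro!: divide_nonneg_nonneg mult_nonneg_nonneg)
  have "ret (n div 2) * (1 - t ^ n) / n \<le> ret (n div 2) * 1 / n"
    using t ret_pos[of "n div 2"] by (intro divide_right_mono mult_left_mono) auto
  then show "(if even n then ret (n div 2) * (1 - t ^ n) / n else 0) \<le> real n powr (- 3 / 2)"
    using ret_div_le[of n] by auto
qed

lemma summable_mass_error:
  assumes "0 \<le> t" "t \<le> 1"
  shows "summable (\<lambda>n. if even n then ret (n div 2) * (1 - t ^ n) / n else 0)"
  by (rule summable_comparison_test'[OF summable_n_powr])
     (use mass_error_summand[OF assms] in \<open>simp only: real_norm_def abs_of_nonneg\<close>)

text \<open>Each summand tends to 0, and Tannery's theorem applies with the majorant
  \<open>n powr (- 3 / 2)\<close>.\<close>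

lemma mass_error_tendsto: "(mass_error \<longlongrightarrow> 0) (at_left 1)"
proof -
  have "eventually (\<lambda>t::real. 0 \<le> t \<and> t \<le> 1) (at_left 1)"
    using eventually_at_left_real[of 0 1] by (auto elim: eventually_mono)
  then have *: "\<forall>\<^sub>F (n, t) in sequentially \<times>\<^sub>F at_left 1.
      norm (if even n then ret (n div 2) * (1 - t ^ n) / n else 0) \<le> real n powr (- 3 / 2)"
    unfolding eventually_prod_filter
    by (intro exI[of _ "\<lambda>_. True"] exI[of _ "\<lambda>t. 0 \<le> t \<and> t \<le> 1"] conjI)
       (auto simp only: real_norm_def abs_of_nonneg[OF mass_error_summand(1)] mass_error_summand(2) eventually_True split_conv)
  have "((\<lambda>t::real. \<Sum>n. if even n then ret (n div 2) * (1 - t ^ n) / n else 0) \<longlongrightarrow> (\<Sum>n. 0)) (at_left 1)"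
  proof (rule tannerys_theorem[OF _ * summable_n_powr, THEN conjunct2, THEN conjunct2])
    fix n
    have "((\<lambda>t::real. ret (n div 2) / n * (1 - t ^ n)) \<longlongrightarrow> ret (n div 2) / n * (1 - 1 ^ n)) (at_left 1)"
      by (intro tendsto_intros)
    then have "((\<lambda>t::real. ret (n div 2) * (1 - t ^ n) / n) \<longlongrightarrow> 0) (at_left 1)" by simp
    then show "((\<lambda>t::real. if even n then ret (n div 2) * (1 - t ^ n) / n else 0) \<longlongrightarrow> 0) (at_left 1)"
      by (cases "even n") (simp_all only: if_True if_False tendsto_const)
  qed auto
  then show ?thesis unfolding mass_error_def by simp
qed

lemma sums_minus_ln_one_minus:
  fixes t :: real
  assumes "\<bar>t\<bar> < 1"
  shows "(\<lambda>n. t ^ n / n) sums (- ln (1 - t))"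
  using sums_minus[OF ln_series'[of "- t"]] assms by simp

lemma summable_ktrace_div:
  assumes "contraction_kernel I A" "\<bar>t\<bar> < 1"
  shows "summable (\<lambda>n. ktrace I A n / n * t ^ n)"
proof (rule summable_comparison_test')
  show "summable (\<lambda>n. real (card I) * \<bar>t\<bar> ^ n)"
    using assms by (intro summable_mult summable_geometric) auto
  show "norm (ktrace I A n / n * t ^ n) \<le> real (card I) * \<bar>t\<bar> ^ n" for n
  proof -
    have "\<bar>ktrace I A n / n\<bar> \<le> card I"
    proof (cases "n = 0")
      case False
      then have "\<bar>ktrace I A n / n\<bar> \<le> \<bar>ktrace I A n\<bar> / 1" unfolding abs_divide
        by (intro divide_left_mono) auto
      then show ?thesis using ktrace_abs_le[OF assms(1), of n] by simp
    qed simp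
    then show ?thesis unfolding real_norm_def abs_mult power_abs by (intro mult_right_mono) auto
  qed
qed

lemma kpow_nonneg: "(\<And>i j. A i j \<ge> 0) ==> kpow I A n i j \<ge> 0"
  by (induction n arbitrary: j) (auto intro!: sum_nonneg)

lemma gaussZ_pos:
  assumes "contraction_kernel I A" "\<bar>t\<bar> < 1"
  shows "gaussZ I (id_minus t A) > 0"
  by (rule gauss_pos[OF _ _ quad_id_minus_ge[OF assms(1)]]) (use assms in \<open>auto simp: contraction_kernel_def\<close>)

text \<open>Two masses appear because \<open>s\<close> stems from the upper bound for a pattern and
  \<open>t\<close> from the lower bound for the total partition function. Odd traces vanish, even
  traces of order below \<open>L\<close> are dominated, with the gap at order 4, and the others
  contribute at most \<open>ret (L div 2 - 1)\<close> times \<open>- ln (1 - s)\<close>.\<close>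

theorem free_energy_comparison:
  fixes L \<alpha> :: nat and p q :: "nat => real" and s t :: real
  assumes L: "even L" "L > 4" and \<alpha>: "\<alpha> \<in> dirs" "p \<alpha> = q \<alpha>" and pq: "circle p" "circle q"
    and s: "0 < s" "s < 1" and t: "0 < t" "t < 1" and gap: "pattern_gap \<alpha> p q \<ge> 0"
  defines "E \<equiv> (- pattern_gap \<alpha> p q * s ^ 4 / 4 + mass_error t - ret (L div 2 - 1) * ln (1 - s)) / 2"
  shows "gaussZ (torus L) (id_minus s (walk L \<alpha> p q)) \<le> exp (real L ^ 3 * E) * gaussZ (torus L) (id_minus t (walk L 1 p_good p_good))"
proof -
  have L0: "L > 0" using L by simp
  define A where "A = walk L \<alpha> p q"
  define G where "G = walk L 1 p_good p_good"
  define \<nu> where "\<nu> = pattern_gap \<alpha> p q"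
  define \<rho> where "\<rho> = ret (L div 2 - 1)"
  define N where "N = real L ^ 3"
  have N: "N > 0" using L by (simp add: N_def)
  have \<rho>: "\<rho> > 0" unfolding \<rho>_def by (rule ret_pos)
  have wt: "walk_weights \<alpha> p q" by (rule walk_weights_circle[OF L \<alpha> pq])
  have cA: "contraction_kernel (torus L) A" unfolding A_def by (rule contraction_walk[OF L(1) L0 wt])
  have cG: "contraction_kernel (torus L) G" unfolding G_def by (rule contraction_walk[OF L(1) L0 walk_weights_good])
  have G0: "ktrace (torus L) G n \<ge> 0" for n
    unfolding ktrace_def G_def by (intro sum_nonneg kpow_nonneg walk_nonneg[OF L(1) L0 walk_weights_good])
  have A0: "ktrace (torus L) A n \<ge> 0" for n
    unfolding ktrace_def A_def by (intro sum_nonneg kpow_nonneg walk_nonneg[OF L(1) L0 wt])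
  have Gle: "ktrace (torus L) G n \<le> N * ret (n div 2)" if "even n" "n < L" for n
    using sum_symb_good_le[of "n div 2" L] that unfolding G_def N_def ktrace_good[OF L(1) L0] by simp
  \<comment> \<open>A majorant per site for the difference of the two series: the gap at order 4,
    the price of the mass of the reference walk, and the tail of the pattern walk.\<close>
  define b where "b n = (if n = 4 then - \<nu> * s ^ 4 / 4 else 0) + (if even n then ret (n div 2) * (1 - t ^ n) / n else 0) + \<rho> * (s ^ n / n)" for n :: nat
  have bsums: "b sums (- \<nu> * s ^ 4 / 4 + mass_error t + \<rho> * (- ln (1 - s)))"
    unfolding b_def mass_error_def
    by (intro sums_add sums_single summable_sums summable_mass_error sums_mult sums_minus_ln_one_minus) (use s t in auto)
  have summand: "ktrace (torus L) A n / n * s ^ n - ktrace (torus L) G n / n * t ^ n \<le> N * b n" for n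
  proof (cases "n = 0")
    case True then show ?thesis by (simp add: b_def)
  next
    case n0: False
    then have n: "real n > 0" by simp
    have me: "(if even n then ret (n div 2) * (1 - t ^ n) / n else 0) \<ge> 0"
      by (rule mass_error_summand) (use t in auto)
    have re: "\<rho> * (s ^ n / n) \<ge> 0" using \<rho> s by simp
    have G1: "ktrace (torus L) G n / n * t ^ n \<ge> 0" using G0[of n] t by simp
    consider "odd n" | "even n" "n < L" | "even n" "L \<le> n" by linarith
    then show ?thesis
    proof cases
      case 1
      have "ktrace (torus L) A n = 0" unfolding A_def by (rule ktrace_walk_odd[OF L(1) L0 wt 1])
      moreover have "b n \<ge> 0" using re 1 by (auto simp: b_def)
      then have "N * b n \<ge> 0" using N by simp
      ultimately show ?thesis using G1 by simp
    next
      case 2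
      have le: "ktrace (torus L) A n \<le> ktrace (torus L) G n - (if n = 4 then \<nu> * N else 0)"
        using ktrace_walk_le_good[OF L \<alpha> pq 2] ktrace_walk_4[OF L \<alpha> pq] by (auto simp: A_def G_def \<nu>_def N_def)
      have sn: "s ^ n \<le> 1" "0 \<le> s ^ n" and tn: "t ^ n \<le> 1" using s t by (auto simp: power_le_one)
      have "ktrace (torus L) A n * s ^ n \<le> (ktrace (torus L) G n - (if n = 4 then \<nu> * N else 0)) * s ^ n"
        by (intro mult_right_mono le sn)
      also have "... = ktrace (torus L) G n * s ^ n - (if n = 4 then \<nu> * N * s ^ 4 else 0)"
        by (simp add: left_diff_distrib)
      also have "ktrace (torus L) G n * s ^ n \<le> ktrace (torus L) G n * 1" using sn G0 by (intro mult_left_mono) auto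
      finally have "ktrace (torus L) A n * s ^ n - ktrace (torus L) G n * t ^ n
        \<le> ktrace (torus L) G n * (1 - t ^ n) - (if n = 4 then \<nu> * N * s ^ 4 else 0)"
        by (simp add: right_diff_distrib)
      also have "ktrace (torus L) G n * (1 - t ^ n) \<le> N * ret (n div 2) * (1 - t ^ n)"
        using Gle[OF 2] tn by (intro mult_right_mono) auto
      finally have "(ktrace (torus L) A n * s ^ n - ktrace (torus L) G n * t ^ n) / n \<le>
        (N * ret (n div 2) * (1 - t ^ n) - (if n = 4 then \<nu> * N * s ^ 4 else 0)) / n"
        using n by (simp add: divide_right_mono)
      also have "... = N * (b n - \<rho> * (s ^ n / n))"
        using 2(1) n0 by (simp add: b_def field_simps)
      also have "... \<le> N * b n" using re N by (intro mult_left_mono) auto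
      finally show ?thesis by (simp add: diff_divide_distrib)
    next
      case 3
      have "ktrace (torus L) A n \<le> N * \<rho>"
        using ktrace_walk_tail[OF L \<alpha> pq 3] by (simp add: A_def N_def \<rho>_def)
      then have "ktrace (torus L) A n / n * s ^ n \<le> N * \<rho> / n * s ^ n"
        using s by (intro mult_right_mono divide_right_mono) auto
      also have "... = N * (\<rho> * (s ^ n / n))" by simp
      also have "... \<le> N * b n"
        using 3 L me N by (intro mult_left_mono) (auto simp: b_def)
      finally show ?thesis using G1 by linarith
    qed
  qed
  have sA: "summable (\<lambda>n. ktrace (torus L) A n / n * s ^ n)" by (rule summable_ktrace_div[OF cA]) (use s in auto)
  have sG: "summable (\<lambda>n. ktrace (torus L) G n / n * t ^ n)" by (rule summable_ktrace_div[OF cG]) (use t in auto)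
  have "(\<Sum>n. ktrace (torus L) A n / n * s ^ n) - (\<Sum>n. ktrace (torus L) G n / n * t ^ n) =
    (\<Sum>n. ktrace (torus L) A n / n * s ^ n - ktrace (torus L) G n / n * t ^ n)"
    by (rule suminf_diff[OF sA sG])
  also have "... \<le> (\<Sum>n. N * b n)"
    by (rule suminf_le[OF summand summable_diff[OF sA sG] summable_mult]) (use bsums in \<open>auto simp: sums_iff\<close>)
  also have "... = N * (2 * E)"
    using sums_mult[OF bsums, of N] by (simp add: sums_iff E_def \<nu>_def \<rho>_def)
  finally have main: "(\<Sum>n. ktrace (torus L) A n / n * s ^ n) / 2 \<le> N * E + (\<Sum>n. ktrace (torus L) G n / n * t ^ n) / 2"
    by argo
  have "\<bar>s\<bar> < 1" "\<bar>t\<bar> < 1" using s t by auto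
  note ln_gaussZ[OF cA this(1)] and ln_gaussZ[OF cG this(2)]
  then have "ln (gaussZ (torus L) (id_minus s A)) \<le> N * E + ln (gaussZ (torus L) (id_minus t G))"
    using main by linarith
  also have "... = ln (exp (N * E) * gaussZ (torus L) (id_minus t G))"
    using gaussZ_pos[OF cG \<open>\<bar>t\<bar> < 1\<close>] by (simp add: ln_mult)
  finally show ?thesis
    using gaussZ_pos[OF cG \<open>\<bar>t\<bar> < 1\<close>] gaussZ_pos[OF cA \<open>\<bar>s\<bar> < 1\<close>]
    by (subst (asm) ln_le_cancel_iff) (auto simp: A_def G_def N_def)
qed

section \<open>Spin patterns\<close>

definition phi :: "nat => real" where
  "phi \<nu> = (if \<nu> = 1 then 0 else if \<nu> = 2 then 2 * pi / 3 else - (2 * pi / 3))"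

lemma spin_proj_cos: "spin_proj \<nu> \<theta> = cos (\<theta> - phi \<nu>)"
  by (simp add: spin_proj_def phi_def)

lemma neighbour_eq_shift:
  assumes "\<nu> \<in> dirs" "r \<in> torus L"
  shows "modL L (vadd r (unit_vec \<nu>)) = shift L \<nu> 1 r"
  using assms by (cases r) (auto simp: modL_def vadd_def unit_vec_def shift_def upd_def crd_def torus_def)

definition edge_energy :: "nat => real => real => real" where
  "edge_energy \<nu> x y = (cos (x - phi \<nu>) - cos (y - phi \<nu>))\<^sup>2"

abbreviation edge_sum :: "nat => config => real" where
  "edge_sum L \<theta> \<equiv> (\<Sum>r\<in>torus L. \<Sum>\<nu>\<in>dirs. edge_energy \<nu> (\<theta> r) (\<theta> (shift L \<nu> 1 r)))"

lemma hamiltonian_eq: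
  "hamiltonian J L \<theta> = J / 2 * edge_sum L \<theta>"
  unfolding hamiltonian_def edge_energy_def
  by (intro arg_cong2[where f="(*)"] sum.cong refl) (simp only: spin_proj_cos neighbour_eq_shift)

lemma edge_energy_nonneg: "edge_energy \<nu> x y \<ge> 0"
  by (simp add: edge_energy_def)

lemma hamiltonian_nonneg: "J \<ge> 0 ==> hamiltonian J L \<theta> \<ge> 0"
  unfolding hamiltonian_eq by (intro mult_nonneg_nonneg sum_nonneg edge_energy_nonneg) auto

lemma measurable_hamiltonian [measurable]: "hamiltonian J L \<in> borel_measurable (config_measure L)"
proof (cases "L = 0")
  case True
  then have "torus L = {}" by (auto simp: torus_def)
  then show ?thesis by (simp add: hamiltonian_def[abs_def])
next
  case False
  have "(\<lambda>\<theta>. \<theta> r) \<in> borel_measurable (config_measure L)" if "r \<in> torus L" for r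
    unfolding config_measure_def using measurable_component_singleton[OF that, of "\<lambda>_. lborel :: real measure"] by simp
  then have m: "(\<lambda>\<theta>. cos (\<theta> r - a)) \<in> borel_measurable (config_measure L)" if "r \<in> torus L" for r a
    using that by (intro measurable_compose[OF _ borel_measurable_continuous_onI[of cos]] continuous_intros borel_measurable_diff) auto
  have "(\<lambda>\<theta>. J / 2 * edge_sum L \<theta>) \<in> borel_measurable (config_measure L)"
    unfolding edge_energy_def
  proof (intro borel_measurable_times borel_measurable_const borel_measurable_sum borel_measurable_power borel_measurable_diff m)
    show "shift L \<nu> 1 r \<in> torus L" if "r \<in> torus L" for \<nu> r using False that by (intro shift_torus) auto
  qed
  then show ?thesis unfolding hamiltonian_eq[abs_def] .
qed

definition near :: "real => real => real => bool" where
  "near e x y \<longleftrightarrow> (\<exists>n::int. \<bar>x - y - 2 * pi * of_int n\<bar> \<le> e)"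

text \<open>The reflection of the circle about the axis \<open>phi \<alpha>\<close>. It preserves
  the projection \<open>\<alpha>\<close>, so that an edge in direction \<open>\<alpha>\<close>
  between a spin and its mirror image has no energy.\<close>

definition fl :: "nat => real => real" where "fl \<alpha> x = 2 * phi \<alpha> - x"

lemma fl_fl [simp]: "fl \<alpha> (fl \<alpha> x) = x" by (simp add: fl_def)

text \<open>To leading order an edge in direction \<open>\<nu>\<close> costs
  \<open>(sin (c - phi \<nu>))^2\<close> times the squared difference of the deviations; the factor
  2/3 makes the three weights a probability vector.\<close>

definition stiff :: "real => nat => real" where
  "stiff c \<nu> = 2 / 3 * (sin (c - phi \<nu>))\<^sup>2"

lemma sin_cos_pi_3: "sin (2 * pi / 3) = sqrt 3 / 2" "cos (2 * pi / 3) = - 1 / 2"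
  by (simp_all add: sin_120 cos_120)

text \<open>For three angles at distance \<open>2 * pi / 3\<close> the squares of the sines add up
  to 3/2 and their fourth powers to 9/8, whatever \<open>c\<close> is.\<close>

lemma circle_stiff: "circle (stiff c)"
proof -
  define s where "s = sin c"
  define k where "k = cos c"
  have sk: "k\<^sup>2 = 1 - s\<^sup>2" unfolding s_def k_def by (simp add: cos_squared_eq)
  have 1: "stiff c 1 = 2 / 3 * s\<^sup>2" by (simp add: stiff_def phi_def s_def)
  have "sin (c - 2 * pi / 3) = - s / 2 - sqrt 3 / 2 * k" "sin (c + 2 * pi / 3) = - s / 2 + sqrt 3 / 2 * k"
    unfolding sin_diff sin_add sin_cos_pi_3 s_def k_def by simp_all
  then have 2: "stiff c 2 = 2 / 3 * (- s / 2 - sqrt 3 / 2 * k)\<^sup>2" and 3: "stiff c 3 = 2 / 3 * (- s / 2 + sqrt 3 / 2 * k)\<^sup>2"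
    by (simp_all add: stiff_def phi_def)
  have q3: "sqrt 3 * sqrt 3 = 3" by simp
  have e2: "(- s / 2 - sqrt 3 / 2 * k)\<^sup>2 = s\<^sup>2 / 4 + 3 / 4 * k\<^sup>2 + sqrt 3 / 2 * (s * k)"
    using q3 by (simp add: power2_eq_square field_simps)
  have e3: "(- s / 2 + sqrt 3 / 2 * k)\<^sup>2 = s\<^sup>2 / 4 + 3 / 4 * k\<^sup>2 - sqrt 3 / 2 * (s * k)"
    using q3 by (simp add: power2_eq_square field_simps)
  have "stiff c 1 + stiff c 2 + stiff c 3 = 1" unfolding 1 2 3 e2 e3 sk by (simp add: algebra_simps)
  moreover have "(stiff c 1)\<^sup>2 + (stiff c 2)\<^sup>2 + (stiff c 3)\<^sup>2 = 1 / 2"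
  proof -
    define a where "a = s\<^sup>2 / 4 + 3 / 4 * k\<^sup>2"
    define w where "w = sqrt 3 / 2 * (s * k)"
    have w2: "w\<^sup>2 = 3 / 4 * s\<^sup>2 * k\<^sup>2" unfolding w_def by (simp add: power_mult_distrib power_divide)
    have "(stiff c 2)\<^sup>2 + (stiff c 3)\<^sup>2 = 8 / 9 * (a\<^sup>2 + w\<^sup>2)"
      unfolding 2 3 e2 e3 a_def[symmetric] w_def[symmetric] by (simp add: power2_eq_square field_simps)
    also have "... = 8 / 9 * ((s\<^sup>2 / 4 + 3 / 4 * k\<^sup>2)\<^sup>2 + 3 / 4 * s\<^sup>2 * k\<^sup>2)" unfolding w2 a_def ..
    finally show ?thesis unfolding 1 sk by (simp add: power2_eq_square field_simps)
  qed
  ultimately show ?thesis by (simp add: circle_def) (simp add: stiff_def)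
qed

lemma stiff_fl: "stiff (fl \<alpha> c) \<alpha> = stiff c \<alpha>"
proof -
  have "fl \<alpha> c - phi \<alpha> = - (c - phi \<alpha>)" by (simp add: fl_def)
  then show ?thesis unfolding stiff_def by (simp only: sin_minus power2_minus)
qed

lemma cos_diff_mvt:
  fixes u x y :: real
  assumes "\<bar>x\<bar> \<le> \<delta>" "\<bar>y\<bar> \<le> \<delta>"
  obtains \<xi> where "\<bar>\<xi>\<bar> \<le> \<delta>" "(cos (u + x) - cos (u + y))\<^sup>2 = (sin (u + \<xi>))\<^sup>2 * (x - y)\<^sup>2"
proof -
  have *: thesis if xy: "x < y" "\<bar>x\<bar> \<le> \<delta>" "\<bar>y\<bar> \<le> \<delta>"
    and th: "\<And>\<xi>. \<bar>\<xi>\<bar> \<le> \<delta> ==> (cos (u + x) - cos (u + y))\<^sup>2 = (sin (u + \<xi>))\<^sup>2 * (x - y)\<^sup>2 ==> thesis" for x y thesis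
  proof -
    have "\<exists>z>x. z < y \<and> cos (u + y) - cos (u + x) = (y - x) * (- sin (u + z))"
      by (rule MVT2[OF xy(1)]) (auto intro!: derivative_eq_intros)
    then obtain z where z: "x < z" "z < y" "cos (u + y) - cos (u + x) = (y - x) * (- sin (u + z))" by auto
    have "(cos (u + x) - cos (u + y))\<^sup>2 = (cos (u + y) - cos (u + x))\<^sup>2" by (rule power2_commute)
    also have "... = (sin (u + z))\<^sup>2 * (x - y)\<^sup>2" unfolding z by (simp add: power2_eq_square algebra_simps)
    finally show thesis using th[of z] z xy by auto
  qed
  consider "x < y" | "x = y" | "y < x" by linarith
  then show thesis
  proof cases
    case 1 then show thesis using *[of x y] assms that by blast
  next
    case 2 then show thesis using that[of x] assms by simp
  next
    case 3
    show thesis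
    proof (rule *[OF 3 assms(2,1)])
      fix \<xi> assume "\<bar>\<xi>\<bar> \<le> \<delta>" "(cos (u + y) - cos (u + x))\<^sup>2 = (sin (u + \<xi>))\<^sup>2 * (y - x)\<^sup>2"
      then show thesis using that[of \<xi>] by (simp add: power2_commute)
    qed
  qed
qed

text \<open>The mean value theorem writes the energy as a squared sine at an intermediate point
  times the squared difference. Continuity of the sine suffices where \<open>sin u\<close> is not 0;
  elsewhere the left side vanishes.\<close>

lemma local_stiffness:
  fixes u \<epsilon> :: real
  assumes \<epsilon>: "0 < \<epsilon>" "\<epsilon> < 1"
  shows "\<exists>\<delta>>0. \<forall>x y. \<bar>x\<bar> \<le> \<delta> --> \<bar>y\<bar> \<le> \<delta> --> (1 - \<epsilon>) * (sin u)\<^sup>2 * (x - y)\<^sup>2 \<le> (cos (u + x) - cos (u + y))\<^sup>2"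
proof (cases "sin u = 0")
  case True
  then show ?thesis by (intro exI[of _ 1]) auto
next
  case False
  have "((\<lambda>z. (sin (u + z))\<^sup>2) \<longlongrightarrow> (sin (u + 0))\<^sup>2) (nhds 0)"
    by (intro tendsto_intros filterlim_ident)
  moreover have "(1 - \<epsilon>) * (sin u)\<^sup>2 < (sin (u + 0))\<^sup>2" using False \<epsilon> by simp
  ultimately have "eventually (\<lambda>z. (1 - \<epsilon>) * (sin u)\<^sup>2 < (sin (u + z))\<^sup>2) (nhds 0)"
    by (rule order_tendstoD)
  then obtain d where d: "d > 0" "\<And>z. dist z 0 < d ==> (1 - \<epsilon>) * (sin u)\<^sup>2 < (sin (u + z))\<^sup>2"
    unfolding eventually_nhds_metric by blast
  show ?thesis
  proof (intro exI[of _ "d / 2"] conjI allI impI)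
    show "d / 2 > 0" using d by simp
    fix x y :: real assume xy: "\<bar>x\<bar> \<le> d / 2" "\<bar>y\<bar> \<le> d / 2"
    obtain z where z: "\<bar>z\<bar> \<le> d / 2" "(cos (u + x) - cos (u + y))\<^sup>2 = (sin (u + z))\<^sup>2 * (x - y)\<^sup>2"
      using cos_diff_mvt[OF xy] by blast
    have "(1 - \<epsilon>) * (sin u)\<^sup>2 \<le> (sin (u + z))\<^sup>2" using d(2)[of z] z(1) d(1) by (simp add: less_imp_le)
    then show "(1 - \<epsilon>) * (sin u)\<^sup>2 * (x - y)\<^sup>2 \<le> (cos (u + x) - cos (u + y))\<^sup>2"
      unfolding z(2) by (intro mult_right_mono) auto
  qed
qed

text \<open>Mirroring every second layer in direction \<open>\<alpha>\<close>, as the flag \<open>b\<close> requests, costs no energy.\<close>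

definition pat_angle :: "bool => nat => real => site => real" where
  "pat_angle b \<alpha> c r = (if b \<and> odd (crd \<alpha> r) then fl \<alpha> c else c)"

text \<open>Deviations in mirrored layers are counted with the opposite sign, so that equal
  deviations at both ends of an edge in direction \<open>\<alpha>\<close> cost nothing.\<close>

definition pat_sign :: "bool => nat => site => real" where
  "pat_sign b \<alpha> r = (if b \<and> odd (crd \<alpha> r) then - 1 else 1)"

definition other_angle :: "bool => nat => real => real" where
  "other_angle b \<alpha> c = (if b then fl \<alpha> c else c)"

definition pat_gap :: "bool => nat => real => real" where
  "pat_gap b \<alpha> c = pattern_gap \<alpha> (stiff c) (stiff (other_angle b \<alpha> c))"

definition stiff_radius :: "real => bool => nat => real => real => bool" where
  "stiff_radius \<epsilon> b \<alpha> c \<delta> \<longleftrightarrow> (\<forall>a\<in>{c, other_angle b \<alpha> c}. \<forall>\<nu>\<in>dirs. \<forall>x y. \<bar>x\<bar> \<le> \<delta> --> \<bar>y\<bar> \<le> \<delta> -->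
     (1 - \<epsilon>) * (sin (a - phi \<nu>))\<^sup>2 * (x - y)\<^sup>2 \<le> (cos (a - phi \<nu> + x) - cos (a - phi \<nu> + y))\<^sup>2)"

lemma stiff_radius_exists:
  assumes "0 < \<epsilon>" "\<epsilon> < 1"
  shows "\<exists>\<delta>>0. \<delta> \<le> 1 \<and> stiff_radius \<epsilon> b \<alpha> c \<delta>"
proof -
  define U where "U = (\<lambda>(a, \<nu>). a - phi \<nu>) ` ({c, other_angle b \<alpha> c} \<times> dirs)"
  have "\<forall>u. \<exists>\<delta>>0. \<forall>x y. \<bar>x\<bar> \<le> \<delta> --> \<bar>y\<bar> \<le> \<delta> --> (1 - \<epsilon>) * (sin u)\<^sup>2 * (x - y)\<^sup>2 \<le> (cos (u + x) - cos (u + y))\<^sup>2"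
    using local_stiffness[OF assms] by blast
  then obtain d where d: "\<And>u. d u > 0"
    "\<And>u x y. \<bar>x\<bar> \<le> d u ==> \<bar>y\<bar> \<le> d u ==> (1 - \<epsilon>) * (sin u)\<^sup>2 * (x - y)\<^sup>2 \<le> (cos (u + x) - cos (u + y))\<^sup>2"
    by metis
  define \<delta> where "\<delta> = Min (insert 1 (d ` U))"
  have fin: "finite (insert 1 (d ` U))" by (simp add: U_def)
  have "\<delta> > 0" unfolding \<delta>_def using fin d(1) by (subst Min_gr_iff) auto
  moreover have "\<delta> \<le> 1" unfolding \<delta>_def using fin by (intro Min_le) auto
  moreover have "stiff_radius \<epsilon> b \<alpha> c \<delta>"
    unfolding stiff_radius_def
  proof (intro ballI allI impI)
    fix a \<nu> x y assume a: "a \<in> {c, other_angle b \<alpha> c}" "\<nu> \<in> dirs" and xy: "\<bar>x\<bar> \<le> \<delta>" "\<bar>y\<bar> \<le> \<delta>"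
    have "(a - phi \<nu>) \<in> U" unfolding U_def using a by (intro image_eqI[of _ _ "(a, \<nu>)"]) auto
    then have "\<delta> \<le> d (a - phi \<nu>)" unfolding \<delta>_def using fin by (intro Min_le) auto
    then show "(1 - \<epsilon>) * (sin (a - phi \<nu>))\<^sup>2 * (x - y)\<^sup>2 \<le> (cos (a - phi \<nu> + x) - cos (a - phi \<nu> + y))\<^sup>2"
      using xy by (intro d(2)) auto
  qed
  ultimately show ?thesis by blast
qed

text \<open>Every edge sees a single base angle: edges in other directions stay within a layer, and
  a mirrored edge in direction \<open>\<alpha>\<close> is unfolded by the evenness of the cosine.
  The bounds add up to the Dirichlet form of the alternating walk; the factor 3/2 undoes the
  normalization of \<open>stiff\<close>.\<close>

lemma pattern_energy:
  assumes L: "even L" "L > 0" and \<alpha>: "\<alpha> \<in> dirs" and sr: "stiff_radius \<epsilon> b \<alpha> c \<delta>" and J: "J \<ge> 0"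
    and \<theta>: "\<And>r. r \<in> torus L ==> \<theta> r = pat_angle b \<alpha> c r + pat_sign b \<alpha> r * x r" "\<And>r. r \<in> torus L ==> \<bar>x r\<bar> \<le> \<delta>"
  shows "3 * J / 2 * (1 - \<epsilon>) * (sumsq (torus L) x - quad (torus L) (walk L \<alpha> (stiff c) (stiff (other_angle b \<alpha> c))) x)
    \<le> hamiltonian J L \<theta>"
proof -
  define c' where "c' = other_angle b \<alpha> c"
  have st: "stiff c \<alpha> = stiff c' \<alpha>" by (simp add: c'_def other_angle_def stiff_fl)
  have wt: "walk_weights \<alpha> (stiff c) (stiff c')"
    using \<alpha> st circle_stiff unfolding walk_weights_def circle_def by blast
  have edge: "3 / 2 * (1 - \<epsilon>) * (wgt \<alpha> (stiff c) (stiff c') \<nu> r * (x r - x (shift L \<nu> 1 r))\<^sup>2) \<le> edge_energy \<nu> (\<theta> r) (\<theta> (shift L \<nu> 1 r))"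
    if r: "r \<in> torus L" and \<nu>: "\<nu> \<in> dirs" for r \<nu>
  proof -
    define s where "s = shift L \<nu> 1 r"
    have s: "s \<in> torus L" unfolding s_def by (rule shift_torus[OF L(2) r])
    have par: "odd (crd \<alpha> s) \<longleftrightarrow> (if \<nu> = \<alpha> then even (crd \<alpha> r) else odd (crd \<alpha> r))"
      unfolding s_def parity_shift[OF L wt \<nu>] by auto
    define a where "a = (if odd (crd \<alpha> r) then c' else c)"
    have ar: "pat_angle b \<alpha> c r = a" by (simp add: a_def pat_angle_def c'_def other_angle_def)
    have srr: "(1 - \<epsilon>) * (sin (a - phi \<nu>))\<^sup>2 * (u - v)\<^sup>2 \<le> (cos (a - phi \<nu> + u) - cos (a - phi \<nu> + v))\<^sup>2"
      if "\<bar>u\<bar> \<le> \<delta>" "\<bar>v\<bar> \<le> \<delta>" for u v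
      using sr \<nu> that unfolding stiff_radius_def a_def c'_def[symmetric] by (cases "odd (crd \<alpha> r)") auto
    have w: "3 / 2 * wgt \<alpha> (stiff c) (stiff c') \<nu> r = (sin (a - phi \<nu>))\<^sup>2"
      by (simp add: wgt_def stiff_def a_def)
    define \<sigma> where "\<sigma> = pat_sign b \<alpha> r"
    have \<sigma>: "\<sigma> = 1 \<or> \<sigma> = - 1" by (simp add: \<sigma>_def pat_sign_def)
    have abs: "\<bar>\<sigma> * x r\<bar> \<le> \<delta>" "\<bar>\<sigma> * x s\<bar> \<le> \<delta>" using \<theta>(2)[OF r] \<theta>(2)[OF s] \<sigma> by auto
    have cr: "cos (\<theta> r - phi \<nu>) = cos (a - phi \<nu> + \<sigma> * x r)"
      unfolding \<theta>(1)[OF r] ar \<sigma>_def by (simp add: algebra_simps)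
    have cs: "cos (\<theta> s - phi \<nu>) = cos (a - phi \<nu> + \<sigma> * x s)"
    proof (cases "\<nu> = \<alpha> \<and> b")
      case False
      then have "pat_angle b \<alpha> c s = a \<and> pat_sign b \<alpha> s = \<sigma>"
        using par by (auto simp: a_def c'_def pat_angle_def other_angle_def \<sigma>_def pat_sign_def)
      then show ?thesis unfolding \<theta>(1)[OF s] by (simp add: algebra_simps)
    next
      case True
      then have "pat_angle b \<alpha> c s = fl \<alpha> a \<and> pat_sign b \<alpha> s = - \<sigma>"
        using par by (auto simp: a_def c'_def pat_angle_def other_angle_def \<sigma>_def pat_sign_def)
      then have "\<theta> s - phi \<nu> = - (a - phi \<nu> + \<sigma> * x s)"
        unfolding \<theta>(1)[OF s] using True by (simp add: fl_def)
      then show ?thesis by (simp only: cos_minus)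
    qed
    have "3 / 2 * (1 - \<epsilon>) * (wgt \<alpha> (stiff c) (stiff c') \<nu> r * (x r - x s)\<^sup>2) =
       (1 - \<epsilon>) * (3 / 2 * wgt \<alpha> (stiff c) (stiff c') \<nu> r) * (\<sigma> * x r - \<sigma> * x s)\<^sup>2"
    proof -
      have "(\<sigma> * x r - \<sigma> * x s)\<^sup>2 = (x r - x s)\<^sup>2" using \<sigma> by (auto simp: power2_eq_square algebra_simps)
      then show ?thesis by simp
    qed
    also have "... \<le> edge_energy \<nu> (\<theta> r) (\<theta> s)"
      unfolding w edge_energy_def cr cs using abs by (rule srr)
    finally show ?thesis unfolding s_def .
  qed
  have "3 * J / 2 * (1 - \<epsilon>) * (sumsq (torus L) x - quad (torus L) (walk L \<alpha> (stiff c) (stiff c')) x) =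
    J / 2 * (\<Sum>r\<in>torus L. \<Sum>\<nu>\<in>dirs. 3 / 2 * (1 - \<epsilon>) * (wgt \<alpha> (stiff c) (stiff c') \<nu> r * (x r - x (shift L \<nu> 1 r))\<^sup>2))"
    unfolding dirichlet_form[OF L wt] sum_distrib_left[symmetric] by simp
  also have "... \<le> hamiltonian J L \<theta>"
    unfolding hamiltonian_eq using J by (intro mult_left_mono sum_mono edge) auto
  finally show ?thesis unfolding c'_def .
qed

lemma near_sets [measurable]: "{x. near e x y} \<in> sets borel"
proof -
  have "{x. near e x y} = (\<Union>n::int. {y + 2 * pi * of_int n - e .. y + 2 * pi * of_int n + e})"
    by (auto simp: near_def abs_le_iff algebra_simps)
  then show ?thesis by simp
qed

lemma near_periodic: "near e (x + 2 * pi) y \<longleftrightarrow> near e x y"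
proof
  assume "near e (x + 2 * pi) y"
  then obtain n :: int where "\<bar>x + 2 * pi - y - 2 * pi * of_int n\<bar> \<le> e" by (auto simp: near_def)
  then show "near e x y" unfolding near_def by (intro exI[of _ "n - 1"]) (simp add: algebra_simps)
next
  assume "near e x y"
  then obtain n :: int where "\<bar>x - y - 2 * pi * of_int n\<bar> \<le> e" by (auto simp: near_def)
  then show "near e (x + 2 * pi) y" unfolding near_def by (intro exI[of _ "n + 1"]) (simp add: algebra_simps)
qed

lemma near_centred:
  assumes "near e x y" "y - pi \<le> x" "x < y + pi" "e < pi"
  shows "\<bar>x - y\<bar> \<le> e"
proof -
  obtain n :: int where n: "\<bar>x - y - 2 * pi * of_int n\<bar> \<le> e" using assms(1) by (auto simp: near_def)
  have "n < 1"
  proof (rule ccontr)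
    assume "\<not> n < 1"
    then have "2 * pi * 1 \<le> 2 * pi * (of_int n :: real)" by (intro mult_left_mono) auto
    then show False using n[unfolded abs_le_iff] assms(2-4) by linarith
  qed
  moreover have "- 1 < n"
  proof (rule ccontr)
    assume "\<not> - 1 < n"
    then have "n \<le> - 1" by simp
    then have "(of_int n :: real) \<le> - 1" by linarith
    then have "2 * pi * (of_int n :: real) \<le> 2 * pi * (- 1)" by (intro mult_left_mono) auto
    then show False using n[unfolded abs_le_iff] assms(2-4) by linarith
  qed
  ultimately have "n = 0" by linarith
  then show ?thesis using n by simp
qed

lemma edge_energy_cong_2pi: "edge_energy \<nu> (x + 2 * pi) y = edge_energy \<nu> x y" "edge_energy \<nu> x (y + 2 * pi) = edge_energy \<nu> x y"
proof -
  have "cos (x + 2 * pi - phi \<nu>) = cos (x - phi \<nu>)" for x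
    using cos_periodic[of "x - phi \<nu>"] by (simp add: algebra_simps)
  then show "edge_energy \<nu> (x + 2 * pi) y = edge_energy \<nu> x y" "edge_energy \<nu> x (y + 2 * pi) = edge_energy \<nu> x y"
    by (simp_all add: edge_energy_def)
qed

lemma hamiltonian_periodic: "hamiltonian J L (\<theta>(r := \<theta> r + 2 * pi)) = hamiltonian J L \<theta>"
proof -
  have "edge_energy \<nu> ((\<theta>(r := \<theta> r + 2 * pi)) u) ((\<theta>(r := \<theta> r + 2 * pi)) v) = edge_energy \<nu> (\<theta> u) (\<theta> v)" for \<nu> u v
    by (cases "u = r"; cases "v = r") (simp_all only: fun_upd_same fun_upd_other edge_energy_cong_2pi not_False_eq_True)
  then show ?thesis unfolding hamiltonian_eq by (simp only:)
qed

lemma quad_scale: "quad I A (\<lambda>i. c * x i) = c\<^sup>2 * quad I A x"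
  unfolding quad_def sum_distrib_left by (intro sum.cong refl) (simp add: power2_eq_square algebra_simps)

lemma nn_integral_gaussZ:
  assumes "contraction_kernel I A" "\<bar>t\<bar> < 1"
  shows "(\<integral>\<^sup>+x. ennreal (gweight I (id_minus t A) x) \<partial>lborelP I) = ennreal (gaussZ I (id_minus t A))"
  unfolding gaussZ_def
  by (rule nn_integral_eq_integral[OF integrable_gauss[OF _ _ quad_id_minus_ge[OF assms(1)]]])
     (use assms in \<open>auto simp: contraction_kernel_def\<close>)

section \<open>Gaussian bounds for the partition functions\<close>

abbreviation angle_ind :: "nat => config => ennreal" where
  "angle_ind L \<theta> \<equiv> (\<Prod>r\<in>torus L. indicator {0..<2*pi} (\<theta> r))"

abbreviation boltz :: "real => real => nat => config => ennreal" where
  "boltz J \<beta> L \<theta> \<equiv> ennreal (exp (- \<beta> * hamiltonian J L \<theta>))"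

definition totZ :: "real => real => nat => ennreal" where
  "totZ J \<beta> L = (\<integral>\<^sup>+\<theta>. angle_ind L \<theta> * boltz J \<beta> L \<theta> \<partial>config_measure L)"

definition patZ :: "real => real => nat => bool => nat => real => real => ennreal" where
  "patZ J \<beta> L b \<alpha> c \<delta> = (\<integral>\<^sup>+\<theta>. angle_ind L \<theta> *
     ((\<Prod>r\<in>torus L. indicator {x. near \<delta> x (pat_angle b \<alpha> c r)} (\<theta> r)) * boltz J \<beta> L \<theta>) \<partial>config_measure L)"

text \<open>Since deviations are at most 1, a factor \<open>exp s\<close> per site pays for the
  additional weight \<open>exp (- s * sumsq)\<close>, which supplies the missing mass. Rescaling by
  \<open>1 / sqrt (K + 2 * s)\<close> normalizes the identity part of the form and leaves
  \<open>K / (K + 2 * s)\<close> in front of the walk.\<close>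

lemma patZ_le:
  fixes J \<beta> \<epsilon> s :: real
  assumes L: "even L" "L > 0" and \<alpha>: "\<alpha> \<in> dirs" and sr: "stiff_radius \<epsilon> b \<alpha> c \<delta>" and \<delta>: "0 < \<delta>" "\<delta> \<le> 1"
    and J: "J > 0" "\<beta> > 0" and \<epsilon>: "\<epsilon> < 1" and s: "s > 0"
  defines "K \<equiv> 3 * \<beta> * J * (1 - \<epsilon>)"
  shows "patZ J \<beta> L b \<alpha> c \<delta> \<le> ennreal ((exp s / sqrt (K + 2 * s)) ^ (L ^ 3) *
     gaussZ (torus L) (id_minus (K / (K + 2 * s)) (walk L \<alpha> (stiff c) (stiff (other_angle b \<alpha> c)))))"
proof -
  define A where "A = walk L \<alpha> (stiff c) (stiff (other_angle b \<alpha> c))"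
  have K: "K > 0" unfolding K_def using J \<epsilon> by simp
  define \<sigma> where "\<sigma> = 1 / sqrt (K + 2 * s)"
  have \<sigma>: "\<sigma> > 0" "\<sigma>\<^sup>2 * (K + 2 * s) = 1" unfolding \<sigma>_def using K s by (auto simp: power_divide)
  define a where "a = pat_angle b \<alpha> c"
  define g where "g = pat_sign b \<alpha>"
  have g: "g r = 1 \<or> g r = - 1" for r by (simp add: g_def pat_sign_def)
  have wt: "walk_weights \<alpha> (stiff c) (stiff (other_angle b \<alpha> c))"
    using \<alpha> circle_stiff stiff_fl unfolding walk_weights_def circle_def other_angle_def by (cases b) auto
  have cA: "contraction_kernel (torus L) A" unfolding A_def by (rule contraction_walk[OF L wt])
  let ?P = "lborelP (torus L) :: config measure"
  define F where "F \<theta> = (\<Prod>r\<in>torus L. indicator {x. near \<delta> x (a r)} (\<theta> r)) * boltz J \<beta> L \<theta>" for \<theta> :: config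
  have hm [measurable]: "hamiltonian J L \<in> borel_measurable ?P"
    using measurable_hamiltonian[of J L] by (simp add: config_measure_def)
  have Fm [measurable]: "F \<in> borel_measurable ?P"
    unfolding F_def by (intro borel_measurable_times_ennreal borel_measurable_prod_ennreal) measurable
  have per: "F (\<theta>(r := \<theta> r + 2 * pi)) = F \<theta>" for \<theta> r
  proof -
    have "indicator {x. near \<delta> x (a u)} ((\<theta>(r := \<theta> r + 2 * pi)) u) = (indicator {x. near \<delta> x (a u)} (\<theta> u) :: ennreal)" for u
      by (cases "u = r") (simp_all add: indicator_def near_periodic)
    then show ?thesis unfolding F_def hamiltonian_periodic by (simp only:)
  qed
  have "patZ J \<beta> L b \<alpha> c \<delta> = (\<integral>\<^sup>+\<theta>. angle_ind L \<theta> * F \<theta> \<partial>?P)"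
    unfolding patZ_def F_def a_def config_measure_def ..
  also have "... = (\<integral>\<^sup>+\<theta>. (\<Prod>r\<in>torus L. indicator {a r - pi..<a r - pi + 2 * pi} (\<theta> r)) * F \<theta> \<partial>?P)"
    by (rule nn_integral_PiM_periodic[OF finite_torus Fm per]) simp
  also have "... = ennreal (\<Prod>r\<in>torus L. \<bar>\<sigma> * g r\<bar>) * (\<integral>\<^sup>+z. (\<Prod>r\<in>torus L. indicator {a r - pi..<a r - pi + 2 * pi} ((\<lambda>r\<in>torus L. a r + \<sigma> * g r * z r) r)) * F (\<lambda>r\<in>torus L. a r + \<sigma> * g r * z r) \<partial>?P)"
  proof (rule nn_integral_PiM_affine[OF finite_torus])
    show "(\<lambda>\<theta>. (\<Prod>r\<in>torus L. indicator {a r - pi..<a r - pi + 2 * pi} (\<theta> r)) * F \<theta>) \<in> borel_measurable ?P"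
      by (intro borel_measurable_times_ennreal borel_measurable_prod_ennreal Fm) measurable
    show "\<sigma> * g r \<noteq> 0" for r using \<sigma>(1) g[of r] by auto
  qed
  also have "(\<Prod>r\<in>torus L. \<bar>\<sigma> * g r\<bar>) = \<sigma> ^ (L ^ 3)"
  proof -
    have "\<bar>\<sigma> * g r\<bar> = \<sigma>" for r using \<sigma>(1) g[of r] by auto
    then show ?thesis by (simp add: card_torus)
  qed
  also have "ennreal (\<sigma> ^ (L ^ 3)) * (\<integral>\<^sup>+z. (\<Prod>r\<in>torus L. indicator {a r - pi..<a r - pi + 2 * pi} ((\<lambda>r\<in>torus L. a r + \<sigma> * g r * z r) r)) * F (\<lambda>r\<in>torus L. a r + \<sigma> * g r * z r) \<partial>?P)
    \<le> ennreal (\<sigma> ^ (L ^ 3)) * (\<integral>\<^sup>+z. ennreal (exp s ^ (L ^ 3)) * ennreal (exp (- quad (torus L) (id_minus (K / (K + 2 * s)) A) z / 2)) \<partial>?P)"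
  proof (intro mult_left_mono nn_integral_mono)
    fix z :: config
    define \<theta> where "\<theta> = (\<lambda>r\<in>torus L. a r + \<sigma> * g r * z r)"
    define x where "x r = \<sigma> * z r" for r
    show "(\<Prod>r\<in>torus L. indicator {a r - pi..<a r - pi + 2 * pi} (\<theta> r)) * F \<theta>
      \<le> ennreal (exp s ^ (L ^ 3)) * ennreal (exp (- quad (torus L) (id_minus (K / (K + 2 * s)) A) z / 2))"
    proof (cases "\<forall>r\<in>torus L. \<theta> r \<in> {a r - pi..<a r - pi + 2 * pi} \<and> near \<delta> (\<theta> r) (a r)")
      case False
      then have "(\<Prod>r\<in>torus L. indicator {a r - pi..<a r - pi + 2 * pi} (\<theta> r) :: ennreal) = 0 \<or>
         (\<Prod>r\<in>torus L. indicator {x. near \<delta> x (a r)} (\<theta> r) :: ennreal) = 0"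
        by (auto simp: prod_zero_iff indicator_def)
      then show ?thesis unfolding F_def by (elim disjE) (simp_all only: mult_zero_left mult_zero_right zero_le)
    next
      case True
      have \<theta>r: "\<theta> r = a r + g r * x r" if "r \<in> torus L" for r using that by (simp add: \<theta>_def x_def mult_ac)
      have xr: "\<bar>x r\<bar> \<le> \<delta>" if r: "r \<in> torus L" for r
      proof -
        have "\<bar>\<theta> r - a r\<bar> \<le> \<delta>"
          using True r \<delta> pi_gt3 by (intro near_centred) (auto simp: algebra_simps)
        then show ?thesis using \<theta>r[OF r] g[of r] by auto
      qed
      have en: "3 * J / 2 * (1 - \<epsilon>) * (sumsq (torus L) x - quad (torus L) A x) \<le> hamiltonian J L \<theta>"
        unfolding A_def by (rule pattern_energy[OF L \<alpha> sr _ \<theta>r[unfolded a_def g_def] xr]) (use J in auto)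
      have "\<beta> * (3 * J / 2 * (1 - \<epsilon>) * (sumsq (torus L) x - quad (torus L) A x)) \<le> \<beta> * hamiltonian J L \<theta>"
        using J en by (intro mult_left_mono) auto
      then have en': "K / 2 * (sumsq (torus L) x - quad (torus L) A x) \<le> \<beta> * hamiltonian J L \<theta>"
        unfolding K_def by (simp add: mult_ac)
      have "sumsq (torus L) x \<le> (\<Sum>r\<in>torus L. 1)"
      proof (rule sum_mono)
        fix r assume "r \<in> torus L"
        then have "\<bar>x r\<bar> \<le> 1" using xr[of r] \<delta> by linarith
        then show "(x r)\<^sup>2 \<le> 1" by (simp add: abs_square_le_1)
      qed
      then have sx: "s * sumsq (torus L) x \<le> s * real (L ^ 3)"
        using s by (intro mult_left_mono) (auto simp: card_torus)
      have q: "quad (torus L) (id_minus (K / (K + 2 * s)) A) z = (K + 2 * s) * sumsq (torus L) x - K * quad (torus L) A x"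
      proof -
        have "(K + 2 * s) * sumsq (torus L) x = (\<sigma>\<^sup>2 * (K + 2 * s)) * (\<Sum>r\<in>torus L. (z r)\<^sup>2)"
          by (simp add: x_def power_mult_distrib sum_distrib_left mult_ac)
        moreover have "K * quad (torus L) A x = (\<sigma>\<^sup>2 * (K + 2 * s)) * (K / (K + 2 * s) * quad (torus L) A z)"
          unfolding x_def quad_scale using K s by (simp add: field_simps)
        ultimately show ?thesis unfolding \<sigma>(2) quad_id_minus[OF finite_torus] by simp
      qed
      have "- \<beta> * hamiltonian J L \<theta> \<le> real (L ^ 3) * s + - quad (torus L) (id_minus (K / (K + 2 * s)) A) z / 2"
      proof -
        have "quad (torus L) (id_minus (K / (K + 2 * s)) A) z / 2 = K / 2 * (sumsq (torus L) x - quad (torus L) A x) + s * sumsq (torus L) x"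
          unfolding q by (simp add: field_simps)
        moreover have "- \<beta> * hamiltonian J L \<theta> = - (\<beta> * hamiltonian J L \<theta>)" "real (L ^ 3) * s = s * real (L ^ 3)" by simp_all
        ultimately show ?thesis using en' sx by linarith
      qed
      then have "exp (- \<beta> * hamiltonian J L \<theta>) \<le> exp (real (L ^ 3) * s + - quad (torus L) (id_minus (K / (K + 2 * s)) A) z / 2)"
        by (simp only: exp_le_cancel_iff)
      also have "... = exp s ^ (L ^ 3) * exp (- quad (torus L) (id_minus (K / (K + 2 * s)) A) z / 2)"
        by (simp only: exp_add exp_of_nat_mult)
      finally have ex: "boltz J \<beta> L \<theta> \<le> ennreal (exp s ^ (L ^ 3)) * ennreal (exp (- quad (torus L) (id_minus (K / (K + 2 * s)) A) z / 2))"
        by (subst ennreal_mult[symmetric]) (auto intro!: ennreal_leI)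
      have "(\<Prod>r\<in>torus L. indicator {a r - pi..<a r - pi + 2 * pi} (\<theta> r) :: ennreal) = 1"
        "(\<Prod>r\<in>torus L. indicator {x. near \<delta> x (a r)} (\<theta> r) :: ennreal) = 1"
        using True by (auto intro!: prod.neutral)
      then show ?thesis unfolding F_def using ex by simp
    qed
  qed simp
  also have "... = ennreal (\<sigma> ^ (L ^ 3)) * (ennreal (exp s ^ (L ^ 3)) * ennreal (gaussZ (torus L) (id_minus (K / (K + 2 * s)) A)))"
  proof -
    have "\<bar>K / (K + 2 * s)\<bar> < 1" using K s by simp
    then show ?thesis
      using nn_integral_gaussZ[OF cA] by (subst nn_integral_cmult) auto
  qed
  also have "... = ennreal ((exp s / sqrt (K + 2 * s)) ^ (L ^ 3) * gaussZ (torus L) (id_minus (K / (K + 2 * s)) A))"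
  proof -
    have "\<bar>K / (K + 2 * s)\<bar> < 1" using K s by simp
    then have "gaussZ (torus L) (id_minus (K / (K + 2 * s)) A) > 0" by (rule gaussZ_pos[OF cA])
    then show ?thesis using \<sigma>(1)
      by (simp add: ennreal_mult[symmetric] \<sigma>_def power_divide mult_ac)
  qed
  finally show ?thesis unfolding A_def .
qed

text \<open>At the angle \<open>pi\<close> the first projection is stationary, so its edges cost
  only fourth order in the deviations; they are bounded by \<open>4 * w^2 * sumsq\<close>, which
  acts as a mass. In the other two directions the squared sine is 3/4, perturbed by at most
  \<open>2 * w\<close>, and this gives the walk with weights \<open>p_good\<close>.\<close>

lemma ground_energy_upper:
  assumes L: "even L" "L > 0" and J: "J \<ge> 0" and w: "0 < w" "w \<le> 1"
    and \<theta>: "\<And>r. r \<in> torus L ==> \<theta> r = pi + x r" "\<And>r. r \<in> torus L ==> \<bar>x r\<bar> \<le> w"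
  shows "hamiltonian J L \<theta> \<le> J / 2 * (4 * w\<^sup>2 * sumsq (torus L) x
    + (3 + 8 * w) * (sumsq (torus L) x - quad (torus L) (walk L 1 p_good p_good) x))"
proof -
  have sin_w: "\<bar>sin (u + \<xi>) - sin u\<bar> \<le> \<bar>\<xi>\<bar>" for u \<xi> :: real
  proof -
    have "\<bar>sin (u + \<xi>) - sin u\<bar> = 2 * \<bar>sin (\<xi> / 2)\<bar> * \<bar>cos ((u + \<xi> + u) / 2)\<bar>"
      unfolding sin_diff_sin by (simp add: abs_mult)
    also have "... \<le> 2 * \<bar>\<xi> / 2\<bar> * 1" by (intro mult_mono abs_sin_x_le_abs_x) auto
    finally show ?thesis by simp
  qed
  have edge: "edge_energy \<nu> (\<theta> r) (\<theta> (shift L \<nu> 1 r)) \<le>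
     (if \<nu> = 1 then 2 * w\<^sup>2 * ((x r)\<^sup>2 + (x (shift L \<nu> 1 r))\<^sup>2) else (3 + 8 * w) / 2 * (p_good \<nu> * (x r - x (shift L \<nu> 1 r))\<^sup>2))"
    if r: "r \<in> torus L" and \<nu>: "\<nu> \<in> dirs" for r \<nu>
  proof -
    define s where "s = shift L \<nu> 1 r"
    have s: "s \<in> torus L" unfolding s_def by (rule shift_torus[OF L(2) r])
    obtain \<xi> where \<xi>: "\<bar>\<xi>\<bar> \<le> w" "(cos (pi - phi \<nu> + x r) - cos (pi - phi \<nu> + x s))\<^sup>2 = (sin (pi - phi \<nu> + \<xi>))\<^sup>2 * (x r - x s)\<^sup>2"
      using cos_diff_mvt[OF \<theta>(2)[OF r] \<theta>(2)[OF s]] by blast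
    have e: "edge_energy \<nu> (\<theta> r) (\<theta> s) = (sin (pi - phi \<nu> + \<xi>))\<^sup>2 * (x r - x s)\<^sup>2"
      unfolding edge_energy_def \<theta>(1)[OF r] \<theta>(1)[OF s] \<xi>(2)[symmetric] by (simp add: algebra_simps)
    show ?thesis
    proof (cases "\<nu> = 1")
      case True
      have "\<bar>sin (pi + \<xi>)\<bar> \<le> w" using sin_w[of pi \<xi>] \<xi>(1) by simp
      then have "(sin (pi + \<xi>))\<^sup>2 \<le> w\<^sup>2" using w by (simp add: abs_le_square_iff[symmetric])
      then have "edge_energy \<nu> (\<theta> r) (\<theta> s) \<le> w\<^sup>2 * (x r - x s)\<^sup>2"
        unfolding e using True by (intro mult_right_mono) (simp_all add: phi_def)
      also have "... \<le> w\<^sup>2 * (2 * ((x r)\<^sup>2 + (x s)\<^sup>2))"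
      proof (rule mult_left_mono)
        have "0 \<le> (x r + x s)\<^sup>2" by simp
        then show "(x r - x s)\<^sup>2 \<le> 2 * ((x r)\<^sup>2 + (x s)\<^sup>2)" by (simp add: power2_eq_square algebra_simps)
      qed simp
      finally have "edge_energy \<nu> (\<theta> r) (\<theta> s) \<le> 2 * w\<^sup>2 * ((x r)\<^sup>2 + (x s)\<^sup>2)" by (simp only: mult_ac)
      then show ?thesis unfolding s_def using True by (simp only: simp_thms if_True)
    next
      case False
      have s3: "(sin (pi - phi \<nu>))\<^sup>2 = 3 / 4"
        using False \<nu> by (auto simp: phi_def sin_diff sin_add sin_cos_pi_3 power_divide)
      define S where "S = sin (pi - phi \<nu>)"
      define T where "T = sin (pi - phi \<nu> + \<xi>)"
      have ST: "\<bar>T - S\<bar> \<le> w" "\<bar>T\<bar> \<le> 1" "\<bar>S\<bar> \<le> 1"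
        using sin_w[of "pi - phi \<nu>" \<xi>] \<xi>(1) by (auto simp: S_def T_def)
      have "T\<^sup>2 - S\<^sup>2 = (T - S) * (T + S)" by (simp add: power2_eq_square algebra_simps)
      also have "... \<le> \<bar>T - S\<bar> * \<bar>T + S\<bar>" by (metis abs_ge_self abs_mult)
      also have "... \<le> w * 2" using ST w by (intro mult_mono) auto
      finally have "T\<^sup>2 \<le> (3 + 8 * w) / 4" using s3 by (simp add: S_def)
      then have "edge_energy \<nu> (\<theta> r) (\<theta> s) \<le> (3 + 8 * w) / 4 * (x r - x s)\<^sup>2"
        unfolding e T_def by (rule mult_right_mono) simp
      then show ?thesis using False by (simp add: s_def p_good_def)
    qed
  qed
  have "edge_sum L \<theta> \<le>
    (\<Sum>r\<in>torus L. \<Sum>\<nu>\<in>dirs. (if \<nu> = 1 then 2 * w\<^sup>2 * ((x r)\<^sup>2 + (x (shift L \<nu> 1 r))\<^sup>2) else (3 + 8 * w) / 2 * (p_good \<nu> * (x r - x (shift L \<nu> 1 r))\<^sup>2)))"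
    by (intro sum_mono edge)
  also have "... = (\<Sum>r\<in>torus L. 2 * w\<^sup>2 * ((x r)\<^sup>2 + (x (shift L 1 1 r))\<^sup>2)
     + (3 + 8 * w) / 2 * (\<Sum>\<nu>\<in>dirs. wgt 1 p_good p_good \<nu> r * (x r - x (shift L \<nu> 1 r))\<^sup>2))"
  proof (rule sum.cong[OF refl])
    fix r
    have p1: "p_good 1 = 0" by (simp add: p_good_def)
    have w1: "wgt 1 p_good p_good \<nu> r = p_good \<nu>" for \<nu> by (simp add: wgt_def)
    have d: "(\<Sum>\<nu>\<in>dirs. h \<nu>) = h 1 + (h 2 + h 3)" for h :: "nat => real" by simp
    show "(\<Sum>\<nu>\<in>dirs. (if \<nu> = 1 then 2 * w\<^sup>2 * ((x r)\<^sup>2 + (x (shift L \<nu> 1 r))\<^sup>2) else (3 + 8 * w) / 2 * (p_good \<nu> * (x r - x (shift L \<nu> 1 r))\<^sup>2)))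
      = 2 * w\<^sup>2 * ((x r)\<^sup>2 + (x (shift L 1 1 r))\<^sup>2)
     + (3 + 8 * w) / 2 * (\<Sum>\<nu>\<in>dirs. wgt 1 p_good p_good \<nu> r * (x r - x (shift L \<nu> 1 r))\<^sup>2)"
      unfolding d w1 p1 by (simp add: distrib_left)
  qed
  also have "... = 4 * w\<^sup>2 * sumsq (torus L) x
     + (3 + 8 * w) * ((\<Sum>r\<in>torus L. \<Sum>\<nu>\<in>dirs. wgt 1 p_good p_good \<nu> r * (x r - x (shift L \<nu> 1 r))\<^sup>2) / 2)"
    unfolding sum.distrib sum_distrib_left[symmetric] sum_shift[OF L(2), of "\<lambda>r. (x r)\<^sup>2" 1 1] by simp
  also have "(\<Sum>r\<in>torus L. \<Sum>\<nu>\<in>dirs. wgt 1 p_good p_good \<nu> r * (x r - x (shift L \<nu> 1 r))\<^sup>2) / 2 =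
     sumsq (torus L) x - quad (torus L) (walk L 1 p_good p_good) x"
    by (rule dirichlet_form[OF L walk_weights_good, symmetric])
  finally show ?thesis unfolding hamiltonian_eq using J by (intro mult_left_mono) auto
qed

text \<open>The walk has nonnegative entries and row sums at most 1, so \<open>1 - t A\<close> is
  dominant with margin \<open>1 - t\<close>.\<close>

lemma dominant_walk:
  assumes L: "even L" "L > 0" and wt: "walk_weights \<alpha> p q" and t: "0 \<le> t" "t < 1"
  shows "dominant (torus L) (id_minus t (walk L \<alpha> p q)) (1 - t) 1"
proof -
  define A where "A = walk L \<alpha> p q"
  have c: "contraction_kernel (torus L) A" unfolding A_def by (rule contraction_walk[OF L wt])
  have A0: "A i j \<ge> 0" for i j unfolding A_def by (rule walk_nonneg[OF L wt])
  show ?thesis unfolding dominant_def A_def[symmetric]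
  proof (intro conjI allI ballI)
    have As: "A i j = A j i" for i j using c unfolding contraction_kernel_def by (elim conjE allE)
    show "id_minus t A i j = id_minus t A j i" for i j
      by (cases "i = j") (simp_all only: id_minus_def As[of i j] eq_commute)
    fix i assume i: "i \<in> torus L"
    show "id_minus t A i i \<le> 1" using A0 t by (simp add: id_minus_def)
    have "(\<Sum>j\<in>torus L - {i}. \<bar>id_minus t A i j\<bar>) = (\<Sum>j\<in>torus L - {i}. t * \<bar>A i j\<bar>)"
      using t by (intro sum.cong refl) (auto simp: id_minus_def abs_mult)
    also have "... = t * ((\<Sum>j\<in>torus L. \<bar>A i j\<bar>) - A i i)"
      using i A0 by (simp add: sum_distrib_left[symmetric] sum_diff1)
    also have "... \<le> t * (1 - A i i)"
      using c i t by (intro mult_left_mono) (auto simp: contraction_kernel_def)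
    finally show "(\<Sum>j\<in>torus L - {i}. \<bar>id_minus t A i j\<bar>) + (1 - t) \<le> id_minus t A i i"
      by (simp add: id_minus_def algebra_simps)
  qed
qed

text \<open>Only deviations of at most \<open>w\<close> from \<open>pi\<close> are kept; after
  rescaling they form the box of radius \<open>w * sqrt K\<close>. As \<open>K\<close> grows with
  \<open>\<beta>\<close>, \<open>gauss_box_lower\<close> loses only the factor
  \<open>1 - 1 / ((1 - t) * (w * sqrt K))^2\<close> per site.\<close>

lemma totZ_ge:
  fixes J \<beta> w :: real
  assumes L: "even L" "L > 0" and J: "J > 0" "\<beta> > 0" and w: "0 < w" "w \<le> 1"
  defines "K \<equiv> \<beta> * J * (3 + 8 * w + 4 * w\<^sup>2)" and "t \<equiv> (3 + 8 * w) / (3 + 8 * w + 4 * w\<^sup>2)"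
  assumes R: "1 \<le> ((1 - t) * (w * sqrt K))\<^sup>2"
  shows "ennreal (((1 - 1 / ((1 - t) * (w * sqrt K))\<^sup>2) / sqrt K) ^ (L ^ 3) * gaussZ (torus L) (id_minus t (walk L 1 p_good p_good)))
    \<le> totZ J \<beta> L"
proof -
  define A where "A = walk L 1 p_good p_good"
  have cA: "contraction_kernel (torus L) A" unfolding A_def by (rule contraction_walk[OF L walk_weights_good])
  have K: "K > 0" unfolding K_def using J w by (simp add: add_pos_nonneg)
  have den: "3 + 8 * w + 4 * w\<^sup>2 > 0" using w by (simp add: add_pos_nonneg)
  have t: "0 < t" "t < 1" unfolding t_def using w den by (auto simp: field_simps)
  define \<sigma> where "\<sigma> = 1 / sqrt K"
  have \<sigma>: "\<sigma> > 0" "\<sigma>\<^sup>2 * K = 1" unfolding \<sigma>_def using K by (auto simp: power_divide)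
  define Rr where "Rr = w * sqrt K"
  have Rr: "Rr > 0" "\<sigma> * Rr = w" unfolding Rr_def \<sigma>_def using K w by auto
  define \<eta> where "\<eta> = 1 - 1 / ((1 - t) * Rr)\<^sup>2"
  have \<eta>: "\<eta> \<ge> 0" unfolding \<eta>_def using R[folded Rr_def] by (subst diff_ge_0_iff_ge, subst divide_le_eq_1_pos) linarith+
  let ?P = "lborelP (torus L) :: config measure"
  have hm [measurable]: "hamiltonian J L \<in> borel_measurable ?P"
    using measurable_hamiltonian[of J L] by (simp add: config_measure_def)
  have "ennreal (\<sigma> ^ (L ^ 3)) * (ennreal \<eta> ^ card (torus L) * (\<integral>\<^sup>+x. ennreal (gweight (torus L) (id_minus t A) x) \<partial>?P))
    \<le> ennreal (\<sigma> ^ (L ^ 3)) * (\<integral>\<^sup>+x. (\<Prod>i\<in>torus L. indicator {-Rr..Rr} (x i)) * ennreal (gweight (torus L) (id_minus t A) x) \<partial>?P)"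
    unfolding \<eta>_def
    by (intro mult_left_mono gauss_box_lower dominant_walk[OF L walk_weights_good, folded A_def] Rr R[folded Rr_def] finite_torus) (use t in auto)
  also have "... \<le> ennreal (\<sigma> ^ (L ^ 3)) * (\<integral>\<^sup>+z. (\<Prod>r\<in>torus L. indicator {0..<2*pi} ((\<lambda>r\<in>torus L. pi + \<sigma> * z r) r)) * ennreal (exp (- \<beta> * hamiltonian J L (\<lambda>r\<in>torus L. pi + \<sigma> * z r))) \<partial>?P)"
  proof (intro mult_left_mono nn_integral_mono)
    fix z :: config
    define \<theta> where "\<theta> = (\<lambda>r\<in>torus L. pi + \<sigma> * z r)"
    define x where "x r = \<sigma> * z r" for r
    show "(\<Prod>i\<in>torus L. indicator {-Rr..Rr} (z i)) * ennreal (gweight (torus L) (id_minus t A) z)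
      \<le> angle_ind L \<theta> * boltz J \<beta> L \<theta>"
    proof (cases "\<forall>r\<in>torus L. z r \<in> {-Rr..Rr}")
      case False
      then have "(\<Prod>i\<in>torus L. indicator {-Rr..Rr} (z i) :: ennreal) = 0"
        by (auto simp: prod_zero_iff indicator_def)
      then show ?thesis by (simp only: mult_zero_left zero_le)
    next
      case True
      have \<theta>r: "\<theta> r = pi + x r" if "r \<in> torus L" for r using that by (simp add: \<theta>_def x_def)
      have xr: "\<bar>x r\<bar> \<le> w" if r: "r \<in> torus L" for r
      proof -
        have "\<bar>z r\<bar> \<le> Rr" using True r by (auto simp: abs_le_iff)
        then have "\<sigma> * \<bar>z r\<bar> \<le> \<sigma> * Rr" using \<sigma> by (intro mult_left_mono) auto
        then show ?thesis using \<sigma> Rr by (simp add: x_def abs_mult)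
      qed
      have box: "\<theta> r \<in> {0..<2*pi}" if r: "r \<in> torus L" for r
        using \<theta>r[OF r] xr[OF r] w pi_gt3 by (auto simp: abs_le_iff)
      have en: "hamiltonian J L \<theta> \<le> J / 2 * (4 * w\<^sup>2 * sumsq (torus L) x + (3 + 8 * w) * (sumsq (torus L) x - quad (torus L) A x))"
        unfolding A_def by (rule ground_energy_upper[OF L _ w \<theta>r xr]) (use J in auto)
      have "\<beta> * hamiltonian J L \<theta> \<le> \<beta> * (J / 2 * (4 * w\<^sup>2 * sumsq (torus L) x + (3 + 8 * w) * (sumsq (torus L) x - quad (torus L) A x)))"
        using J en by (intro mult_left_mono) auto
      also have "... = (K * sumsq (torus L) x - (K * t) * quad (torus L) A x) / 2"
      proof -
        have "K * t = \<beta> * J * (3 + 8 * w)" unfolding K_def t_def using den by simp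
        then show ?thesis by (simp add: K_def field_simps)
      qed
      also have "K * sumsq (torus L) x = (\<sigma>\<^sup>2 * K) * (\<Sum>r\<in>torus L. (z r)\<^sup>2)"
        by (simp add: x_def power_mult_distrib sum_distrib_left mult_ac)
      also have "(K * t) * quad (torus L) A x = (\<sigma>\<^sup>2 * K) * (t * quad (torus L) A z)"
        unfolding x_def quad_scale by simp
      finally have "\<beta> * hamiltonian J L \<theta> \<le> quad (torus L) (id_minus t A) z / 2"
        unfolding \<sigma>(2) quad_id_minus[OF finite_torus] by simp
      then have "gweight (torus L) (id_minus t A) z \<le> exp (- \<beta> * hamiltonian J L \<theta>)" by simp
      then have "ennreal (gweight (torus L) (id_minus t A) z) \<le> boltz J \<beta> L \<theta>"
        by (rule ennreal_leI)
      moreover have "(\<Prod>i\<in>torus L. indicator {-Rr..Rr} (z i) :: ennreal) = 1" "(\<Prod>r\<in>torus L. indicator {0..<2*pi} (\<theta> r) :: ennreal) = 1"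
        using True box by (auto intro!: prod.neutral simp: indicator_def)
      ultimately show ?thesis by simp
    qed
  qed simp
  also have "... = totZ J \<beta> L"
  proof -
    have "totZ J \<beta> L = ennreal (\<Prod>r\<in>torus L. \<bar>\<sigma>\<bar>) * (\<integral>\<^sup>+z. (\<Prod>r\<in>torus L. indicator {0..<2*pi} ((\<lambda>r\<in>torus L. pi + \<sigma> * z r) r)) * ennreal (exp (- \<beta> * hamiltonian J L (\<lambda>r\<in>torus L. pi + \<sigma> * z r))) \<partial>?P)"
      unfolding totZ_def config_measure_def
    proof (rule nn_integral_PiM_affine[OF finite_torus])
      show "(\<lambda>\<theta>. angle_ind L \<theta> * boltz J \<beta> L \<theta>) \<in> borel_measurable ?P"
        by (intro borel_measurable_times_ennreal borel_measurable_prod_ennreal) measurable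
    qed (use \<sigma> in auto)
    then show ?thesis using \<sigma> by (simp add: card_torus)
  qed
  finally have "ennreal (\<sigma> ^ (L ^ 3)) * (ennreal \<eta> ^ card (torus L) * ennreal (gaussZ (torus L) (id_minus t A))) \<le> totZ J \<beta> L"
    using nn_integral_gaussZ[OF cA, of t] t by simp
  moreover have "ennreal (\<sigma> ^ (L ^ 3)) * (ennreal \<eta> ^ card (torus L) * ennreal (gaussZ (torus L) (id_minus t A))) =
    ennreal ((\<eta> / sqrt K) ^ (L ^ 3) * gaussZ (torus L) (id_minus t A))"
    using \<sigma> \<eta> t gaussZ_pos[OF cA, of t]
    by (simp add: card_torus ennreal_power ennreal_mult[symmetric] \<sigma>_def power_divide mult_ac)
  ultimately show ?thesis unfolding \<eta>_def Rr_def A_def by simp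
qed

text \<open>The gap contributes at least \<open>3 * g / 32\<close>: the 3/4 bounds
  \<open>s' ^ 4\<close>, a factor 1/4 belongs to order 4 and a factor 1/2 to the logarithm of a
  Gaussian integral. Five errors of at most \<open>g / 80\<close>, together
  \<open>2 * g / 32\<close>, leave \<open>g / 32\<close>.\<close>

lemma pattern_suppressed_at:
  fixes J \<beta> w s :: real
  assumes L: "even L" "L > 4" and \<alpha>: "\<alpha> \<in> dirs" and J: "J > 0" "\<beta> > 0" and w: "0 < w" "w < 1"
    and sr: "stiff_radius w b \<alpha> c \<delta>" and \<delta>: "0 < \<delta>" "\<delta> \<le> 1" and s: "s > 0"
    and g: "g = pat_gap b \<alpha> c" "g > 0"
  defines "t \<equiv> (3 + 8 * w) / (3 + 8 * w + 4 * w\<^sup>2)" and "K1 \<equiv> 3 * \<beta> * J * (1 - w)" and "K2 \<equiv> \<beta> * J * (3 + 8 * w + 4 * w\<^sup>2)"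
  defines "\<rho> \<equiv> 1 / ((1 - t) * (w * sqrt K2))\<^sup>2" and "s' \<equiv> K1 / (K1 + 2 * s)"
  assumes b: "s \<le> g / 80" "ln ((3 + 8 * w + 4 * w\<^sup>2) / (3 * (1 - w))) / 2 \<le> g / 80" "mass_error t / 2 \<le> g / 80"
    "\<rho> < 1" "- ln (1 - \<rho>) \<le> g / 80" "3 / 4 \<le> s' ^ 4" "- ret (L div 2 - 1) * ln (1 - s') / 2 \<le> g / 80"
  shows "patZ J \<beta> L b \<alpha> c \<delta> \<le> ennreal (exp (- g / 32) ^ (L ^ 3)) * totZ J \<beta> L"
proof -
  have K: "K1 > 0" "K2 > 0" unfolding K1_def K2_def using J w by (auto intro!: mult_pos_pos add_pos_nonneg)
  have den: "3 + 8 * w + 4 * w\<^sup>2 > 0" using w by (simp add: add_pos_nonneg)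
  have t: "0 < t" "t < 1" unfolding t_def using w den by (auto simp: field_simps)
  have s': "0 < s'" "s' < 1" unfolding s'_def using K s by auto
  define D where "D = (1 - t) * (w * sqrt K2)"
  have D: "D\<^sup>2 > 0" unfolding D_def using t w K by simp
  have \<rho>: "\<rho> > 0" unfolding \<rho>_def D_def[symmetric] using D by simp
  have R: "1 \<le> D\<^sup>2" using b(4) D unfolding \<rho>_def D_def[symmetric] by (simp add: divide_less_eq)
  define n where "n = L ^ 3"
  define Gp where "Gp = gaussZ (torus L) (id_minus s' (walk L \<alpha> (stiff c) (stiff (other_angle b \<alpha> c))))"
  define G0 where "G0 = gaussZ (torus L) (id_minus t (walk L 1 p_good p_good))"
  define E where "E = (- g * s' ^ 4 / 4 + mass_error t - ret (L div 2 - 1) * ln (1 - s')) / 2"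
  have L0: "L > 0" using L by simp
  have G0: "G0 > 0" unfolding G0_def
    by (rule gaussZ_pos[OF contraction_walk[OF L(1) L0 walk_weights_good]]) (use t in auto)
  have "Gp \<le> exp (real L ^ 3 * E) * G0"
    unfolding Gp_def G0_def E_def g(1) pat_gap_def
    by (rule free_energy_comparison[OF L \<alpha> _ circle_stiff circle_stiff s' t])
       (use g in \<open>auto simp: pat_gap_def other_angle_def stiff_fl\<close>)
  then have Gp: "Gp \<le> exp E ^ n * G0" unfolding n_def by (simp add: exp_of_nat_mult[symmetric])
  have up: "patZ J \<beta> L b \<alpha> c \<delta> \<le> ennreal ((exp s / sqrt (K1 + 2 * s)) ^ n * Gp)"
    unfolding n_def Gp_def s'_def K1_def by (rule patZ_le[OF L(1) L0 \<alpha> sr \<delta> J w(2) s])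
  have lo: "ennreal (((1 - \<rho>) / sqrt K2) ^ n * G0) \<le> totZ J \<beta> L"
    unfolding n_def \<rho>_def G0_def K2_def t_def
    by (rule totZ_ge[OF L(1) L0 J]) (use w R in \<open>auto simp: D_def t_def K2_def\<close>)
  have main: "exp s / sqrt (K1 + 2 * s) * exp E \<le> exp (- g / 32) * ((1 - \<rho>) / sqrt K2)"
  proof -
    have "sqrt K2 / sqrt (K1 + 2 * s) \<le> sqrt (K2 / K1)"
      unfolding real_sqrt_divide using K s by (intro divide_left_mono) auto
    also have "K2 / K1 = (3 + 8 * w + 4 * w\<^sup>2) / (3 * (1 - w))" unfolding K1_def K2_def using J w by (simp add: field_simps)
    also have "sqrt ... \<le> exp (g / 80)"
    proof -
      have "sqrt ((3 + 8 * w + 4 * w\<^sup>2) / (3 * (1 - w))) > 0" using den w by simp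
      moreover have "ln (sqrt ((3 + 8 * w + 4 * w\<^sup>2) / (3 * (1 - w)))) \<le> g / 80"
        using b(2) den w by (subst ln_sqrt) auto
      ultimately show ?thesis by (metis exp_ln exp_le_cancel_iff)
    qed
    finally have 1: "sqrt K2 / sqrt (K1 + 2 * s) \<le> exp (g / 80)" .
    have "exp (- (g / 80)) \<le> exp (ln (1 - \<rho>))" using b(5) by simp
    then have 2: "exp (- (g / 80)) \<le> 1 - \<rho>" using b(4) by simp
    have "g * (3 / 4) \<le> g * s' ^ 4" using b(6) g by (intro mult_left_mono) auto
    then have 3: "E \<le> - (3 * g / 32) + g / 80 + g / 80" unfolding E_def using b(3,7) by (simp add: field_simps)
    have "exp s * (sqrt K2 / sqrt (K1 + 2 * s)) * exp E \<le> exp (g / 80) * exp (g / 80) * exp (- (3 * g / 32) + g / 80 + g / 80)"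
      using 1 3 b(1) K s by (intro mult_mono) auto
    also have "... = exp (- g / 32) * exp (- (g / 80))"
      unfolding exp_add[symmetric] by (simp add: field_simps)
    also have "... \<le> exp (- g / 32) * (1 - \<rho>)" using 2 by (intro mult_left_mono) auto
    finally show ?thesis using K s by (simp add: field_simps)
  qed
  have "(exp s / sqrt (K1 + 2 * s)) ^ n * Gp \<le> (exp s / sqrt (K1 + 2 * s)) ^ n * (exp E ^ n * G0)"
    using Gp K s by (intro mult_left_mono) auto
  also have "... = (exp s / sqrt (K1 + 2 * s) * exp E) ^ n * G0" by (simp only: power_mult_distrib mult.assoc)
  also have "... \<le> (exp (- g / 32) * ((1 - \<rho>) / sqrt K2)) ^ n * G0"
    using main G0 K s by (intro mult_right_mono power_mono) auto
  also have "... = exp (- g / 32) ^ n * (((1 - \<rho>) / sqrt K2) ^ n * G0)" by (simp only: power_mult_distrib mult.assoc)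
  finally have "ennreal ((exp s / sqrt (K1 + 2 * s)) ^ n * Gp) \<le> ennreal (exp (- g / 32) ^ n) * ennreal (((1 - \<rho>) / sqrt K2) ^ n * G0)"
    using G0 K b(4) by (subst ennreal_mult[symmetric]) (auto intro!: ennreal_leI)
  also have "... \<le> ennreal (exp (- g / 32) ^ n) * totZ J \<beta> L" by (intro mult_left_mono lo) auto
  finally show ?thesis using up unfolding n_def by (rule order.trans[rotated])
qed

text \<open>The accuracy \<open>w\<close> depends on the gap alone and determines the radius
  \<open>\<delta>\<close>; for fixed \<open>w\<close> the remaining errors vanish as
  \<open>\<beta>\<close> grows. Only the tail couples \<open>\<beta>\<close> and \<open>L\<close>:
  it is a logarithm of \<open>\<beta>\<close> over the square root of \<open>L - 1\<close>, which is
  small once \<open>\<beta> powr (1 / 20) \<le> L\<close>.\<close>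

proposition pattern_suppressed:
  fixes J c :: real
  assumes J: "J > 0" and \<alpha>: "\<alpha> \<in> dirs" and gap: "pat_gap b \<alpha> c > 0"
  shows "\<exists>\<delta>>0. \<delta> \<le> 1 \<and> (\<forall>\<^sub>F \<beta> in at_top. \<forall>L. even L --> L > 4 --> \<beta> powr (1 / 20) \<le> real L -->
    patZ J \<beta> L b \<alpha> c \<delta> \<le> ennreal (exp (- pat_gap b \<alpha> c / 32) ^ (L ^ 3)) * totZ J \<beta> L)"
proof -
  define g where "g = pat_gap b \<alpha> c"
  have g: "g > 0" using gap by (simp add: g_def)
  define T where "T w = (3 + 8 * w) / (3 + 8 * w + 4 * w\<^sup>2)" for w :: real
  have "((\<lambda>w::real. ln ((3 + 8 * w + 4 * w\<^sup>2) / (3 * (1 - w))) / 2) \<longlongrightarrow> 0) (at_right 0)" by real_asymp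
  from order_tendstoD(2)[OF this, of "g / 80"] have e1: "\<forall>\<^sub>F w in at_right 0. ln ((3 + 8 * w + 4 * w\<^sup>2) / (3 * (1 - w))) / 2 < g / 80"
    using g by simp
  have "filterlim T (at_left 1) (at_right 0)" unfolding T_def by real_asymp
  then have "((\<lambda>w. mass_error (T w)) \<longlongrightarrow> 0) (at_right 0)" by (rule filterlim_compose[OF mass_error_tendsto])
  from order_tendstoD(2)[OF this, of "g / 40"] have e2: "\<forall>\<^sub>F w in at_right 0. mass_error (T w) < g / 40" using g by simp
  have e3: "\<forall>\<^sub>F w::real in at_right 0. w < 1 \<and> w > 0"
    by (intro eventually_conj eventually_at_right_less eventually_at_rightI[of 0 1]) auto
  obtain w where w: "0 < w" "w < 1" "ln ((3 + 8 * w + 4 * w\<^sup>2) / (3 * (1 - w))) / 2 < g / 80" "mass_error (T w) < g / 40"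
    using eventually_happens[OF eventually_conj[OF e1 eventually_conj[OF e2 e3]]] by auto
  obtain \<delta> where \<delta>: "\<delta> > 0" "\<delta> \<le> 1" "stiff_radius w b \<alpha> c \<delta>" using stiff_radius_exists[OF w(1,2)] by blast
  define s where "s = g / 80"
  have s: "s > 0" using g by (simp add: s_def)
  define k1 where "k1 = 3 * J * (1 - w)"
  define k2 where "k2 = (1 - T w)\<^sup>2 * (w\<^sup>2 * (J * (3 + 8 * w + 4 * w\<^sup>2)))"
  have den: "3 + 8 * w + 4 * w\<^sup>2 > 0" using w by (simp add: add_pos_nonneg)
  have T: "0 < T w" "T w < 1" unfolding T_def using w den by (auto simp: field_simps)
  have k: "k1 > 0" "k2 > 0" unfolding k1_def k2_def using J w T den by auto
  have "((\<lambda>\<beta>. - ln (1 - 1 / (k2 * \<beta>))) \<longlongrightarrow> 0) at_top" using k by real_asymp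
  from order_tendstoD(2)[OF this, of "g / 80"] have f1: "\<forall>\<^sub>F \<beta> in at_top. - ln (1 - 1 / (k2 * \<beta>)) < g / 80" using g by simp
  have "((\<lambda>\<beta>. 1 / (k2 * \<beta>)) \<longlongrightarrow> 0) at_top" using k by real_asymp
  from order_tendstoD(2)[OF this, of 1] have f2: "\<forall>\<^sub>F \<beta> in at_top. 1 / (k2 * \<beta>) < 1" by simp
  have "((\<lambda>\<beta>. (k1 * \<beta> / (k1 * \<beta> + 2 * s)) ^ 4) \<longlongrightarrow> 1) at_top" using k s by real_asymp
  from order_tendstoD(1)[OF this, of "3/4"] have f3: "\<forall>\<^sub>F \<beta> in at_top. 3 / 4 < (k1 * \<beta> / (k1 * \<beta> + 2 * s)) ^ 4" by simp
  have "((\<lambda>\<beta>. ln ((k1 * \<beta> + 2 * s) / (2 * s)) / (2 * sqrt (\<beta> powr (1 / 20) - 1))) \<longlongrightarrow> 0) at_top" using k s by real_asymp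
  from order_tendstoD(2)[OF this, of "g / 80"] have f4: "\<forall>\<^sub>F \<beta> in at_top. ln ((k1 * \<beta> + 2 * s) / (2 * s)) / (2 * sqrt (\<beta> powr (1 / 20) - 1)) < g / 80"
    using g by simp
  have f5: "\<forall>\<^sub>F \<beta>::real in at_top. \<beta> > 1" by (rule eventually_gt_at_top)
  have "\<forall>\<^sub>F \<beta> in at_top. \<forall>L. even L --> L > 4 --> \<beta> powr (1 / 20) \<le> real L -->
    patZ J \<beta> L b \<alpha> c \<delta> \<le> ennreal (exp (- g / 32) ^ (L ^ 3)) * totZ J \<beta> L"
    using f1 f2 f3 f4 f5
  proof eventually_elim
    case (elim \<beta>)
    show ?case
    proof (intro allI impI)
      fix L :: nat assume L: "even L" "L > 4" "\<beta> powr (1 / 20) \<le> real L"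
      have K1: "3 * \<beta> * J * (1 - w) = k1 * \<beta>" by (simp add: k1_def)
      have D: "((1 - T w) * (w * sqrt (\<beta> * J * (3 + 8 * w + 4 * w\<^sup>2))))\<^sup>2 = k2 * \<beta>"
        using elim J den by (simp add: k2_def power_mult_distrib)
      have k1\<beta>: "k1 * \<beta> > 0" using k elim by simp
      define x where "x = ln ((k1 * \<beta> + 2 * s) / (2 * s))"
      have x0: "x \<ge> 0" unfolding x_def using k1\<beta> s by simp
      have ln: "ln (1 - k1 * \<beta> / (k1 * \<beta> + 2 * s)) = - x"
      proof -
        have "1 - k1 * \<beta> / (k1 * \<beta> + 2 * s) = inverse ((k1 * \<beta> + 2 * s) / (2 * s))"
          using k1\<beta> s by (simp add: field_simps)
        then show ?thesis unfolding x_def using k1\<beta> s by (simp only: ln_inverse)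
      qed
      define y where "y = sqrt (\<beta> powr (1 / 20) - 1)"
      have "\<beta> powr (1 / 20) > \<beta> powr 0" using elim by (intro powr_less_mono) auto
      then have y: "y > 0" unfolding y_def using elim by simp
      have "ret (L div 2 - 1) * y \<le> 1"
      proof -
        have "2 * real (L div 2 - 1) + 1 = real L - 1" using L by (auto simp: of_nat_diff elim!: evenE)
        then have "(ret (L div 2 - 1))\<^sup>2 * (real L - 1) \<le> 1" using ret_le[of "L div 2 - 1"] by (simp only:)
        moreover have "(ret (L div 2 - 1))\<^sup>2 * y\<^sup>2 \<le> (ret (L div 2 - 1))\<^sup>2 * (real L - 1)"
          using L y unfolding y_def by (intro mult_left_mono) auto
        ultimately have "(ret (L div 2 - 1) * y)\<^sup>2 \<le> 1\<^sup>2" by (simp add: power_mult_distrib)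
        then show ?thesis by (rule power2_le_imp_le) simp
      qed
      then have "ret (L div 2 - 1) \<le> 1 / y" using y by (simp add: field_simps)
      then have "ret (L div 2 - 1) * x / 2 \<le> 1 / y * x / 2" using x0 by (intro divide_right_mono mult_right_mono) auto
      also have "... \<le> g / 80" using elim(4) by (simp add: x_def y_def)
      finally have r: "- ret (L div 2 - 1) * ln (1 - k1 * \<beta> / (k1 * \<beta> + 2 * s)) / 2 \<le> g / 80" unfolding ln by simp
      show "patZ J \<beta> L b \<alpha> c \<delta> \<le> ennreal (exp (- g / 32) ^ (L ^ 3)) * totZ J \<beta> L"
        by (rule pattern_suppressed_at[OF L(1,2) \<alpha> J _ w(1,2) \<delta>(3,1,2) s g_def g])
           (use elim w r in \<open>auto simp: K1 D[unfolded T_def] T_def s_def[symmetric]\<close>, simp_all add: s_def)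
    qed
  qed
  then show ?thesis using \<delta>(1,2) unfolding g_def by blast
qed

text \<open>Spins confined to an interval of length \<open>1 / sqrt \<beta>\<close> have edge
  energies of at most \<open>1 / \<beta>\<close>. The crude factor \<open>1 / sqrt \<beta>\<close>
  per site is good enough against events whose weight is exponentially small in a power of
  \<open>\<beta>\<close>.\<close>

lemma totZ_lower:
  fixes J \<beta> :: real
  assumes L: "L > 0" and J: "J > 0" "\<beta> \<ge> 1"
  shows "ennreal ((exp (- 3 * J / 2) / sqrt \<beta>) ^ (L ^ 3)) \<le> totZ J \<beta> L"
proof -
  define a where "a = 1 / sqrt \<beta>"
  have a: "0 < a" "a \<le> 1" "a\<^sup>2 = 1 / \<beta>" using J by (auto simp: a_def power_divide)
  let ?P = "lborelP (torus L) :: config measure"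
  have "ennreal ((exp (- 3 * J / 2) * a) ^ (L ^ 3)) = ennreal (exp (- 3 * J / 2) ^ (L ^ 3)) * (\<Prod>r\<in>torus L. \<integral>\<^sup>+x. indicator {0..a} x \<partial>lborel)"
    using a by (simp add: power_mult_distrib ennreal_mult' card_torus ennreal_power)
  also have "(\<Prod>r\<in>torus L. \<integral>\<^sup>+x. indicator {0..a} x \<partial>lborel) = (\<integral>\<^sup>+\<theta>. (\<Prod>r\<in>torus L. indicator {0..a} (\<theta> r)) \<partial>?P)"
    by (rule PL.product_nn_integral_prod[symmetric, OF finite_torus]) simp
  also have "ennreal (exp (- 3 * J / 2) ^ (L ^ 3)) * ... = (\<integral>\<^sup>+\<theta>. ennreal (exp (- 3 * J / 2) ^ (L ^ 3)) * (\<Prod>r\<in>torus L. indicator {0..a} (\<theta> r)) \<partial>?P)"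
    by (rule nn_integral_cmult[symmetric]) (intro borel_measurable_prod_ennreal, measurable)
  also have "... \<le> totZ J \<beta> L"
    unfolding totZ_def config_measure_def
  proof (rule nn_integral_mono)
    fix \<theta> :: config
    show "ennreal (exp (- 3 * J / 2) ^ (L ^ 3)) * (\<Prod>r\<in>torus L. indicator {0..a} (\<theta> r)) \<le>
      angle_ind L \<theta> * boltz J \<beta> L \<theta>"
    proof (cases "\<forall>r\<in>torus L. \<theta> r \<in> {0..a}")
      case False
      then have "(\<Prod>r\<in>torus L. indicator {0..a} (\<theta> r) :: ennreal) = 0"
        by (auto simp: prod_zero_iff indicator_def)
      then show ?thesis by (simp only: mult_zero_right zero_le)
    next
      case True
      have i: "(\<Prod>r\<in>torus L. indicator {0..a} (\<theta> r) :: ennreal) = 1" "(\<Prod>r\<in>torus L. indicator {0..<2*pi} (\<theta> r) :: ennreal) = 1"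
        using True a pi_gt3 by (auto intro!: prod.neutral simp: indicator_def)
      have "edge_energy \<nu> (\<theta> r) (\<theta> (shift L \<nu> 1 r)) \<le> 1 / \<beta>" if r: "r \<in> torus L" for \<nu> r
      proof -
        define x y where "x = \<theta> r - phi \<nu>" and "y = \<theta> (shift L \<nu> 1 r) - phi \<nu>"
        have xy: "\<bar>x - y\<bar> \<le> a"
          using True[rule_format, OF r] True[rule_format, OF shift_torus[OF L r, of \<nu> 1]] unfolding x_def y_def by auto
        have "\<bar>cos x - cos y\<bar> = 2 * \<bar>sin ((x + y) / 2)\<bar> * \<bar>sin ((y - x) / 2)\<bar>"
          unfolding cos_diff_cos by (simp add: abs_mult)
        also have "... \<le> 2 * 1 * \<bar>(y - x) / 2\<bar>" by (intro mult_mono abs_sin_x_le_abs_x) auto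
        also have "... \<le> a" using xy by simp
        finally have "\<bar>cos x - cos y\<bar>\<^sup>2 \<le> a\<^sup>2" by (rule power_mono) simp
        then show ?thesis using a by (simp add: edge_energy_def x_def y_def)
      qed
      then have "edge_sum L \<theta> \<le> (\<Sum>r\<in>torus L. \<Sum>\<nu>\<in>dirs. 1 / \<beta>)"
        by (intro sum_mono)
      then have "hamiltonian J L \<theta> \<le> J / 2 * (\<Sum>r\<in>torus L. \<Sum>\<nu>\<in>dirs. 1 / \<beta>)"
        unfolding hamiltonian_eq using J by (intro mult_left_mono) auto
      also have "... = real (L ^ 3) * (3 * J / 2) / \<beta>" by (simp add: card_torus)
      finally have "\<beta> * hamiltonian J L \<theta> \<le> real (L ^ 3) * (3 * J / 2)" using J by (simp add: field_simps)
      then have "exp (real (L ^ 3) * (- (3 * J / 2))) \<le> exp (- \<beta> * hamiltonian J L \<theta>)" by simp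
      then have "exp (- 3 * J / 2) ^ (L ^ 3) \<le> exp (- \<beta> * hamiltonian J L \<theta>)" unfolding exp_of_nat_mult by simp
      then show ?thesis unfolding i by (simp add: ennreal_leI)
    qed
  qed
  finally show ?thesis by (simp add: a_def)
qed

section \<open>Structure of bad blocks\<close>

lemma near_commute: "near e x y \<longleftrightarrow> near e y x"
proof -
  have "near e y x" if n: "near e x y" for x y
  proof -
    obtain n :: int where "\<bar>x - y - 2 * pi * of_int n\<bar> \<le> e" using n by (auto simp: near_def)
    then show ?thesis unfolding near_def by (intro exI[of _ "- n"]) (simp add: abs_minus_commute algebra_simps abs_le_iff)
  qed
  then show ?thesis by blast
qed

lemma near_trans: "near e x y ==> near e' y z ==> e + e' \<le> e'' ==> near e'' x z"
proof -
  assume "near e x y" "near e' y z" and le: "e + e' \<le> e''"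
  then obtain n m :: int where "\<bar>x - y - 2 * pi * of_int n\<bar> \<le> e" "\<bar>y - z - 2 * pi * of_int m\<bar> \<le> e'" by (auto simp: near_def)
  then show ?thesis unfolding near_def using le
    by (intro exI[of _ "n + m"]) (simp add: abs_le_iff distrib_left)
qed

lemma near_mono: "near e x y ==> e \<le> e' ==> near e' x y"
  unfolding near_def by (meson order.trans)

lemma near_refl: "e \<ge> 0 ==> near e x x"
  unfolding near_def by (intro exI[of _ 0]) simp

lemma near_fl: "near e (fl \<alpha> x) (fl \<alpha> y) \<longleftrightarrow> near e x y"
proof -
  have "near e (fl \<alpha> x) (fl \<alpha> y)" if n: "near e x y" for x y
  proof -
    obtain n :: int where "\<bar>x - y - 2 * pi * of_int n\<bar> \<le> e" using n by (auto simp: near_def)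
    then show ?thesis unfolding near_def fl_def by (intro exI[of _ "- n"]) (simp add: abs_le_iff algebra_simps)
  qed
  from this[of x y] this[of "fl \<alpha> x" "fl \<alpha> y"] show ?thesis by auto
qed

lemma near_fl_left: "near e (fl \<alpha> x) y \<longleftrightarrow> near e x (fl \<alpha> y)"
  using near_fl[of e \<alpha> "fl \<alpha> x" y] by simp

text \<open>Two reflections about different axes compose to a rotation by a multiple of
  \<open>2 * pi / 3\<close> that is not a full turn, and so does the comparison of the two orders.
  Both move every angle by at least \<open>2 * pi / 3 > 2\<close> modulo
  \<open>2 * pi\<close>.\<close>

lemma fl_fl_translation:
  assumes "\<alpha> \<in> dirs" "\<nu> \<in> dirs" "\<alpha> \<noteq> \<nu>" "e < 2"
  shows "\<not> near e (fl \<nu> (fl \<alpha> x)) x" "\<not> near e (fl \<nu> (fl \<alpha> x)) (fl \<alpha> (fl \<nu> x))"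
proof -
  have int: "\<bar>m * (2 * pi / 3) - 2 * pi * of_int n\<bar> > e" if m: "m \<in> {2, -2, 4, -4, 8, -8}" for m :: real and n :: int
  proof -
    obtain k :: int where k: "m = of_int k" "k \<in> {2, -2, 4, -4, 8, -8}" using m by (auto intro: that[of 2] that[of "-2"] that[of 4] that[of "-4"] that[of 8] that[of "-8"])
    have "k - 3 * n \<noteq> 0" using k(2) by auto presburger+
    then have "1 \<le> \<bar>k - 3 * n\<bar>" by linarith
    then have "1 \<le> \<bar>of_int (k - 3 * n) :: real\<bar>" by (metis of_int_1 of_int_abs of_int_le_iff)
    then have "2 * pi / 3 * 1 \<le> 2 * pi / 3 * \<bar>of_int (k - 3 * n)\<bar>" by (intro mult_left_mono) auto
    also have "... = \<bar>m * (2 * pi / 3) - 2 * pi * of_int n\<bar>"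
    proof -
      have "m * (2 * pi / 3) - 2 * pi * of_int n = 2 * pi / 3 * of_int (k - 3 * n)" unfolding k(1) by (simp add: field_simps)
      then show ?thesis by (simp only: abs_mult) simp
    qed
    finally show ?thesis using assms(4) pi_gt3 by simp
  qed
  obtain m where m: "fl \<nu> (fl \<alpha> x) - x = m * (2 * pi / 3)" "m \<in> {2, -2, 4, -4::real}"
  proof (rule that[of "2 * (phi \<nu> - phi \<alpha>) / (2 * pi / 3)"])
    show "2 * (phi \<nu> - phi \<alpha>) / (2 * pi / 3) \<in> {2, - 2, 4, - 4}"
      using assms(1-3) by (auto simp: phi_def field_simps)
  qed (simp add: fl_def)
  show "\<not> near e (fl \<nu> (fl \<alpha> x)) x"
  proof
    assume "near e (fl \<nu> (fl \<alpha> x)) x"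
    then obtain n :: int where "\<bar>fl \<nu> (fl \<alpha> x) - x - 2 * pi * of_int n\<bar> \<le> e" by (auto simp: near_def)
    then show False unfolding m(1) using int[of m n] m(2) by auto
  qed
  show "\<not> near e (fl \<nu> (fl \<alpha> x)) (fl \<alpha> (fl \<nu> x))"
  proof
    assume "near e (fl \<nu> (fl \<alpha> x)) (fl \<alpha> (fl \<nu> x))"
    then obtain n :: int where n: "\<bar>fl \<nu> (fl \<alpha> x) - fl \<alpha> (fl \<nu> x) - 2 * pi * of_int n\<bar> \<le> e" by (auto simp: near_def)
    have "fl \<nu> (fl \<alpha> x) - fl \<alpha> (fl \<nu> x) = 2 * m * (2 * pi / 3)" using m(1) by (simp add: fl_def)
    then show False using n int[of "2 * m" n] m(2) by auto
  qed
qed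

definition linked :: "real => nat => real => real => bool" where
  "linked e \<alpha> x y \<longleftrightarrow> near e y x \<or> near e y (fl \<alpha> x)"

lemma linked_commute: "linked e \<alpha> x y \<longleftrightarrow> linked e \<alpha> y x"
  unfolding linked_def using near_commute near_fl_left by metis

text \<open>Reduced modulo \<open>pi\<close>, \<open>z / 2\<close> lies in
  \<open>[- pi / 2, pi / 2]\<close>, where \<open>\<bar>sin x\<bar> \<ge> \<bar>x\<bar> / 2\<close>.
  One factor 2 comes from this bound, the other from halving \<open>z\<close>.\<close>

lemma near_sin:
  assumes "\<bar>sin (z / 2)\<bar> \<le> q"
  shows "\<exists>n::int. \<bar>z - 2 * pi * of_int n\<bar> \<le> 4 * q"
proof -
  have j: "x / 2 \<le> sin x" if x: "0 \<le> x" "x \<le> pi / 2" for x :: real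
  proof (cases "x = 0")
    case False
    define y where "y = x / 2"
    have y: "0 < y" "y \<le> pi / 4" using x False by (auto simp: y_def)
    have c: "cos (pi / 4) \<le> cos z" if "0 \<le> z" "z \<le> y" for z
      using that y by (intro cos_monotone_0_pi_le) auto
    obtain z where z: "0 < z" "z < y" "sin y - sin 0 = (y - 0) * cos z"
      using MVT2[OF y(1), of sin cos] by (auto intro: derivative_eq_intros)
    have "cos (pi / 4) * cos (pi / 4) = 1 / 2" by (simp add: cos_45)
    have s0: "sin y \<ge> 0" using y pi_gt_zero by (intro sin_ge_zero) linarith+
    have "x / 2 = 2 * (y * cos (pi / 4)) * cos (pi / 4)"
      using \<open>cos (pi / 4) * cos (pi / 4) = 1 / 2\<close> by (simp add: y_def mult.assoc)
    also have "... \<le> 2 * sin y * cos y"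
      using z y s0 c[of z] c[of y] by (intro mult_mono) (auto simp: cos_45 intro!: mult_left_mono)
    also have "... = sin x" by (simp add: sin_double[symmetric] y_def)
    finally show ?thesis .
  qed simp
  define n where "n = round (z / (2 * pi))"
  define x where "x = z / 2 - pi * of_int n"
  have "\<bar>of_int n - z / (2 * pi)\<bar> \<le> 1 / 2" unfolding n_def by (rule of_int_round_abs_le)
  then have "pi * \<bar>of_int n - z / (2 * pi)\<bar> \<le> pi * (1 / 2)" by (intro mult_left_mono) auto
  moreover have "pi * \<bar>of_int n - z / (2 * pi)\<bar> = \<bar>x\<bar>"
  proof -
    have "x = - (pi * (of_int n - z / (2 * pi)))" by (simp add: x_def field_simps)
    then show ?thesis by (simp add: abs_mult)
  qed
  ultimately have x: "\<bar>x\<bar> \<le> pi / 2" by simp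
  have "\<bar>sin x\<bar> = \<bar>sin (z / 2)\<bar>"
    by (simp add: x_def sin_diff)
  moreover have "\<bar>x\<bar> / 2 \<le> \<bar>sin x\<bar>"
    using j[of "\<bar>x\<bar>"] x by (cases "x \<ge> 0") (auto simp: abs_if)
  ultimately have "\<bar>2 * x\<bar> \<le> 4 * q" using assms by simp
  then show ?thesis by (intro exI[of _ n]) (simp add: x_def)
qed

text \<open>The difference of the cosines is twice a product of two sines, one of which is at most
  \<open>sqrt \<Gamma>\<close>. If it is the sine of half the difference, the spins are close; if it
  is that of half the sum, one is close to the mirror image of the other. This is the origin of the
  relation \<open>\<Gamma> = (e / 4)^2\<close>.\<close>

lemma linked_if_energy_small:
  assumes "\<bar>spin_proj \<alpha> x - spin_proj \<alpha> y\<bar> < \<Gamma>"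
  shows "linked (4 * sqrt \<Gamma>) \<alpha> x y"
proof -
  have \<Gamma>: "\<Gamma> > 0" using assms by linarith
  define u v where "u = x - phi \<alpha>" and "v = y - phi \<alpha>"
  have "\<bar>cos u - cos v\<bar> = 2 * (\<bar>sin ((u + v) / 2)\<bar> * \<bar>sin ((v - u) / 2)\<bar>)"
    unfolding cos_diff_cos by (simp add: abs_mult)
  then have "2 * (\<bar>sin ((u + v) / 2)\<bar> * \<bar>sin ((v - u) / 2)\<bar>) < \<Gamma>" using assms by (simp add: spin_proj_cos u_def v_def)
  then have p: "\<bar>sin ((u + v) / 2)\<bar> * \<bar>sin ((v - u) / 2)\<bar> < sqrt \<Gamma> * sqrt \<Gamma>" using \<Gamma> mult_nonneg_nonneg[OF abs_ge_zero abs_ge_zero, of "sin ((u + v) / 2)" "sin ((v - u) / 2)"] unfolding real_sqrt_mult_self by linarith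
  consider "\<bar>sin ((u + v) / 2)\<bar> \<le> sqrt \<Gamma>" | "\<bar>sin ((v - u) / 2)\<bar> \<le> sqrt \<Gamma>"
  proof (rule ccontr)
    assume "\<not> thesis"
    then have "sqrt \<Gamma> \<le> \<bar>sin ((u + v) / 2)\<bar>" "sqrt \<Gamma> \<le> \<bar>sin ((v - u) / 2)\<bar>" using that by linarith+
    then have "sqrt \<Gamma> * sqrt \<Gamma> \<le> \<bar>sin ((u + v) / 2)\<bar> * \<bar>sin ((v - u) / 2)\<bar>" using \<Gamma> by (intro mult_mono) auto
    then show False using p by simp
  qed
  then show ?thesis
  proof cases
    case 1
    have "near (4 * sqrt \<Gamma>) y (fl \<alpha> x)"
      using near_sin[OF 1] unfolding near_def fl_def u_def v_def by (simp add: algebra_simps)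
    then show ?thesis by (simp add: linked_def)
  next
    case 2
    have "near (4 * sqrt \<Gamma>) y x"
      using near_sin[OF 2] unfolding near_def u_def v_def by (simp add: algebra_simps)
    then show ?thesis by (simp add: linked_def)
  qed
qed

text \<open>Around a plaquette a genuine reflection of one edge is copied to the opposite edge,
  since products of two different reflections are nontrivial rotations.\<close>

lemma plaquette:
  assumes dirs: "\<alpha> \<in> dirs" "\<nu> \<in> dirs" "\<alpha> \<noteq> \<nu>" and e: "0 \<le> e" "e \<le> 1 / 10"
    and ab: "near e b (fl \<alpha> a)" and far: "\<not> near (4 * e) a (fl \<alpha> a)"
    and ac: "linked e \<nu> a c" and bd: "linked e \<nu> b d" and cd: "linked e \<alpha> c d"
  shows "near (3 * e) c a \<and> near e d (fl \<alpha> c)"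
proof -
  note tr = near_trans
  have f: "\<not> near (4 * e) (fl \<nu> (fl \<alpha> x)) x" "\<not> near (4 * e) (fl \<nu> (fl \<alpha> x)) (fl \<alpha> (fl \<nu> x))"
     "\<not> near (4 * e) (fl \<alpha> x) (fl \<nu> x)" for x
    using fl_fl_translation[OF dirs(1-3), of "4 * e" x] e near_fl_left by auto
  have bd': "near (2 * e) d (fl \<alpha> a) \<or> near (2 * e) d (fl \<nu> (fl \<alpha> a))"
    using bd unfolding linked_def
  proof
    assume "near e d b"
    from tr[OF this ab, of "2 * e"] show ?thesis by simp
  next
    assume d: "near e d (fl \<nu> b)"
    have "near e (fl \<nu> b) (fl \<nu> (fl \<alpha> a))" using ab by (simp add: near_fl)
    from tr[OF d this, of "2 * e"] show ?thesis by simp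
  qed
  \<comment> \<open>If \<open>c\<close> and \<open>d\<close> were nearly equal, going around the
    plaquette would bring \<open>a\<close> close to its mirror image, or make a product of two
    different reflections nearly fix an angle.\<close>
  have same: "near e d c ==> False"
  proof -
    assume "near e d c"
    then have cd: "near e c d" by (simp add: near_commute)
    from bd' show False
    proof
      assume d: "near (2 * e) d (fl \<alpha> a)"
      have c: "near (3 * e) c (fl \<alpha> a)" by (rule tr[OF cd d]) simp
      from ac show False unfolding linked_def
      proof
        assume "near e c a"
        then have "near e a c" by (simp add: near_commute)
        from tr[OF this c, of "4 * e"] far show False by simp
      next
        assume "near e c (fl \<nu> a)"
        then have "near e (fl \<nu> a) c" by (simp add: near_commute)
        from tr[OF this c, of "4 * e"] f(3)[of a] show False by (simp add: near_commute)
      qed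
    next
      assume d: "near (2 * e) d (fl \<nu> (fl \<alpha> a))"
      have c: "near (3 * e) c (fl \<nu> (fl \<alpha> a))" by (rule tr[OF cd d]) simp
      from ac show False unfolding linked_def
      proof
        assume "near e c a"
        then have "near e a c" by (simp add: near_commute)
        from tr[OF this c, of "4 * e"] f(1)[of a] show False by (simp add: near_commute)
      next
        assume "near e c (fl \<nu> a)"
        then have "near e (fl \<nu> a) c" by (simp add: near_commute)
        from tr[OF this c, of "4 * e"] far show False by (simp add: near_fl)
      qed
    qed
  qed
  then have d: "near e d (fl \<alpha> c)" using cd by (auto simp: linked_def)
  have "near (3 * e) c a"
    using ac unfolding linked_def
  proof
    assume "near e c a" then show ?thesis by (rule near_mono) (use e in simp)
  next
    assume c: "near e c (fl \<nu> a)"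
    have fc: "near e (fl \<alpha> c) d" using d by (simp add: near_commute)
    from bd' show ?thesis
    proof
      assume "near (2 * e) d (fl \<alpha> a)"
      from tr[OF fc this, of "3 * e"] show ?thesis by (simp add: near_fl)
    next
      assume d: "near (2 * e) d (fl \<nu> (fl \<alpha> a))"
      have "near e (fl \<alpha> (fl \<nu> a)) (fl \<alpha> c)" using c by (simp add: near_fl near_commute)
      from tr[OF tr[OF this fc order.refl] d, of "4 * e"] f(2)[of a] show ?thesis by (simp add: near_commute)
    qed
  qed
  then show ?thesis using d by simp
qed

lemma block_iff: "r \<in> block B \<longleftrightarrow> (\<forall>\<alpha>\<in>dirs. 0 \<le> crd \<alpha> r \<and> crd \<alpha> r \<le> int B)"
  by (cases r) (auto simp: block_def crd_def)

lemma vadd_unit_vec: "\<nu> \<in> dirs ==> vadd r (unit_vec \<nu>) = upd \<nu> r (crd \<nu> r + 1)"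
  by (cases r) (auto simp: vadd_def unit_vec_def upd_def crd_def)

lemma upd_block:
  assumes "r \<in> block B" "0 \<le> x" "x \<le> int B"
  shows "upd \<nu> r x \<in> block B"
  using assms by (cases r) (auto simp: block_def upd_def)

text \<open>The counter \<open>k\<close> measures accumulated error, one unit per edge; a line
  through the block has at most \<open>B\<close> edges.\<close>

lemma line_walk:
  fixes P :: "nat => site => bool"
  assumes step: "\<And>k s x. P k s ==> s \<in> block B ==> 0 \<le> x ==> x \<le> int B ==> \<bar>x - crd \<nu> s\<bar> = 1 ==> P (Suc k) (upd \<nu> s x)"
    and mono: "\<And>k k' s. P k s ==> k \<le> k' ==> P k' s" and \<nu>: "\<nu> \<in> dirs"
    and s: "P k s" "s \<in> block B" and x: "0 \<le> x" "x \<le> int B"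
  shows "P (k + B) (upd \<nu> s x)"
proof -
  have "P (k + m) (upd \<nu> s x)" if "nat \<bar>x - crd \<nu> s\<bar> = m" "0 \<le> x" "x \<le> int B" for m x
    using that
  proof (induction m arbitrary: x)
    case 0
    then have "x = crd \<nu> s" by simp
    then show ?case using s by simp
  next
    case (Suc m)
    define y where "y = (if x > crd \<nu> s then x - 1 else x + 1)"
    have cs: "0 \<le> crd \<nu> s" "crd \<nu> s \<le> int B" using s(2) \<nu> by (auto simp: block_iff)
    have y: "nat \<bar>y - crd \<nu> s\<bar> = m" "0 \<le> y" "y \<le> int B" "\<bar>x - y\<bar> = 1"
      using Suc.prems cs by (auto simp: y_def)
    have "P (Suc (k + m)) (upd \<nu> (upd \<nu> s y) x)"
      by (rule step[OF Suc.IH[OF y(1-3)] upd_block[OF s(2) y(2,3)]]) (use Suc.prems y in auto)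
    then show ?case by simp
  qed
  from this[OF refl x] have "P (k + nat \<bar>x - crd \<nu> s\<bar>) (upd \<nu> s x)" .
  moreover have "0 \<le> crd \<nu> s" "crd \<nu> s \<le> int B" using s(2) \<nu> by (auto simp: block_iff)
  ultimately show ?thesis using mono x by (elim mono) auto
qed

definition well_dist :: "real => real => bool" where
  "well_dist \<kappa> x \<longleftrightarrow> (\<exists>\<tau>::int. near \<kappa> x (pi / 3 * of_int \<tau>))"

lemma phi_thirds: "\<alpha> \<in> dirs ==> \<exists>m::int. phi \<alpha> = pi / 3 * of_int m"
  by (auto simp: phi_def intro: exI[of _ 2] exI[of _ "-2"])

lemma near_fl_self:
  assumes \<alpha>: "\<alpha> \<in> dirs" and n: "near \<kappa> x (fl \<alpha> x)"
  shows "\<exists>m n::int. phi \<alpha> = pi / 3 * of_int m \<and> \<bar>x - pi / 3 * of_int (m + 3 * n)\<bar> \<le> \<kappa> / 2"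
proof -
  obtain m :: int where m: "phi \<alpha> = pi / 3 * of_int m" using phi_thirds[OF \<alpha>] by blast
  obtain n :: int where "\<bar>x - fl \<alpha> x - 2 * pi * of_int n\<bar> \<le> \<kappa>" using n by (auto simp: near_def)
  then have "\<bar>2 * (x - pi / 3 * of_int (m + 3 * n))\<bar> \<le> \<kappa>" by (simp add: fl_def m algebra_simps)
  then have "2 * \<bar>x - pi / 3 * of_int (m + 3 * n)\<bar> \<le> \<kappa>" by (simp only: abs_mult abs_numeral)
  then have "\<bar>x - pi / 3 * of_int (m + 3 * n)\<bar> \<le> \<kappa> / 2" by (simp only: field_simps)
  with m show ?thesis by blast
qed

text \<open>A spin near its own mirror image lies near the axis, which consists of multiples of
  \<open>pi / 3\<close>. As it is also near \<open>pi / 3 * \<tau>\<close>, the axis passes through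
  that very angle and the reflection fixes it. The distance thus grows by \<open>e\<close>
  only.\<close>

lemma well_preserved:
  assumes \<alpha>: "\<alpha> \<in> dirs" and y: "near e y (fl \<alpha> x)" and self: "near \<kappa> x (fl \<alpha> x)"
    and x: "near d x (pi / 3 * of_int \<tau>)" and d: "d + \<kappa> / 2 < 1"
  shows "near (d + e) y (pi / 3 * of_int \<tau>)"
proof -
  obtain m n :: int where m: "phi \<alpha> = pi / 3 * of_int m" and n: "\<bar>x - pi / 3 * of_int (m + 3 * n)\<bar> \<le> \<kappa> / 2"
    using near_fl_self[OF \<alpha> self] by blast
  obtain k :: int where k: "\<bar>x - pi / 3 * of_int \<tau> - 2 * pi * of_int k\<bar> \<le> d" using x by (auto simp: near_def)
  have "m + 3 * n - \<tau> - 6 * k = 0"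
  proof (rule ccontr)
    assume "m + 3 * n - \<tau> - 6 * k \<noteq> 0"
    then have "1 \<le> \<bar>m + 3 * n - \<tau> - 6 * k\<bar>" by linarith
    then have "1 \<le> \<bar>of_int (m + 3 * n - \<tau> - 6 * k) :: real\<bar>" by (metis of_int_1 of_int_abs of_int_le_iff)
    then have "pi / 3 * 1 \<le> pi / 3 * \<bar>of_int (m + 3 * n - \<tau> - 6 * k)\<bar>" by (intro mult_left_mono) auto
    also have "... = \<bar>pi / 3 * of_int (m + 3 * n) - (pi / 3 * of_int \<tau> + 2 * pi * of_int k)\<bar>"
    proof -
      have "pi / 3 * of_int (m + 3 * n) - (pi / 3 * of_int \<tau> + 2 * pi * of_int k) = pi / 3 * of_int (m + 3 * n - \<tau> - 6 * k)"
        by (simp add: field_simps)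
      then show ?thesis by (simp only: abs_mult) simp
    qed
    also have "... \<le> \<kappa> / 2 + d"
    proof -
      have "\<bar>A - (T + K)\<bar> \<le> h + d" if "\<bar>x - A\<bar> \<le> h" "\<bar>x - T - K\<bar> \<le> d" for A T K h :: real
        using that by linarith
      from this[OF n k] show ?thesis .
    qed
    finally show False using d pi_gt3 by simp
  qed
  then have mm: "m = \<tau> + 6 * k - 3 * n" by linarith
  obtain j :: int where j: "\<bar>y - fl \<alpha> x - 2 * pi * of_int j\<bar> \<le> e" using y by (auto simp: near_def)
  have "y - pi / 3 * of_int \<tau> - 2 * pi * of_int (j + k - n) = (y - fl \<alpha> x - 2 * pi * of_int j) - (x - pi / 3 * of_int \<tau> - 2 * pi * of_int k)"
    unfolding fl_def m mm by (simp add: field_simps)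
  then show ?thesis unfolding near_def using j k by (intro exI[of _ "j + k - n"]) (simp add: abs_le_iff)
qed

text \<open>If some edge reflects a spin that is far from its mirror image, \<open>plaquette\<close>
  carries the reflection over the whole layer. Otherwise reflections occur only near preferred
  angles: a block with one spin in a well stays in that well, and a block with none has no genuine
  reflection, so its angle drifts by at most \<open>e\<close> per edge.\<close>

proposition block_trichotomy:
  fixes \<psi> :: config
  assumes link: "\<And>r \<nu>. r \<in> block B ==> \<nu> \<in> dirs ==> vadd r (unit_vec \<nu>) \<in> block B ==> linked e \<nu> (\<psi> r) (\<psi> (vadd r (unit_vec \<nu>)))"
    and e: "0 < e" "16 * real B * e \<le> \<kappa>" "\<kappa> \<le> 1 / 10" and B: "B \<ge> 1"
  obtains (well) \<tau> :: int where "\<And>r. r \<in> block B ==> near (\<kappa> + 3 * real B * e) (\<psi> r) (pi / 3 * of_int \<tau>)"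
  | (hom) \<theta>0 where "\<not> well_dist \<kappa> \<theta>0" "\<And>r. r \<in> block B ==> near (3 * real B * e) (\<psi> r) \<theta>0"
  | (flip) \<alpha> a \<theta>0 where "\<alpha> \<in> dirs" "0 \<le> a" "a < int B" "\<not> near \<kappa> \<theta>0 (fl \<alpha> \<theta>0)"
     "\<And>r. r \<in> block B ==> crd \<alpha> r = a ==> near (7 * real B * e) (\<psi> r) \<theta>0"
     "\<And>r. r \<in> block B ==> crd \<alpha> r = a + 1 ==> near (7 * real B * e) (\<psi> r) (fl \<alpha> \<theta>0)"
proof -
  have Be: "e \<le> real B * e" using B e by simp
  have e10: "e \<le> 1 / 10" using Be e by linarith
  have lnk: "linked e \<nu> (\<psi> s) (\<psi> (upd \<nu> s x))"
    if s: "s \<in> block B" "\<nu> \<in> dirs" "0 \<le> x" "x \<le> int B" "\<bar>x - crd \<nu> s\<bar> = 1" for s \<nu> x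
  proof (cases "x = crd \<nu> s + 1")
    case True
    then show ?thesis using link[of s \<nu>] s upd_block[of s B x \<nu>] by (simp add: vadd_unit_vec)
  next
    case False
    then have x: "x = crd \<nu> s - 1" using s(5) by linarith
    have "vadd (upd \<nu> s x) (unit_vec \<nu>) = s" using s(2) x by (simp add: vadd_unit_vec)
    then show ?thesis using link[OF upd_block[OF s(1,3,4)] s(2)] s(1) linked_commute by metis
  qed
  \<comment> \<open>Any two sites of the block are joined along three coordinate lines, in at most
    \<open>3 * B\<close> steps.\<close>
  have conn: "P (3 * B) s" if s: "s \<in> block B" and P0: "P 0 r" and r: "r \<in> block B"
    and mono: "\<And>k k' s. P k s ==> k \<le> k' ==> P k' s"
    and step: "\<And>\<nu> k s x. \<nu> \<in> dirs ==> P k s ==> s \<in> block B ==> 0 \<le> x ==> x \<le> int B ==> \<bar>x - crd \<nu> s\<bar> = 1 ==> P (Suc k) (upd \<nu> s x)"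
    for P :: "nat => site => bool" and r s
  proof -
    have lw: "P (k + B) (upd \<nu> s x)" if "\<nu> \<in> dirs" "P k s" "s \<in> block B" "0 \<le> x" "x \<le> int B" for \<nu> k s x
      by (rule line_walk[where P = P and B = B]; (rule that | erule (1) mono | (rule step[OF that(1)]; assumption)))
    obtain a b c where abc: "s = (a, b, c)" by (cases s)
    have bd: "0 \<le> a" "a \<le> int B" "0 \<le> b" "b \<le> int B" "0 \<le> c" "c \<le> int B" using s by (auto simp: abc block_def)
    have 1: "P B (upd 1 r a)" using lw[of 1 0 r a] P0 r bd by simp
    have b1: "upd 1 r a \<in> block B" using upd_block r bd by simp
    have 2: "P (B + B) (upd 2 (upd 1 r a) b)" using lw[of 2 B "upd 1 r a" b] 1 b1 bd by simp
    have b2: "upd 2 (upd 1 r a) b \<in> block B" using upd_block b1 bd by simp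
    have 3: "P (B + B + B) (upd 3 (upd 2 (upd 1 r a) b) c)" using lw[of 3 "B + B" "upd 2 (upd 1 r a) b" c] 2 b2 bd by simp
    moreover have "upd 3 (upd 2 (upd 1 r a) b) c = s" unfolding abc by (cases r) (simp add: upd_def)
    moreover have "B + B + B = 3 * B" by simp
    ultimately show ?thesis by metis
  qed
  show thesis
  proof (cases "\<exists>r\<in>block B. \<exists>\<alpha>\<in>dirs. vadd r (unit_vec \<alpha>) \<in> block B \<and> near e (\<psi> (vadd r (unit_vec \<alpha>))) (fl \<alpha> (\<psi> r)) \<and> \<not> near \<kappa> (\<psi> r) (fl \<alpha> (\<psi> r))")
    case True
    then obtain r \<alpha> where r: "r \<in> block B" "\<alpha> \<in> dirs" "vadd r (unit_vec \<alpha>) \<in> block B"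
      and fe: "near e (\<psi> (vadd r (unit_vec \<alpha>))) (fl \<alpha> (\<psi> r))" and far: "\<not> near \<kappa> (\<psi> r) (fl \<alpha> (\<psi> r))" by blast
    define a where "a = crd \<alpha> r"
    define \<theta>0 where "\<theta>0 = \<psi> r"
    have a: "0 \<le> a" "a < int B"
      using r(1-3) unfolding a_def by (auto simp: block_iff vadd_unit_vec)
    define up where "up s = upd \<alpha> s (a + 1)" for s
    \<comment> \<open>The induction over the layer carries along both the angle in the lower layer
      and the fact that the upper layer is its mirror image.\<close>
    define P where "P k s \<longleftrightarrow> crd \<alpha> s = a \<and> near (3 * real k * e) (\<psi> s) \<theta>0 \<and> near e (\<psi> (up s)) (fl \<alpha> (\<psi> s))" for k s
    have P0: "P 0 r" using r fe by (auto simp: P_def a_def \<theta>0_def near_refl up_def vadd_unit_vec)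
    have mono: "P k s ==> k \<le> k' ==> P k' s" for k k' s
      unfolding P_def using e by (auto elim!: near_mono)
    have step: "P (Suc k) (upd \<nu> s x)"
      if \<nu>: "\<nu> \<in> dirs" "\<nu> \<noteq> \<alpha>" and k: "k \<le> 2 * B" and P: "P k s" and s: "s \<in> block B" and x: "0 \<le> x" "x \<le> int B" "\<bar>x - crd \<nu> s\<bar> = 1" for \<nu> k s x
    proof -
      have u: "up s \<in> block B" unfolding up_def using s a by (intro upd_block) auto
      have comm: "upd \<alpha> (upd \<nu> s x) (a + 1) = upd \<nu> (up s) x"
        using r(2) \<nu> by (cases s) (auto simp: up_def upd_def)
      have cu: "crd \<nu> (up s) = crd \<nu> s" using r(2) \<nu> by (simp add: up_def crd_upd)
      have ca: "crd \<alpha> (upd \<nu> s x) = a" using P r(2) \<nu> by (auto simp: P_def crd_upd)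
      have sx: "upd \<nu> s x \<in> block B" using s x by (intro upd_block) auto
      have cd: "linked e \<alpha> (\<psi> (upd \<nu> s x)) (\<psi> (upd \<nu> (up s) x))"
        using lnk[OF sx r(2), of "a + 1"] a ca comm by simp
      have fs: "\<not> near (4 * e) (\<psi> s) (fl \<alpha> (\<psi> s))"
      proof
        assume n: "near (4 * e) (\<psi> s) (fl \<alpha> (\<psi> s))"
        have 1: "near (3 * real k * e) \<theta>0 (\<psi> s)" and 2: "near (3 * real k * e) (fl \<alpha> (\<psi> s)) (fl \<alpha> \<theta>0)"
          using P by (auto simp: P_def near_commute near_fl)
        have "real k * e \<le> real (2 * B) * e" using k e by (intro mult_right_mono) auto
        then have "real k * e \<le> 2 * (real B * e)" by simp
        \<comment> \<open>Origin of the 16: at most \<open>2 * B\<close> steps with error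
          \<open>3 * e\<close> each enter twice, which gives \<open>12 * B * e\<close>, and
          \<open>4 * e\<close> is the threshold of \<open>plaquette\<close>.\<close>
        then have "3 * real k * e + 4 * e + 3 * real k * e \<le> \<kappa>" using e(2) Be by linarith
        from near_trans[OF near_trans[OF 1 n order.refl] 2 this] far show False by (simp add: \<theta>0_def)
      qed
      have "near (3 * e) (\<psi> (upd \<nu> s x)) (\<psi> s) \<and> near e (\<psi> (upd \<nu> (up s) x)) (fl \<alpha> (\<psi> (upd \<nu> s x)))"
      proof (rule plaquette[OF r(2) \<nu>(1) \<nu>(2)[symmetric] _ _ _ fs lnk[OF s \<nu>(1) x] lnk[OF u \<nu>(1) x(1,2)] cd])
        show "near e (\<psi> (up s)) (fl \<alpha> (\<psi> s))" using P by (simp add: P_def)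
      qed (use e e10 x cu in auto)
      then show ?thesis unfolding P_def up_def comm[unfolded up_def] using ca P
        by (auto simp: P_def algebra_simps intro: near_trans)
    qed
    have all: "P (2 * B) s" if s: "s \<in> block B" "crd \<alpha> s = a" for s
    proof -
      obtain \<nu>1 \<nu>2 where g5: "dirs = {\<alpha>, \<nu>1, \<nu>2}" and g': "\<nu>1 \<noteq> \<alpha>" "\<nu>2 \<noteq> \<alpha>" "\<nu>1 \<noteq> \<nu>2"
        using dirs_split[OF r(2)] by metis
      have g: "\<nu>1 \<in> dirs" "\<nu>2 \<in> dirs" using g5 by blast+
      have sb: "0 \<le> crd \<nu> s" "crd \<nu> s \<le> int B" if "\<nu> \<in> dirs" for \<nu> using s(1) that by (auto simp: block_iff)
      have lwQ: "P (k + B) (upd \<nu> s' x)" if "\<nu> \<in> dirs" "\<nu> \<noteq> \<alpha>" "k + B \<le> 2 * B" "P k s'" "s' \<in> block B" "0 \<le> x" "x \<le> int B" for \<nu> k s' x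
      proof -
        have "(k + B \<le> 2 * B --> P (k + B) (upd \<nu> s' x))"
          by (rule line_walk[of "\<lambda>k s. k \<le> 2 * B --> P k s" B \<nu> k s' x])
             (use that step mono in \<open>auto intro: le_trans\<close>)
        then show ?thesis using that by simp
      qed
      have 1: "P (0 + B) (upd \<nu>1 r (crd \<nu>1 s))" by (rule lwQ) (use g g' P0 r sb in auto)
      have b1: "upd \<nu>1 r (crd \<nu>1 s) \<in> block B" using r sb g by (intro upd_block) auto
      have "P (B + B) (upd \<nu>2 (upd \<nu>1 r (crd \<nu>1 s)) (crd \<nu>2 s))" by (rule lwQ) (use g g' 1 b1 sb in auto)
      moreover have "upd \<nu>2 (upd \<nu>1 r (crd \<nu>1 s)) (crd \<nu>2 s) = s"
      proof (rule site_eqI)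
        fix \<nu> :: nat assume gd: "\<nu> \<in> dirs"
        then have "\<nu> = \<alpha> \<or> \<nu> = \<nu>1 \<or> \<nu> = \<nu>2" using g5 by blast
        then show "crd \<nu> (upd \<nu>2 (upd \<nu>1 r (crd \<nu>1 s)) (crd \<nu>2 s)) = crd \<nu> s"
          unfolding crd_upd[OF g(2) gd] crd_upd[OF g(1) gd] using g' s(2) a_def by auto
      qed
      ultimately show ?thesis by (simp add: mult_2)
    qed
    show thesis
    proof (rule flip[OF r(2) a])
      show "\<not> near \<kappa> \<theta>0 (fl \<alpha> \<theta>0)" using far by (simp add: \<theta>0_def)
      show "near (7 * real B * e) (\<psi> s) \<theta>0" if "s \<in> block B" "crd \<alpha> s = a" for s
        using all[OF that] e by (auto simp: P_def elim!: near_mono)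
      show "near (7 * real B * e) (\<psi> s) (fl \<alpha> \<theta>0)" if s: "s \<in> block B" "crd \<alpha> s = a + 1" for s
      proof -
        define s' where "s' = upd \<alpha> s a"
        have s': "s' \<in> block B" unfolding s'_def using s a by (intro upd_block) auto
        have us: "up s' = s" unfolding up_def s'_def using s(2) by (metis upd_upd upd_crd)
        have "P (2 * B) s'" by (rule all[OF s']) (simp add: s'_def)
        then have 1: "near e (\<psi> s) (fl \<alpha> (\<psi> s'))" and 2: "near (3 * real (2 * B) * e) (fl \<alpha> (\<psi> s')) (fl \<alpha> \<theta>0)"
          by (auto simp: P_def us near_fl)
        show ?thesis by (rule near_trans[OF 1 2]) (use Be in \<open>simp add: mult.commute\<close>)
      qed
    qed
  next
    case False
    have nf: "near \<kappa> (\<psi> r) (fl \<alpha> (\<psi> r))"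
      if "r \<in> block B" "\<alpha> \<in> dirs" "vadd r (unit_vec \<alpha>) \<in> block B" "near e (\<psi> (vadd r (unit_vec \<alpha>))) (fl \<alpha> (\<psi> r))" for r \<alpha>
      using False that by blast
    have nofar: "near e (\<psi> (upd \<nu> s x)) (\<psi> s) \<or> (near e (\<psi> (upd \<nu> s x)) (fl \<nu> (\<psi> s)) \<and> near (\<kappa> + 2 * e) (\<psi> s) (fl \<nu> (\<psi> s)))"
      if s: "s \<in> block B" "\<nu> \<in> dirs" "0 \<le> x" "x \<le> int B" "\<bar>x - crd \<nu> s\<bar> = 1" for s \<nu> x
    proof (cases "x = crd \<nu> s + 1")
      case True
      then have v: "vadd s (unit_vec \<nu>) = upd \<nu> s x" "vadd s (unit_vec \<nu>) \<in> block B" using s upd_block by (auto simp: vadd_unit_vec)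
      from lnk[OF s] show ?thesis unfolding linked_def
      proof
        assume n: "near e (\<psi> (upd \<nu> s x)) (fl \<nu> (\<psi> s))"
        then have "near \<kappa> (\<psi> s) (fl \<nu> (\<psi> s))" using nf[OF s(1,2) v(2)] v(1) by simp
        then have "near (\<kappa> + 2 * e) (\<psi> s) (fl \<nu> (\<psi> s))" by (rule near_mono) (use e in simp)
        then show ?thesis using n by simp
      qed simp
    next
      case False
      then have x: "x = crd \<nu> s - 1" using s(5) by linarith
      have v: "vadd (upd \<nu> s x) (unit_vec \<nu>) = s" using s(2) x by (simp add: vadd_unit_vec)
      have u: "upd \<nu> s x \<in> block B" by (rule upd_block[OF s(1,3,4)])
      from lnk[OF s] show ?thesis unfolding linked_def
      proof
        assume n: "near e (\<psi> (upd \<nu> s x)) (fl \<nu> (\<psi> s))"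
        then have n': "near e (\<psi> s) (fl \<nu> (\<psi> (upd \<nu> s x)))" by (metis near_commute near_fl_left)
        then have "near \<kappa> (\<psi> (upd \<nu> s x)) (fl \<nu> (\<psi> (upd \<nu> s x)))"
          using nf[OF u s(2)] v s(1) by simp
        moreover have "near e (fl \<nu> (\<psi> s)) (\<psi> (upd \<nu> s x))" using n by (simp add: near_commute)
        ultimately have "near (e + \<kappa>) (fl \<nu> (\<psi> s)) (fl \<nu> (\<psi> (upd \<nu> s x)))" by (intro near_trans[OF _ _ order.refl])
        moreover have "near e (fl \<nu> (\<psi> (upd \<nu> s x))) (\<psi> s)" using n' by (simp add: near_commute)
        ultimately have "near (e + \<kappa> + e) (fl \<nu> (\<psi> s)) (\<psi> s)" by (rule near_trans[OF _ _ order.refl])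
        then show ?thesis using n by (simp add: near_commute algebra_simps)
      qed simp
    qed
    show thesis
    proof (cases "\<exists>r\<in>block B. well_dist \<kappa> (\<psi> r)")
      case True
      then obtain r \<tau> where r: "r \<in> block B" "near \<kappa> (\<psi> r) (pi / 3 * of_int \<tau>)" by (auto simp: well_dist_def)
      define P where "P k s \<longleftrightarrow> (k \<le> 3 * B --> near (\<kappa> + real k * e) (\<psi> s) (pi / 3 * of_int \<tau>))" for k s
      have "P (3 * B) s" if s: "s \<in> block B" for s
      proof (rule conn[OF s _ r(1)])
        show "P 0 r" using r by (simp add: P_def)
        show "P k s ==> k \<le> k' ==> P k' s" for k k' s
          unfolding P_def using e by (auto elim!: near_mono intro!: mult_right_mono)
        fix \<nu> k s x assume a: "\<nu> \<in> dirs" "P k s" "s \<in> block B" "0 \<le> x" "x \<le> int B" "\<bar>x - crd \<nu> s\<bar> = 1"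
        show "P (Suc k) (upd \<nu> s x)" unfolding P_def
        proof
          assume k: "Suc k \<le> 3 * B"
          then have n: "near (\<kappa> + real k * e) (\<psi> s) (pi / 3 * of_int \<tau>)" using a by (simp add: P_def)
          have "real k * e \<le> real (3 * B) * e" using k e by (intro mult_right_mono) auto
          then have "real k * e \<le> 3 * (real B * e)" by simp
          moreover have "(\<kappa> + 2 * e) / 2 = \<kappa> / 2 + e" by simp
          ultimately have small: "\<kappa> + real k * e + (\<kappa> + 2 * e) / 2 < 1" using e(2,3) Be by linarith
          from nofar[OF a(3,1,4,5,6)] have "near (\<kappa> + real k * e + e) (\<psi> (upd \<nu> s x)) (pi / 3 * of_int \<tau>)"
          proof
            assume "near e (\<psi> (upd \<nu> s x)) (\<psi> s)"
            from near_trans[OF this n] show ?thesis by simp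
          next
            assume "near e (\<psi> (upd \<nu> s x)) (fl \<nu> (\<psi> s)) \<and> near (\<kappa> + 2 * e) (\<psi> s) (fl \<nu> (\<psi> s))"
            then show ?thesis using well_preserved[OF a(1) _ _ n small] by blast
          qed
          then show "near (\<kappa> + real (Suc k) * e) (\<psi> (upd \<nu> s x)) (pi / 3 * of_int \<tau>)" by (simp add: algebra_simps)
        qed
      qed
      then show thesis by (intro well[of \<tau>]) (auto simp: P_def)
    next
      case nowell: False
      define r0 :: site where "r0 = (0, 0, 0)"
      have r0: "r0 \<in> block B" by (simp add: r0_def block_def)
      define P where "P k s \<longleftrightarrow> near (real k * e) (\<psi> s) (\<psi> r0)" for k s
      have "P (3 * B) s" if s: "s \<in> block B" for s
      proof (rule conn[OF s _ r0])
        show "P 0 r0" by (simp add: P_def near_refl)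
        show "P k s ==> k \<le> k' ==> P k' s" for k k' s
          unfolding P_def using e by (auto elim!: near_mono intro!: mult_right_mono)
        fix \<nu> k s x assume a: "\<nu> \<in> dirs" "P k s" "s \<in> block B" "0 \<le> x" "x \<le> int B" "\<bar>x - crd \<nu> s\<bar> = 1"
        from nofar[OF a(3,1,4,5,6)] have "near e (\<psi> (upd \<nu> s x)) (\<psi> s)"
        proof
          assume "near e (\<psi> (upd \<nu> s x)) (fl \<nu> (\<psi> s)) \<and> near (\<kappa> + 2 * e) (\<psi> s) (fl \<nu> (\<psi> s))"
          then obtain m n :: int where "\<bar>\<psi> s - pi / 3 * of_int (m + 3 * n)\<bar> \<le> (\<kappa> + 2 * e) / 2"
            using near_fl_self[OF a(1)] by blast
          moreover have "2 * e \<le> \<kappa>" using e(1,2) Be by linarith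
          then have "(\<kappa> + 2 * e) / 2 \<le> \<kappa>" by simp
          ultimately have "well_dist \<kappa> (\<psi> s)" unfolding well_dist_def near_def
            by (intro exI[of _ "m + 3 * n"] exI[of _ 0]) simp
          then show ?thesis using nowell a(3) by blast
        qed simp
        then show "P (Suc k) (upd \<nu> s x)" using a(2) unfolding P_def by (rule near_trans) (simp add: algebra_simps)
      qed
      then show thesis using nowell r0 by (intro hom[of "\<psi> r0"]) (auto simp: P_def)
    qed
  qed
qed

section \<open>Finite families of patterns\<close>

text \<open>\<open>fl \<alpha>\<close> exchanges the other two axes, because
  \<open>2 * phi \<alpha> - phi \<nu> - phi \<nu>'\<close> is a multiple of
  \<open>2 * pi\<close>.\<close>

lemma stiff_fl_other:
  assumes "\<alpha> \<in> dirs" "\<nu> \<in> dirs" "\<nu>' \<in> dirs" "\<alpha> \<noteq> \<nu>" "\<nu> \<noteq> \<nu>'" "\<nu>' \<noteq> \<alpha>"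
  shows "stiff (fl \<alpha> c) \<nu> = stiff c \<nu>'"
proof -
  have "2 * phi \<alpha> - phi \<nu> - phi \<nu>' = 0 \<or> 2 * phi \<alpha> - phi \<nu> - phi \<nu>' = 2 * pi \<or> 2 * phi \<alpha> - phi \<nu> - phi \<nu>' = - 2 * pi"
    using assms by (auto simp: phi_def)
  moreover have "fl \<alpha> c - phi \<nu> = (2 * phi \<alpha> - phi \<nu> - phi \<nu>') - (c - phi \<nu>')" by (simp add: fl_def)
  ultimately have "sin (fl \<alpha> c - phi \<nu>) = - sin (c - phi \<nu>')"
    by (elim disjE) (simp_all only: sin_diff sin_minus cos_minus mult_minus_left sin_zero cos_zero sin_two_pi cos_two_pi, simp_all)
  then show ?thesis by (simp add: stiff_def)
qed

lemma stiff_nonneg: "stiff c \<nu> \<ge> 0" by (simp add: stiff_def)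

text \<open>It vanishes exactly at the angles whose pattern has gap 0: the multiples of
  \<open>pi / 3\<close> for homogeneous patterns, the axis of \<open>\<alpha>\<close> for mirrored
  ones.\<close>

definition pat_test :: "bool => nat => real => real" where
  "pat_test b \<alpha> \<theta> = (if b then sin (\<theta> - phi \<alpha>) else sin (3 * \<theta>))"

lemma stiff_zero_sin3: "\<nu> \<in> dirs ==> stiff c \<nu> = 0 ==> sin (3 * c) = 0"
proof -
  assume \<nu>: "\<nu> \<in> dirs" and 0: "stiff c \<nu> = 0"
  then have "sin (c - phi \<nu>) = 0" by (simp add: stiff_def)
  then obtain n :: int where n: "c - phi \<nu> = of_int n * pi" using sin_zero_iff_int2 by blast
  obtain m :: int where m: "phi \<nu> = pi / 3 * of_int m" using phi_thirds[OF \<nu>] by blast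
  have "3 * c = of_int (m + 3 * n) * pi" using n m by (simp add: algebra_simps)
  then show ?thesis using sin_zero_iff_int2 by blast
qed

text \<open>A mirrored pattern has \<open>p \<alpha> > 0\<close>, and the reflection exchanges the
  other two weights. If these differ, the alternation term is positive. If they agree, they are not
  0, since a vector with both equal to 0 is not on the circle, and the product term is
  positive.\<close>

lemma pat_gap_pos:
  assumes \<alpha>: "\<alpha> \<in> dirs" and t: "pat_test b \<alpha> c \<noteq> 0"
  shows "pat_gap b \<alpha> c > 0"
proof (cases b)
  case False
  then have s: "sin (3 * c) \<noteq> 0" using t by (simp add: pat_test_def)
  have "stiff c \<nu> > 0" if "\<nu> \<in> dirs" for \<nu>
    using stiff_zero_sin3[OF that, of c] s stiff_nonneg[of c \<nu>] by (cases "stiff c \<nu> = 0") auto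
  from this[of 1] this[of 2] this[of 3] show ?thesis
    using False by (simp add: pat_gap_def pattern_gap_def other_angle_def)
next
  case True
  define p q where "p = stiff c" and "q = stiff (fl \<alpha> c)"
  have p\<alpha>: "p \<alpha> > 0" using t True by (simp add: p_def stiff_def pat_test_def)
  have nn: "p \<nu> \<ge> 0" "q \<nu> \<ge> 0" for \<nu> by (simp_all add: p_def q_def stiff_nonneg)
  obtain \<nu>1 \<nu>2 where d: "dirs = {\<alpha>, \<nu>1, \<nu>2}" and n: "\<nu>1 \<noteq> \<alpha>" "\<nu>2 \<noteq> \<alpha>" "\<nu>1 \<noteq> \<nu>2"
    using dirs_split[OF \<alpha>] by metis
  have g: "\<nu>1 \<in> dirs" "\<nu>2 \<in> dirs" "dirs - {\<alpha>} = {\<nu>1, \<nu>2}" using d n by blast+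
  have prod: "h 1 * h 2 * h 3 = h \<alpha> * (h \<nu>1 * h \<nu>2)" for h :: "nat => real"
  proof -
    have "h 1 * h 2 * h 3 = prod h dirs" by simp
    also have "... = h \<alpha> * (h \<nu>1 * h \<nu>2)" unfolding d using n by simp
    finally show ?thesis .
  qed
  have sum: "h 1 + h 2 + h 3 = h \<alpha> + h \<nu>1 + h \<nu>2" for h :: "nat => real"
  proof -
    have "h 1 + h 2 + h 3 = sum h dirs" by simp
    also have "... = h \<alpha> + h \<nu>1 + h \<nu>2" unfolding d using n by simp
    finally show ?thesis .
  qed
  have q: "q \<nu>1 = p \<nu>2" "q \<nu>2 = p \<nu>1" unfolding p_def q_def
    using stiff_fl_other[OF \<alpha> g(1,2)] stiff_fl_other[OF \<alpha> g(2,1)] n by auto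
  have gap: "pat_gap b \<alpha> c = 3 / 4 * (p \<alpha> * (p \<nu>1 * p \<nu>2) + q \<alpha> * (q \<nu>1 * q \<nu>2)) + (p \<alpha>)\<^sup>2 / 4 * (2 * (p \<nu>1 - p \<nu>2)\<^sup>2)"
  proof -
    have oa: "other_angle b \<alpha> c = fl \<alpha> c" using True by (simp add: other_angle_def)
    have sq: "(p \<nu>2 - p \<nu>1)\<^sup>2 = (p \<nu>1 - p \<nu>2)\<^sup>2" by (rule power2_commute)
    show ?thesis
      unfolding pat_gap_def oa pattern_gap_def p_def[symmetric] q_def[symmetric] g(3) prod[of p] prod[of q]
      using n(3) by (simp add: q sq)
  qed
  have ci: "p \<alpha> + p \<nu>1 + p \<nu>2 = 1" "(p \<alpha>)\<^sup>2 + (p \<nu>1)\<^sup>2 + (p \<nu>2)\<^sup>2 = 1 / 2"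
    using circle_stiff[of c] sum[of p] sum[of "\<lambda>\<nu>. (p \<nu>)\<^sup>2"] by (auto simp: circle_def p_def)
  show ?thesis
  proof (cases "p \<nu>1 = p \<nu>2")
    case False
    then have "(p \<alpha>)\<^sup>2 / 4 * (2 * (p \<nu>1 - p \<nu>2)\<^sup>2) > 0" using p\<alpha> by simp
    moreover have "3 / 4 * (p \<alpha> * (p \<nu>1 * p \<nu>2) + q \<alpha> * (q \<nu>1 * q \<nu>2)) \<ge> 0"
      by (intro mult_nonneg_nonneg add_nonneg_nonneg nn) auto
    ultimately show ?thesis unfolding gap by linarith
  next
    case eq: True
    have "p \<nu>2 \<noteq> 0"
    proof
      assume "p \<nu>2 = 0"
      then show False using ci eq by simp
    qed
    then have "p \<nu>2 > 0" using nn(1)[of \<nu>2] by simp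
    then have "3 / 4 * (p \<alpha> * (p \<nu>1 * p \<nu>2)) > 0" using p\<alpha> eq by simp
    moreover have "q \<alpha> * (q \<nu>1 * q \<nu>2) \<ge> 0" "(p \<alpha>)\<^sup>2 / 4 * (2 * (p \<nu>1 - p \<nu>2)\<^sup>2) \<ge> 0"
      by (intro mult_nonneg_nonneg nn) auto
    ultimately show ?thesis unfolding gap distrib_left by linarith
  qed
qed

lemma pat_test_if_not_well:
  assumes "\<not> well_dist \<kappa> \<theta>" "\<kappa> > 0"
  shows "\<kappa> / 4 \<le> \<bar>pat_test False \<alpha> \<theta>\<bar>"
proof (rule ccontr)
  assume "\<not> ?thesis"
  then have "\<bar>sin (6 * \<theta> / 2)\<bar> \<le> \<kappa> / 4" by (simp add: pat_test_def)
  then obtain n :: int where n: "\<bar>6 * \<theta> - 2 * pi * of_int n\<bar> \<le> 4 * (\<kappa> / 4)" using near_sin by blast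
  have "6 * \<theta> - 2 * pi * of_int n = 6 * (\<theta> - pi / 3 * of_int n)" by (simp add: field_simps)
  then have "6 * \<bar>\<theta> - pi / 3 * of_int n\<bar> \<le> \<kappa>" using n by (simp only: abs_mult abs_numeral)
  then have "\<bar>\<theta> - pi / 3 * of_int n\<bar> \<le> \<kappa>" using assms(2) by simp
  then have "well_dist \<kappa> \<theta>" unfolding well_dist_def near_def by (intro exI[of _ n] exI[of _ 0]) simp
  then show False using assms by simp
qed

lemma pat_test_if_far:
  assumes "\<not> near \<kappa> \<theta> (fl \<alpha> \<theta>)"
  shows "\<kappa> / 4 \<le> \<bar>pat_test True \<alpha> \<theta>\<bar>"
proof (rule ccontr)
  assume "\<not> ?thesis"
  moreover have "2 * (\<theta> - phi \<alpha>) / 2 = \<theta> - phi \<alpha>" by simp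
  ultimately have "\<bar>sin (2 * (\<theta> - phi \<alpha>) / 2)\<bar> \<le> \<kappa> / 4" unfolding pat_test_def by (simp only: if_True)
  then obtain n :: int where n: "\<bar>2 * (\<theta> - phi \<alpha>) - 2 * pi * of_int n\<bar> \<le> 4 * (\<kappa> / 4)" using near_sin by blast
  moreover have "\<theta> - fl \<alpha> \<theta> = 2 * (\<theta> - phi \<alpha>)" by (simp add: fl_def)
  ultimately have "near \<kappa> \<theta> (fl \<alpha> \<theta>)" unfolding near_def by (intro exI[of _ n]) simp
  then show False using assms by simp
qed

type_synonym pattern = "bool \<times> nat \<times> real \<times> real"

text \<open>The margin \<open>d\<close> leaves room for the drift of the spins within a
  block.\<close>

abbreviation covered :: "pattern set => real => bool => nat => real => bool" where
  "covered Pt d b \<alpha> \<theta> \<equiv> \<exists>c \<delta>. (b, \<alpha>, c, \<delta>) \<in> Pt \<and> near (\<delta> - d) \<theta> c"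

definition suppressed :: "real => real => real => pattern => bool" where
  "suppressed J g \<beta> = (\<lambda>(b, \<alpha>, c, \<delta>). \<forall>L. even L --> L > 4 --> \<beta> powr (1 / 20) \<le> real L -->
     patZ J \<beta> L b \<alpha> c \<delta> \<le> ennreal (exp (- g) ^ (L ^ 3)) * totZ J \<beta> L)"

text \<open>Each angle with test value at least \<open>q\<close> has its own radius and its own gap.
  By compactness finitely many balls of half the radius cover these angles, so that a single rate
  \<open>g\<close> and a single margin \<open>\<delta>0\<close> serve for all of them, independently
  of \<open>\<beta>\<close>.\<close>

lemma finite_pattern_cover:
  assumes J: "J > 0" and \<alpha>: "\<alpha> \<in> dirs" and q: "q > 0"
  shows "\<exists>S :: (real \<times> real) set. \<exists>g \<delta>0. finite S \<and> g > 0 \<and> \<delta>0 > 0 \<and>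
    (\<forall>\<^sub>F \<beta> in at_top. \<forall>(c, \<delta>)\<in>S. suppressed J g \<beta> (b, \<alpha>, c, \<delta>)) \<and>
    (\<forall>\<theta>. q \<le> \<bar>pat_test b \<alpha> \<theta>\<bar> --> (\<exists>(c, \<delta>)\<in>S. near (\<delta> - \<delta>0) \<theta> c))"
proof -
  define K where "K = {\<theta>\<in>{0..2*pi}. q \<le> \<bar>pat_test b \<alpha> \<theta>\<bar>}"
  have "closed {\<theta>. q \<le> \<bar>pat_test b \<alpha> \<theta>\<bar>}"
    unfolding pat_test_def by (cases b) (auto intro!: closed_Collect_le continuous_intros)
  from compact_Int_closed[OF compact_Icc this, of 0 "2 * pi"] have K: "compact K"
    unfolding K_def by (simp add: Int_def)
  have "\<forall>c\<in>K. \<exists>\<delta>>0. \<delta> \<le> 1 \<and> (\<forall>\<^sub>F \<beta> in at_top. suppressed J (pat_gap b \<alpha> c / 32) \<beta> (b, \<alpha>, c, \<delta>))"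
  proof
    fix c assume "c \<in> K"
    then have "pat_gap b \<alpha> c > 0" using q by (intro pat_gap_pos[OF \<alpha>]) (auto simp: K_def)
    from pattern_suppressed[OF J \<alpha> this] show "\<exists>\<delta>>0. \<delta> \<le> 1 \<and> (\<forall>\<^sub>F \<beta> in at_top. suppressed J (pat_gap b \<alpha> c / 32) \<beta> (b, \<alpha>, c, \<delta>))"
      unfolding suppressed_def by simp
  qed
  then obtain d where d: "\<And>c. c \<in> K ==> d c > 0"
    "\<And>c. c \<in> K ==> \<forall>\<^sub>F \<beta> in at_top. suppressed J (pat_gap b \<alpha> c / 32) \<beta> (b, \<alpha>, c, d c)"
    by metis
  have "K \<subseteq> (\<Union>c\<in>K. ball c (d c / 2))" using d(1) by fastforce
  from compactE_image[OF K _ this] obtain C where C: "C \<subseteq> K" "finite C" "K \<subseteq> (\<Union>c\<in>C. ball c (d c / 2))" by auto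
  define S where "S = (\<lambda>c. (c, d c)) ` C"
  define g where "g = Min (insert 1 ((\<lambda>c. pat_gap b \<alpha> c / 32) ` C))"
  define \<delta>0 where "\<delta>0 = Min (insert 1 ((\<lambda>c. d c / 2) ` C))"
  have gp: "pat_gap b \<alpha> c > 0" if "c \<in> C" for c
    using that C(1) q by (intro pat_gap_pos[OF \<alpha>]) (auto simp: K_def)
  have g: "g > 0" unfolding g_def using C gp by (subst Min_gr_iff) auto
  have \<delta>0: "\<delta>0 > 0" unfolding \<delta>0_def using C d(1) by (subst Min_gr_iff) auto
  have gle: "g \<le> pat_gap b \<alpha> c / 32" "\<delta>0 \<le> d c / 2" if "c \<in> C" for c
    unfolding g_def \<delta>0_def using that C(2) by (intro Min_le; blast)+
  show ?thesis
  proof (rule exI[of _ S], rule exI[of _ g], rule exI[of _ \<delta>0], intro conjI g \<delta>0)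
    show "finite S" unfolding S_def using C by simp
    have "\<forall>\<^sub>F \<beta> in at_top. \<forall>c\<in>C. suppressed J (pat_gap b \<alpha> c / 32) \<beta> (b, \<alpha>, c, d c)"
      using C d(2) by (intro eventually_ball_finite) auto
    then show "\<forall>\<^sub>F \<beta> in at_top. \<forall>(c, \<delta>)\<in>S. suppressed J g \<beta> (b, \<alpha>, c, \<delta>)"
    proof eventually_elim
      case (elim \<beta>)
      have "suppressed J g \<beta> (b, \<alpha>, c, d c)" if c: "c \<in> C" for c
        unfolding suppressed_def split_conv
      proof (intro allI impI)
        fix L :: nat assume L: "even L" "L > 4" "\<beta> powr (1 / 20) \<le> real L"
        have "patZ J \<beta> L b \<alpha> c (d c) \<le> ennreal (exp (- (pat_gap b \<alpha> c / 32)) ^ (L ^ 3)) * totZ J \<beta> L"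
          using elim c L unfolding suppressed_def by blast
        also have "... \<le> ennreal (exp (- g) ^ (L ^ 3)) * totZ J \<beta> L"
          using gle(1)[OF c] by (intro mult_right_mono ennreal_leI power_mono) auto
        finally show "patZ J \<beta> L b \<alpha> c (d c) \<le> ennreal (exp (- g) ^ (L ^ 3)) * totZ J \<beta> L" .
      qed
      then show ?case unfolding S_def by auto
    qed
    show "\<forall>\<theta>. q \<le> \<bar>pat_test b \<alpha> \<theta>\<bar> --> (\<exists>(c, \<delta>)\<in>S. near (\<delta> - \<delta>0) \<theta> c)"
    proof (intro allI impI)
    fix \<theta> assume \<theta>: "q \<le> \<bar>pat_test b \<alpha> \<theta>\<bar>"
    define n where "n = \<lfloor>\<theta> / (2 * pi)\<rfloor>"
    define \<theta>' where "\<theta>' = \<theta> - 2 * pi * of_int n"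
    have "of_int n \<le> \<theta> / (2 * pi)" "\<theta> / (2 * pi) < of_int n + 1" unfolding n_def by linarith+
    then have r: "0 \<le> \<theta>'" "\<theta>' \<le> 2 * pi" unfolding \<theta>'_def by (auto simp: field_simps)
    have "sin (x - 2 * pi * of_int n) = sin x" for x and n :: int
      unfolding sin_diff cos_int_2pin sin_int_2pin by simp
    from this[of "\<theta> - phi \<alpha>" n] this[of "3 * \<theta>" "3 * n"] have "pat_test b \<alpha> \<theta>' = pat_test b \<alpha> \<theta>"
      unfolding pat_test_def \<theta>'_def by (simp add: algebra_simps)
    then have "\<theta>' \<in> K" using r \<theta> by (simp add: K_def)
    then obtain c where c: "c \<in> C" "dist c \<theta>' < d c / 2" using C(3) by auto
    have "\<bar>\<theta>' - c\<bar> \<le> d c - \<delta>0" using gle(2)[OF c(1)] c(2) by (simp add: dist_real_def abs_minus_commute)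
    then have "near (d c - \<delta>0) \<theta> c" unfolding near_def \<theta>'_def by (intro exI[of _ n]) (simp add: algebra_simps)
    then show "\<exists>(c, \<delta>)\<in>S. near (\<delta> - \<delta>0) \<theta> c" unfolding S_def using c(1) by auto
    qed
  qed
qed

lemma suppressed_mono:
  assumes "suppressed J g \<beta> p" "g' \<le> g"
  shows "suppressed J g' \<beta> p"
proof -
  obtain b \<alpha> c \<delta> where p: "p = (b, \<alpha>, c, \<delta>)" by (cases p)
  have "ennreal (exp (- g) ^ (L ^ 3)) * totZ J \<beta> L \<le> ennreal (exp (- g') ^ (L ^ 3)) * totZ J \<beta> L" for L
    using assms(2) by (intro mult_right_mono ennreal_leI power_mono) auto
  then show ?thesis using assms(1) unfolding p suppressed_def split_conv by (meson order.trans)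
qed

proposition pattern_family:
  assumes J: "J > 0" and \<kappa>: "\<kappa> > 0"
  obtains Pt :: "pattern set" and g \<delta>0 where "finite Pt" "g > 0" "\<delta>0 > 0" "\<And>b \<alpha> c \<delta>. (b, \<alpha>, c, \<delta>) \<in> Pt ==> \<alpha> \<in> dirs"
    "\<forall>\<^sub>F \<beta> in at_top. \<forall>p\<in>Pt. suppressed J g \<beta> p"
    "\<And>\<theta>. \<not> well_dist \<kappa> \<theta> ==> covered Pt \<delta>0 False 1 \<theta>"
    "\<And>\<alpha> \<theta>. \<alpha> \<in> dirs ==> \<not> near \<kappa> \<theta> (fl \<alpha> \<theta>) ==> covered Pt \<delta>0 True \<alpha> \<theta>"
proof -
  define I where "I = (UNIV :: bool set) \<times> dirs"
  define Q where "Q i x \<longleftrightarrow> finite (fst x) \<and> fst (snd x) > 0 \<and> snd (snd x) > 0 \<and>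
    (\<forall>\<^sub>F \<beta> in at_top. \<forall>(c, \<delta>)\<in>fst x. suppressed J (fst (snd x)) \<beta> (fst i, snd i, c, \<delta>)) \<and>
    (\<forall>\<theta>. \<kappa> / 4 \<le> \<bar>pat_test (fst i) (snd i) \<theta>\<bar> --> (\<exists>(c, \<delta>)\<in>fst x. near (\<delta> - snd (snd x)) \<theta> c))"
    for i :: "bool \<times> nat" and x :: "(real \<times> real) set \<times> real \<times> real"
  have "\<forall>i\<in>I. \<exists>x. Q i x"
  proof
    fix i assume "i \<in> I"
    then have "snd i \<in> dirs" "\<kappa> / 4 > 0" using \<kappa> by (auto simp: I_def)
    from finite_pattern_cover[OF J this, of "fst i"] obtain S g \<delta>0 where "Q i (S, g, \<delta>0)"
      unfolding Q_def fst_conv snd_conv by blast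
    then show "\<exists>x. Q i x" by blast
  qed
  from bchoice[OF this] obtain F where F: "\<And>i. i \<in> I ==> Q i (F i)" by blast
  define S G D where "S i = fst (F i)" and "G i = fst (snd (F i))" and "D i = snd (snd (F i))" for i
  have *: "finite (S i)" "G i > 0" "D i > 0"
    "\<forall>\<^sub>F \<beta> in at_top. \<forall>(c, \<delta>)\<in>S i. suppressed J (G i) \<beta> (fst i, snd i, c, \<delta>)"
    "\<And>\<theta>. \<kappa> / 4 \<le> \<bar>pat_test (fst i) (snd i) \<theta>\<bar> ==> \<exists>(c, \<delta>)\<in>S i. near (\<delta> - D i) \<theta> c" if "i \<in> I" for i
    using F[OF that] unfolding Q_def S_def G_def D_def by blast+
  have I: "finite I" "I \<noteq> {}" by (auto simp: I_def)
  define Pt where "Pt = (\<Union>i\<in>I. (\<lambda>(c, \<delta>). (fst i, snd i, c, \<delta>)) ` S i)"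
  define g where "g = Min (G ` I)"
  define \<delta>0 where "\<delta>0 = Min (D ` I)"
  have le: "g \<le> G i" "\<delta>0 \<le> D i" if "i \<in> I" for i unfolding g_def \<delta>0_def using I that by auto
  have near': "near (\<delta> - \<delta>0) \<theta> c" if "near (\<delta> - D i) \<theta> c" "i \<in> I" for \<delta> \<theta> c i
    using that(1) le(2)[OF that(2)] by (auto elim: near_mono)
  show thesis
  proof (rule that[of Pt g \<delta>0])
    show "finite Pt" unfolding Pt_def using I(1) *(1) by blast
    show "g > 0" unfolding g_def using I *(2) by (subst Min_gr_iff) auto
    show "\<delta>0 > 0" unfolding \<delta>0_def using I *(3) by (subst Min_gr_iff) auto
    show "\<alpha> \<in> dirs" if "(b, \<alpha>, c, \<delta>) \<in> Pt" for b \<alpha> c \<delta> using that unfolding Pt_def I_def by auto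
    have "\<forall>\<^sub>F \<beta> in at_top. \<forall>i\<in>I. \<forall>(c, \<delta>)\<in>S i. suppressed J (G i) \<beta> (fst i, snd i, c, \<delta>)"
      by (rule eventually_ball_finite[OF I(1)]) (rule ballI, erule *(4))
    then show "\<forall>\<^sub>F \<beta> in at_top. \<forall>p\<in>Pt. suppressed J g \<beta> p"
    proof eventually_elim
      case (elim \<beta>)
      then show ?case unfolding Pt_def using le(1) by (fastforce intro: suppressed_mono)
    qed
    show "covered Pt \<delta>0 False 1 \<theta>" if "\<not> well_dist \<kappa> \<theta>" for \<theta>
    proof -
      have i: "(False, 1) \<in> I" by (simp add: I_def)
      have "\<kappa> / 4 \<le> \<bar>pat_test False 1 \<theta>\<bar>" using pat_test_if_not_well[OF that \<kappa>] .
      then obtain c \<delta> where "(c, \<delta>) \<in> S (False, 1)" "near (\<delta> - D (False, 1)) \<theta> c" using *(5)[OF i, of \<theta>] unfolding fst_conv snd_conv by blast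
      then show ?thesis using near'[OF _ i] i unfolding Pt_def by force
    qed
    show "covered Pt \<delta>0 True \<alpha> \<theta>" if "\<alpha> \<in> dirs" "\<not> near \<kappa> \<theta> (fl \<alpha> \<theta>)" for \<alpha> \<theta>
    proof -
      have i: "(True, \<alpha>) \<in> I" using that by (simp add: I_def)
      have "\<kappa> / 4 \<le> \<bar>pat_test True \<alpha> \<theta>\<bar>" using pat_test_if_far[OF that(2)] .
      then obtain c \<delta> where "(c, \<delta>) \<in> S (True, \<alpha>)" "near (\<delta> - D (True, \<alpha>)) \<theta> c" using *(5)[OF i, of \<theta>] unfolding fst_conv snd_conv by blast
      then show ?thesis using near'[OF _ i] i unfolding Pt_def by force
    qed
  qed
qed

section \<open>Probability of bad blocks\<close>

definition toggle :: "nat => site => site" where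
  "toggle \<nu> u = upd \<nu> u (1 - crd \<nu> u)"

definition cube_energy :: "config => real" where
  "cube_energy \<omega> = (\<Sum>\<nu>\<in>dirs. \<Sum>u\<in>torus 2. edge_energy \<nu> (\<omega> u) (\<omega> (toggle \<nu> u)))"

lemma toggle_torus: "u \<in> torus 2 ==> toggle \<nu> u \<in> torus 2"
  unfolding toggle_def using crd_torus[of u 2 \<nu>] by (intro upd_torus) auto

lemma crd_modL: "crd \<nu> (modL L x) = crd \<nu> x mod int L"
  by (cases x) (simp add: crd_def modL_def)

lemma crd_vadd: "crd \<nu> (vadd x y) = crd \<nu> x + crd \<nu> y"
  by (cases x; cases y) (simp add: crd_def vadd_def)

lemma modL_torus: "L > 0 ==> modL L x \<in> torus L"
  by (cases x) (auto simp: torus_def modL_def)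

lemma sum_translate:
  assumes "L > 0"
  shows "(\<Sum>r\<in>torus L. f (modL L (vadd r d))) = (\<Sum>r\<in>torus L. f r)"
proof (rule sum.reindex_bij_betw, rule bij_betw_byWitness[where f' = "\<lambda>r. modL L (vadd r (- crd 1 d, - crd 2 d, - crd 3 d))"])
  have m: "crd \<nu> (- crd 1 d, - crd 2 d, - crd 3 d) = - crd \<nu> d" if "\<nu> \<in> dirs" for \<nu> using that by (auto simp: crd_def split: prod.splits)
  show "\<forall>r\<in>torus L. modL L (vadd (modL L (vadd r d)) (- crd 1 d, - crd 2 d, - crd 3 d)) = r"
    using m crd_torus by (intro ballI site_eqI) (auto simp only: crd_modL crd_vadd mod_add_left_eq add.assoc add.right_inverse add_0_right mod_pos_pos_trivial)
  show "\<forall>r\<in>torus L. modL L (vadd (modL L (vadd r (- crd 1 d, - crd 2 d, - crd 3 d))) d) = r"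
    using m crd_torus by (intro ballI site_eqI) (auto simp only: crd_modL crd_vadd mod_add_left_eq add.assoc add.left_inverse add_0_right mod_pos_pos_trivial)
qed (use assms in \<open>blast intro: modL_torus\<close>)+

lemma edge_energy_commute: "edge_energy \<nu> x y = edge_energy \<nu> y x"
  by (simp add: edge_energy_def power2_commute)

text \<open>An edge belongs to four cubes and is counted from both ends in each of them, whence
  \<open>J / 16\<close> in place of \<open>J / 2\<close>.\<close>

lemma hamiltonian_cubes:
  assumes L: "L > 0"
  shows "hamiltonian J L \<theta> = J / 16 * (\<Sum>r\<in>torus L. cube_energy (cube L \<theta> r))"
proof -
  define \<rho> where "\<rho> r u = (if odd (crd 1 r) then 1 - crd 1 u else crd 1 u, if odd (crd 2 r) then 1 - crd 2 u else crd 2 u,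
     if odd (crd 3 r) then 1 - crd 3 u else crd 3 u)" for r u :: site
  have c\<rho>: "crd \<nu> (\<rho> r u) = (if odd (crd \<nu> r) then 1 - crd \<nu> u else crd \<nu> u)" if "\<nu> \<in> dirs" for \<nu> r u
    using that by (auto simp: \<rho>_def crd_def split: prod.splits)
  have bm: "block_map L 1 r u = modL L (vadd r (\<rho> r u))" for r u
    by (rule site_eqI) (simp only: crd_block_map_1 crd_modL crd_vadd c\<rho>)
  have \<rho>t: "\<rho> r u \<in> torus 2" if "u \<in> torus 2" for r u
    unfolding torus_iff
  proof
    fix \<nu> :: nat assume "\<nu> \<in> dirs"
    from c\<rho>[OF this, of r u] show "0 \<le> crd \<nu> (\<rho> r u) \<and> crd \<nu> (\<rho> r u) < int 2"
      using crd_torus[OF that, of \<nu>] by (cases "odd (crd \<nu> r)") simp_all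
  qed
  have \<rho>\<rho>: "\<rho> r (\<rho> r u) = u" for r u by (rule site_eqI) (simp only: c\<rho>, simp)
  have \<rho>bij: "bij_betw (\<rho> r) (torus 2) (torus 2)" for r
    by (rule bij_betw_byWitness[where f' = "\<rho> r"]) (auto simp: \<rho>\<rho> \<rho>t)
  have \<rho>tog: "\<rho> r (toggle \<nu> u) = toggle \<nu> (\<rho> r u)" if \<nu>: "\<nu> \<in> dirs" for r \<nu> u
  proof (rule site_eqI)
    fix \<alpha> :: nat assume \<alpha>: "\<alpha> \<in> dirs"
    show "crd \<alpha> (\<rho> r (toggle \<nu> u)) = crd \<alpha> (toggle \<nu> (\<rho> r u))"
      unfolding c\<rho>[OF \<alpha>] toggle_def crd_upd[OF \<nu> \<alpha>] c\<rho>[OF \<nu>] by simp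
  qed
  define S where "S \<nu> = (\<Sum>r\<in>torus L. edge_energy \<nu> (\<theta> r) (\<theta> (shift L \<nu> 1 r)))" for \<nu>
  have d: "(\<Sum>r\<in>torus L. edge_energy \<nu> (\<theta> (modL L (vadd r d))) (\<theta> (modL L (vadd r (toggle \<nu> d))))) = S \<nu>"
    if \<nu>: "\<nu> \<in> dirs" and d: "d \<in> torus 2" for \<nu> d
  proof -
    have sh: "modL L (vadd r (toggle \<nu> d)) = shift L \<nu> 1 (modL L (vadd r d))" if "crd \<nu> d = 0" for r d
    proof (rule site_eqI)
      fix \<alpha> :: nat assume \<alpha>: "\<alpha> \<in> dirs"
      show "crd \<alpha> (modL L (vadd r (toggle \<nu> d))) = crd \<alpha> (shift L \<nu> 1 (modL L (vadd r d)))"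
        using that unfolding crd_modL crd_vadd toggle_def shift_def crd_upd[OF \<nu> \<alpha>] by (auto simp: mod_simps add_ac)
    qed
    have "crd \<nu> d = 0 \<or> crd \<nu> d = 1" using crd_torus[OF d, of \<nu>] by auto
    then show ?thesis
    proof
      assume 0: "crd \<nu> d = 0"
      show ?thesis unfolding sh[OF 0] S_def
        by (rule sum_translate[OF L, of "\<lambda>r. edge_energy \<nu> (\<theta> r) (\<theta> (shift L \<nu> 1 r))"])
    next
      assume 1: "crd \<nu> d = 1"
      define d' where "d' = toggle \<nu> d"
      have 0: "crd \<nu> d' = 0" and dd: "d = toggle \<nu> d'" using 1 by (auto simp: d'_def toggle_def) (metis upd_crd)
      have "(\<Sum>r\<in>torus L. edge_energy \<nu> (\<theta> (modL L (vadd r d))) (\<theta> (modL L (vadd r d')))) = 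
        (\<Sum>r\<in>torus L. edge_energy \<nu> (\<theta> (modL L (vadd r d'))) (\<theta> (shift L \<nu> 1 (modL L (vadd r d')))))"
        unfolding dd sh[OF 0] by (rule sum.cong[OF refl]) (rule edge_energy_commute)
      also have "... = S \<nu>" unfolding S_def
        by (rule sum_translate[OF L, of "\<lambda>r. edge_energy \<nu> (\<theta> r) (\<theta> (shift L \<nu> 1 r))"])
      finally show ?thesis unfolding d'_def .
    qed
  qed
  have "(\<Sum>r\<in>torus L. cube_energy (cube L \<theta> r)) =
    (\<Sum>r\<in>torus L. \<Sum>\<nu>\<in>dirs. \<Sum>d\<in>torus 2. edge_energy \<nu> (\<theta> (modL L (vadd r d))) (\<theta> (modL L (vadd r (toggle \<nu> d)))))"
  proof (rule sum.cong[OF refl])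
    fix r
    show "cube_energy (cube L \<theta> r) = (\<Sum>\<nu>\<in>dirs. \<Sum>d\<in>torus 2. edge_energy \<nu> (\<theta> (modL L (vadd r d))) (\<theta> (modL L (vadd r (toggle \<nu> d)))))"
      unfolding cube_energy_def
    proof (rule sum.cong[OF refl])
      fix \<nu> assume \<nu>: "\<nu> \<in> dirs"
      have "(\<Sum>u\<in>torus 2. edge_energy \<nu> (cube L \<theta> r u) (cube L \<theta> r (toggle \<nu> u))) =
        (\<Sum>u\<in>torus 2. edge_energy \<nu> (\<theta> (modL L (vadd r (\<rho> r u)))) (\<theta> (modL L (vadd r (toggle \<nu> (\<rho> r u))))))"
        by (rule sum.cong[OF refl]) (simp only: cube_def restrict_apply' toggle_torus bm \<rho>tog[OF \<nu>])
      also have "... = (\<Sum>d\<in>torus 2. edge_energy \<nu> (\<theta> (modL L (vadd r d))) (\<theta> (modL L (vadd r (toggle \<nu> d)))))"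
        by (rule sum.reindex_bij_betw[OF \<rho>bij])
      finally show "(\<Sum>u\<in>torus 2. edge_energy \<nu> (cube L \<theta> r u) (cube L \<theta> r (toggle \<nu> u))) = ..." .
    qed
  qed
  also have "... = (\<Sum>\<nu>\<in>dirs. \<Sum>d\<in>torus 2. \<Sum>r\<in>torus L. edge_energy \<nu> (\<theta> (modL L (vadd r d))) (\<theta> (modL L (vadd r (toggle \<nu> d)))))"
    by (subst sum.swap) (rule sum.cong[OF refl], rule sum.swap)
  also have "... = (\<Sum>\<nu>\<in>dirs. \<Sum>d\<in>torus 2. S \<nu>)" by (intro sum.cong[OF refl] d)
  also have "... = 8 * (\<Sum>\<nu>\<in>dirs. S \<nu>)" by (simp only: sum_constant card_torus sum_distrib_left) simp
  also have "(\<Sum>\<nu>\<in>dirs. S \<nu>) = edge_sum L \<theta>"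
    unfolding S_def by (rule sum.swap)
  finally show ?thesis unfolding hamiltonian_eq by simp
qed

text \<open>The mirror image of a block sends the site \<open>x\<close> to \<open>B - x\<close>,
  hence the lower corner \<open>v\<close> of a unit cube to \<open>B - 1 - v\<close>.\<close>

definition cidx :: "nat => site => site => site" where
  "cidx B t v = (int B * crd 1 t + (if odd (crd 1 t) then int B - 1 - crd 1 v else crd 1 v),
     int B * crd 2 t + (if odd (crd 2 t) then int B - 1 - crd 2 v else crd 2 v),
     int B * crd 3 t + (if odd (crd 3 t) then int B - 1 - crd 3 v else crd 3 v))"

lemma crd_cidx: "\<nu> \<in> dirs ==> crd \<nu> (cidx B t v) = int B * crd \<nu> t + (if odd (crd \<nu> t) then int B - 1 - crd \<nu> v else crd \<nu> v)"
  by (auto simp: cidx_def crd_def)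

lemma crd_block_map: "\<nu> \<in> dirs ==> crd \<nu> (block_map L B t x) = (int B * crd \<nu> t + (if odd (crd \<nu> t) then int B - crd \<nu> x else crd \<nu> x)) mod int L"
  by (cases t; cases x) (auto simp: crd_def block_map_def modL_def refl_coord_def)

lemma block_map_modL:
  assumes "L > 0"
  shows "block_map L B t (modL L x) = block_map L B t x"
proof (rule site_eqI)
  fix \<nu> :: nat assume \<nu>: "\<nu> \<in> dirs"
  show "crd \<nu> (block_map L B t (modL L x)) = crd \<nu> (block_map L B t x)"
    unfolding crd_block_map[OF \<nu>] crd_modL
    by (cases "odd (crd \<nu> t)") (simp_all add: mod_add_right_eq mod_diff_right_eq add_diff_eq)
qed

text \<open>For even \<open>B\<close> the corners of blocks have even coordinates, so the
  coordinates modulo 2 within a block, mirrored or not, are the positions at which the unit cubes of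
  the torus read the same spins.\<close>

lemma cube_block:
  assumes B: "even B" and x: "\<And>\<nu>. \<nu> \<in> dirs ==> crd \<nu> v \<le> crd \<nu> x \<and> crd \<nu> x \<le> crd \<nu> v + 1"
  shows "cube L \<theta> (cidx B t v) (modL 2 x) = \<theta> (block_map L B t x)"
proof -
  have "block_map L 1 (cidx B t v) (modL 2 x) = block_map L B t x"
  proof (rule site_eqI)
    fix \<nu> :: nat assume \<nu>: "\<nu> \<in> dirs"
    obtain b where b: "B = 2 * b" using B by blast
    define k where "k = int b * crd \<nu> t"
    define X V T where "X = crd \<nu> x" and "V = crd \<nu> v" and "T = crd \<nu> t"
    have k: "int B * T = 2 * k" by (simp add: b k_def T_def)
    have "X = V \<or> X = V + 1" using x[OF \<nu>] by (auto simp: X_def V_def)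
    moreover have "2 * k + V + (if odd (2 * k + V) then 1 - X mod 2 else X mod 2) = 2 * k + X" if "X = V \<or> X = V + 1"
      using that by presburger
    moreover have "2 * k + (2 * int b - 1 - V) + (if odd (2 * k + (2 * int b - 1 - V)) then 1 - X mod 2 else X mod 2) = 2 * k + (2 * int b - X)" if "X = V \<or> X = V + 1"
      using that by presburger
    ultimately have "(int B * T + (if odd T then int B - 1 - V else V)) + (if odd (int B * T + (if odd T then int B - 1 - V else V)) then 1 - X mod 2 else X mod 2)
       = int B * T + (if odd T then int B - X else X)"
      unfolding k unfolding b by (cases "odd T") (simp_all only: if_True if_False of_nat_mult of_nat_numeral simp_thms)
    then show "crd \<nu> (block_map L 1 (cidx B t v) (modL 2 x)) = crd \<nu> (block_map L B t x)"
      unfolding crd_block_map_1[OF \<nu>] crd_block_map[OF \<nu>] crd_cidx[OF \<nu>] crd_modL X_def V_def T_def of_nat_numeral by (simp only: of_nat_1 mult_1_left)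
  qed
  then show ?thesis unfolding cube_def using modL_torus[of 2 x] by simp
qed

lemma cidx_bij:
  assumes B: "B > 0"
  shows "bij_betw (\<lambda>(t, v). cidx B t v) (torus M \<times> torus B) (torus (B * M))"
proof -
  define tb where "tb r = (crd 1 r div int B, crd 2 r div int B, crd 3 r div int B)" for r
  define f where "f T V = (if odd T then int B - 1 - V else V)" for T V :: int
  define vb where "vb r = (f (crd 1 (tb r)) (crd 1 r mod int B), f (crd 2 (tb r)) (crd 2 r mod int B), f (crd 3 (tb r)) (crd 3 r mod int B))" for r
  have ct: "crd \<nu> (tb r) = crd \<nu> r div int B" "crd \<nu> (vb r) = f (crd \<nu> r div int B) (crd \<nu> r mod int B)" if "\<nu> \<in> dirs" for \<nu> r
    using that by (auto simp: tb_def vb_def crd_def split: prod.splits)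
  have ff: "f T (f T V) = V" for T V by (simp add: f_def)
  have fb: "0 \<le> f T V \<and> f T V < int B" if "0 \<le> V" "V < int B" for T V using that by (simp add: f_def)
  have cc: "crd \<nu> (cidx B t v) = int B * crd \<nu> t + f (crd \<nu> t) (crd \<nu> v)" if "\<nu> \<in> dirs" for \<nu> t v
    unfolding crd_cidx[OF that] f_def ..
  have dm: "(int B * T + f T V) div int B = T" "(int B * T + f T V) mod int B = f T V" if "0 \<le> V" "V < int B" for T V
    using fb[OF that, of T] B by (simp_all add: div_pos_pos_trivial)
  show ?thesis
  proof (rule bij_betw_byWitness[where f' = "\<lambda>r. (tb r, vb r)"])
    show "\<forall>p\<in>torus M \<times> torus B. (tb (case p of (t, v) => cidx B t v), vb (case p of (t, v) => cidx B t v)) = p"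
    proof
      fix p assume "p \<in> torus M \<times> torus B"
      then obtain t v where p: "p = (t, v)" and v: "v \<in> torus B" by auto
      have b: "0 \<le> crd \<nu> v" "crd \<nu> v < int B" for \<nu> using crd_torus[OF v] by auto
      have "tb (cidx B t v) = t" "vb (cidx B t v) = v"
        by (rule site_eqI, simp only: ct cc dm[OF b] ff)+
      then show "(tb (case p of (t, v) => cidx B t v), vb (case p of (t, v) => cidx B t v)) = p" by (simp add: p)
    qed
    show "\<forall>r\<in>torus (B * M). (case (tb r, vb r) of (t, v) => cidx B t v) = r"
    proof
      fix r
      have "cidx B (tb r) (vb r) = r" by (rule site_eqI) (simp only: ct cc ff mult_div_mod_eq)
      then show "(case (tb r, vb r) of (t, v) => cidx B t v) = r" by simp
    qed
    show "(\<lambda>(t, v). cidx B t v) ` (torus M \<times> torus B) \<subseteq> torus (B * M)"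
    proof (rule image_subsetI)
      fix p assume "p \<in> torus M \<times> torus B"
      then obtain t v where p: "p = (t, v)" and t: "t \<in> torus M" and v: "v \<in> torus B" by auto
      show "(case p of (t, v) => cidx B t v) \<in> torus (B * M)" unfolding torus_iff p split_conv
      proof (rule ballI)
        fix \<nu> :: nat assume \<nu>: "\<nu> \<in> dirs"
        have 1: "0 \<le> crd \<nu> t" "crd \<nu> t + 1 \<le> int M" using crd_torus[OF t, of \<nu>] by auto
        have 2: "0 \<le> f (crd \<nu> t) (crd \<nu> v)" "f (crd \<nu> t) (crd \<nu> v) < int B" using fb crd_torus[OF v, of \<nu>] by auto
        have "int B * (crd \<nu> t + 1) \<le> int B * int M" using 1 by (intro mult_left_mono) auto
        then show "0 \<le> crd \<nu> (cidx B t v) \<and> crd \<nu> (cidx B t v) < int (B * M)"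
          unfolding cc[OF \<nu>] using 1 2 by (simp add: distrib_left)
      qed
    qed
    show "(\<lambda>r. (tb r, vb r)) ` torus (B * M) \<subseteq> torus M \<times> torus B"
    proof (rule image_subsetI)
      fix r assume r: "r \<in> torus (B * M)"
      show "(tb r, vb r) \<in> torus M \<times> torus B" unfolding torus_iff mem_Times_iff fst_conv snd_conv
      proof (intro conjI ballI)
        fix \<nu> :: nat assume \<nu>: "\<nu> \<in> dirs"
        have c: "0 \<le> crd \<nu> r" "crd \<nu> r < int B * int M" using crd_torus[OF r, of \<nu>] by auto
        show "0 \<le> crd \<nu> (tb r)" unfolding ct[OF \<nu>] using c B by (simp add: pos_imp_zdiv_nonneg_iff)
        show "crd \<nu> (tb r) < int M"
        proof (rule ccontr)
          assume "\<not> ?thesis"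
          then have "int B * int M \<le> int B * (crd \<nu> r div int B)" unfolding ct[OF \<nu>] by (intro mult_left_mono) auto
          moreover have "0 \<le> crd \<nu> r mod int B" using B by simp
          ultimately show False using mult_div_mod_eq[of "int B" "crd \<nu> r"] c by linarith
        qed
        have "0 \<le> crd \<nu> r mod int B" "crd \<nu> r mod int B < int B" using B by simp_all
        from fb[OF this] show "0 \<le> crd \<nu> (vb r)" "crd \<nu> (vb r) < int B" unfolding ct[OF \<nu>] by auto
      qed
    qed
  qed
qed

section \<open>Labelled cubes and their partition functions\<close>

datatype label = Free | Energetic | Pattern bool nat real real

fun cube_event :: "real => label => config => bool" where
  "cube_event \<Gamma> Free \<omega> \<longleftrightarrow> True"
| "cube_event \<Gamma> Energetic \<omega> \<longleftrightarrow> (\<exists>\<nu>\<in>dirs. \<exists>u\<in>torus 2. \<Gamma> \<le> \<bar>spin_proj \<nu> (\<omega> u) - spin_proj \<nu> (\<omega> (toggle \<nu> u))\<bar>)"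
| "cube_event \<Gamma> (Pattern b \<alpha> c \<delta>) \<omega> \<longleftrightarrow> (\<forall>u\<in>torus 2. near \<delta> (\<omega> u) (pat_angle b \<alpha> c u))"

text \<open>The angle window and the Boltzmann factor are distributed over the cubes; the product
  over the torus restores them (\<open>prod_cube_fun\<close>).\<close>

definition cube_fun :: "real => real => real => label => config => ennreal" where
  "cube_fun J \<beta> \<Gamma> k \<omega> = (if cube_event \<Gamma> k \<omega> then 1 else 0) * ((\<Prod>u\<in>torus 2. indicator {0..<2*pi} (\<omega> u)) *
     ennreal (exp (- \<beta> * J / 16 * cube_energy \<omega>)))"

lemma measurable_cube_event:
  "{\<omega> \<in> space (lborelP (torus 2)). cube_event \<Gamma> k \<omega>} \<in> sets (lborelP (torus 2))"
proof -
  let ?M = "lborelP (torus 2)"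
  have c: "(\<lambda>\<omega>. \<omega> u) \<in> borel_measurable ?M" if "u \<in> torus 2" for u
    using measurable_component_singleton[OF that, of "\<lambda>_. lborel :: real measure"] by simp
  have s: "(\<lambda>\<omega>. spin_proj \<nu> (\<omega> u)) \<in> borel_measurable ?M" if "u \<in> torus 2" for u \<nu>
    unfolding spin_proj_cos using c[OF that] by measurable
  have "Measurable.pred ?M (cube_event \<Gamma> k)"
  proof (cases k)
    case Free
    then have "cube_event \<Gamma> k = (\<lambda>_. True)" by (simp add: fun_eq_iff)
    then show ?thesis by simp
  next
    case Energetic
    then have eq: "cube_event \<Gamma> k = (\<lambda>\<omega>. \<exists>\<nu>\<in>dirs. \<exists>u\<in>torus 2. \<Gamma> \<le> \<bar>spin_proj \<nu> (\<omega> u) - spin_proj \<nu> (\<omega> (toggle \<nu> u))\<bar>)"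
      by (simp only: fun_eq_iff cube_event.simps simp_thms)
    show ?thesis unfolding eq
    proof (intro pred_intros_finite)
      fix \<nu> u assume u: "u \<in> torus 2"
      show "Measurable.pred ?M (\<lambda>\<omega>. \<Gamma> \<le> \<bar>spin_proj \<nu> (\<omega> u) - spin_proj \<nu> (\<omega> (toggle \<nu> u))\<bar>)"
        using s[OF u] s[OF toggle_torus[OF u]] by measurable
    qed (auto simp: finite_torus)
  next
    case (Pattern b \<alpha> c' \<delta>)
    then have eq: "cube_event \<Gamma> k = (\<lambda>\<omega>. \<forall>u\<in>torus 2. near \<delta> (\<omega> u) (pat_angle b \<alpha> c' u))"
      by (simp only: fun_eq_iff cube_event.simps simp_thms)
    show ?thesis unfolding eq
    proof (intro pred_intros_finite)
      fix u assume u: "u \<in> torus 2"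
      have "{x \<in> space borel. near \<delta> x (pat_angle b \<alpha> c' u)} \<in> sets borel" using near_sets by simp
      from pred_sets1[OF this c[OF u]] show "Measurable.pred ?M (\<lambda>\<omega>. near \<delta> (\<omega> u) (pat_angle b \<alpha> c' u))" .
    qed (auto simp: finite_torus)
  qed
  then show ?thesis by (simp add: pred_def)
qed

lemma measurable_cube_fun: "cube_fun J \<beta> \<Gamma> k \<in> borel_measurable (lborelP (torus 2))"
proof -
  let ?M = "lborelP (torus 2)"
  have c: "(\<lambda>\<omega>. \<omega> u) \<in> borel_measurable ?M" if "u \<in> torus 2" for u
    using measurable_component_singleton[OF that, of "\<lambda>_. lborel :: real measure"] by simp
  have e: "(\<lambda>\<omega>. edge_energy \<nu> (\<omega> u) (\<omega> (toggle \<nu> u))) \<in> borel_measurable ?M" if u: "u \<in> torus 2" for \<nu> u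
    unfolding edge_energy_def using c[OF u] c[OF toggle_torus[OF u]] by measurable
  have "cube_energy \<in> borel_measurable ?M"
    unfolding cube_energy_def[abs_def] by (intro borel_measurable_sum e)
  then have 1: "(\<lambda>\<omega>. ennreal (exp (- \<beta> * J / 16 * cube_energy \<omega>))) \<in> borel_measurable ?M" by measurable
  have 2: "(\<lambda>\<omega>. \<Prod>u\<in>torus 2. indicator {0..<2*pi} (\<omega> u) :: ennreal) \<in> borel_measurable ?M"
    by (intro borel_measurable_prod_ennreal measurable_compose[OF c]) auto
  have "(\<lambda>\<omega>. if cube_event \<Gamma> k \<omega> then 1 else 0 :: ennreal) \<in> borel_measurable ?M"
    by (intro measurable_If measurable_const measurable_cube_event) auto
  then show ?thesis unfolding cube_fun_def[abs_def] using 1 2 by (intro borel_measurable_times_ennreal)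
qed

lemma prod_if_1: "finite A ==> (\<Prod>i\<in>A. if P i then 1 else 0 :: ennreal) = (if \<forall>i\<in>A. P i then 1 else 0)"
  by (auto intro!: prod_zero bexI)

lemma indicator_if: "(indicator A x :: ennreal) = (if x \<in> A then 1 else 0)"
  by (simp add: indicator_def)

lemma block_map_self: "r \<in> torus L ==> block_map L 1 r (modL 2 r) = r"
proof (rule site_eqI)
  fix \<nu> :: nat assume r: "r \<in> torus L" and \<nu>: "\<nu> \<in> dirs"
  have "(if odd (crd \<nu> r) then 1 - crd \<nu> r mod 2 else crd \<nu> r mod 2) = 0" by (simp add: odd_iff_mod_2_eq_one)
  then show "crd \<nu> (block_map L 1 r (modL 2 r)) = crd \<nu> r"
    unfolding crd_block_map_1[OF \<nu>] crd_modL of_nat_numeral using crd_torus[OF r, of \<nu>] by simp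
qed

lemma prod_cube_fun:
  assumes L: "L > 0"
  shows "(\<Prod>r\<in>torus L. cube_fun J \<beta> \<Gamma> (a r) (cube L \<theta> r)) =
    (if \<forall>r\<in>torus L. cube_event \<Gamma> (a r) (cube L \<theta> r) then 1 else 0) *
    (angle_ind L \<theta> * boltz J \<beta> L \<theta>)"
proof -
  have "(\<Prod>r\<in>torus L. \<Prod>u\<in>torus 2. indicator {0..<2*pi} (cube L \<theta> r u) :: ennreal) = angle_ind L \<theta>"
  proof -
    have "(\<forall>r\<in>torus L. \<forall>u\<in>torus 2. cube L \<theta> r u \<in> {0..<2*pi}) \<longleftrightarrow> (\<forall>r\<in>torus L. \<theta> r \<in> {0..<2*pi})"
    proof (intro iffI ballI)
      fix r assume *: "\<forall>r\<in>torus L. \<forall>u\<in>torus 2. cube L \<theta> r u \<in> {0..<2*pi}" and r: "r \<in> torus L"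
      have "modL 2 r \<in> torus 2" by (rule modL_torus) simp
      then have "cube L \<theta> r (modL 2 r) = \<theta> r" unfolding cube_def using block_map_self[OF r] by simp
      then show "\<theta> r \<in> {0..<2*pi}" using * r \<open>modL 2 r \<in> torus 2\<close> by metis
    next
      fix r u assume *: "\<forall>r\<in>torus L. \<theta> r \<in> {0..<2*pi}" and u: "u \<in> torus 2"
      then show "cube L \<theta> r u \<in> {0..<2*pi}" unfolding cube_def restrict_apply'[OF u] using block_map_torus[OF L] by blast
    qed
    then show ?thesis unfolding indicator_if prod_if_1[OF finite_torus] by simp
  qed
  moreover have "(\<Prod>r\<in>torus L. ennreal (exp (- \<beta> * J / 16 * cube_energy (cube L \<theta> r)))) = boltz J \<beta> L \<theta>"
    unfolding hamiltonian_cubes[OF L] by (simp add: prod_ennreal exp_sum[OF finite_torus, symmetric] sum_distrib_left mult.assoc)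
  ultimately show ?thesis unfolding cube_fun_def prod.distrib prod_if_1[OF finite_torus] by simp
qed

lemma cubeZ_cube_fun:
  assumes L: "L > 0"
  shows "cubeZ L (cube_fun J \<beta> \<Gamma>) a = (\<integral>\<^sup>+\<theta>. (if \<forall>r\<in>torus L. cube_event \<Gamma> (a r) (cube L \<theta> r) then 1 else 0) *
    (angle_ind L \<theta> * boltz J \<beta> L \<theta>) \<partial>config_measure L)"
  unfolding cubeZ_def prod_cube_fun[OF L] ..

lemma cubeZ_Free: "L > 0 ==> cubeZ L (cube_fun J \<beta> \<Gamma>) (\<lambda>_. Free) = totZ J \<beta> L"
  unfolding cubeZ_cube_fun totZ_def by simp

lemma box_volume: "(\<integral>\<^sup>+\<theta>. angle_ind L \<theta> \<partial>config_measure L) = ennreal ((2 * pi) ^ (L ^ 3))"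
proof -
  have "(\<integral>\<^sup>+\<theta>. angle_ind L \<theta> \<partial>config_measure L) = (\<Prod>r\<in>torus L. \<integral>\<^sup>+x. indicator {0..<2*pi} x \<partial>lborel)"
    unfolding config_measure_def by (rule PL.product_nn_integral_prod[OF finite_torus]) simp
  also have "... = ennreal ((2 * pi) ^ (L ^ 3))" by (simp add: card_torus ennreal_power)
  finally show ?thesis .
qed

lemma measurable_box: "(\<lambda>\<theta>. \<Prod>r\<in>torus L. indicator {0..<2*pi} (\<theta> r) :: ennreal) \<in> borel_measurable (config_measure L)"
  unfolding config_measure_def by (intro borel_measurable_prod_ennreal) measurable

text \<open>An edge of energy at least \<open>\<Gamma>^2\<close> in every cube forces the
  Hamiltonian up to \<open>J / 16 * L^3 * \<Gamma>^2\<close>; the angles contribute their volume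
  \<open>2 * pi\<close> per site.\<close>

lemma cubeZ_Energetic:
  assumes L: "L > 0" and J: "J > 0" "\<beta> > 0" "\<Gamma> > 0"
  shows "cubeZ L (cube_fun J \<beta> \<Gamma>) (\<lambda>_. Energetic) \<le> ennreal ((2 * pi * exp (- \<beta> * J * \<Gamma>\<^sup>2 / 16)) ^ (L ^ 3))"
proof -
  have "cubeZ L (cube_fun J \<beta> \<Gamma>) (\<lambda>_. Energetic) \<le> (\<integral>\<^sup>+\<theta>. ennreal (exp (- \<beta> * J * \<Gamma>\<^sup>2 / 16) ^ (L ^ 3)) * angle_ind L \<theta> \<partial>config_measure L)"
    unfolding cubeZ_cube_fun[OF L]
  proof (rule nn_integral_mono)
    fix \<theta> :: config
    show "(if \<forall>r\<in>torus L. cube_event \<Gamma> Energetic (cube L \<theta> r) then 1 else 0) *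
      (angle_ind L \<theta> * boltz J \<beta> L \<theta>) \<le>
      ennreal (exp (- \<beta> * J * \<Gamma>\<^sup>2 / 16) ^ (L ^ 3)) * angle_ind L \<theta>"
    proof (cases "\<forall>r\<in>torus L. cube_event \<Gamma> Energetic (cube L \<theta> r)")
      case True
      have "\<Gamma>\<^sup>2 \<le> cube_energy \<omega>" if ev: "cube_event \<Gamma> Energetic \<omega>" for \<omega>
      proof -
        obtain \<nu> u where \<nu>: "\<nu> \<in> dirs" and u: "u \<in> torus 2" and big: "\<Gamma> \<le> \<bar>spin_proj \<nu> (\<omega> u) - spin_proj \<nu> (\<omega> (toggle \<nu> u))\<bar>"
          using ev unfolding cube_event.simps by blast
        have "\<Gamma>\<^sup>2 \<le> \<bar>spin_proj \<nu> (\<omega> u) - spin_proj \<nu> (\<omega> (toggle \<nu> u))\<bar>\<^sup>2" using big J by (intro power_mono) auto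
        also have "... = edge_energy \<nu> (\<omega> u) (\<omega> (toggle \<nu> u))" by (simp add: edge_energy_def spin_proj_cos)
        also have "... \<le> (\<Sum>u\<in>torus 2. edge_energy \<nu> (\<omega> u) (\<omega> (toggle \<nu> u)))"
          by (rule member_le_sum[OF u]) (auto simp: edge_energy_nonneg finite_torus)
        also have "... \<le> cube_energy \<omega>" unfolding cube_energy_def
          by (rule member_le_sum[OF \<nu>]) (auto intro!: sum_nonneg edge_energy_nonneg)
        finally show ?thesis .
      qed
      then have "(\<Sum>r\<in>torus L. \<Gamma>\<^sup>2) \<le> (\<Sum>r\<in>torus L. cube_energy (cube L \<theta> r))" using True by (intro sum_mono) blast
      then have "real (L ^ 3) * \<Gamma>\<^sup>2 \<le> (\<Sum>r\<in>torus L. cube_energy (cube L \<theta> r))" by (simp add: card_torus)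
      then have "\<beta> * (J / 16 * (real (L ^ 3) * \<Gamma>\<^sup>2)) \<le> \<beta> * hamiltonian J L \<theta>"
        unfolding hamiltonian_cubes[OF L] using J by (intro mult_left_mono) auto
      then have "- \<beta> * hamiltonian J L \<theta> \<le> real (L ^ 3) * (- \<beta> * J * \<Gamma>\<^sup>2 / 16)" by (simp add: field_simps)
      then have "exp (- \<beta> * hamiltonian J L \<theta>) \<le> exp (- \<beta> * J * \<Gamma>\<^sup>2 / 16) ^ (L ^ 3)"
        unfolding exp_of_nat_mult[symmetric] by (simp only: exp_le_cancel_iff)
      then have "angle_ind L \<theta> * boltz J \<beta> L \<theta> \<le>
        angle_ind L \<theta> * ennreal (exp (- \<beta> * J * \<Gamma>\<^sup>2 / 16) ^ (L ^ 3))"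
        by (intro mult_left_mono ennreal_leI) auto
      then show ?thesis unfolding if_P[OF True] by (simp only: mult_1_left mult.commute)
    next
      case False
      show ?thesis unfolding if_not_P[OF False] by (simp only: mult_zero_left zero_le)
    qed
  qed
  also have "... = ennreal (exp (- \<beta> * J * \<Gamma>\<^sup>2 / 16) ^ (L ^ 3)) * ennreal ((2 * pi) ^ (L ^ 3))"
    unfolding box_volume[symmetric] by (rule nn_integral_cmult[OF measurable_box])
  also have "... = ennreal ((2 * pi * exp (- \<beta> * J * \<Gamma>\<^sup>2 / 16)) ^ (L ^ 3))"
    unfolding power_mult_distrib by (subst ennreal_mult[symmetric]) (auto simp: mult.commute)
  finally show ?thesis .
qed

text \<open>All cubes read a site at its coordinates modulo 2, so requiring the pattern in every
  cube amounts to requiring it at every site. Evenness of \<open>L\<close> makes the parity of a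
  layer well defined.\<close>

lemma cubeZ_Pattern:
  assumes L: "even L" "L > 0" and \<alpha>: "\<alpha> \<in> dirs"
  shows "cubeZ L (cube_fun J \<beta> \<Gamma>) (\<lambda>_. Pattern b \<alpha> c \<delta>) = patZ J \<beta> L b \<alpha> c \<delta>"
  unfolding cubeZ_cube_fun[OF L(2)] patZ_def
proof (rule nn_integral_cong)
  fix \<theta> :: config
  have par: "odd (crd \<alpha> (block_map L 1 r u)) \<longleftrightarrow> odd (crd \<alpha> u)" for r u
  proof -
    have "2 dvd int L" using L by simp
    then have "odd (x mod int L) \<longleftrightarrow> odd x" for x by (simp add: dvd_mod_iff)
    then show ?thesis unfolding crd_block_map_1[OF \<alpha>] by auto
  qed
  then have pa: "pat_angle b \<alpha> c (block_map L 1 r u) = pat_angle b \<alpha> c u" for r u by (simp add: pat_angle_def)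
  have "(\<forall>r\<in>torus L. cube_event \<Gamma> (Pattern b \<alpha> c \<delta>) (cube L \<theta> r)) \<longleftrightarrow> (\<forall>r\<in>torus L. \<theta> r \<in> {x. near \<delta> x (pat_angle b \<alpha> c r)})"
  proof (intro iffI ballI)
    fix r assume *: "\<forall>r\<in>torus L. cube_event \<Gamma> (Pattern b \<alpha> c \<delta>) (cube L \<theta> r)" and r: "r \<in> torus L"
    have u: "modL 2 r \<in> torus 2" by (rule modL_torus) simp
    have "near \<delta> (cube L \<theta> r (modL 2 r)) (pat_angle b \<alpha> c (modL 2 r))" using * r u by simp
    moreover have "cube L \<theta> r (modL 2 r) = \<theta> r" unfolding cube_def restrict_apply'[OF u] block_map_self[OF r] ..
    moreover have "pat_angle b \<alpha> c (modL 2 r) = pat_angle b \<alpha> c r" using pa[of r "modL 2 r"] unfolding block_map_self[OF r] by simp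
    ultimately show "\<theta> r \<in> {x. near \<delta> x (pat_angle b \<alpha> c r)}" by simp
  next
    fix r assume *: "\<forall>r\<in>torus L. \<theta> r \<in> {x. near \<delta> x (pat_angle b \<alpha> c r)}"
    have "near \<delta> (cube L \<theta> r u) (pat_angle b \<alpha> c u)" if u: "u \<in> torus 2" for u
      unfolding cube_def restrict_apply'[OF u] pa[of r u, symmetric] using * block_map_torus[OF L(2)] by blast
    then show "cube_event \<Gamma> (Pattern b \<alpha> c \<delta>) (cube L \<theta> r)" by simp
  qed
  then have "(if \<forall>r\<in>torus L. cube_event \<Gamma> (Pattern b \<alpha> c \<delta>) (cube L \<theta> r) then 1 else 0) =
    (\<Prod>r\<in>torus L. indicator {x. near \<delta> x (pat_angle b \<alpha> c r)} (\<theta> r) :: ennreal)"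
    unfolding indicator_if prod_if_1[OF finite_torus] by (simp only:)
  then show "(if \<forall>r\<in>torus L. cube_event \<Gamma> (Pattern b \<alpha> c \<delta>) (cube L \<theta> r) then 1 else 0) *
    (angle_ind L \<theta> * boltz J \<beta> L \<theta>) =
    angle_ind L \<theta> * ((\<Prod>r\<in>torus L. indicator {x. near \<delta> x (pat_angle b \<alpha> c r)} (\<theta> r)) * boltz J \<beta> L \<theta>)"
    by (simp only: mult_ac)
qed

lemma cubeZ_le_box:
  assumes "L > 0" "J \<ge> 0" "\<beta> \<ge> 0"
  shows "cubeZ L (cube_fun J \<beta> \<Gamma>) a \<le> ennreal ((2 * pi) ^ (L ^ 3))"
  unfolding cubeZ_cube_fun[OF assms(1)] box_volume[symmetric]
proof (rule nn_integral_mono)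
  fix \<theta> :: config
  have "boltz J \<beta> L \<theta> \<le> 1"
    using hamiltonian_nonneg[OF assms(2), of L \<theta>] assms(3) by simp
  then have "angle_ind L \<theta> * boltz J \<beta> L \<theta> \<le> angle_ind L \<theta> * 1"
    by (intro mult_left_mono) auto
  then show "(if \<forall>r\<in>torus L. cube_event \<Gamma> (a r) (cube L \<theta> r) then 1 else 0) *
    (angle_ind L \<theta> * boltz J \<beta> L \<theta>) \<le> angle_ind L \<theta>"
    by (cases "\<forall>r\<in>torus L. cube_event \<Gamma> (a r) (cube L \<theta> r)")
       (simp_all only: if_P if_not_P not_False_eq_True mult_1_left mult_1_right mult_zero_left zero_le)
qed

lemma cubeZ_finite: "L > 0 ==> J \<ge> 0 ==> \<beta> \<ge> 0 ==> cubeZ L (cube_fun J \<beta> \<Gamma>) a < \<infinity>"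
  using cubeZ_le_box[of L J \<beta> \<Gamma> a] by (auto intro: le_less_trans)

lemma totZ_finite_pos:
  assumes "L > 0" "J > 0" "\<beta> \<ge> 1"
  shows "totZ J \<beta> L < \<infinity>" "enn2real (totZ J \<beta> L) > 0"
proof -
  show fin: "totZ J \<beta> L < \<infinity>" using cubeZ_finite[of L J \<beta> 1 "\<lambda>_. Free"] assms by (simp add: cubeZ_Free)
  have "ennreal ((exp (- 3 * J / 2) / sqrt \<beta>) ^ (L ^ 3)) > 0" using assms by (simp add: ennreal_zero_less_divide)
  then have "totZ J \<beta> L > 0" using totZ_lower[OF assms] by (rule less_le_trans)
  then show "enn2real (totZ J \<beta> L) > 0" using fin by (simp add: enn2real_positive_iff)
qed

lemma powr_root_power:
  fixes x :: real
  assumes "x \<ge> 0" "n > 0"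
  shows "(x ^ n) powr (1 / real n) = x" "(x powr (1 / real n)) ^ n = x"
proof -
  have "(x ^ n) powr (1 / real n) = x \<and> (x powr (1 / real n)) ^ n = x"
  proof (cases "x = 0")
    case True
    then show ?thesis using assms by (simp add: power_0_left)
  next
    case False
    then have x: "x > 0" using assms by simp
    have "(x ^ n) powr (1 / real n) = (x powr real n) powr (1 / real n)" by (simp only: powr_realpow[OF x])
    also have "... = x" unfolding powr_powr using assms x by simp
    finally have 1: "(x ^ n) powr (1 / real n) = x" .
    have "(x powr (1 / real n)) ^ n = (x powr (1 / real n)) powr real n" using x by (intro powr_realpow[symmetric]) simp
    also have "... = x" unfolding powr_powr using assms x by simp
    finally show ?thesis using 1 by simp
  qed
  then show "(x ^ n) powr (1 / real n) = x" "(x powr (1 / real n)) ^ n = x" by auto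
qed

text \<open>In the chessboard estimate the root of order \<open>L ^ 3\<close> turns each constant
  bound into a factor \<open>z\<close> per labelled cube, and the \<open>L ^ 3\<close> roots of
  \<open>totZ\<close> recombine to one total partition function.\<close>

lemma cubeZ_bound:
  fixes z :: "label => real"
  assumes L: "even L" "L > 0" and J: "J > 0" "\<beta> \<ge> 1"
    and z: "\<And>r. r \<in> torus L ==> z (a r) \<ge> 0 \<and> cubeZ L (cube_fun J \<beta> \<Gamma>) (\<lambda>_. a r) \<le> ennreal (z (a r) ^ (L ^ 3)) * totZ J \<beta> L"
  shows "enn2real (cubeZ L (cube_fun J \<beta> \<Gamma>) a) \<le> (\<Prod>r\<in>torus L. z (a r)) * enn2real (totZ J \<beta> L)"
proof -
  define Z where "Z = enn2real (totZ J \<beta> L)"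
  have fin: "cubeZ L (cube_fun J \<beta> \<Gamma>) a < \<infinity>" for a using cubeZ_finite L J by simp
  note tf = totZ_finite_pos(1)[OF L(2) J]
  have "enn2real (cubeZ L (cube_fun J \<beta> \<Gamma>) a) \<le> (\<Prod>r\<in>torus L. enn2real (cubeZ L (cube_fun J \<beta> \<Gamma>) (\<lambda>_. a r)) powr (1 / L ^ 3))"
    using chessboard[OF L measurable_cube_fun fin] by simp
  also have "... \<le> (\<Prod>r\<in>torus L. z (a r) * Z powr (1 / L ^ 3))"
  proof (rule prod_mono, intro conjI)
    fix r assume r: "r \<in> torus L"
    have "enn2real (cubeZ L (cube_fun J \<beta> \<Gamma>) (\<lambda>_. a r)) \<le> z (a r) ^ (L ^ 3) * Z"
    proof -
      have "ennreal (z (a r) ^ (L ^ 3)) * totZ J \<beta> L < \<infinity>" using tf by (simp add: ennreal_mult_less_top)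
      then have "enn2real (cubeZ L (cube_fun J \<beta> \<Gamma>) (\<lambda>_. a r)) \<le> enn2real (ennreal (z (a r) ^ (L ^ 3)) * totZ J \<beta> L)"
        using z[OF r] by (intro enn2real_mono) auto
      then show ?thesis using z[OF r] by (simp add: enn2real_mult Z_def)
    qed
    then have "enn2real (cubeZ L (cube_fun J \<beta> \<Gamma>) (\<lambda>_. a r)) powr (1 / L ^ 3) \<le> (z (a r) ^ (L ^ 3) * Z) powr (1 / L ^ 3)"
      by (intro powr_mono2) auto
    also have "... = (z (a r) ^ (L ^ 3)) powr (1 / L ^ 3) * Z powr (1 / L ^ 3)"
      using z[OF r] by (intro powr_mult)
    also have "(z (a r) ^ (L ^ 3)) powr (1 / L ^ 3) = z (a r)"
      using z[OF r] L by (intro powr_root_power(1)) auto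
    finally show "enn2real (cubeZ L (cube_fun J \<beta> \<Gamma>) (\<lambda>_. a r)) powr (1 / L ^ 3) \<le> z (a r) * Z powr (1 / L ^ 3)" .
  qed simp
  also have "... = (\<Prod>r\<in>torus L. z (a r)) * (Z powr (1 / L ^ 3)) ^ (L ^ 3)"
    by (simp add: prod.distrib card_torus)
  also have "(Z powr (1 / L ^ 3)) ^ (L ^ 3) = Z"
    using totZ_finite_pos(2)[OF L(2) J] L unfolding Z_def by (intro powr_root_power(2)) auto
  finally show ?thesis unfolding Z_def .
qed

lemma vertex_exists:
  assumes u: "u \<in> torus 2" and v: "v \<in> torus B"
  obtains x where "x \<in> block B" "modL 2 x = u" "\<And>\<nu>. \<nu> \<in> dirs ==> crd \<nu> v \<le> crd \<nu> x \<and> crd \<nu> x \<le> crd \<nu> v + 1"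
proof -
  define x where "x = (crd 1 v + (crd 1 u - crd 1 v) mod 2, crd 2 v + (crd 2 u - crd 2 v) mod 2, crd 3 v + (crd 3 u - crd 3 v) mod 2)"
  have cx: "crd \<nu> x = crd \<nu> v + (crd \<nu> u - crd \<nu> v) mod 2" if "\<nu> \<in> dirs" for \<nu>
    using that by (auto simp: x_def crd_def split: prod.splits)
  have m: "0 \<le> (crd \<nu> u - crd \<nu> v) mod 2 \<and> (crd \<nu> u - crd \<nu> v) mod 2 \<le> 1" for \<nu> by simp
  show thesis
  proof (rule that[of x])
    show "x \<in> block B" unfolding block_iff
    proof
      fix \<nu> :: nat assume \<nu>: "\<nu> \<in> dirs"
      show "0 \<le> crd \<nu> x \<and> crd \<nu> x \<le> int B" unfolding cx[OF \<nu>] using m[of \<nu>] crd_torus[OF v, of \<nu>] by linarith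
    qed
    show "modL 2 x = u"
    proof (rule site_eqI)
      fix \<nu> :: nat assume \<nu>: "\<nu> \<in> dirs"
      show "crd \<nu> (modL 2 x) = crd \<nu> u" unfolding crd_modL cx[OF \<nu>] using crd_torus[OF u, of \<nu>] by (simp add: mod_simps)
    qed
    show "crd \<nu> v \<le> crd \<nu> x \<and> crd \<nu> x \<le> crd \<nu> v + 1" if "\<nu> \<in> dirs" for \<nu> unfolding cx[OF that] using m[of \<nu>] by linarith
  qed
qed

section \<open>Witnesses of bad blocks and the sum over their choices\<close>

type_synonym witness = "site + pattern \<times> int"

definition witnesses :: "pattern set => nat => witness set" where
  "witnesses Pt B = torus B <+> (Pt \<times> {0..<int B})"

fun wit_cubes :: "nat => witness => site set" where
  "wit_cubes B (Inl v) = {v}"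
| "wit_cubes B (Inr ((b, \<alpha>, c, \<delta>), a)) = {v \<in> torus B. b --> crd \<alpha> v = a}"

fun wit_label :: "witness => label" where
  "wit_label (Inl v) = Energetic"
| "wit_label (Inr ((b, \<alpha>, c, \<delta>), a)) = Pattern b \<alpha> c \<delta>"

lemma in_vartheta_bad:
  assumes L: "L > 0" and \<theta>: "\<theta> \<in> vartheta L B t (bad_event L \<kappa> \<Gamma> B)"
    and edges: "\<And>r \<alpha>. r \<in> block B ==> \<alpha> \<in> dirs ==> vadd r (unit_vec \<alpha>) \<in> block B ==>
      \<bar>spin_proj \<alpha> (\<theta> (block_map L B t r)) - spin_proj \<alpha> (\<theta> (block_map L B t (vadd r (unit_vec \<alpha>))))\<bar> < \<Gamma>"
    and wells: "\<And>r. r \<in> block B ==> near \<kappa>' (\<theta> (block_map L B t r)) (pi / 3 * of_int \<tau>)" and \<kappa>: "\<kappa>' < 2 * \<kappa>"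
  shows False
proof -
  define \<theta>' where "\<theta>' = restrict (\<lambda>r. \<theta> (block_map L B t r)) (torus L)"
  have e: "\<theta>' (modL L x) = \<theta> (block_map L B t x)" for x
    unfolding \<theta>'_def using modL_torus[OF L] by (simp add: block_map_modL[OF L])
  \<comment> \<open>The representative of \<open>\<tau>\<close> modulo 6 in the range that
    \<open>good_block\<close> prescribes.\<close>
  define \<tau>' where "\<tau>' = nat ((\<tau> - 1) mod 6 + 1)"
  obtain q where q: "\<tau> = int \<tau>' + 6 * q" "\<tau>' \<in> {1..6}"
  proof (rule that[of "(\<tau> - 1) div 6"])
    have "0 \<le> (\<tau> - 1) mod 6" "(\<tau> - 1) mod 6 < 6" by simp_all
    then show "\<tau>' \<in> {1..6}" "\<tau> = int \<tau>' + 6 * ((\<tau> - 1) div 6)" unfolding \<tau>'_def by auto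
  qed
  have "good_block L \<kappa> \<Gamma> B \<theta>'" unfolding good_block_def e
  proof (intro conjI ballI impI bexI[of _ \<tau>'])
    fix r \<alpha> assume "r \<in> block B" "\<alpha> \<in> dirs" "vadd r (unit_vec \<alpha>) \<in> block B"
    then show "\<bar>spin_proj \<alpha> (\<theta> (block_map L B t r)) - spin_proj \<alpha> (\<theta> (block_map L B t (vadd r (unit_vec \<alpha>))))\<bar> < \<Gamma>"
      by (rule edges)
  next
    fix r assume "r \<in> block B"
    from wells[OF this] obtain n :: int where n: "\<bar>\<theta> (block_map L B t r) - pi / 3 * of_int \<tau> - 2 * pi * of_int n\<bar> \<le> \<kappa>'"
      by (auto simp: near_def)
    have "pi / 3 * of_int \<tau> + 2 * pi * of_int n = pi / 3 * real \<tau>' + 2 * pi * of_int (n + q)" unfolding q by (simp add: field_simps)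
    then have "\<bar>\<theta> (block_map L B t r) - pi / 3 * real \<tau>' - 2 * pi * of_int (n + q)\<bar> < 2 * \<kappa>" using n \<kappa> by linarith
    then show "\<exists>n::int. \<bar>\<theta> (block_map L B t r) - pi / 3 * real \<tau>' - 2 * pi * of_int n\<bar> < 2 * \<kappa>" by blast
  qed (rule q)
  then show False using \<theta> by (simp add: vartheta_def bad_event_def \<theta>'_def)
qed

text \<open>Without a costly edge \<open>block_trichotomy\<close> applies with
  \<open>e = 4 * sqrt \<Gamma>\<close>. Its first case would make the block good, because
  \<open>\<kappa> + 3 * B * e < 2 * \<kappa>\<close>. In the other two the margin
  \<open>\<delta>0\<close> absorbs the drift of at most \<open>7 * B * e\<close>, so that one
  pattern of the finite family holds in all cubes concerned.\<close>

lemma bad_witness: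
  assumes L: "L > 0" and B: "even B" "B \<ge> 1" and \<kappa>: "\<kappa> \<le> 1 / 10"
    and e: "0 < e" "16 * real B * e \<le> \<kappa>" "7 * real B * e \<le> \<delta>0"
    and hom: "\<And>\<theta>. \<not> well_dist \<kappa> \<theta> ==> covered Pt \<delta>0 False 1 \<theta>"
    and flip: "\<And>\<alpha> \<theta>. \<alpha> \<in> dirs ==> \<not> near \<kappa> \<theta> (fl \<alpha> \<theta>) ==> covered Pt \<delta>0 True \<alpha> \<theta>"
    and \<theta>: "\<theta> \<in> vartheta L B t (bad_event L \<kappa> ((e / 4)\<^sup>2) B)"
  shows "\<exists>w\<in>witnesses Pt B. \<forall>v\<in>wit_cubes B w. cube_event ((e / 4)\<^sup>2) (wit_label w) (cube L \<theta> (cidx B t v))"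
proof -
  define \<Gamma> where "\<Gamma> = (e / 4)\<^sup>2"
  have sq: "4 * sqrt \<Gamma> = e" using e by (simp add: \<Gamma>_def)
  define \<psi> where "\<psi> x = \<theta> (block_map L B t x)" for x
  have cb: "cube L \<theta> (cidx B t v) (modL 2 x) = \<psi> x" if "\<And>\<nu>. \<nu> \<in> dirs ==> crd \<nu> v \<le> crd \<nu> x \<and> crd \<nu> x \<le> crd \<nu> v + 1" for v x
    unfolding \<psi>_def by (rule cube_block[OF B(1) that])
  have pattern_event: "cube_event \<Gamma> (Pattern b \<alpha> c \<delta>) (cube L \<theta> (cidx B t v))"
    if v: "v \<in> torus B" and n: "\<And>x. x \<in> block B ==> (\<And>\<nu>. \<nu> \<in> dirs ==> crd \<nu> v \<le> crd \<nu> x \<and> crd \<nu> x \<le> crd \<nu> v + 1) ==> near \<delta> (\<psi> x) (pat_angle b \<alpha> c (modL 2 x))"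
    for b \<alpha> c \<delta> v
    unfolding cube_event.simps
  proof
    fix u assume u: "u \<in> torus 2"
    obtain x where x: "x \<in> block B" "modL 2 x = u" "\<And>\<nu>. \<nu> \<in> dirs ==> crd \<nu> v \<le> crd \<nu> x \<and> crd \<nu> x \<le> crd \<nu> v + 1"
      using vertex_exists[OF u v] by blast
    show "near \<delta> (cube L \<theta> (cidx B t v) u) (pat_angle b \<alpha> c u)"
      using n[OF x(1,3)] cb[OF x(3)] unfolding x(2) by simp
  qed
  show ?thesis
  proof (cases "\<exists>r\<in>block B. \<exists>\<alpha>\<in>dirs. vadd r (unit_vec \<alpha>) \<in> block B \<and> \<Gamma> \<le> \<bar>spin_proj \<alpha> (\<psi> r) - spin_proj \<alpha> (\<psi> (vadd r (unit_vec \<alpha>)))\<bar>")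
    case True
    then obtain r \<alpha> where r: "r \<in> block B" "\<alpha> \<in> dirs" "vadd r (unit_vec \<alpha>) \<in> block B"
      and big: "\<Gamma> \<le> \<bar>spin_proj \<alpha> (\<psi> r) - spin_proj \<alpha> (\<psi> (vadd r (unit_vec \<alpha>)))\<bar>" by blast
    \<comment> \<open>Lower corners of cubes run only up to \<open>B - 1\<close>; the minimum
      assigns an edge in an upper face of the block to a cube inside the block.\<close>
    define v where "v = (min (crd 1 r) (int B - 1), min (crd 2 r) (int B - 1), min (crd 3 r) (int B - 1))"
    have cv: "crd \<nu> v = min (crd \<nu> r) (int B - 1)" if "\<nu> \<in> dirs" for \<nu> using that by (cases r) (auto simp: v_def crd_def)
    have br: "0 \<le> crd \<nu> r \<and> crd \<nu> r \<le> int B" if "\<nu> \<in> dirs" for \<nu> using r(1) that unfolding block_iff by blast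
    have v: "v \<in> torus B" unfolding torus_iff
    proof
      fix \<nu> :: nat assume \<nu>: "\<nu> \<in> dirs"
      show "0 \<le> crd \<nu> v \<and> crd \<nu> v < int B" unfolding cv[OF \<nu>] using br[OF \<nu>] B(2) by auto
    qed
    have r\<alpha>: "crd \<alpha> r + 1 \<le> int B" using r(3) r(2) unfolding block_iff vadd_unit_vec[OF r(2)] by (metis crd_upd_same)
    have 1: "cube L \<theta> (cidx B t v) (modL 2 r) = \<psi> r"
    proof (rule cb)
      fix \<nu> :: nat assume \<nu>: "\<nu> \<in> dirs"
      show "crd \<nu> v \<le> crd \<nu> r \<and> crd \<nu> r \<le> crd \<nu> v + 1" unfolding cv[OF \<nu>] using br[OF \<nu>] by auto
    qed
    have 2: "cube L \<theta> (cidx B t v) (modL 2 (vadd r (unit_vec \<alpha>))) = \<psi> (vadd r (unit_vec \<alpha>))"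
    proof (rule cb)
      fix \<nu> :: nat assume \<nu>: "\<nu> \<in> dirs"
      show "crd \<nu> v \<le> crd \<nu> (vadd r (unit_vec \<alpha>)) \<and> crd \<nu> (vadd r (unit_vec \<alpha>)) \<le> crd \<nu> v + 1"
        unfolding cv[OF \<nu>] vadd_unit_vec[OF r(2)] crd_upd[OF r(2) \<nu>] using br[OF \<nu>] r\<alpha> by auto
    qed
    have tog: "toggle \<alpha> (modL 2 r) = modL 2 (vadd r (unit_vec \<alpha>))"
    proof (rule site_eqI)
      fix \<nu> :: nat assume \<nu>: "\<nu> \<in> dirs"
      have "1 - x mod 2 = (x + 1) mod 2" for x :: int by presburger
      then show "crd \<nu> (toggle \<alpha> (modL 2 r)) = crd \<nu> (modL 2 (vadd r (unit_vec \<alpha>)))"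
        unfolding toggle_def crd_upd[OF r(2) \<nu>] crd_modL vadd_unit_vec[OF r(2)] by simp
    qed
    have "cube_event \<Gamma> Energetic (cube L \<theta> (cidx B t v))"
      unfolding cube_event.simps
    proof (rule bexI[OF bexI r(2)])
      show "\<Gamma> \<le> \<bar>spin_proj \<alpha> (cube L \<theta> (cidx B t v) (modL 2 r)) - spin_proj \<alpha> (cube L \<theta> (cidx B t v) (toggle \<alpha> (modL 2 r)))\<bar>"
        unfolding tog 1 2 by (rule big)
    qed (rule modL_torus, simp)
    then show ?thesis unfolding \<Gamma>_def[symmetric]
      by (intro bexI[of _ "Inl v"]) (auto simp: witnesses_def v simp del: cube_event.simps)
  next
    case False
    then have small: "\<bar>spin_proj \<alpha> (\<psi> r) - spin_proj \<alpha> (\<psi> (vadd r (unit_vec \<alpha>)))\<bar> < \<Gamma>"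
      if "r \<in> block B" "\<alpha> \<in> dirs" "vadd r (unit_vec \<alpha>) \<in> block B" for r \<alpha> using that not_le by blast
    have lk: "linked e \<nu> (\<psi> r) (\<psi> (vadd r (unit_vec \<nu>)))" if "r \<in> block B" "\<nu> \<in> dirs" "vadd r (unit_vec \<nu>) \<in> block B" for r \<nu>
      using linked_if_energy_small[OF small[OF that]] unfolding sq .
    show ?thesis
    proof (rule block_trichotomy[of B e \<psi> \<kappa>, OF lk e(1,2) \<kappa> B(2)])
      fix \<tau> :: int assume w: "\<And>r. r \<in> block B ==> near (\<kappa> + 3 * real B * e) (\<psi> r) (pi / 3 * of_int \<tau>)"
      have "0 < real B * e" using e B by simp
      then have "\<kappa> + 3 * real B * e < 2 * \<kappa>" using e(2) by linarith
      from in_vartheta_bad[OF L \<theta>[folded \<Gamma>_def] small[unfolded \<psi>_def] w[unfolded \<psi>_def] this] show ?thesis by blast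
    next
      fix \<theta>0 assume 0: "\<not> well_dist \<kappa> \<theta>0" and n: "\<And>r. r \<in> block B ==> near (3 * real B * e) (\<psi> r) \<theta>0"
      obtain c \<delta> where c: "(False, 1, c, \<delta>) \<in> Pt" "near (\<delta> - \<delta>0) \<theta>0 c" using hom[OF 0] by blast
      have "real B * e \<ge> 0" using e by simp
      then have le: "3 * real B * e + (\<delta> - \<delta>0) \<le> \<delta>" using e(3) by linarith
      have "cube_event \<Gamma> (Pattern False 1 c \<delta>) (cube L \<theta> (cidx B t v))" if "v \<in> torus B" for v
      proof (rule pattern_event[OF that])
        fix x assume "x \<in> block B"
        from near_trans[OF n[OF this] c(2) le] show "near \<delta> (\<psi> x) (pat_angle False 1 c (modL 2 x))" by (simp add: pat_angle_def)
      qed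
      then show ?thesis unfolding \<Gamma>_def[symmetric] using c B
        by (intro bexI[of _ "Inr ((False, 1, c, \<delta>), 0)"]) (auto simp: witnesses_def simp del: cube_event.simps)
    next
      fix \<alpha> a \<theta>0 assume \<alpha>: "\<alpha> \<in> dirs" and a: "0 \<le> a" "a < int B" and far: "\<not> near \<kappa> \<theta>0 (fl \<alpha> \<theta>0)"
        and n1: "\<And>r. r \<in> block B ==> crd \<alpha> r = a ==> near (7 * real B * e) (\<psi> r) \<theta>0"
        and n2: "\<And>r. r \<in> block B ==> crd \<alpha> r = a + 1 ==> near (7 * real B * e) (\<psi> r) (fl \<alpha> \<theta>0)"
      \<comment> \<open>Patterns are anchored at even layers: for odd \<open>a\<close> the angle and
        its mirror image exchange their roles.\<close>
      define \<theta>1 where "\<theta>1 = (if even a then \<theta>0 else fl \<alpha> \<theta>0)"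
      have "\<not> near \<kappa> \<theta>1 (fl \<alpha> \<theta>1)" using far unfolding \<theta>1_def by (auto simp: near_commute)
      then obtain c \<delta> where c: "(True, \<alpha>, c, \<delta>) \<in> Pt" "near (\<delta> - \<delta>0) \<theta>1 c" using flip[OF \<alpha>] by blast
      have c': "near (\<delta> - \<delta>0) (fl \<alpha> \<theta>1) (fl \<alpha> c)" using c(2) by (simp add: near_fl)
      have le: "7 * real B * e + (\<delta> - \<delta>0) \<le> \<delta>" using e(3) by simp
      have "cube_event \<Gamma> (Pattern True \<alpha> c \<delta>) (cube L \<theta> (cidx B t v))" if v: "v \<in> torus B" "crd \<alpha> v = a" for v
      proof (rule pattern_event[OF v(1)])
        fix x assume x: "x \<in> block B" "\<And>\<nu>. \<nu> \<in> dirs ==> crd \<nu> v \<le> crd \<nu> x \<and> crd \<nu> x \<le> crd \<nu> v + 1"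
        have xa: "crd \<alpha> x = a \<or> crd \<alpha> x = a + 1" using x(2)[OF \<alpha>] v(2) by linarith
        have pa: "pat_angle True \<alpha> c (modL 2 x) = (if odd (crd \<alpha> x) then fl \<alpha> c else c)"
          unfolding pat_angle_def crd_modL by (simp add: odd_iff_mod_2_eq_one even_iff_mod_2_eq_zero)
        have "near (7 * real B * e) (\<psi> x) (if odd (crd \<alpha> x) then fl \<alpha> \<theta>1 else \<theta>1)"
          using xa n1[OF x(1)] n2[OF x(1)] unfolding \<theta>1_def by (cases "even a") auto
        moreover have "near (\<delta> - \<delta>0) (if odd (crd \<alpha> x) then fl \<alpha> \<theta>1 else \<theta>1) (if odd (crd \<alpha> x) then fl \<alpha> c else c)"
          using c(2) c' by simp
        ultimately show "near \<delta> (\<psi> x) (pat_angle True \<alpha> c (modL 2 x))" unfolding pa by (rule near_trans[OF _ _ le])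
      qed
      then show ?thesis unfolding \<Gamma>_def[symmetric] using c a
        by (intro bexI[of _ "Inr ((True, \<alpha>, c, \<delta>), a)"]) (auto simp: witnesses_def simp del: cube_event.simps)
    qed
  qed
qed

lemma layer_card:
  assumes "\<alpha> \<in> dirs" "0 \<le> a" "a < int B"
  shows "card {v \<in> torus B. crd \<alpha> v = a} = B\<^sup>2"
proof -
  consider "\<alpha> = 1" | "\<alpha> = 2" | "\<alpha> = 3" using assms(1) by blast
  then show ?thesis
  proof cases
    case 1
    then have "{v \<in> torus B. crd \<alpha> v = a} = {a} \<times> {0..<int B} \<times> {0..<int B}"
      using assms by (auto simp: torus_def crd_def)
    then show ?thesis by (simp add: card_cartesian_product power2_eq_square)
  next
    case 2
    then have "{v \<in> torus B. crd \<alpha> v = a} = {0..<int B} \<times> {a} \<times> {0..<int B}"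
      using assms by (auto simp: torus_def crd_def)
    then show ?thesis by (simp add: card_cartesian_product power2_eq_square)
  next
    case 3
    then have "{v \<in> torus B. crd \<alpha> v = a} = {0..<int B} \<times> {0..<int B} \<times> {a}"
      using assms by (auto simp: torus_def crd_def)
    then show ?thesis by (simp add: card_cartesian_product power2_eq_square)
  qed
qed

fun label_bound :: "real => real => label => real" where
  "label_bound zE zP Free = 1"
| "label_bound zE zP Energetic = zE"
| "label_bound zE zP (Pattern b \<alpha> c \<delta>) = zP"

text \<open>There are \<open>B ^ 3\<close> cubes that may be costly and \<open>card Pt * B\<close>
  pairs of a pattern and a layer index, each of which occupies at least \<open>B^2\<close>
  cubes.\<close>

lemma witness_sum:
  assumes fin: "finite Pt" and \<alpha>: "\<And>b \<alpha> c \<delta>. (b, \<alpha>, c, \<delta>) \<in> Pt ==> \<alpha> \<in> dirs" and z: "0 \<le> zP" "zP \<le> 1"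
  shows "(\<Sum>w\<in>witnesses Pt B. label_bound zE zP (wit_label w) ^ card (wit_cubes B w)) \<le> real (B ^ 3) * zE + real (card Pt) * real B * zP ^ (B\<^sup>2)"
proof -
  have "(\<Sum>x\<in>Pt \<times> {0..<int B}. label_bound zE zP (wit_label (Inr x)) ^ card (wit_cubes B (Inr x))) \<le> (\<Sum>x\<in>Pt \<times> {0..<int B}. zP ^ (B\<^sup>2))"
  proof (rule sum_mono)
    fix x assume x: "x \<in> Pt \<times> {0..<int B}"
    obtain b \<alpha> c \<delta> a where xe: "x = ((b, \<alpha>, c, \<delta>), a)" by (metis surj_pair)
    have "card {v \<in> torus B. crd \<alpha> v = a} \<le> card {v \<in> torus B. b --> crd \<alpha> v = a}"
      by (intro card_mono) (auto simp: finite_torus)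
    then have "B\<^sup>2 \<le> card {v \<in> torus B. b --> crd \<alpha> v = a}"
      using x \<alpha> layer_card[of \<alpha> a B] unfolding xe by auto
    then show "label_bound zE zP (wit_label (Inr x)) ^ card (wit_cubes B (Inr x)) \<le> zP ^ (B\<^sup>2)"
      unfolding xe using z by (simp add: power_decreasing)
  qed
  also have "... = real (card Pt) * real B * zP ^ (B\<^sup>2)" by (simp add: card_cartesian_product)
  finally have "(\<Sum>x\<in>Pt \<times> {0..<int B}. label_bound zE zP (wit_label (Inr x)) ^ card (wit_cubes B (Inr x))) \<le> real (card Pt) * real B * zP ^ (B\<^sup>2)" .
  moreover have "(\<Sum>w\<in>witnesses Pt B. label_bound zE zP (wit_label w) ^ card (wit_cubes B w)) =
    (\<Sum>v\<in>torus B. zE) + (\<Sum>x\<in>Pt \<times> {0..<int B}. label_bound zE zP (wit_label (Inr x)) ^ card (wit_cubes B (Inr x)))"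
    unfolding witnesses_def using fin by (subst sum.Plus) (auto simp: finite_torus)
  ultimately show ?thesis by (simp add: card_torus)
qed

text \<open>A function that is not integrable has Bochner integral 0, so the bound holds in either
  case. This settles the intersection of bad events without a discussion of its
  measurability.\<close>

lemma integral_le_nn_integral:
  fixes f :: "'a => real"
  assumes "\<And>x. f x \<ge> 0" "\<And>x. ennreal (f x) \<le> h x" "(\<integral>\<^sup>+x. h x \<partial>M) \<le> ennreal c" "c \<ge> 0"
  shows "(\<integral>x. f x \<partial>M) \<le> c"
proof (cases "integrable M f")
  case True
  then have "ennreal (\<integral>x. f x \<partial>M) = (\<integral>\<^sup>+x. ennreal (f x) \<partial>M)" using assms(1) by (intro nn_integral_eq_integral[symmetric]) auto
  also have "... \<le> (\<integral>\<^sup>+x. h x \<partial>M)" using assms(2) by (intro nn_integral_mono) auto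
  also have "... \<le> ennreal c" by (rule assms(3))
  finally show ?thesis using assms(4) by (simp add: ennreal_le_iff)
next
  case False
  then show ?thesis using assms(4) by (simp add: not_integrable_integral_eq)
qed

lemma gibbs_weight_ennreal:
  "ennreal (gibbs_weight J \<beta> L \<theta>) = angle_ind L \<theta> * boltz J \<beta> L \<theta>"
proof -
  have "\<theta> \<in> angle_box L \<longleftrightarrow> (\<forall>r\<in>torus L. \<theta> r \<in> {0..<2*pi})" by (auto simp: angle_box_def)
  then show ?thesis unfolding gibbs_weight_def indicator_if prod_if_1[OF finite_torus] by (auto simp: indicator_def)
qed

lemma gibbs_weight_nonneg: "gibbs_weight J \<beta> L \<theta> \<ge> 0"
  by (simp add: gibbs_weight_def)

lemma partition_function: "(\<integral>\<theta>. gibbs_weight J \<beta> L \<theta> \<partial>config_measure L) = enn2real (totZ J \<beta> L)"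
proof -
  have "(\<lambda>\<theta>. enn2real (angle_ind L \<theta> * boltz J \<beta> L \<theta>)) \<in> borel_measurable (config_measure L)"
    by (intro borel_measurable_enn2real borel_measurable_times_ennreal measurable_box) measurable
  then have "gibbs_weight J \<beta> L \<in> borel_measurable (config_measure L)"
    unfolding gibbs_weight_ennreal[symmetric] enn2real_ennreal[OF gibbs_weight_nonneg] .
  then show ?thesis unfolding totZ_def gibbs_weight_ennreal[symmetric]
    by (intro integral_eq_nn_integral) (auto simp: gibbs_weight_nonneg)
qed

abbreviation all_bad :: "nat => nat => real => real => site set => config set" where
  "all_bad L B \<kappa> \<Gamma> T \<equiv> \<Inter>t\<in>T. vartheta L B t (bad_event L \<kappa> \<Gamma> B)"

text \<open>Union bound over the choice of one witness per bad block. The cubes of distinct blocks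
  are disjoint, so for a fixed choice the chessboard estimate gives a product over the blocks, and
  the sum over all choices factorizes into a power of a single sum.\<close>

proposition bad_blocks_bound:
  assumes J: "J > 0" "\<beta> \<ge> 1" and B: "even B" "B > 4" "\<beta> powr (1 / 20) \<le> real B" and M: "M > 0" and \<kappa>: "\<kappa> \<le> 1 / 10"
    and e: "0 < e" "16 * real B * e \<le> \<kappa>" "7 * real B * e \<le> \<delta>0"
    and Pt: "finite Pt" "\<And>b \<alpha> c \<delta>. (b, \<alpha>, c, \<delta>) \<in> Pt ==> \<alpha> \<in> dirs" "\<And>p. p \<in> Pt ==> suppressed J g \<beta> p" "g > 0"
    and hom: "\<And>\<theta>. \<not> well_dist \<kappa> \<theta> ==> covered Pt \<delta>0 False 1 \<theta>"
    and flip: "\<And>\<alpha> \<theta>. \<alpha> \<in> dirs ==> \<not> near \<kappa> \<theta> (fl \<alpha> \<theta>) ==> covered Pt \<delta>0 True \<alpha> \<theta>"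
    and T: "T \<subseteq> torus M"
  defines "\<Gamma> \<equiv> (e / 4)\<^sup>2" and "L \<equiv> B * M"
  defines "zE \<equiv> 2 * pi * exp (- \<beta> * J * \<Gamma>\<^sup>2 / 16) * (exp (3 * J / 2) * sqrt \<beta>)"
  shows "gibbs_prob J L \<beta> (all_bad L B \<kappa> \<Gamma> T)
    \<le> (real (B ^ 3) * zE + real (card Pt) * real B * exp (- g) ^ (B\<^sup>2)) ^ card T"
proof -
  have L: "even L" "L > 0" "L > 4" "B \<le> L" unfolding L_def using B M by (auto intro: less_le_trans)
  have \<beta>L: "\<beta> powr (1 / 20) \<le> real L" using B(3) L(4) by linarith
  have \<Gamma>: "\<Gamma> > 0" using e by (simp add: \<Gamma>_def)
  define z where "z = label_bound zE (exp (- g))"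
  define W where "W = witnesses Pt B"
  have finW: "finite W" unfolding W_def witnesses_def using Pt by (simp add: finite_torus)
  have finT: "finite T" using T finite_torus finite_subset by blast
  have zE: "zE \<ge> 0" unfolding zE_def using J by simp
  have z0: "z k \<ge> 0" for k unfolding z_def using zE by (cases k) auto
  have zk: "cubeZ L (cube_fun J \<beta> \<Gamma>) (\<lambda>_. k) \<le> ennreal (z k ^ (L ^ 3)) * totZ J \<beta> L"
    if k: "k = Free \<or> k \<in> wit_label ` W" for k
  proof (cases k)
    case Free
    then show ?thesis by (simp add: z_def cubeZ_Free[OF L(2)])
  next
    case Energetic
    \<comment> \<open>\<open>zE\<close> is the weight of a costly cube divided by the lower bound
      per site from \<open>totZ_lower\<close>.\<close>
    have "(2 * pi * exp (- \<beta> * J * \<Gamma>\<^sup>2 / 16)) ^ (L ^ 3) = zE ^ (L ^ 3) * (exp (- 3 * J / 2) / sqrt \<beta>) ^ (L ^ 3)"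
      unfolding power_mult_distrib[symmetric]
    proof (rule arg_cong[where f = "\<lambda>x. x ^ (L ^ 3)"])
      have "exp (3 * J / 2) * exp (- 3 * J / 2) = 1" by (simp add: exp_add[symmetric])
      then have "zE * (exp (- 3 * J / 2) / sqrt \<beta>) = (2 * pi * exp (- \<beta> * J * \<Gamma>\<^sup>2 / 16)) * 1 * (sqrt \<beta> / sqrt \<beta>)"
        unfolding zE_def by (simp add: mult_ac)
      then show "2 * pi * exp (- \<beta> * J * \<Gamma>\<^sup>2 / 16) = zE * (exp (- 3 * J / 2) / sqrt \<beta>)" using J by simp
    qed
    then have "ennreal ((2 * pi * exp (- \<beta> * J * \<Gamma>\<^sup>2 / 16)) ^ (L ^ 3)) = ennreal (zE ^ (L ^ 3)) * ennreal ((exp (- 3 * J / 2) / sqrt \<beta>) ^ (L ^ 3))"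
      using zE J by (simp add: ennreal_mult)
    also have "... \<le> ennreal (zE ^ (L ^ 3)) * totZ J \<beta> L" by (intro mult_left_mono totZ_lower L J) simp
    finally show ?thesis using cubeZ_Energetic[OF L(2) J(1) _ \<Gamma>, of \<beta>] J Energetic
      by (auto simp: z_def intro: order.trans)
  next
    case (Pattern b \<alpha> c \<delta>)
    then have "(b, \<alpha>, c, \<delta>) \<in> Pt" using k unfolding W_def witnesses_def by auto
    then have "\<alpha> \<in> dirs" "suppressed J g \<beta> (b, \<alpha>, c, \<delta>)" using Pt by blast+
    then show ?thesis unfolding Pattern cubeZ_Pattern[OF L(1,2) \<open>\<alpha> \<in> dirs\<close>] z_def label_bound.simps
      using L(1,3) \<beta>L unfolding suppressed_def split_conv by blast
  qed
  define Z where "Z = enn2real (totZ J \<beta> L)"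
  have fin: "cubeZ L (cube_fun J \<beta> \<Gamma>) a < \<infinity>" for a using cubeZ_finite L J by simp
  have Z: "Z > 0" unfolding Z_def by (rule totZ_finite_pos(2)[OF L(2) J])
  define bj where "bj = (\<lambda>(t, v). cidx B t v)"
  have bj: "bij_betw bj (torus M \<times> torus B) (torus L)" unfolding bj_def L_def by (rule cidx_bij) (use B in simp)
  define iv where "iv = the_inv_into (torus M \<times> torus B) bj"
  have iv: "iv (cidx B t v) = (t, v)" if "t \<in> torus M" "v \<in> torus B" for t v
  proof -
    have "iv (bj (t, v)) = (t, v)" unfolding iv_def
      by (rule the_inv_into_f_f[OF bij_betw_imp_inj_on[OF bj]]) (use that in simp)
    then show ?thesis by (simp add: bj_def)
  qed
  have rep: "\<exists>t\<in>torus M. \<exists>v\<in>torus B. r = cidx B t v" if "r \<in> torus L" for r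
  proof -
    have "r \<in> bj ` (torus M \<times> torus B)" unfolding bij_betw_imp_surj_on[OF bj] by (rule that)
    then obtain p where p: "r = bj p" "p \<in> torus M \<times> torus B" by (rule imageE)
    then have "fst p \<in> torus M" "snd p \<in> torus B" "r = cidx B (fst p) (snd p)"
      by (simp_all only: mem_Times_iff bj_def split_def)
    then show ?thesis by (intro bexI)
  qed
  \<comment> \<open>The labelling of the whole torus induced by a choice \<open>w\<close> of
    witnesses; \<open>iv\<close> recovers the block of a cube and its position there.\<close>
  define lab where "lab w r = (if fst (iv r) \<in> T \<and> snd (iv r) \<in> wit_cubes B (w (fst (iv r))) then wit_label (w (fst (iv r))) else Free)" for w r
  define G where "G w \<theta> = (\<Prod>r\<in>torus L. cube_fun J \<beta> \<Gamma> (lab w r) (cube L \<theta> r))" for w \<theta>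
  define P where "P = PiE T (\<lambda>_. W)"
  have finP: "finite P" unfolding P_def using finT finW by (intro finite_PiE) auto
  have labW: "lab w r = Free \<or> lab w r \<in> wit_label ` W" if "w \<in> P" for w r
    using that unfolding lab_def P_def by (auto simp: PiE_iff)
  have pw: "ennreal (indicator (all_bad L B \<kappa> \<Gamma> T) \<theta> * gibbs_weight J \<beta> L \<theta>) \<le> (\<Sum>w\<in>P. G w \<theta>)" for \<theta>
  proof (cases "\<theta> \<in> (all_bad L B \<kappa> \<Gamma> T)")
    case True
    have "\<forall>t\<in>T. \<exists>w. w \<in> W \<and> (\<forall>v\<in>wit_cubes B w. cube_event \<Gamma> (wit_label w) (cube L \<theta> (cidx B t v)))"
    proof
      fix t assume "t \<in> T"
      then have t: "\<theta> \<in> vartheta L B t (bad_event L \<kappa> ((e / 4)\<^sup>2) B)" using True unfolding \<Gamma>_def by blast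
      have "B \<ge> 1" using B by simp
      from bad_witness[OF L(2) B(1) this \<kappa> e hom flip t] show "\<exists>w. w \<in> W \<and> (\<forall>v\<in>wit_cubes B w. cube_event \<Gamma> (wit_label w) (cube L \<theta> (cidx B t v)))"
        unfolding W_def \<Gamma>_def by blast
    qed
    from bchoice[OF this] obtain w0 where w0: "\<And>t. t \<in> T ==> w0 t \<in> W"
      "\<And>t v. t \<in> T ==> v \<in> wit_cubes B (w0 t) ==> cube_event \<Gamma> (wit_label (w0 t)) (cube L \<theta> (cidx B t v))" by blast
    define w where "w = restrict w0 T"
    have w: "w \<in> P" unfolding w_def P_def using w0(1) by auto
    have "\<forall>r\<in>torus L. cube_event \<Gamma> (lab w r) (cube L \<theta> r)"
    proof
      fix r assume "r \<in> torus L"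
      then obtain t v where r: "t \<in> torus M" "v \<in> torus B" "r = cidx B t v" using rep by blast
      show "cube_event \<Gamma> (lab w r) (cube L \<theta> r)"
        unfolding lab_def r(3) iv[OF r(1,2)] fst_conv snd_conv using w0(2)[of t v] by (simp add: w_def)
    qed
    then have "G w \<theta> = ennreal (gibbs_weight J \<beta> L \<theta>)" unfolding G_def prod_cube_fun[OF L(2)] gibbs_weight_ennreal by simp
    moreover have "G w \<theta> \<le> (\<Sum>w\<in>P. G w \<theta>)" by (rule member_le_sum[OF w]) (auto simp: finP)
    ultimately show ?thesis using True by simp
  qed simp
  have GZ: "(\<integral>\<^sup>+\<theta>. G w \<theta> \<partial>config_measure L) \<le> ennreal ((\<Prod>t\<in>T. z (wit_label (w t)) ^ card (wit_cubes B (w t))) * Z)" if w: "w \<in> P" for w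
  proof -
    have "(\<integral>\<^sup>+\<theta>. G w \<theta> \<partial>config_measure L) = cubeZ L (cube_fun J \<beta> \<Gamma>) (lab w)" unfolding G_def cubeZ_def ..
    also have "... = ennreal (enn2real (cubeZ L (cube_fun J \<beta> \<Gamma>) (lab w)))" using fin by simp
    also have "... \<le> ennreal ((\<Prod>r\<in>torus L. z (lab w r)) * Z)" unfolding Z_def
      by (intro ennreal_leI cubeZ_bound[OF L(1,2) J]) (use z0 zk labW[OF w] in blast)
    also have "(\<Prod>r\<in>torus L. z (lab w r)) = (\<Prod>p\<in>torus M \<times> torus B. z (lab w (bj p)))"
      by (rule prod.reindex_bij_betw[OF bj, symmetric])
    also have "... = (\<Prod>t\<in>torus M. \<Prod>v\<in>torus B. z (lab w (cidx B t v)))"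
      unfolding bj_def by (simp add: prod.cartesian_product split_def)
    also have "... = (\<Prod>t\<in>torus M. if t \<in> T then z (wit_label (w t)) ^ card (wit_cubes B (w t)) else 1)"
    proof (rule prod.cong[OF refl])
      fix t assume t: "t \<in> torus M"
      show "(\<Prod>v\<in>torus B. z (lab w (cidx B t v))) = (if t \<in> T then z (wit_label (w t)) ^ card (wit_cubes B (w t)) else 1)"
      proof (cases "t \<in> T")
        case True
        have "w t \<in> W" using w True unfolding P_def by auto
        then have sub: "wit_cubes B (w t) \<subseteq> torus B" unfolding W_def witnesses_def by auto
        have "(\<Prod>v\<in>torus B. z (lab w (cidx B t v))) = (\<Prod>v\<in>torus B. if v \<in> wit_cubes B (w t) then z (wit_label (w t)) else 1)"
          using t True by (intro prod.cong refl) (auto simp: lab_def iv z_def)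
        also have "... = (\<Prod>v\<in>wit_cubes B (w t). z (wit_label (w t)))"
          using sub by (simp add: prod.If_cases finite_torus Int_absorb1)
        finally show ?thesis using True by simp
      next
        case False
        then show ?thesis using t by (auto simp: lab_def iv z_def intro!: prod.neutral)
      qed
    qed
    also have "... = (\<Prod>t\<in>T. z (wit_label (w t)) ^ card (wit_cubes B (w t)))"
      using T by (simp add: prod.If_cases finite_torus Int_absorb1)
    finally show ?thesis .
  qed
  define S where "S = (\<Sum>x\<in>W. z (wit_label x) ^ card (wit_cubes B x))"
  have S0: "S \<ge> 0" unfolding S_def using z0 by (intro sum_nonneg) auto
  have Gm: "G w \<in> borel_measurable (config_measure L)" for w
  proof -
    have "(\<lambda>\<theta>. cube L \<theta> r) \<in> config_measure L \<rightarrow>\<^sub>M lborelP (torus 2)" for r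
      unfolding config_measure_def by (rule measurable_cube) (rule block_map_torus[OF L(2)])
    then show ?thesis unfolding G_def[abs_def]
      by (intro borel_measurable_prod_ennreal measurable_compose[OF _ measurable_cube_fun])
  qed
  have "(\<integral>\<^sup>+\<theta>. (\<Sum>w\<in>P. G w \<theta>) \<partial>config_measure L) = (\<Sum>w\<in>P. \<integral>\<^sup>+\<theta>. G w \<theta> \<partial>config_measure L)"
    by (rule nn_integral_sum) (rule Gm)
  also have "... \<le> (\<Sum>w\<in>P. ennreal ((\<Prod>t\<in>T. z (wit_label (w t)) ^ card (wit_cubes B (w t))) * Z))"
    by (intro sum_mono GZ)
  also have "... = ennreal ((\<Sum>w\<in>P. \<Prod>t\<in>T. z (wit_label (w t)) ^ card (wit_cubes B (w t))) * Z)"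
    unfolding sum_distrib_right using z0 Z by (intro sum_ennreal) (auto intro!: mult_nonneg_nonneg prod_nonneg)
  also have "(\<Sum>w\<in>P. \<Prod>t\<in>T. z (wit_label (w t)) ^ card (wit_cubes B (w t))) = (\<Prod>t\<in>T. S)"
    unfolding P_def S_def using finT finW by (subst prod_sum_PiE) auto
  finally have up: "(\<integral>\<^sup>+\<theta>. (\<Sum>w\<in>P. G w \<theta>) \<partial>config_measure L) \<le> ennreal (S ^ card T * Z)" by simp
  have "(\<integral>\<theta>. indicator (all_bad L B \<kappa> \<Gamma> T) \<theta> * gibbs_weight J \<beta> L \<theta> \<partial>config_measure L) \<le> S ^ card T * Z"
    by (rule integral_le_nn_integral[OF _ pw up]) (use S0 Z in \<open>auto simp: gibbs_weight_nonneg\<close>)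
  then have "gibbs_prob J L \<beta> (all_bad L B \<kappa> \<Gamma> T) \<le> S ^ card T"
    unfolding gibbs_prob_def partition_function Z_def[symmetric] using Z by (simp add: divide_le_eq)
  also have "... \<le> (real (B ^ 3) * zE + real (card Pt) * real B * exp (- g) ^ (B\<^sup>2)) ^ card T"
    using S0 witness_sum[OF Pt(1,2), where zP = "exp (- g)" and B = B and zE = zE] Pt(4) unfolding S_def z_def W_def by (intro power_mono) auto
  finally show ?thesis .
qed

lemma power_of_two_scale:
  fixes y :: real
  assumes "y \<ge> 8"
  obtains m where "m \<ge> 3" "real (2 ^ m) \<le> y" "y / 2 \<le> real (2 ^ m)"
proof -
  define m where "m = nat \<lfloor>log 2 y\<rfloor>"
  have "log 2 8 \<le> log 2 y" using assms by simp
  moreover have "log 2 8 = (3 :: real)" using log_pow_cancel[of 2 3] by simp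
  ultimately have l: "3 \<le> log 2 y" by simp
  then have m: "real m = of_int \<lfloor>log 2 y\<rfloor>" "m \<ge> 3" unfolding m_def by (auto simp: le_nat_iff le_floor_iff)
  have "real m \<le> log 2 y" "log 2 y \<le> real m + 1" unfolding m(1) by linarith+
  then have "2 powr real m \<le> 2 powr log 2 y" "2 powr log 2 y \<le> 2 powr (real m + 1)" by simp_all
  then have "2 ^ m \<le> y" "y \<le> 2 * 2 ^ m" using assms by (simp_all add: powr_realpow powr_add)
  then show thesis using m by (intro that[of m]) auto
qed

text \<open>\<open>B\<close> is a power of two between half of \<open>\<beta> powr (1 / 16)\<close>
  and \<open>\<beta> powr (1 / 16)\<close>, \<open>e\<close> is of order \<open>1 / B\<close> and
  \<open>\<Gamma>\<close> of order \<open>1 / B^2\<close>. The exponent of a costly cube is then at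
  least a multiple of \<open>\<beta> / B^4 \<ge> \<beta> powr (3 / 4)\<close>, that of a pattern is
  \<open>g * B^2\<close>, of order \<open>\<beta> powr (1 / 8)\<close>; they beat the counts
  \<open>B^3\<close> and \<open>card Pt * B\<close>. Since
  \<open>B \<ge> \<beta> powr (1 / 20)\<close>, any torus that contains a block is large enough, and
  \<open>L0 = 1\<close> will do.\<close>

theorem theorem3p1:
  fixes J :: real
  assumes "J > 0"
  shows "\<exists>\<kappa>0>0. \<forall>\<kappa>. 0 < \<kappa> \<and> \<kappa> < \<kappa>0 \<longrightarrow> (\<forall>\<eta>. 0 < \<eta> \<and> \<eta> < 1 \<longrightarrow>
    (\<exists>L0::real. L0 > 0 \<and> (\<exists>\<beta>0::real. \<beta>0 > 0 \<and> (\<forall>\<beta>\<ge>\<beta>0.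
      (\<exists>\<Gamma>::real. 0 < \<Gamma> \<and> \<Gamma> < 1 \<and> (\<exists>B::nat. B > 0 \<and>
        (\<forall>L::nat. real L \<ge> L0 \<and> (\<exists>k::nat. L = B * 2 ^ k) \<longrightarrow>
          (\<forall>T. T \<subseteq> torus (L div B) \<longrightarrow>
             gibbs_prob J L \<beta> (\<Inter>t\<in>T. vartheta L B t (bad_event L \<kappa> \<Gamma> B))
               \<le> \<eta> ^ card T))))))))"
proof (rule exI[of _ "1 / 10 :: real"], intro conjI allI impI)
  fix \<kappa> \<eta> :: real assume \<kappa>: "0 < \<kappa> \<and> \<kappa> < 1 / 10" and \<eta>: "0 < \<eta> \<and> \<eta> < 1"
  obtain Pt g \<delta>0 where Pt: "finite Pt" "g > 0" "\<delta>0 > 0" "\<And>b \<alpha> c \<delta>. (b, \<alpha>, c, \<delta>) \<in> Pt \<Longrightarrow> \<alpha> \<in> dirs"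
    "\<forall>\<^sub>F \<beta> in at_top. \<forall>p\<in>Pt. suppressed J g \<beta> p"
    "\<And>\<theta>. \<not> well_dist \<kappa> \<theta> \<Longrightarrow> covered Pt \<delta>0 False 1 \<theta>"
    "\<And>\<alpha> \<theta>. \<alpha> \<in> dirs \<Longrightarrow> \<not> near \<kappa> \<theta> (fl \<alpha> \<theta>) \<Longrightarrow> covered Pt \<delta>0 True \<alpha> \<theta>"
    using pattern_family[OF assms, of \<kappa>] \<kappa> by blast
  \<comment> \<open>The numbers 16 and 7 are the drift constants of \<open>block_trichotomy\<close>;
    with \<open>e = \<mu> / B\<close> its conditions hold for every \<open>B\<close>.\<close>
  define \<mu> where "\<mu> = min (\<kappa> / 16) (\<delta>0 / 7)"
  have \<mu>: "0 < \<mu>" "16 * \<mu> \<le> \<kappa>" "7 * \<mu> \<le> \<delta>0" unfolding \<mu>_def using \<kappa> Pt(3) by auto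
  \<comment> \<open>The 16 is the divisor in \<open>hamiltonian_cubes\<close>, and
    \<open>256 = 4 ^ 4\<close> comes from \<open>\<Gamma>^2 = (e / 4)^4\<close>.\<close>
  define K where "K = J * \<mu> ^ 4 / (16 * 256)"
  define C where "C = 2 * pi * exp (3 * J / 2)"
  define N where "N = real (card Pt)"
  have K: "K > 0" "C > 0" "N \<ge> 0" unfolding K_def C_def N_def using assms \<mu> by auto
  have lim1: "((\<lambda>\<beta>::real. (\<beta> powr (1 / 16)) ^ 3 * (C * exp (- (K * \<beta> powr (3 / 4))) * sqrt \<beta>)) \<longlongrightarrow> 0) at_top"
    using K by real_asymp
  have lim2: "((\<lambda>\<beta>::real. N * \<beta> powr (1 / 16) * exp (- (g * (\<beta> powr (1 / 16) / 2)\<^sup>2))) \<longlongrightarrow> N * 0) at_top"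
  proof -
    have "((\<lambda>\<beta>::real. \<beta> powr (1 / 16) * exp (- (g * (\<beta> powr (1 / 16) / 2)\<^sup>2))) \<longlongrightarrow> 0) at_top"
      using Pt(2) by real_asymp
    then show ?thesis unfolding mult.assoc by (rule tendsto_mult_left)
  qed
  define Q where "Q \<beta> \<longleftrightarrow> \<beta> powr (1 / 16) \<ge> 8 \<and> \<beta> powr (1 / 20) \<le> \<beta> powr (1 / 16) / 2 \<and> \<beta> \<ge> 1 \<and>
      (\<beta> powr (1 / 16)) ^ 3 * (C * exp (- (K * \<beta> powr (3 / 4))) * sqrt \<beta>) < \<eta> / 2 \<and>
      N * \<beta> powr (1 / 16) * exp (- (g * (\<beta> powr (1 / 16) / 2)\<^sup>2)) < \<eta> / 2 \<and> (\<forall>p\<in>Pt. suppressed J g \<beta> p)" for \<beta>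
  have "\<forall>\<^sub>F \<beta>::real in at_top. \<beta> powr (1 / 16) \<ge> 8" by real_asymp
  moreover have "\<forall>\<^sub>F \<beta>::real in at_top. \<beta> powr (1 / 20) \<le> \<beta> powr (1 / 16) / 2" by real_asymp
  moreover have "\<forall>\<^sub>F \<beta>::real in at_top. \<beta> \<ge> 1" by (rule eventually_ge_at_top)
  moreover have "\<forall>\<^sub>F \<beta> in at_top. (\<beta> powr (1 / 16)) ^ 3 * (C * exp (- (K * \<beta> powr (3 / 4))) * sqrt \<beta>) < \<eta> / 2"
    by (rule order_tendstoD(2)[OF lim1]) (use \<eta> in simp)
  moreover have "\<forall>\<^sub>F \<beta> in at_top. N * \<beta> powr (1 / 16) * exp (- (g * (\<beta> powr (1 / 16) / 2)\<^sup>2)) < \<eta> / 2"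
    by (rule order_tendstoD(2)[OF lim2]) (use \<eta> in simp)
  ultimately have "\<forall>\<^sub>F \<beta> in at_top. Q \<beta>" using Pt(5) unfolding Q_def by eventually_elim simp
  then obtain \<beta>1 where \<beta>1: "\<And>\<beta>. \<beta> \<ge> \<beta>1 \<Longrightarrow> Q \<beta>" unfolding eventually_at_top_linorder by blast
  show "\<exists>L0::real. L0 > 0 \<and> (\<exists>\<beta>0::real. \<beta>0 > 0 \<and> (\<forall>\<beta>\<ge>\<beta>0.
      (\<exists>\<Gamma>::real. 0 < \<Gamma> \<and> \<Gamma> < 1 \<and> (\<exists>B::nat. B > 0 \<and>
        (\<forall>L::nat. real L \<ge> L0 \<and> (\<exists>k::nat. L = B * 2 ^ k) \<longrightarrow>
          (\<forall>T. T \<subseteq> torus (L div B) \<longrightarrow>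
             gibbs_prob J L \<beta> (all_bad L B \<kappa> \<Gamma> T) \<le> \<eta> ^ card T))))))"
  proof (rule exI[of _ 1], rule conjI[OF zero_less_one], rule exI[of _ "max \<beta>1 1"], rule conjI, simp, rule allI, rule impI)
    fix \<beta> assume \<beta>: "\<beta> \<ge> max \<beta>1 1"
    define y where "y = \<beta> powr (1 / 16)"
    have b: "y \<ge> 8" "\<beta> powr (1 / 20) \<le> y / 2" "\<beta> \<ge> 1" "y ^ 3 * (C * exp (- (K * \<beta> powr (3 / 4))) * sqrt \<beta>) < \<eta> / 2"
      "N * y * exp (- (g * (y / 2)\<^sup>2)) < \<eta> / 2" "\<And>p. p \<in> Pt \<Longrightarrow> suppressed J g \<beta> p"
      using \<beta>1[of \<beta>] \<beta> unfolding y_def Q_def by auto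
    obtain m where m: "m \<ge> 3" "real (2 ^ m) \<le> y" "y / 2 \<le> real (2 ^ m)" using power_of_two_scale[OF b(1)] by blast
    define B :: nat where "B = 2 ^ m"
    have "(2::nat) ^ 3 \<le> 2 ^ m" using m by (intro power_increasing) auto
    then have B: "even B" "B > 4" "real B \<le> y" "y / 2 \<le> real B" "real B > 0" using m unfolding B_def by auto
    define e where "e = \<mu> / real B"
    have e: "0 < e" "16 * real B * e \<le> \<kappa>" "7 * real B * e \<le> \<delta>0" unfolding e_def using \<mu> B by auto
    define \<Gamma> where "\<Gamma> = (e / 4)\<^sup>2"
    have "e \<le> \<mu>" unfolding e_def using B \<mu> by (simp add: divide_le_eq)
    then have e1: "e / 4 < 1" using \<mu> \<kappa> by simp
    have \<Gamma>: "0 < \<Gamma>" "\<Gamma> < 1" unfolding \<Gamma>_def using e e1 by (auto simp: power_less_one_iff)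
    define zE where "zE = 2 * pi * exp (- \<beta> * J * \<Gamma>\<^sup>2 / 16) * (exp (3 * J / 2) * sqrt \<beta>)"
    have "K * \<beta> powr (3 / 4) \<le> \<beta> * J * \<Gamma>\<^sup>2 / 16"
    proof -
      have "\<mu> / y \<le> e" unfolding e_def using B \<mu> by (intro divide_left_mono) auto
      then have "(\<mu> / y) ^ 4 \<le> e ^ 4" using \<mu> b by (intro power_mono) auto
      then have 1: "\<beta> * J * (\<mu> / y) ^ 4 / (16 * 256) \<le> \<beta> * J * e ^ 4 / (16 * 256)"
        using b assms by (intro divide_right_mono mult_left_mono) auto
      have "\<Gamma>\<^sup>2 = e ^ 4 / 256" unfolding \<Gamma>_def by (simp add: power_divide)
      then have 2: "\<beta> * J * \<Gamma>\<^sup>2 / 16 = \<beta> * J * e ^ 4 / (16 * 256)" by simp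
      have "y ^ 4 = y powr 4" by (rule powr_numeral[symmetric]) (use b in simp)
      also have "... = \<beta> powr (1 / 4)" unfolding y_def powr_powr by simp
      finally have "y ^ 4 = \<beta> powr (1 / 4)" .
      moreover have "\<beta> powr (3 / 4) * \<beta> powr (1 / 4) = \<beta>" using b by (simp add: powr_add[symmetric])
      ultimately have "\<beta> / y ^ 4 = \<beta> powr (3 / 4)" using b by (simp add: field_simps)
      moreover have "\<beta> * J * (\<mu> / y) ^ 4 / (16 * 256) = K * (\<beta> / y ^ 4)" unfolding K_def by (simp add: power_divide mult_ac)
      ultimately have "\<beta> * J * (\<mu> / y) ^ 4 / (16 * 256) = K * \<beta> powr (3 / 4)" by simp
      then show ?thesis unfolding 2 using 1 by (simp only:)
    qed
    then have "exp (- \<beta> * J * \<Gamma>\<^sup>2 / 16) \<le> exp (- (K * \<beta> powr (3 / 4)))" by simp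
    then have "zE \<le> C * exp (- (K * \<beta> powr (3 / 4))) * sqrt \<beta>"
      unfolding zE_def C_def using b by (simp add: mult_ac)
    moreover have "zE \<ge> 0" unfolding zE_def using b by simp
    ultimately have "real (B ^ 3) * zE \<le> y ^ 3 * (C * exp (- (K * \<beta> powr (3 / 4))) * sqrt \<beta>)"
      using B unfolding of_nat_power by (intro mult_mono power_mono) auto
    then have s1: "real (B ^ 3) * zE \<le> \<eta> / 2" using b by linarith
    have "exp (- g) ^ (B\<^sup>2) = exp (- (g * (real B)\<^sup>2))" unfolding exp_of_nat_mult[symmetric] by (simp add: mult.commute)
    also have "... \<le> exp (- (g * (y / 2)\<^sup>2))" using B b Pt(2) by (auto intro!: mult_left_mono power_mono)
    finally have "N * real B * exp (- g) ^ (B\<^sup>2) \<le> N * y * exp (- (g * (y / 2)\<^sup>2))"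
      using B K by (intro mult_mono) auto
    then have s2: "N * real B * exp (- g) ^ (B\<^sup>2) \<le> \<eta> / 2" using b by linarith
    show "\<exists>\<Gamma>::real. 0 < \<Gamma> \<and> \<Gamma> < 1 \<and> (\<exists>B::nat. B > 0 \<and>
        (\<forall>L::nat. real L \<ge> 1 \<and> (\<exists>k::nat. L = B * 2 ^ k) \<longrightarrow>
          (\<forall>T. T \<subseteq> torus (L div B) \<longrightarrow>
             gibbs_prob J L \<beta> (all_bad L B \<kappa> \<Gamma> T) \<le> \<eta> ^ card T)))"
    proof (intro exI[of _ \<Gamma>] conjI \<Gamma> exI[of _ B] allI impI)
      show "B > 0" using B by simp
      fix L :: nat and T assume L: "real L \<ge> 1 \<and> (\<exists>k::nat. L = B * 2 ^ k)" and T: "T \<subseteq> torus (L div B)"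
      then obtain k where k: "L = B * 2 ^ k" by blast
      have T': "T \<subseteq> torus (2 ^ k)" using T k B by simp
      have "gibbs_prob J L \<beta> (all_bad L B \<kappa> \<Gamma> T) \<le> (real (B ^ 3) * zE + N * real B * exp (- g) ^ (B\<^sup>2)) ^ card T"
        unfolding k \<Gamma>_def zE_def N_def
        by (rule bad_blocks_bound[OF assms b(3) B(1,2) _ _ _ e Pt(1,4) b(6) Pt(2,6,7) T']) (use b B \<kappa> in auto)
      also have "... \<le> \<eta> ^ card T"
        using s1 s2 \<open>zE \<ge> 0\<close> K by (intro power_mono) (auto intro!: add_nonneg_nonneg mult_nonneg_nonneg)
      finally show "gibbs_prob J L \<beta> (all_bad L B \<kappa> \<Gamma> T) \<le> \<eta> ^ card T" .
    qed
  qed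
qed simp

end
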